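(* The functors \[ \mathbb{T}_{(-)}\colon \mathrm{grBAlg}\to\mathrm{HAff},\qquad (-)\text{-}\mathrm{Set}\colon\mathrm{grBAlg}\to(B_{\mathcal J}\text{-}\mathrm{Var})^{\mathrm{op}},\qquad (-)\text{-}\mathrm{Mod}\colon\mathrm{HAff}\to(B_{\mathcal J}\text{-}\mathrm{Var})^{\mathrm{op}} \] are all equivalences of categories, and the composite of $\mathbb{T}_{(-)}$ with $(-)\text{-}\mathrm{Mod}$ is naturally isomorphic to $(-)\text{-}\mathrm{Set}$. Moreover, this triangle restricts to a triangle of equivalences \[ \mathbb{T}_{(-)}\colon \mathrm{BAlg}\to\mathrm{HAff}^\omega,\qquad (-)\text{-}\mathrm{Set}\colon\mathrm{BAlg}\to(B\text{-}\mathrm{Var})^{\mathrm{op}},\qquad (-)\text{-}\mathrm{Mod}\colon\mathrm{HAff}^\omega\to(B\text{-}\mathrm{Var})^{\mathrm{op}}, \] again commuting to within natural isomorphism, where $\mathrm{BAlg}$ is regarded as a full subcategory of $\mathrm{grBAlg}$ by equipping each $B$ with the topology of all finite partitions.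
   Context: Notation: for sets $I,J$, $J^I$ is the set of functions $I \to J$; $u_i$ is the value of $u\in J^I$ at $i$; $\lambda i.\, t_i$ is the function $i \mapsto t_i$; $n$ is identified with $\{1,\dots,n\}$. Algebraic theories. An algebraic theory $\mathbb{T}$ comprises: for each set $I$, a set $T(I)$; for each $i\in I$, an element $\pi_i \in T(I)$; and for all sets $I,J$, a substitution function $T(I)\times T(J)^I \to T(J)$, $(t,u)\mapsto t(u)$; subject to $t(\lambda i.\,\pi_i)=t$, $\pi_i(u)=u_i$ and $(t(u))(v) = t(\lambda i.\, u_i(v))$. Homomorphisms are families of functions preserving projections and substitution. $\mathbb{T}$ is non-degenerate if $\pi_1\ne\pi_2\in T(2)$, and finitary if each $t\in T(I)$ can be written as $t(x)=u(x_{i_1},\dots,x_{i_n})$ for some $n \in \mathbb{N}$, $i_1,\dots,i_n\in I$, $u\in T(n)$. An operation $t\in T(I)$ is hyperaffine if $t(\lambda i.\, x) = x$ and $t(\lambda i.\, t(\lambda j.\, x_{ij})) = t(\lambda i.\, x_{ii})$ (universally quantified over all sets $K$ and elements $x,x_{ij}\in T(K)$); $\mathbb{T}$ is hyperaffine if all its operations are. $\mathrm{HAff}$ (resp. $\mathrm{HAff}^\omega$) is the category of non-degenerate hyperaffine (resp. non-degenerate finitary hyperaffine) theories and all theory homomorphisms. Models and varieties. A $\mathbb{T}$-model is a (possibly empty) set $X$ with functions $T(I)\times X^I\to X$, $(t,x)\mapsto [\![t]\!](x)$, such that $[\![\pi_i]\!](x)=x_i$ and $[\![t(u)]\!](x)=[\![t]\!](\lambda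 i.\,[\![u_i]\!](x))$; homomorphisms preserve the $[\![t]\!]$. $\mathbb{T}\text{-}\mathrm{Mod}$ is the concrete category of $\mathbb{T}$-models; a theory homomorphism $\varphi\colon\mathbb{S}\to\mathbb{T}$ induces $\varphi^*\colon\mathbb{T}\text{-}\mathrm{Mod}\to\mathbb{S}\text{-}\mathrm{Mod}$ by $[\![t]\!]_{\varphi^*X}=[\![\varphi(t)]\!]_X$. A variety is the concrete category of (possibly empty) models of a possibly infinitary single-sorted equational theory, possibly with a proper class of function symbols, for which free models on all sets exist. $\mathrm{Var}$ is the category of varieties and concrete functors (functors commuting strictly with underlying-set functors). Grothendieck Boolean algebras. For a Boolean algebra $B$ (negation written $b'$; non-degenerate if $0\neq1$), a partition of $B$ is a subset $P\subseteq B\setminus\{0\}$ with $\bigvee P=1$ and $c\wedge d=0$ for distinct $c,d\in P$. For $S\subseteq B$, $S^-=S\setminus\{0\}$. A zero-dimensional topology on $B$ is a collection $\mathcal J$ of partitions of $B$ containing every finite partition such that: (i) if $P\in\mathcal J$ and $Q_b\in\mathcal J$ for each $b\in P$ then $\{b\wedge c:b\in P,c\in Q_b\}^-\in\mathcal J$; (ii) if $P\in\mathcal J$ and $\alpha\colon P\to I$ is surjective, then each join $\bigvee\alpha^{-1}(i)$ exists and $\{\bigvee\alpha^{-1}(i):i\in I\}\in\mathcal J$. A Grothendieck Boolean algebra $B_{\mathcal J}$ is a Boolean algebra with a zero-dimensional topology; a homomorphism $B_{\mathcal J}\to C_{\mathcal K}$ is a Boolean homomorphism $f$ with $f(P)^-\in\mathcal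 K$ for all $P\in\mathcal J$. $\mathrm{BAlg}$ (resp. $\mathrm{grBAlg}$) is the category of non-degenerate Boolean (resp. Grothendieck Boolean) algebras and homomorphisms. $B$-sets. For $B$ non-degenerate, a $B$-set is a set $X$ with an action $B\times X\times X\to X$, $(b,x,y)\mapsto b(x,y)$, such that $b(x,x)=x$, $b(b(x,y),z)=b(x,z)$, $b(x,b(y,z))=b(x,z)$, $1(x,y)=x$, $b'(x,y)=b(y,x)$, $(b\wedge c)(x,y)=b(c(x,y),y)$. A $B_{\mathcal J}$-set is a $B$-set with, for each infinite $P\in\mathcal J$, a function $P\colon X^P\to X$ such that $P(\lambda b.\,x)=x$, $P(\lambda b.\,b(x_b,y_b))=P(\lambda b.\,x_b)$, and $b(P(x),x_b)=x_b$ for all $b\in P$ (such operations are unique when they exist and are preserved by all $B$-set homomorphisms). $B\text{-}\mathrm{Set}$ and $B_{\mathcal J}\text{-}\mathrm{Set}$ are the resulting varieties (when $\mathcal J$ consists of the finite partitions, they coincide). $B\text{-}\mathrm{Var}$ (resp. $B_{\mathcal J}\text{-}\mathrm{Var}$) is the full subcategory of $\mathrm{Var}$ on the varieties concretely isomorphic to $B\text{-}\mathrm{Set}$ for some non-degenerate Boolean algebra $B$ (resp. to $B_{\mathcal J}\text{-}\mathrm{Set}$ for some non-degenerate Grothendieck Boolean algebra $B_{\mathcal J}$). The functors. $\mathbb{T}_{B_{\mathcal J}}$ is the theory in which $T_{B_{\mathcal J}}(I)$ is the set of functions $\omega\colon I\to B$ whose restriction to $\mathrm{supp}(\omega)=\{i:\omega(i)\ne0\}$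 is an injection onto a partition in $\mathcal J$; $\pi_i(j)=1$ if $i=j$ and $0$ otherwise; and $\omega(\gamma)(j)=\bigvee_{i\in I}\omega(i)\wedge\gamma_i(j)$. $\mathbb{T}_B$ denotes this theory for $\mathcal J$ the finite partitions. A homomorphism $f\colon B_{\mathcal J}\to B'_{\mathcal J'}$ is sent by $\mathbb{T}_{(-)}$ to the theory homomorphism $\omega\mapsto f\circ\omega$, and by $(-)\text{-}\mathrm{Set}$ to the concrete functor $B'_{\mathcal J'}\text{-}\mathrm{Set}\to B_{\mathcal J}\text{-}\mathrm{Set}$ which equips a $B'_{\mathcal J'}$-set $X$ with the $B_{\mathcal J}$-set structure $(b,x,y)\mapsto(fb)(x,y)$. *)

theory Defs
  imports "HOL-Library.FuncSet"
begin

unbundle cardinal_syntax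

section \<open>Sets\<close>

text \<open>
  The paper quantifies over all sets, and speaks of categories whose objects are proper classes.
  We fix a type \<open>'u\<close> whose cardinality \<open>\<kappa>\<close> is a regular strong limit, and read
  ``set'' as ``subset of \<open>'u\<close> of cardinality less than \<open>\<kappa>\<close>'' (a small set) and ``class'' as
  ``arbitrary subset of a type built from \<open>'u\<close>''.  For \<open>\<kappa>\<close> strongly inaccessible this loses
  nothing: the subsets of \<open>V\<^sub>\<kappa>\<close> of cardinality less than \<open>\<kappa>\<close> are exactly the elements of
  \<open>V\<^sub>\<kappa>\<close>, so along any bijection between \<open>'u\<close> and \<open>V\<^sub>\<kappa>\<close> the small subsets of
  \<open>'u\<close> and the functions between them are the category of sets of the universe \<open>V\<^sub>\<kappa>\<close>.
  Uncountability is not demanded, so \<open>nat\<close> (with the finite sets as small sets) also qualifies.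
\<close>

definition universe :: "'u itself \<Rightarrow> bool" where
  "universe _ \<longleftrightarrow>
     infinite (UNIV :: 'u set) \<and>
     regularCard |UNIV :: 'u set| \<and>
     (\<forall>A :: 'u set. |A| <o |UNIV :: 'u set| \<longrightarrow> |Pow A| <o |UNIV :: 'u set| )"

lemma universe_nat: "universe TYPE(nat)"
proof -
  have fin: "|A| <o |UNIV :: nat set| \<longleftrightarrow> finite A" for A :: "'a set"
    by (metis finite_iff_ordLess_natLeq card_of_nat ordIso_symmetric ordLess_ordIso_trans)
  have "regularCard |UNIV :: nat set|"
    using regularCard_ordIso[OF ordIso_symmetric[OF card_of_nat] natLeq_Cinfinite regularCard_natLeq] .
  then show ?thesis unfolding universe_def fin by auto
qed

definition small :: "'u itself \<Rightarrow> 'a set \<Rightarrow> bool" where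
  "small _ A \<longleftrightarrow> |A| <o |UNIV :: 'u set|"

text \<open>The elements 1, 2, 3, ... of \<open>'u\<close>, and the set \<open>n = {1, ..., n}\<close>.\<close>

definition num :: "nat \<Rightarrow> 'u" where
  "num = (SOME f. inj f)"

definition nset :: "nat \<Rightarrow> 'u set" where
  "nset n = num ` {1..n}"


section \<open>Categories\<close>

text \<open>
  Hom-sets need not be disjoint, so composition and the arrow part of a functor take the relevant
  objects as arguments: \<open>cmp C X Y Z g f\<close> is the composite of \<open>f : X \<rightarrow> Y\<close> and \<open>g : Y \<rightarrow> Z\<close>.
\<close>

record ('o, 'a) cat =
  ob :: "'o set"
  hom :: "'o \<Rightarrow> 'o \<Rightarrow> 'a set"
  idt :: "'o \<Rightarrow> 'a"
  cmp :: "'o \<Rightarrow> 'o \<Rightarrow> 'o \<Rightarrow> 'a \<Rightarrow> 'a \<Rightarrow> 'a"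

definition category :: "('o, 'a) cat \<Rightarrow> bool" where
  "category C \<longleftrightarrow>
     (\<forall>X\<in>ob C. idt C X \<in> hom C X X) \<and>
     (\<forall>X\<in>ob C. \<forall>Y\<in>ob C. \<forall>Z\<in>ob C. \<forall>f\<in>hom C X Y. \<forall>g\<in>hom C Y Z.
        cmp C X Y Z g f \<in> hom C X Z) \<and>
     (\<forall>X\<in>ob C. \<forall>Y\<in>ob C. \<forall>f\<in>hom C X Y.
        cmp C X X Y f (idt C X) = f \<and> cmp C X Y Y (idt C Y) f = f) \<and>
     (\<forall>W\<in>ob C. \<forall>X\<in>ob C. \<forall>Y\<in>ob C. \<forall>Z\<in>ob C.
        \<forall>f\<in>hom C W X. \<forall>g\<in>hom C X Y. \<forall>h\<in>hom C Y Z.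
        cmp C W Y Z h (cmp C W X Y g f) = cmp C W X Z (cmp C X Y Z h g) f)"

definition op_cat :: "('o, 'a) cat \<Rightarrow> ('o, 'a) cat" where
  "op_cat C = \<lparr>ob = ob C, hom = (\<lambda>X Y. hom C Y X), idt = idt C,
     cmp = (\<lambda>X Y Z g f. cmp C Z Y X f g)\<rparr>"

definition full_subcat :: "('o, 'a) cat \<Rightarrow> ('o \<Rightarrow> bool) \<Rightarrow> ('o, 'a) cat" where
  "full_subcat C P = C\<lparr>ob := {X \<in> ob C. P X}\<rparr>"

definition iso_in :: "('o, 'a) cat \<Rightarrow> 'o \<Rightarrow> 'o \<Rightarrow> 'a \<Rightarrow> bool" where
  "iso_in C X Y f \<longleftrightarrow> f \<in> hom C X Y \<and>
     (\<exists>g\<in>hom C Y X. cmp C X Y X g f = idt C X \<and> cmp C Y X Y f g = idt C Y)"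

definition isomorphic_in :: "('o, 'a) cat \<Rightarrow> 'o \<Rightarrow> 'o \<Rightarrow> bool" where
  "isomorphic_in C X Y \<longleftrightarrow> (\<exists>f. iso_in C X Y f)"

record ('o, 'a, 'p, 'b) funct =
  fob :: "'o \<Rightarrow> 'p"
  far :: "'o \<Rightarrow> 'o \<Rightarrow> 'a \<Rightarrow> 'b"

definition is_functor :: "('o, 'a) cat \<Rightarrow> ('p, 'b) cat \<Rightarrow> ('o, 'a, 'p, 'b) funct \<Rightarrow> bool" where
  "is_functor C D F \<longleftrightarrow> category C \<and> category D \<and>
     (\<forall>X\<in>ob C. fob F X \<in> ob D) \<and>
     (\<forall>X\<in>ob C. \<forall>Y\<in>ob C. \<forall>f\<in>hom C X Y. far F X Y f \<in> hom D (fob F X) (fob F Y)) \<and>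
     (\<forall>X\<in>ob C. far F X X (idt C X) = idt D (fob F X)) \<and>
     (\<forall>X\<in>ob C. \<forall>Y\<in>ob C. \<forall>Z\<in>ob C. \<forall>f\<in>hom C X Y. \<forall>g\<in>hom C Y Z.
        far F X Z (cmp C X Y Z g f) =
          cmp D (fob F X) (fob F Y) (fob F Z) (far F Y Z g) (far F X Y f))"

definition id_functor :: "('o, 'a, 'o, 'a) funct" where
  "id_functor = \<lparr>fob = (\<lambda>X. X), far = (\<lambda>X Y f. f)\<rparr>"

definition comp_functor ::
  "('p, 'b, 'q, 'c) funct \<Rightarrow> ('o, 'a, 'p, 'b) funct \<Rightarrow> ('o, 'a, 'q, 'c) funct"
  (infixl "\<circ>\<^sub>F" 55) where
  "G \<circ>\<^sub>F F = \<lparr>fob = (\<lambda>X. fob G (fob F X)),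
     far = (\<lambda>X Y f. far G (fob F X) (fob F Y) (far F X Y f))\<rparr>"

definition naturally_isomorphic ::
  "('o, 'a) cat \<Rightarrow> ('p, 'b) cat \<Rightarrow> ('o, 'a, 'p, 'b) funct \<Rightarrow> ('o, 'a, 'p, 'b) funct \<Rightarrow> bool" where
  "naturally_isomorphic C D F G \<longleftrightarrow> is_functor C D F \<and> is_functor C D G \<and>
     (\<exists>\<eta>. (\<forall>X\<in>ob C. iso_in D (fob F X) (fob G X) (\<eta> X)) \<and>
        (\<forall>X\<in>ob C. \<forall>Y\<in>ob C. \<forall>f\<in>hom C X Y.
           cmp D (fob F X) (fob F Y) (fob G Y) (\<eta> Y) (far F X Y f) =
           cmp D (fob F X) (fob G X) (fob G Y) (far G X Y f) (\<eta> X)))"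

definition equivalence :: "('o, 'a) cat \<Rightarrow> ('p, 'b) cat \<Rightarrow> ('o, 'a, 'p, 'b) funct \<Rightarrow> bool" where
  "equivalence C D F \<longleftrightarrow> is_functor C D F \<and>
     (\<exists>G. is_functor D C G \<and>
        naturally_isomorphic C C (G \<circ>\<^sub>F F) id_functor \<and>
        naturally_isomorphic D D (F \<circ>\<^sub>F G) id_functor)"

definition fully_faithful :: "('o, 'a) cat \<Rightarrow> ('p, 'b) cat \<Rightarrow> ('o, 'a, 'p, 'b) funct \<Rightarrow> bool" where
  "fully_faithful C D F \<longleftrightarrow> is_functor C D F \<and>
     (\<forall>X\<in>ob C. \<forall>Y\<in>ob C. bij_betw (far F X Y) (hom C X Y) (hom D (fob F X) (fob F Y)))"


section \<open>Algebraic theories\<close>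

text \<open>\<open>subst T I J t u\<close> is \<open>t(u)\<close> for \<open>t \<in> T(I)\<close> and \<open>u \<in> T(J)\<^sup>I\<close>.\<close>

record ('u, 't) algth =
  ops :: "'u set \<Rightarrow> 't set"
  proj :: "'u set \<Rightarrow> 'u \<Rightarrow> 't"
  subst :: "'u set \<Rightarrow> 'u set \<Rightarrow> 't \<Rightarrow> ('u \<Rightarrow> 't) \<Rightarrow> 't"

definition algebraic_theory :: "('u, 't) algth \<Rightarrow> bool" where
  "algebraic_theory T \<longleftrightarrow>
     (\<forall>I. small TYPE('u) I \<longrightarrow> small TYPE('u) (ops T I)) \<and>
     (\<forall>I. small TYPE('u) I \<longrightarrow> (\<forall>i\<in>I. proj T I i \<in> ops T I)) \<and>
     (\<forall>I J. small TYPE('u) I \<longrightarrow> small TYPE('u) J \<longrightarrow>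
        (\<forall>t\<in>ops T I. \<forall>u\<in>I \<rightarrow>\<^sub>E ops T J. subst T I J t u \<in> ops T J)) \<and>
     (\<forall>I. small TYPE('u) I \<longrightarrow>
        (\<forall>t\<in>ops T I. subst T I I t (\<lambda>i\<in>I. proj T I i) = t)) \<and>
     (\<forall>I J. small TYPE('u) I \<longrightarrow> small TYPE('u) J \<longrightarrow>
        (\<forall>i\<in>I. \<forall>u\<in>I \<rightarrow>\<^sub>E ops T J. subst T I J (proj T I i) u = u i)) \<and>
     (\<forall>I J K. small TYPE('u) I \<longrightarrow> small TYPE('u) J \<longrightarrow> small TYPE('u) K \<longrightarrow>
        (\<forall>t\<in>ops T I. \<forall>u\<in>I \<rightarrow>\<^sub>E ops T J. \<forall>v\<in>J \<rightarrow>\<^sub>E ops T K.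
           subst T J K (subst T I J t u) v = subst T I K t (\<lambda>i\<in>I. subst T J K (u i) v)))"

definition theory_homs :: "('u, 't) algth \<Rightarrow> ('u, 't) algth \<Rightarrow> ('u set \<Rightarrow> 't \<Rightarrow> 't) set" where
  "theory_homs S T =
     {\<phi> \<in> (\<Pi>\<^sub>E I\<in>{I. small TYPE('u) I}. ops S I \<rightarrow>\<^sub>E ops T I).
        (\<forall>I. small TYPE('u) I \<longrightarrow> (\<forall>i\<in>I. \<phi> I (proj S I i) = proj T I i)) \<and>
        (\<forall>I J. small TYPE('u) I \<longrightarrow> small TYPE('u) J \<longrightarrow>
           (\<forall>t\<in>ops S I. \<forall>u\<in>I \<rightarrow>\<^sub>E ops S J.
              \<phi> J (subst S I J t u) = subst T I J (\<phi> I t) (\<lambda>i\<in>I. \<phi> J (u i))))}"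

definition nondegenerate_theory :: "('u, 't) algth \<Rightarrow> bool" where
  "nondegenerate_theory T \<longleftrightarrow> proj T (nset 2) (num 1) \<noteq> proj T (nset 2) (num 2)"

definition finitary :: "('u, 't) algth \<Rightarrow> bool" where
  "finitary T \<longleftrightarrow>
     (\<forall>I. small TYPE('u) I \<longrightarrow> (\<forall>t\<in>ops T I.
        \<exists>n. \<exists>i\<in>nset n \<rightarrow>\<^sub>E I. \<exists>u\<in>ops T (nset n).
          \<forall>K. small TYPE('u) K \<longrightarrow> (\<forall>x\<in>I \<rightarrow>\<^sub>E ops T K.
            subst T I K t x = subst T (nset n) K u (\<lambda>k\<in>nset n. x (i k)))))"

definition hyperaffine_op :: "('u, 't) algth \<Rightarrow> 'u set \<Rightarrow> 't \<Rightarrow> bool" where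
  "hyperaffine_op T I t \<longleftrightarrow>
     (\<forall>K. small TYPE('u) K \<longrightarrow>
        (\<forall>x\<in>ops T K. subst T I K t (\<lambda>i\<in>I. x) = x) \<and>
        (\<forall>x\<in>I \<rightarrow>\<^sub>E (I \<rightarrow>\<^sub>E ops T K).
           subst T I K t (\<lambda>i\<in>I. subst T I K t (\<lambda>j\<in>I. x i j)) =
           subst T I K t (\<lambda>i\<in>I. x i i)))"

definition hyperaffine :: "('u, 't) algth \<Rightarrow> bool" where
  "hyperaffine T \<longleftrightarrow> (\<forall>I. small TYPE('u) I \<longrightarrow> (\<forall>t\<in>ops T I. hyperaffine_op T I t))"

text \<open>
  Operations are taken to be elements of \<open>'u \<Rightarrow> 'u\<close>, so that the theories of partitions below are
  literally objects; every small set has a copy in this type.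
\<close>

definition HAff :: "(('u, 'u \<Rightarrow> 'u) algth, 'u set \<Rightarrow> ('u \<Rightarrow> 'u) \<Rightarrow> ('u \<Rightarrow> 'u)) cat" where
  "HAff = \<lparr>
     ob = {T. algebraic_theory T \<and> nondegenerate_theory T \<and> hyperaffine T},
     hom = theory_homs,
     idt = (\<lambda>T. \<lambda>I\<in>{I. small TYPE('u) I}. \<lambda>t\<in>ops T I. t),
     cmp = (\<lambda>R S T \<psi> \<phi>. \<lambda>I\<in>{I. small TYPE('u) I}. \<lambda>t\<in>ops R I. \<psi> I (\<phi> I t))\<rparr>"

definition HAff_fin :: "(('u, 'u \<Rightarrow> 'u) algth, 'u set \<Rightarrow> ('u \<Rightarrow> 'u) \<Rightarrow> ('u \<Rightarrow> 'u)) cat" where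
  "HAff_fin = full_subcat HAff finitary"


section \<open>Varieties\<close>

record ('u, 'm) concrete_cat =
  cobj :: "'m set"
  cund :: "'m \<Rightarrow> 'u set"
  chom :: "'m \<Rightarrow> 'm \<Rightarrow> ('u \<Rightarrow> 'u) set"

text \<open>
  As a concrete functor commutes strictly with the underlying-set functors, it acts on homomorphisms
  as the identity on underlying functions; hence it is determined by its action on objects.
\<close>

definition concrete_functors ::
  "('u, 'm) concrete_cat \<Rightarrow> ('u, 'n) concrete_cat \<Rightarrow> ('m \<Rightarrow> 'n) set" where
  "concrete_functors C D =
     {F \<in> cobj C \<rightarrow>\<^sub>E cobj D.
        (\<forall>M\<in>cobj C. cund D (F M) = cund C M) \<and>
        (\<forall>M\<in>cobj C. \<forall>N\<in>cobj C. chom C M N \<subseteq> chom D (F M) (F N))}"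

record ('u, 's) signature =
  syms :: "'s set"
  arity :: "'s \<Rightarrow> 'u set"

record ('u, 's) model =
  und :: "'u set"
  intp :: "'s \<Rightarrow> ('u \<Rightarrow> 'u) \<Rightarrow> 'u"

definition structures :: "('u, 's) signature \<Rightarrow> ('u, 's) model set" where
  "structures Sg = {M. small TYPE('u) (und M) \<and>
     intp M \<in> (\<Pi>\<^sub>E s\<in>syms Sg. (arity Sg s \<rightarrow>\<^sub>E und M) \<rightarrow>\<^sub>E und M)}"

definition homomorphisms ::
  "('u, 's) signature \<Rightarrow> ('u, 's) model \<Rightarrow> ('u, 's) model \<Rightarrow> ('u \<Rightarrow> 'u) set" where
  "homomorphisms Sg M N = {h \<in> und M \<rightarrow>\<^sub>E und N.
     \<forall>s\<in>syms Sg. \<forall>x\<in>arity Sg s \<rightarrow>\<^sub>E und M.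
       h (intp M s x) = intp N s (\<lambda>i\<in>arity Sg s. h (x i))}"

definition concrete_cat_of ::
  "('u, 's) signature \<Rightarrow> ('u, 's) model set \<Rightarrow> ('u, ('u, 's) model) concrete_cat" where
  "concrete_cat_of Sg \<M> = \<lparr>cobj = \<M>, cund = und,
     chom = (\<lambda>M N. if M \<in> \<M> \<and> N \<in> \<M> then homomorphisms Sg M N else {})\<rparr>"

text \<open>
  Infinitary terms; the subterms of \<open>App s f\<close> are the \<open>f i\<close> with \<open>i\<close> in the arity of \<open>s\<close>.
\<close>

datatype ('u, 's) trm = Var 'u | App 's "'u \<Rightarrow> ('u, 's) trm"

inductive_set terms :: "('u, 's) signature \<Rightarrow> 'u set \<Rightarrow> ('u, 's) trm set"
  for Sg :: "('u, 's) signature" and V :: "'u set" where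
  "i \<in> V \<Longrightarrow> Var i \<in> terms Sg V"
| "s \<in> syms Sg \<Longrightarrow> (\<And>i. i \<in> arity Sg s \<Longrightarrow> f i \<in> terms Sg V) \<Longrightarrow> App s f \<in> terms Sg V"

primrec evalt :: "('u, 's) signature \<Rightarrow> ('u, 's) model \<Rightarrow> ('u \<Rightarrow> 'u) \<Rightarrow> ('u, 's) trm \<Rightarrow> 'u" where
  "evalt Sg M v (Var i) = v i"
| "evalt Sg M v (App s f) = intp M s (\<lambda>i\<in>arity Sg s. evalt Sg M v (f i))"

text \<open>
  An equation \<open>(V, l, r)\<close> carries its set \<open>V\<close> of variables, which matters for empty models.
\<close>

definition models ::
  "('u, 's) signature \<Rightarrow> ('u set \<times> ('u, 's) trm \<times> ('u, 's) trm) set \<Rightarrow> ('u, 's) model set" where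
  "models Sg E = {M \<in> structures Sg.
     \<forall>(V, l, r)\<in>E. \<forall>v\<in>V \<rightarrow>\<^sub>E und M. evalt Sg M v l = evalt Sg M v r}"

definition has_free_models :: "('u, 'm) concrete_cat \<Rightarrow> bool" where
  "has_free_models C \<longleftrightarrow>
     (\<forall>V :: 'u set. small TYPE('u) V \<longrightarrow>
        (\<exists>F\<in>cobj C. \<exists>\<eta>\<in>V \<rightarrow>\<^sub>E cund C F.
           \<forall>M\<in>cobj C. \<forall>v\<in>V \<rightarrow>\<^sub>E cund C M.
             \<exists>!h. h \<in> chom C F M \<and> (\<forall>i\<in>V. h (\<eta> i) = v i)))"

definition variety :: "('u, ('u, 's) model) concrete_cat \<Rightarrow> bool" where
  "variety C \<longleftrightarrow>
     (\<exists>Sg E. (\<forall>s\<in>syms Sg. small TYPE('u) (arity Sg s)) \<and>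
        (\<forall>(V, l, r)\<in>E. small TYPE('u) V \<and> l \<in> terms Sg V \<and> r \<in> terms Sg V) \<and>
        C = concrete_cat_of Sg (models Sg E)) \<and>
     has_free_models C"

text \<open>
  One type of function symbols, large enough for all varieties at hand: \<open>Act b\<close> for the binary
  operation of a Boolean algebra element, \<open>Glue P\<close> for the operation of an infinite partition,
  \<open>Opn I t\<close> for an operation \<open>t \<in> T(I)\<close> of an algebraic theory.  In \<open>variety\<close> above
  these are just names, and may be given other arities.
\<close>

datatype 'u symbol = Act 'u | Glue "'u set" | Opn "'u set" "'u \<Rightarrow> 'u"

type_synonym 'u mdl = "('u, 'u symbol) model"
type_synonym 'u ccat = "('u, 'u mdl) concrete_cat"

fun std_arity :: "'u symbol \<Rightarrow> 'u set" where
  "std_arity (Act b) = nset 2"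
| "std_arity (Glue P) = P"
| "std_arity (Opn I t) = I"

definition VAR :: "('u ccat, 'u mdl \<Rightarrow> 'u mdl) cat" where
  "VAR = \<lparr>
     ob = {C. variety C},
     hom = concrete_functors,
     idt = (\<lambda>C. \<lambda>M\<in>cobj C. M),
     cmp = (\<lambda>C D E G F. \<lambda>M\<in>cobj C. G (F M))\<rparr>"


section \<open>Models of an algebraic theory\<close>

definition theory_sig :: "('u, 'u \<Rightarrow> 'u) algth \<Rightarrow> ('u, 'u symbol) signature" where
  "theory_sig T = \<lparr>syms = {Opn I t | I t. small TYPE('u) I \<and> t \<in> ops T I}, arity = std_arity\<rparr>"

definition theory_models :: "('u, 'u \<Rightarrow> 'u) algth \<Rightarrow> 'u mdl set" where
  "theory_models T = {M \<in> structures (theory_sig T).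
     (\<forall>I. small TYPE('u) I \<longrightarrow> (\<forall>i\<in>I. \<forall>x\<in>I \<rightarrow>\<^sub>E und M. intp M (Opn I (proj T I i)) x = x i)) \<and>
     (\<forall>I J. small TYPE('u) I \<longrightarrow> small TYPE('u) J \<longrightarrow>
        (\<forall>t\<in>ops T I. \<forall>u\<in>I \<rightarrow>\<^sub>E ops T J. \<forall>x\<in>J \<rightarrow>\<^sub>E und M.
           intp M (Opn J (subst T I J t u)) x =
           intp M (Opn I t) (\<lambda>i\<in>I. intp M (Opn J (u i)) x)))}"

definition theory_Mod :: "('u, 'u \<Rightarrow> 'u) algth \<Rightarrow> 'u ccat" where
  "theory_Mod T = concrete_cat_of (theory_sig T) (theory_models T)"

text \<open>The model \<open>\<phi>\<^sup>* M\<close> of \<open>S\<close>, for a homomorphism \<open>\<phi>\<close> out of \<open>S\<close>.\<close>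

definition pullback_model ::
  "('u, 'u \<Rightarrow> 'u) algth \<Rightarrow> ('u set \<Rightarrow> ('u \<Rightarrow> 'u) \<Rightarrow> ('u \<Rightarrow> 'u)) \<Rightarrow> 'u mdl \<Rightarrow> 'u mdl" where
  "pullback_model S \<phi> M = \<lparr>und = und M,
     intp = (\<lambda>s\<in>syms (theory_sig S). case s of Opn I t \<Rightarrow>
       (\<lambda>x\<in>I \<rightarrow>\<^sub>E und M. intp M (Opn I (\<phi> I t)) x))\<rparr>"

definition Mod_functor ::
  "(('u, 'u \<Rightarrow> 'u) algth, 'u set \<Rightarrow> ('u \<Rightarrow> 'u) \<Rightarrow> ('u \<Rightarrow> 'u), 'u ccat, 'u mdl \<Rightarrow> 'u mdl) funct" where
  "Mod_functor = \<lparr>fob = theory_Mod,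
     far = (\<lambda>S T \<phi>. \<lambda>M\<in>cobj (theory_Mod T). pullback_model S \<phi> M)\<rparr>"


section \<open>Grothendieck Boolean algebras\<close>

record 'u balg =
  bcarrier :: "'u set"
  bmeet :: "'u \<Rightarrow> 'u \<Rightarrow> 'u"
  bjoin :: "'u \<Rightarrow> 'u \<Rightarrow> 'u"
  bneg :: "'u \<Rightarrow> 'u"
  bzero :: 'u
  bone :: 'u

definition boolean_alg :: "('u, 'z) balg_scheme \<Rightarrow> bool" where
  "boolean_alg B \<longleftrightarrow>
     small TYPE('u) (bcarrier B) \<and>
     bzero B \<in> bcarrier B \<and> bone B \<in> bcarrier B \<and>
     (\<forall>a\<in>bcarrier B. bneg B a \<in> bcarrier B) \<and>
     (\<forall>a\<in>bcarrier B. \<forall>b\<in>bcarrier B. bmeet B a b \<in> bcarrier B \<and> bjoin B a b \<in> bcarrier B) \<and>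
     (\<forall>a\<in>bcarrier B. \<forall>b\<in>bcarrier B.
        bmeet B a b = bmeet B b a \<and> bjoin B a b = bjoin B b a) \<and>
     (\<forall>a\<in>bcarrier B. \<forall>b\<in>bcarrier B. \<forall>c\<in>bcarrier B.
        bmeet B (bmeet B a b) c = bmeet B a (bmeet B b c) \<and>
        bjoin B (bjoin B a b) c = bjoin B a (bjoin B b c) \<and>
        bmeet B a (bjoin B b c) = bjoin B (bmeet B a b) (bmeet B a c) \<and>
        bjoin B a (bmeet B b c) = bmeet B (bjoin B a b) (bjoin B a c)) \<and>
     (\<forall>a\<in>bcarrier B. bmeet B a (bone B) = a \<and> bjoin B a (bzero B) = a \<and>
        bmeet B a (bneg B a) = bzero B \<and> bjoin B a (bneg B a) = bone B)"

definition boolean_homs :: "('u, 'y) balg_scheme \<Rightarrow> ('u, 'z) balg_scheme \<Rightarrow> ('u \<Rightarrow> 'u) set" where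
  "boolean_homs B C = {f \<in> bcarrier B \<rightarrow>\<^sub>E bcarrier C.
     f (bzero B) = bzero C \<and> f (bone B) = bone C \<and>
     (\<forall>a\<in>bcarrier B. f (bneg B a) = bneg C (f a)) \<and>
     (\<forall>a\<in>bcarrier B. \<forall>b\<in>bcarrier B.
        f (bmeet B a b) = bmeet C (f a) (f b) \<and> f (bjoin B a b) = bjoin C (f a) (f b))}"

definition ble :: "('u, 'z) balg_scheme \<Rightarrow> 'u \<Rightarrow> 'u \<Rightarrow> bool" where
  "ble B a b \<longleftrightarrow> bmeet B a b = a"

definition is_lub :: "('u, 'z) balg_scheme \<Rightarrow> 'u set \<Rightarrow> 'u \<Rightarrow> bool" where
  "is_lub B S a \<longleftrightarrow> a \<in> bcarrier B \<and> (\<forall>s\<in>S. ble B s a) \<and>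
     (\<forall>c\<in>bcarrier B. (\<forall>s\<in>S. ble B s c) \<longrightarrow> ble B a c)"

definition bsup :: "('u, 'z) balg_scheme \<Rightarrow> 'u set \<Rightarrow> 'u" where
  "bsup B S = (THE a. is_lub B S a)"

definition partition_of :: "('u, 'z) balg_scheme \<Rightarrow> 'u set \<Rightarrow> bool" where
  "partition_of B P \<longleftrightarrow> P \<subseteq> bcarrier B - {bzero B} \<and> is_lub B P (bone B) \<and>
     (\<forall>c\<in>P. \<forall>d\<in>P. c \<noteq> d \<longrightarrow> bmeet B c d = bzero B)"

text \<open>
  In the last clause \<open>\<alpha>\<close> has target \<open>\<alpha> ` P\<close>; as every surjection out of \<open>P\<close> is isomorphic
  to one onto a subset of \<open>P\<close>, it suffices to consider \<open>\<alpha>\<close> with values in \<open>'u\<close>.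
\<close>

definition zero_dim_topology :: "('u, 'z) balg_scheme \<Rightarrow> 'u set set \<Rightarrow> bool" where
  "zero_dim_topology B J \<longleftrightarrow>
     (\<forall>P\<in>J. partition_of B P) \<and>
     (\<forall>P. partition_of B P \<and> finite P \<longrightarrow> P \<in> J) \<and>
     (\<forall>P\<in>J. \<forall>Q. (\<forall>b\<in>P. Q b \<in> J) \<longrightarrow>
        {bmeet B b c | b c. b \<in> P \<and> c \<in> Q b} - {bzero B} \<in> J) \<and>
     (\<forall>P\<in>J. \<forall>\<alpha> :: 'u \<Rightarrow> 'u.
        (\<forall>i\<in>\<alpha> ` P. \<exists>a. is_lub B {b \<in> P. \<alpha> b = i} a) \<and>
        {bsup B {b \<in> P. \<alpha> b = i} | i. i \<in> \<alpha> ` P} \<in> J)"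

record 'u gbalg = "'u balg" +
  topo :: "'u set set"

definition BAlg :: "('u balg, 'u \<Rightarrow> 'u) cat" where
  "BAlg = \<lparr>
     ob = {B. boolean_alg B \<and> bzero B \<noteq> bone B},
     hom = boolean_homs,
     idt = (\<lambda>B. \<lambda>b\<in>bcarrier B. b),
     cmp = (\<lambda>A B C g f. \<lambda>a\<in>bcarrier A. g (f a))\<rparr>"

definition grBAlg :: "('u gbalg, 'u \<Rightarrow> 'u) cat" where
  "grBAlg = \<lparr>
     ob = {B. boolean_alg B \<and> bzero B \<noteq> bone B \<and> zero_dim_topology B (topo B)},
     hom = (\<lambda>B C. {f \<in> boolean_homs B C. \<forall>P\<in>topo B. f ` P - {bzero C} \<in> topo C}),
     idt = (\<lambda>B. \<lambda>b\<in>bcarrier B. b),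
     cmp = (\<lambda>A B C g f. \<lambda>a\<in>bcarrier A. g (f a))\<rparr>"

definition finite_topology :: "'u balg \<Rightarrow> 'u gbalg" where
  "finite_topology B = balg.extend B \<lparr>topo = {P. partition_of B P \<and> finite P}\<rparr>"

definition BAlg_inclusion :: "('u balg, 'u \<Rightarrow> 'u, 'u gbalg, 'u \<Rightarrow> 'u) funct" where
  "BAlg_inclusion = \<lparr>fob = finite_topology, far = (\<lambda>B C f. f)\<rparr>"


section \<open>Sets over a Grothendieck Boolean algebra\<close>

definition act :: "'u mdl \<Rightarrow> 'u \<Rightarrow> 'u \<Rightarrow> 'u \<Rightarrow> 'u" where
  "act M b x y = intp M (Act b) (\<lambda>k\<in>nset 2. if k = num 1 then x else y)"

definition B_sig :: "('u, 'z) balg_scheme \<Rightarrow> ('u, 'u symbol) signature" where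
  "B_sig B = \<lparr>syms = Act ` bcarrier B, arity = std_arity\<rparr>"

definition BJ_sig :: "'u gbalg \<Rightarrow> ('u, 'u symbol) signature" where
  "BJ_sig B = \<lparr>syms = Act ` bcarrier B \<union> Glue ` {P \<in> topo B. infinite P}, arity = std_arity\<rparr>"

definition B_set_laws :: "('u, 'z) balg_scheme \<Rightarrow> 'u mdl \<Rightarrow> bool" where
  "B_set_laws B M \<longleftrightarrow>
     (\<forall>b\<in>bcarrier B. \<forall>x\<in>und M. \<forall>y\<in>und M. \<forall>z\<in>und M.
        act M b x x = x \<and>
        act M b (act M b x y) z = act M b x z \<and>
        act M b x (act M b y z) = act M b x z \<and>
        act M (bone B) x y = x \<and>
        act M (bneg B b) x y = act M b y x \<and>
        (\<forall>c\<in>bcarrier B. act M (bmeet B b c) x y = act M b (act M c x y) y))"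

definition glue_laws :: "'u gbalg \<Rightarrow> 'u mdl \<Rightarrow> bool" where
  "glue_laws B M \<longleftrightarrow>
     (\<forall>P\<in>topo B. infinite P \<longrightarrow>
        (\<forall>x\<in>und M. intp M (Glue P) (\<lambda>b\<in>P. x) = x) \<and>
        (\<forall>x\<in>P \<rightarrow>\<^sub>E und M. \<forall>y\<in>P \<rightarrow>\<^sub>E und M.
           intp M (Glue P) (\<lambda>b\<in>P. act M b (x b) (y b)) = intp M (Glue P) x) \<and>
        (\<forall>x\<in>P \<rightarrow>\<^sub>E und M. \<forall>b\<in>P. act M b (intp M (Glue P) x) (x b) = x b))"

definition B_Set :: "'u balg \<Rightarrow> 'u ccat" where
  "B_Set B = concrete_cat_of (B_sig B) {M \<in> structures (B_sig B). B_set_laws B M}"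

definition BJ_Set :: "'u gbalg \<Rightarrow> 'u ccat" where
  "BJ_Set B = concrete_cat_of (BJ_sig B)
     {M \<in> structures (BJ_sig B). B_set_laws B M \<and> glue_laws B M}"

definition B_Var :: "('u ccat, 'u mdl \<Rightarrow> 'u mdl) cat" where
  "B_Var = full_subcat VAR (\<lambda>C. \<exists>B\<in>ob BAlg. isomorphic_in VAR C (B_Set B))"

definition BJ_Var :: "('u ccat, 'u mdl \<Rightarrow> 'u mdl) cat" where
  "BJ_Var = full_subcat VAR (\<lambda>C. \<exists>B\<in>ob grBAlg. isomorphic_in VAR C (BJ_Set B))"

text \<open>
  On a homomorphism \<open>f : A \<rightarrow> B\<close>, the functor equips a set over \<open>B\<close> with the structure over \<open>A\<close>
  whose binary operations are those of the \<open>f b\<close>; the operations \<open>Glue P\<close> of that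
  structure are then uniquely determined.
\<close>

definition Set_functor :: "('u gbalg, 'u \<Rightarrow> 'u, 'u ccat, 'u mdl \<Rightarrow> 'u mdl) funct" where
  "Set_functor = \<lparr>fob = BJ_Set,
     far = (\<lambda>A B f. \<lambda>M\<in>cobj (BJ_Set B).
       THE N. N \<in> cobj (BJ_Set A) \<and> und N = und M \<and>
         (\<forall>b\<in>bcarrier A. \<forall>x\<in>und M. \<forall>y\<in>und M. act N b x y = act M (f b) x y))\<rparr>"


section \<open>The theory of a Grothendieck Boolean algebra\<close>

definition bsupp :: "('u, 'z) balg_scheme \<Rightarrow> 'u set \<Rightarrow> ('u \<Rightarrow> 'u) \<Rightarrow> 'u set" where
  "bsupp B I \<omega> = {i \<in> I. \<omega> i \<noteq> bzero B}"

definition partition_theory :: "'u gbalg \<Rightarrow> ('u, 'u \<Rightarrow> 'u) algth" where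
  "partition_theory B = \<lparr>
     ops = (\<lambda>I. {\<omega> \<in> I \<rightarrow>\<^sub>E bcarrier B.
       inj_on \<omega> (bsupp B I \<omega>) \<and> \<omega> ` bsupp B I \<omega> \<in> topo B}),
     proj = (\<lambda>I i. \<lambda>j\<in>I. if i = j then bone B else bzero B),
     subst = (\<lambda>I J \<omega> \<gamma>. \<lambda>j\<in>J. bsup B {bmeet B (\<omega> i) (\<gamma> i j) | i. i \<in> I})\<rparr>"

definition T_functor ::
  "('u gbalg, 'u \<Rightarrow> 'u, ('u, 'u \<Rightarrow> 'u) algth, 'u set \<Rightarrow> ('u \<Rightarrow> 'u) \<Rightarrow> ('u \<Rightarrow> 'u)) funct" where
  "T_functor = \<lparr>fob = partition_theory,
     far = (\<lambda>B C f. \<lambda>I\<in>{I. small TYPE('u) I}. \<lambda>\<omega>\<in>ops (partition_theory B) I. \<lambda>i\<in>I. f (\<omega> i))\<rparr>"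

end

theory Submission
  imports Defs
begin

text \<open>
  In a hyperaffine theory \<open>T\<close> the diagonal law for a composite \<open>s(t(x\<^sub>i\<^sub>j))\<close> forces \<open>s\<close> and \<open>t\<close> to
  commute.  Reading \<open>b(x, y)\<close> as ``if \<open>b\<close> then \<open>x\<close> else \<open>y\<close>'', the set \<open>T(2)\<close> is therefore a Boolean
  algebra \<open>B\<close>, and every model of \<open>T\<close> is a \<open>B\<close>-set.  An operation \<open>t \<in> T(I)\<close> has components
  \<open>t\<^sub>i \<in> B\<close>, obtained by substituting the first projection at \<open>i\<close> and the second one elsewhere; they
  form a partition of \<open>B\<close>, and \<open>t(x)\<close> is the unique \<open>z\<close> with \<open>t\<^sub>i(z, x\<^sub>i) = x\<^sub>i\<close> for all \<open>i\<close>.  The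
  partitions so arising are a zero-dimensional topology \<open>J\<close> with \<open>T\<close> isomorphic to the theory of
  \<open>B\<^sub>J\<close>.  Conversely, the same condition on \<open>z\<close> defines the operations of that theory in any
  \<open>B\<^sub>J\<close>-set, so that its models are the \<open>B\<^sub>J\<close>-sets.  Finally, a concrete functor between categories
  of models comes from the theory homomorphism that is read off at the generic elements of the free
  models.
\<close>

section \<open>Categories\<close>

text \<open>Only two of the three functors are studied directly. \<open>T_functor\<close> and
  \<open>Mod_functor\<close> are shown to be fully faithful; \<open>Set_functor\<close> inherits
  this along the natural isomorphism with their composite. Essential surjectivity onto
  \<open>BJ_Var\<close> is built into the definition of that category, so the reconstruction of B_J
  from a theory is the one surjectivity argument with content. The obstacle on the algebraic side is
  that B may lack infinite joins. Those which substitution uses are joins over fibres of a refined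
  partition, so the two closure axioms provide them. Afterwards they are handled only through their
  meets with the members of a partition, and elements of a B_J-set likewise through agreement on
  each member. On the side of theories, identities in T(2) are tested by acting on the free model
  T(2), where they become laws of nested conditionals. Operations are functions on
  \<open>'u\<close>, whereas models live on subsets of \<open>'u\<close>; free models are therefore
  carried by an injective copy of the small set T(K) in \<open>'u\<close>.\<close>

lemma
  assumes "category C"
  shows cat_idt: "X \<in> ob C \<Longrightarrow> idt C X \<in> hom C X X"
    and cat_cmp: "\<lbrakk>X \<in> ob C; Y \<in> ob C; Z \<in> ob C; f \<in> hom C X Y; g \<in> hom C Y Z\<rbrakk>
      \<Longrightarrow> cmp C X Y Z g f \<in> hom C X Z"
    and cat_idr: "\<lbrakk>X \<in> ob C; Y \<in> ob C; f \<in> hom C X Y\<rbrakk> \<Longrightarrow> cmp C X X Y f (idt C X) = f"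
    and cat_idl: "\<lbrakk>X \<in> ob C; Y \<in> ob C; f \<in> hom C X Y\<rbrakk> \<Longrightarrow> cmp C X Y Y (idt C Y) f = f"
    and cat_assoc: "\<lbrakk>W \<in> ob C; X \<in> ob C; Y \<in> ob C; Z \<in> ob C; f \<in> hom C W X; g \<in> hom C X Y;
      h \<in> hom C Y Z\<rbrakk> \<Longrightarrow> cmp C W Y Z h (cmp C W X Y g f) = cmp C W X Z (cmp C X Y Z h g) f"
  using assms unfolding category_def by blast+

lemma
  assumes "is_functor C D F"
  shows functor_dom: "category C" and functor_cod: "category D"
    and functor_ob: "X \<in> ob C \<Longrightarrow> fob F X \<in> ob D"
    and functor_hom: "\<lbrakk>X \<in> ob C; Y \<in> ob C; f \<in> hom C X Y\<rbrakk>
      \<Longrightarrow> far F X Y f \<in> hom D (fob F X) (fob F Y)"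
    and functor_idt: "X \<in> ob C \<Longrightarrow> far F X X (idt C X) = idt D (fob F X)"
    and functor_cmp: "\<lbrakk>X \<in> ob C; Y \<in> ob C; Z \<in> ob C; f \<in> hom C X Y; g \<in> hom C Y Z\<rbrakk>
      \<Longrightarrow> far F X Z (cmp C X Y Z g f) =
        cmp D (fob F X) (fob F Y) (fob F Z) (far F Y Z g) (far F X Y f)"
  using assms unfolding is_functor_def by blast+

lemma iso_inE:
  assumes "iso_in C X Y f"
  obtains g where "f \<in> hom C X Y" "g \<in> hom C Y X"
    "cmp C X Y X g f = idt C X" "cmp C Y X Y f g = idt C Y"
  using assms unfolding iso_in_def by blast

lemma isomorphic_in_refl: "category C \<Longrightarrow> X \<in> ob C \<Longrightarrow> isomorphic_in C X X"
  unfolding isomorphic_in_def iso_in_def by (metis cat_idl cat_idt)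

lemma isomorphic_in_sym: "isomorphic_in C X Y \<Longrightarrow> isomorphic_in C Y X"
  unfolding isomorphic_in_def iso_in_def by blast

lemma iso_in_cmp:
  assumes C: "category C" and ob: "X \<in> ob C" "Y \<in> ob C" "Z \<in> ob C"
    and f: "iso_in C X Y f" and g: "iso_in C Y Z g"
  shows "iso_in C X Z (cmp C X Y Z g f)"
proof -
  obtain f' where f': "f \<in> hom C X Y" "f' \<in> hom C Y X"
    "cmp C X Y X f' f = idt C X" "cmp C Y X Y f f' = idt C Y"
    using f by (rule iso_inE)
  obtain g' where g': "g \<in> hom C Y Z" "g' \<in> hom C Z Y"
    "cmp C Y Z Y g' g = idt C Y" "cmp C Z Y Z g g' = idt C Z"
    using g by (rule iso_inE)
  note [simp] = f' g' ob cat_cmp[OF C] cat_idl[OF C] cat_idr[OF C]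
  have "cmp C X Z X (cmp C Z Y X f' g') (cmp C X Y Z g f) = idt C X"
    using cat_assoc[OF C, of X Z Y X "cmp C X Y Z g f" g' f']
      cat_assoc[OF C, of X Y Z Y f g g'] by simp
  moreover have "cmp C Z X Z (cmp C X Y Z g f) (cmp C Z Y X f' g') = idt C Z"
    using cat_assoc[OF C, of Z X Y Z "cmp C Z Y X f' g'" f g]
      cat_assoc[OF C, of Z Y X Y g' f' f] by simp
  ultimately show ?thesis
    unfolding iso_in_def by (auto intro!: bexI[of _ "cmp C Z Y X f' g'"])
qed

lemma isomorphic_in_trans:
  assumes "category C" "X \<in> ob C" "Y \<in> ob C" "Z \<in> ob C"
    and "isomorphic_in C X Y" "isomorphic_in C Y Z"
  shows "isomorphic_in C X Z"
  using assms iso_in_cmp unfolding isomorphic_in_def by metis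

lemma iso_in_functor:
  assumes F: "is_functor C D F" and ob: "X \<in> ob C" "Y \<in> ob C" and f: "iso_in C X Y f"
  shows "iso_in D (fob F X) (fob F Y) (far F X Y f)"
  using f ob functor_hom[OF F] functor_cmp[OF F, symmetric] functor_idt[OF F]
  unfolding iso_in_def by metis

lemma isomorphic_in_functor:
  "\<lbrakk>is_functor C D F; X \<in> ob C; Y \<in> ob C; isomorphic_in C X Y\<rbrakk>
    \<Longrightarrow> isomorphic_in D (fob F X) (fob F Y)"
  using iso_in_functor unfolding isomorphic_in_def by metis

lemma op_cat_simps [simp]:
  "ob (op_cat C) = ob C" "hom (op_cat C) X Y = hom C Y X" "idt (op_cat C) X = idt C X"
  "cmp (op_cat C) X Y Z g f = cmp C Z Y X f g"
  by (simp_all add: op_cat_def)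

lemma full_subcat_simps [simp]:
  "ob (full_subcat C P) = {X \<in> ob C. P X}" "hom (full_subcat C P) = hom C"
  "idt (full_subcat C P) = idt C" "cmp (full_subcat C P) = cmp C"
  by (simp_all add: full_subcat_def)

lemma iso_in_op_cat [simp]: "iso_in (op_cat C) X Y f \<longleftrightarrow> iso_in C Y X f"
  by (auto simp: iso_in_def)

lemma isomorphic_in_op_cat [simp]: "isomorphic_in (op_cat C) X Y \<longleftrightarrow> isomorphic_in C Y X"
  by (simp add: isomorphic_in_def)

lemma iso_in_full_subcat [simp]: "iso_in (full_subcat C P) X Y f \<longleftrightarrow> iso_in C X Y f"
  by (simp add: iso_in_def)

lemma isomorphic_in_full_subcat [simp]:
  "isomorphic_in (full_subcat C P) X Y \<longleftrightarrow> isomorphic_in C X Y"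
  by (simp add: isomorphic_in_def)

text \<open>With this the targets \<open>op_cat BJ_Var\<close> and \<open>op_cat B_Var\<close> are
  full subcategories of \<open>op_cat VAR\<close>, the shape that the corestriction lemmas
  require.\<close>

lemma op_cat_full_subcat: "op_cat (full_subcat C P) = full_subcat (op_cat C) P"
  by (simp add: op_cat_def full_subcat_def)

lemma category_op_cat: "category C \<Longrightarrow> category (op_cat C)"
  unfolding category_def by simp

lemma category_full_subcat: "category C \<Longrightarrow> category (full_subcat C P)"
  unfolding category_def by simp

lemma is_functor_corestrict:
  "is_functor C D F \<Longrightarrow> (\<And>X. X \<in> ob C \<Longrightarrow> P (fob F X)) \<Longrightarrow> is_functor C (full_subcat D P) F"
  unfolding is_functor_def by (simp add: category_full_subcat)

lemma is_functor_restrict: "is_functor C D F \<Longrightarrow> is_functor (full_subcat C P) D F"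
  unfolding is_functor_def by (simp add: category_full_subcat)

lemma comp_functor_simps [simp]:
  "fob (G \<circ>\<^sub>F F) X = fob G (fob F X)"
  "far (G \<circ>\<^sub>F F) X Y f = far G (fob F X) (fob F Y) (far F X Y f)"
  by (simp_all add: comp_functor_def)

lemma comp_functor_assoc: "H \<circ>\<^sub>F (G \<circ>\<^sub>F F) = (H \<circ>\<^sub>F G) \<circ>\<^sub>F F"
  by (simp add: comp_functor_def)

lemma is_functor_comp:
  "is_functor C D F \<Longrightarrow> is_functor D E G \<Longrightarrow> is_functor C E (G \<circ>\<^sub>F F)"
  unfolding is_functor_def by simp

lemma is_functor_id: "category C \<Longrightarrow> is_functor C C id_functor"
  unfolding is_functor_def id_functor_def by simp

lemma naturally_isomorphic_comp:
  assumes "naturally_isomorphic C D F G" and K: "is_functor B C K"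
  shows "naturally_isomorphic B D (F \<circ>\<^sub>F K) (G \<circ>\<^sub>F K)"
proof -
  from assms obtain \<eta> where "is_functor C D F" "is_functor C D G"
    and "\<forall>X\<in>ob C. iso_in D (fob F X) (fob G X) (\<eta> X)"
    and "\<forall>X\<in>ob C. \<forall>Y\<in>ob C. \<forall>f\<in>hom C X Y.
           cmp D (fob F X) (fob F Y) (fob G Y) (\<eta> Y) (far F X Y f) =
           cmp D (fob F X) (fob G X) (fob G Y) (far G X Y f) (\<eta> X)"
    unfolding naturally_isomorphic_def by blast
  then show ?thesis
    unfolding naturally_isomorphic_def
    by (auto simp: functor_ob[OF K] functor_hom[OF K] intro!: is_functor_comp[OF K] exI[of _
        "\<lambda>X. \<eta> (fob K X)"])
qed

lemma naturally_isomorphic_corestrict: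
  assumes "naturally_isomorphic C D F G"
    and "\<And>X. X \<in> ob C \<Longrightarrow> P (fob F X)" "\<And>X. X \<in> ob C \<Longrightarrow> P (fob G X)"
  shows "naturally_isomorphic C (full_subcat D P) F G"
  using assms is_functor_corestrict[of C D _ P] unfolding naturally_isomorphic_def by auto

section \<open>Fully faithful functors and equivalences\<close>

lemma fully_faithful_comp:
  "fully_faithful C D F \<Longrightarrow> fully_faithful D E G \<Longrightarrow> fully_faithful C E (G \<circ>\<^sub>F F)"
  unfolding fully_faithful_def
proof (intro conjI ballI)
  assume F: "is_functor C D F \<and> (\<forall>X\<in>ob C. \<forall>Y\<in>ob C. bij_betw (far F X Y) (hom C X Y)
      (hom D (fob F X) (fob F Y)))"
    and G: "is_functor D E G \<and> (\<forall>X\<in>ob D. \<forall>Y\<in>ob D. bij_betw (far G X Y) (hom D X Y)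
        (hom E (fob G X) (fob G Y)))"
  show "is_functor C E (G \<circ>\<^sub>F F)"
    by (rule is_functor_comp[OF conjunct1[OF F] conjunct1[OF G]])
  fix X Y assume "X \<in> ob C" "Y \<in> ob C"
  then have "bij_betw (far F X Y) (hom C X Y) (hom D (fob F X) (fob F Y))"
    "bij_betw (far G (fob F X) (fob F Y)) (hom D (fob F X) (fob F Y))
        (hom E (fob G (fob F X)) (fob G (fob F Y)))"
    using F G functor_ob[OF conjunct1[OF F]] by blast+
  from bij_betw_trans[OF this]
  show "bij_betw (far (G \<circ>\<^sub>F F) X Y) (hom C X Y) (hom E (fob (G \<circ>\<^sub>F F) X) (fob (G \<circ>\<^sub>F F) Y))"
    by (simp add: comp_functor_def o_def)
qed

lemma fully_faithful_corestrict:
  "fully_faithful C D F \<Longrightarrow> (\<And>X. X \<in> ob C \<Longrightarrow> P (fob F X)) \<Longrightarrow> fully_faithful C (full_subcat D P) F"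
  unfolding fully_faithful_def by (auto intro: is_functor_corestrict)

lemma fully_faithful_restrict: "fully_faithful C D F \<Longrightarrow> fully_faithful (full_subcat C P) D F"
  unfolding fully_faithful_def by (auto intro: is_functor_restrict)

text \<open>Conjugating back with \<open>u'\<close> and \<open>v'\<close> undoes the conjugation,
  because associativity brings each isomorphism next to its inverse.\<close>

lemma bij_betw_conjugate:
  assumes C: "category C" and ob: "X \<in> ob C" "Y \<in> ob C" "X' \<in> ob C" "Y' \<in> ob C"
    and u: "u \<in> hom C X' X" "u' \<in> hom C X X'" "cmp C X X' X u u' = idt C X" "cmp C X' X X' u' u
        = idt C X'"
    and v: "v \<in> hom C Y Y'" "v' \<in> hom C Y' Y" "cmp C Y Y' Y v' v = idt C Y" "cmp C Y' Y Y' v v'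
        = idt C Y'"
  shows "bij_betw (\<lambda>f. cmp C X' Y Y' v (cmp C X' X Y f u)) (hom C X Y) (hom C X' Y')"
proof (rule bij_betw_byWitness[where f' = "\<lambda>g. cmp C X Y' Y v' (cmp C X X' Y' g u')"])
  note [simp] = ob u v cat_cmp[OF C] cat_idl[OF C] cat_idr[OF C]
  show "\<forall>f\<in>hom C X Y. cmp C X Y' Y v' (cmp C X X' Y' (cmp C X' Y Y' v (cmp C X' X Y f u)) u') = f"
  proof
    fix f assume [simp]: "f \<in> hom C X Y"
    have "cmp C X X' Y' (cmp C X' Y Y' v (cmp C X' X Y f u)) u' = cmp C X Y Y' v f"
      using cat_assoc[OF C, of X X' Y Y' u' "cmp C X' X Y f u"
          v] cat_assoc[OF C, of X X' X Y u' u f]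
      by simp
    then show "cmp C X Y' Y v' (cmp C X X' Y' (cmp C X' Y Y' v (cmp C X' X Y f u)) u') = f"
      using cat_assoc[OF C, of X Y Y' Y f v v'] by simp
  qed
  show "\<forall>g\<in>hom C X' Y'. cmp C X' Y Y' v (cmp C X' X Y (cmp C X Y' Y v' (cmp C X X' Y' g u')) u) = g"
  proof
    fix g assume [simp]: "g \<in> hom C X' Y'"
    have "cmp C X' X Y (cmp C X Y' Y v' (cmp C X X' Y' g u')) u = cmp C X' Y' Y v' g"
      using cat_assoc[OF C, of X' X Y' Y u "cmp C X X' Y' g u'"
          v'] cat_assoc[OF C, of X' X X' Y' u u' g]
      by simp
    then show "cmp C X' Y Y' v (cmp C X' X Y (cmp C X Y' Y v' (cmp C X X' Y' g u')) u) = g"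
      using cat_assoc[OF C, of X' Y' Y Y' g v' v] by simp
  qed
qed (auto simp: ob u v cat_cmp[OF C])

text \<open>Naturality says that \<open>far G X Y f\<close> is \<open>far F X Y f\<close> conjugated
  by the components at X and Y, so the bijection of hom-sets for F is followed by the one of
  \<open>bij_betw_conjugate\<close>. This spares a direct study of concrete functors between
  categories of B_J-sets.\<close>

lemma fully_faithful_naturally_isomorphic:
  assumes F: "fully_faithful C D F" and N: "naturally_isomorphic C D F G"
  shows "fully_faithful C D G"
proof -
  from N obtain \<eta> where FF: "is_functor C D F" and GF: "is_functor C D G"
    and \<eta>: "\<And>X. X \<in> ob C \<Longrightarrow> iso_in D (fob F X) (fob G X) (\<eta> X)"
    and nat: "\<And>X Y f. \<lbrakk>X \<in> ob C; Y \<in> ob C; f \<in> hom C X Y\<rbrakk> \<Longrightarrow>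
           cmp D (fob F X) (fob F Y) (fob G Y) (\<eta> Y) (far F X Y f) =
           cmp D (fob F X) (fob G X) (fob G Y) (far G X Y f) (\<eta> X)"
    unfolding naturally_isomorphic_def by blast
  note D = functor_cod[OF FF]
  have "bij_betw (far G X Y) (hom C X Y) (hom D (fob G X) (fob G Y))" if XY: "X \<in> ob C" "Y \<in> ob C"
      for X Y
  proof -
    obtain u where u: "\<eta> X \<in> hom D (fob F X) (fob G X)" "u \<in> hom D (fob G X) (fob F X)"
      "cmp D (fob F X) (fob G X) (fob F X) u (\<eta> X) = idt D (fob F X)"
      "cmp D (fob G X) (fob F X) (fob G X) (\<eta> X) u = idt D (fob G X)"
      using \<eta>[OF XY(1)] by (rule iso_inE)
    obtain v where v: "\<eta> Y \<in> hom D (fob F Y) (fob G Y)" "v \<in> hom D (fob G Y) (fob F Y)"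
      "cmp D (fob F Y) (fob G Y) (fob F Y) v (\<eta> Y) = idt D (fob F Y)"
      "cmp D (fob G Y) (fob F Y) (fob G Y) (\<eta> Y) v = idt D (fob G Y)"
      using \<eta>[OF XY(2)] by (rule iso_inE)
    note obs = functor_ob[OF FF XY(1)] functor_ob[OF FF XY(2)] functor_ob[OF GF XY(1)]
        functor_ob[OF GF XY(2)]
    have *: "bij_betw (\<lambda>f. cmp D (fob G X) (fob F Y) (fob G Y) (\<eta> Y)
        (cmp D (fob G X) (fob F X) (fob F Y) f u))
       (hom D (fob F X) (fob F Y)) (hom D (fob G X) (fob G Y))"
      using obs u v by (intro bij_betw_conjugate[OF D]) auto
    have "bij_betw (\<lambda>f. cmp D (fob G X) (fob F Y) (fob G Y) (\<eta> Y)
        (cmp D (fob G X) (fob F X) (fob F Y) (far F X Y f) u))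
       (hom C X Y) (hom D (fob G X) (fob G Y))"
      using bij_betw_trans[OF _ *, of "far F X Y"] F XY unfolding fully_faithful_def
          by (auto simp: o_def)
    moreover have "cmp D (fob G X) (fob F Y) (fob G Y) (\<eta> Y)
        (cmp D (fob G X) (fob F X) (fob F Y) (far F X Y f) u)
      = far G X Y f" if f: "f \<in> hom C X Y" for f
      using cat_assoc[OF D obs(3,1,2,4) u(2) functor_hom[OF FF XY f] v(1)]
        cat_assoc[OF D obs(3,1,3,4) u(2,1) functor_hom[OF GF XY f]]
        cat_idr[OF D obs(3,4) functor_hom[OF GF XY f]]
      by (simp add: u v nat XY f)
    ultimately show ?thesis by (simp cong: bij_betw_cong)
  qed
  then show ?thesis using GF unfolding fully_faithful_def by blast
qed

text \<open>The inverse functor is built by choice: Y goes to some \<open>G Y\<close> with an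
  isomorphism \<open>e Y\<close> from F(G Y) to Y, and an arrow goes to the unique preimage under F
  of its conjugate by these isomorphisms.\<close>

lemma equivalenceI:
  assumes F: "fully_faithful C D F"
    and es: "\<And>Y. Y \<in> ob D \<Longrightarrow> \<exists>X\<in>ob C. isomorphic_in D (fob F X) Y"
  shows "equivalence C D F"
proof -
  have FF: "is_functor C D F" using F by (simp add: fully_faithful_def)
  note C = functor_dom[OF FF] and D = functor_cod[OF FF]
  define L where "L X Y = inv_into (hom C X Y) (far F X Y)" for X Y
  have bij: "bij_betw (far F X Y) (hom C X Y) (hom D (fob F X) (fob F Y))" if "X \<in> ob C" "Y \<in> ob C"
      for X Y
    using F that by (simp add: fully_faithful_def)
  have L: "L X Y g \<in> hom C X Y" "far F X Y (L X Y g) = g"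
    if "X \<in> ob C" "Y \<in> ob C" "g \<in> hom D (fob F X) (fob F Y)" for X Y g
    using bij[OF that(1,2)] that(3) unfolding L_def
    by (auto simp: bij_betw_def inv_into_into f_inv_into_f)
  have inj: "f = f'" if "far F X Y f = far F X Y f'" "X \<in> ob C" "Y \<in> ob C" "f \<in> hom C X Y"
      "f' \<in> hom C X Y" for X Y f f'
    using bij[OF that(2,3)] that unfolding bij_betw_def inj_on_def by blast
  from es have "\<forall>Y\<in>ob D. \<exists>X e e'. X \<in> ob C \<and> e \<in> hom D (fob F X) Y \<and> e' \<in> hom D Y (fob F X) \<and>
     cmp D (fob F X) Y (fob F X) e' e = idt D (fob F X) \<and> cmp D Y (fob F X) Y e e' = idt D Y"
    unfolding isomorphic_in_def iso_in_def by blast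
  then obtain G e e' where G: "\<And>Y. Y \<in> ob D \<Longrightarrow> G Y \<in> ob C \<and> e Y \<in> hom D (fob F (G Y)) Y \<and>
      e' Y \<in> hom D Y (fob F (G Y)) \<and>
     cmp D (fob F (G Y)) Y (fob F (G Y)) (e' Y) (e Y)
         = idt D (fob F (G Y)) \<and> cmp D Y (fob F (G Y)) Y (e Y) (e' Y) = idt D Y"
    by metis
  define A where "A Y = fob F (G Y)" for Y
  have G': "G Y \<in> ob C" "A Y \<in> ob D" "e Y \<in> hom D (A Y) Y" "e' Y \<in> hom D Y (A Y)"
     "cmp D (A Y) Y (A Y) (e' Y) (e Y) = idt D (A Y)" "cmp D Y (A Y) Y (e Y) (e' Y) = idt D Y"
    if "Y \<in> ob D" for Y
    using G[OF that] functor_ob[OF FF] by (auto simp: A_def)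
  \<comment> \<open>The only arrow from \<open>A Y\<close> to \<open>A Z\<close> that can make
    \<open>e\<close> natural; naturality is the second half of the fact \<open>K\<close>
    below.\<close>
  define K where "K Y Z g = cmp D (A Y) Z (A Z) (e' Z) (cmp D (A Y) Y Z g (e Y))" for Y Z g
  note [simp] = G' cat_idt[OF C] cat_idt[OF D] cat_cmp[OF C] cat_cmp[OF D] cat_idl[OF C]
      cat_idr[OF C]
    cat_idl[OF D] cat_idr[OF D] functor_ob[OF FF] functor_hom[OF FF] functor_idt[OF FF]
    functor_cmp[OF FF] A_def[symmetric]
  have K: "K Y Z g \<in> hom D (A Y) (A Z)" "cmp D (A Y) (A Z) Z (e Z) (K Y Z g)
      = cmp D (A Y) Y Z g (e Y)"
    if "Y \<in> ob D" "Z \<in> ob D" "g \<in> hom D Y Z" for Y Z g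
    using that cat_assoc[OF D, of "A Y" Z "A Z" Z "cmp D (A Y) Y Z g (e Y)" "e' Z" "e Z"]
    by (simp_all add: K_def)
  have K_id: "K Y Y (idt D Y) = idt D (A Y)" if "Y \<in> ob D" for Y
    using that by (simp add: K_def)
  have K_cmp: "K Y W (cmp D Y Z W h g) = cmp D (A Y) (A Z) (A W) (K Z W h) (K Y Z g)"
    if [simp]: "Y \<in> ob D" "Z \<in> ob D" "W \<in> ob D" "g \<in> hom D Y Z" "h \<in> hom D Z W" for Y Z W g h
  proof -
    have "cmp D (A Y) (A Z) (A W) (K Z W h) (K Y Z g)
        = cmp D (A Y) W (A W) (e' W) (cmp D (A Y) (A Z) W (cmp D (A Z) Z W h (e Z)) (K Y Z g))"
      using cat_assoc[OF D, of "A Y" "A Z" W "A W" "K Y Z g" "cmp D (A Z) Z W h (e Z)" "e' W"]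
      by (simp add: K(1) K_def[of Z W])
    also have "cmp D (A Y) (A Z) W (cmp D (A Z) Z W h (e Z)) (K Y Z g)
        = cmp D (A Y) Z W h (cmp D (A Y) Y Z g (e Y))"
      using cat_assoc[OF D, of "A Y" "A Z" Z W "K Y Z g" "e Z" h] by (simp add: K)
    also have "\<dots> = cmp D (A Y) Y W (cmp D Y Z W h g) (e Y)"
      using cat_assoc[OF D, of "A Y" Y Z W "e Y" g h] by simp
    finally show ?thesis by (simp add: K_def)
  qed
  define GF where "GF = \<lparr>fob = G, far = (\<lambda>Y Z g. L (G Y) (G Z) (K Y Z g))\<rparr>"
  have LK: "L (G Y) (G Z) (K Y Z g) \<in> hom C (G Y) (G Z)"
      "far F (G Y) (G Z) (L (G Y) (G Z) (K Y Z g)) = K Y Z g"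
    if "Y \<in> ob D" "Z \<in> ob D" "g \<in> hom D Y Z" for Y Z g
    using that K(1) by (auto intro!: L)
  have Gfun: "is_functor D C GF"
    unfolding is_functor_def
  proof (intro conjI ballI)
    show "far GF X X (idt D X) = idt C (fob GF X)" if "X \<in> ob D" for X
      using that LK[of X X "idt D X"] by (intro inj[of "fob GF X"
          "fob GF X"]) (auto simp: GF_def K_id)
    show "far GF X Z (cmp D X Y Z g f) = cmp C (fob GF X) (fob GF Y) (fob GF Z) (far GF Y Z g)
        (far GF X Y f)"
      if "X \<in> ob D" "Y \<in> ob D" "Z \<in> ob D" "f \<in> hom D X Y" "g \<in> hom D Y Z" for X Y Z f g
      using that LK[of X Z "cmp D X Y Z g f"] LK[of X Y f] LK[of Y Z g]
      by (intro inj[of "fob GF X" "fob GF Z"]) (auto simp: GF_def K_cmp)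
  qed (use C D in \<open>auto simp: GF_def LK\<close>)
  have "naturally_isomorphic D D (F \<circ>\<^sub>F GF) id_functor"
    unfolding naturally_isomorphic_def
  proof (intro conjI exI[of _ e] ballI)
    show "iso_in D (fob (F \<circ>\<^sub>F GF) X) (fob id_functor X) (e X)" if "X \<in> ob D" for X
      using that by (auto simp: iso_in_def GF_def id_functor_def intro!: bexI[of _ "e' X"])
  qed (auto simp: GF_def LK K is_functor_id[OF D, unfolded id_functor_def] id_functor_def
      is_functor_comp[OF Gfun FF, unfolded GF_def])
  moreover have "naturally_isomorphic C C (GF \<circ>\<^sub>F F) id_functor"
    unfolding naturally_isomorphic_def
  \<comment> \<open>The component at X is the preimage under F of \<open>e (fob F X)\<close>.
    Equations in C are verified after applying F, by faithfulness.\<close>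
  proof (intro conjI exI[of _ "\<lambda>X. L (G (fob F X)) X (e (fob F X))"] ballI)
    fix X assume [simp]: "X \<in> ob C"
    have l: "L (G (fob F X)) X (e (fob F X)) \<in> hom C (G (fob F X)) X"
       "L X (G (fob F X)) (e' (fob F X)) \<in> hom C X (G (fob F X))"
      by (auto intro!: L)
    let ?l = "L (G (fob F X)) X (e (fob F X))" and ?l' = "L X (G (fob F X)) (e' (fob F X))"
    have "cmp C (G (fob F X)) X (G (fob F X)) ?l' ?l = idt C (G (fob F X))"
      using l by (intro inj[of "G (fob F X)" "G (fob F X)"]) (auto simp: L)
    moreover have "cmp C X (G (fob F X)) X ?l ?l' = idt C X"
      using l by (intro inj[of X X]) (auto simp: L)
    ultimately show "iso_in C (fob (GF \<circ>\<^sub>F F) X) (fob id_functor X) ?l"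
      unfolding iso_in_def using l by (auto simp: GF_def id_functor_def)
  next
    fix X Y f assume [simp]: "X \<in> ob C" "Y \<in> ob C" "f \<in> hom C X Y"
    have l: "L (G (fob F X)) X (e (fob F X)) \<in> hom C (G (fob F X)) X"
      "L (G (fob F Y)) Y (e (fob F Y)) \<in> hom C (G (fob F Y)) Y"
      by (auto intro!: L)
    show "cmp C (fob (GF \<circ>\<^sub>F F) X) (fob (GF \<circ>\<^sub>F F) Y) (fob id_functor Y)
        (L (G (fob F Y)) Y (e (fob F Y))) (far (GF \<circ>\<^sub>F F) X Y f) =
       cmp C (fob (GF \<circ>\<^sub>F F) X) (fob id_functor X) (fob id_functor Y) (far id_functor X Y f)
           (L (G (fob F X)) X (e (fob F X)))"
      using l by (auto simp: GF_def id_functor_def L LK K intro!: inj[of "G (fob F X)" Y])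
  qed (auto simp: is_functor_id[OF C] is_functor_comp[OF FF Gfun])
  ultimately show ?thesis using FF Gfun unfolding equivalence_def by blast
qed

section \<open>Small sets\<close>

lemma small_subset: "small TYPE('u) B \<Longrightarrow> A \<subseteq> B \<Longrightarrow> small TYPE('u) A"
  unfolding small_def using card_of_mono1 ordLeq_ordLess_trans by blast

lemma small_image: "small TYPE('u) A \<Longrightarrow> small TYPE('u) (f ` A)"
  unfolding small_def using card_of_image ordLeq_ordLess_trans by blast

lemma small_embed:
  assumes "small TYPE('u) A"
  obtains e :: "'a \<Rightarrow> 'u" where "inj_on e A"
  using assms ordLess_imp_ordLeq card_of_ordLeq[of A "UNIV :: 'u set"] unfolding small_def by blast

lemma small_inj_on: "inj_on f A \<Longrightarrow> small TYPE('u) (f ` A) \<Longrightarrow> small TYPE('u) A"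
  using small_image[of "f ` A" "inv_into A f"] by (simp add: inv_into_image_cancel)

lemma infinite_universe: "universe TYPE('u) \<Longrightarrow> infinite (UNIV :: 'u set)"
  by (simp add: universe_def)

lemma small_finite: "universe TYPE('u) \<Longrightarrow> finite A \<Longrightarrow> small TYPE('u) A"
  unfolding small_def
  by (intro finite_ordLess_infinite card_of_Well_order)
      (simp_all add: infinite_universe Field_card_of)

text \<open>Both factors embed in the disjoint sum \<open>A <+> B\<close>, which is small. If the
  sum is infinite, its square has the same cardinality; if it is finite, so is its square.\<close>

lemma small_Times:
  assumes "universe TYPE('u)" and A: "small TYPE('u) A" and B: "small TYPE('u) B"
  shows "small TYPE('u) (A \<times> B)"
proof -
  let ?D = "A <+> B"
  have D: "small TYPE('u) ?D"
    using assms unfolding small_def by (simp add: card_of_Plus_ordLess_infinite infinite_universe)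
  have "small TYPE('u) (?D \<times> ?D)"
  proof (cases "finite ?D")
    case True
    then show ?thesis using assms(1) by (simp add: small_finite)
  next
    case False
    then show ?thesis
      using D card_of_Times_same_infinite ordIso_ordLess_trans unfolding small_def by blast
  qed
  then have "small TYPE('u) (map_prod Inl Inr ` (A \<times> B) :: (('a + 'b) \<times> ('a + 'b)) set)"
    by (rule small_subset) auto
  then show ?thesis
    by (rule small_inj_on[rotated]) (auto intro!: inj_onI)
qed

text \<open>The strong limit clause of \<open>universe\<close> speaks of subsets of
  \<open>'u\<close>, so A is first embedded there.\<close>

lemma small_Pow:
  assumes "universe TYPE('u)" and A: "small TYPE('u) A"
  shows "small TYPE('u) (Pow A)"
proof -
  obtain e :: "_ \<Rightarrow> 'u" where e: "inj_on e A" using A by (rule small_embed)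
  have "small TYPE('u) (Pow (e ` A))"
    using assms small_image[OF A, of e] by (simp add: universe_def small_def)
  then have "small TYPE('u) (image e ` Pow A)"
    by (rule small_subset) auto
  then show ?thesis
    by (rule small_inj_on[rotated]) (meson e inj_on_image_Pow)
qed

text \<open>An extensional function is determined by its graph, a subset of
  \<open>A \<times> B\<close>.\<close>

lemma small_PiE:
  assumes U: "universe TYPE('u)" and A: "small TYPE('u) A" and B: "small TYPE('u) B"
  shows "small TYPE('u) (A \<rightarrow>\<^sub>E B)"
proof (rule small_inj_on)
  show "inj_on (\<lambda>f. (\<lambda>a. (a, f a)) ` A) (A \<rightarrow>\<^sub>E B)"
  proof (rule inj_onI)
    fix f g assume fg: "f \<in> A \<rightarrow>\<^sub>E B" "g \<in> A \<rightarrow>\<^sub>E B" "(\<lambda>a. (a, f a)) ` A = (\<lambda>a. (a, g a)) ` A"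
    have "f a = g a" if "a \<in> A" for a
    proof -
      have "(a, f a) \<in> (\<lambda>a. (a, g a)) ` A" using that fg(3) by blast
      then show ?thesis by auto
    qed
    then show "f = g" using fg(1,2) by (rule PiE_ext[rotated 2])
  qed
  show "small TYPE('u) ((\<lambda>f. (\<lambda>a. (a, f a)) ` A) ` (A \<rightarrow>\<^sub>E B))"
    by (rule small_subset[OF small_Pow[OF U small_Times[OF U A B]]]) auto
qed

lemma
  assumes "universe TYPE('u)"
  shows num_eq_iff: "(num m :: 'u) = num n \<longleftrightarrow> m = n"
    and nset_2: "nset 2 = {num 1 :: 'u, num 2}"
    and small_nset: "small TYPE('u) (nset n :: 'u set)"
proof -
  have "inj (num :: nat \<Rightarrow> 'u)"
    unfolding num_def using infinite_countable_subset[OF infinite_universe[OF assms]]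
    by (intro someI_ex[of inj]) blast
  then show "(num m :: 'u) = num n \<longleftrightarrow> m = n" by (auto dest: injD)
  have "{1..2::nat} = {1, 2}" by auto
  then show "nset 2 = {num 1 :: 'u, num 2}" unfolding nset_def by simp
  show "small TYPE('u) (nset n :: 'u set)"
    by (rule small_finite[OF assms]) (simp add: nset_def)
qed

text \<open>Arities are subsets of \<open>'u\<close>, so an operation whose arguments are indexed by
  pairs needs the pairs coded inside \<open>'u\<close>.\<close>

definition pair :: "'u \<times> 'u \<Rightarrow> 'u" where
  "pair = (SOME f. inj f)"

lemma inj_pair:
  assumes "universe TYPE('u)"
  shows "inj (pair :: 'u \<times> 'u \<Rightarrow> 'u)"
proof -
  have "|(UNIV :: 'u set) \<times> (UNIV :: 'u set)| \<le>o |UNIV :: 'u set|"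
    using card_of_Times_same_infinite[OF infinite_universe[OF assms]] ordIso_iff_ordLeq by blast
  then have "\<exists>f :: 'u \<times> 'u \<Rightarrow> 'u. inj f"
    unfolding card_of_ordLeq[symmetric] by auto
  then show ?thesis unfolding pair_def by (rule someI_ex)
qed

section \<open>Theories and their models\<close>

text \<open>\<open>subst\<close> is specified only on families that are extensional on I.
  Restricting first lets any function serve as a family of arguments, with \<open>app_cong\<close>
  in place of extensionality.\<close>

definition app :: "('u, 't) algth \<Rightarrow> 'u set \<Rightarrow> 'u set \<Rightarrow> 't \<Rightarrow> ('u \<Rightarrow> 't) \<Rightarrow> 't" where
  "app T I J t f = subst T I J t (restrict f I)"

locale alg_theory =
  fixes T :: "('u, 't) algth"
  assumes universe: "universe TYPE('u)" and algebraic_theory: "algebraic_theory T"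
begin

abbreviation sm :: "'u set \<Rightarrow> bool" where
  "sm I \<equiv> small TYPE('u) I"

lemmas num_eq [simp] = num_eq_iff[OF universe]
lemmas nset_2_eq = nset_2[OF universe]
lemmas small_nset' [simp] = small_nset[OF universe]

lemma num_in_nset_2 [simp]: "num 1 \<in> (nset 2 :: 'u set)" "num 2 \<in> (nset 2 :: 'u set)"
  "num (Suc 0) \<in> (nset 2 :: 'u set)"
  by (simp_all add: nset_2_eq)

lemma small_ops: "sm I \<Longrightarrow> small TYPE('u) (ops T I)"
  and proj_closed [simp]: "sm I \<Longrightarrow> i \<in> I \<Longrightarrow> proj T I i \<in> ops T I"
  and subst_closed: "\<lbrakk>sm I; sm J; t \<in> ops T I; u \<in> I \<rightarrow>\<^sub>E ops T J\<rbrakk> \<Longrightarrow> subst T I J t u \<in> ops T J"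
  and subst_id: "\<lbrakk>sm I; t \<in> ops T I\<rbrakk> \<Longrightarrow> subst T I I t (\<lambda>i\<in>I. proj T I i) = t"
  and subst_proj: "\<lbrakk>sm I; sm J; i \<in> I; u \<in> I \<rightarrow>\<^sub>E ops T J\<rbrakk> \<Longrightarrow> subst T I J (proj T I i) u = u i"
  and subst_subst: "\<lbrakk>sm I; sm J; sm K; t \<in> ops T I; u \<in> I \<rightarrow>\<^sub>E ops T J; v \<in> J \<rightarrow>\<^sub>E ops T K\<rbrakk>
    \<Longrightarrow> subst T J K (subst T I J t u) v = subst T I K t (\<lambda>i\<in>I. subst T J K (u i) v)"
  by (use algebraic_theory in \<open>simp add: algebraic_theory_def\<close>)+

lemma app_closed [simp]:
  "\<lbrakk>sm I; sm J; t \<in> ops T I; \<And>i. i \<in> I \<Longrightarrow> f i \<in> ops T J\<rbrakk> \<Longrightarrow> app T I J t f \<in> ops T J"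
  by (simp add: app_def subst_closed)

lemma app_proj_id: "\<lbrakk>sm I; t \<in> ops T I\<rbrakk> \<Longrightarrow> app T I I t (proj T I) = t"
  by (simp add: app_def subst_id)

lemma app_cong: "(\<And>i. i \<in> I \<Longrightarrow> f i = g i) \<Longrightarrow> app T I J t f = app T I J t g"
  by (simp add: app_def cong: restrict_cong)

lemma app_proj [simp]:
  "\<lbrakk>sm I; sm J; i \<in> I; \<And>i. i \<in> I \<Longrightarrow> f i \<in> ops T J\<rbrakk> \<Longrightarrow> app T I J (proj T I i) f = f i"
  by (simp add: app_def subst_proj)

lemma app_app:
  "\<lbrakk>sm I; sm J; sm K; t \<in> ops T I; \<And>i. i \<in> I \<Longrightarrow> u i \<in> ops T J; \<And>j. j \<in> J \<Longrightarrow> f j \<in> ops T K\<rbrakk>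
    \<Longrightarrow> app T J K (app T I J t u) f = app T I K t (\<lambda>i. app T J K (u i) f)"
  by (simp add: app_def subst_subst cong: restrict_cong)

end

text \<open>The carrier may lie in any type, and operations take arbitrary functions of which only
  the values on the arity count. Thus T(K), whose elements need not lie in \<open>'u\<close>, is a
  model as it stands, and facts about models apply to computations inside the theory.\<close>

locale model_of = alg_theory T for T :: "('u, 't) algth" +
  fixes X :: "'x set" and m :: "'u set \<Rightarrow> 't \<Rightarrow> ('u \<Rightarrow> 'x) \<Rightarrow> 'x"
  assumes m_closed [simp]:
      "\<lbrakk>sm I; t \<in> ops T I; \<And>i. i \<in> I \<Longrightarrow> f i \<in> X\<rbrakk> \<Longrightarrow> m I t f \<in> X"
    and m_cong: "(\<And>i. i \<in> I \<Longrightarrow> f i = g i) \<Longrightarrow> m I t f = m I t g"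
    and m_proj [simp]: "\<lbrakk>sm I; i \<in> I; \<And>i. i \<in> I \<Longrightarrow> f i \<in> X\<rbrakk> \<Longrightarrow> m I (proj T I i) f = f i"
    and m_app: "\<lbrakk>sm I; sm J; t \<in> ops T I; \<And>i. i \<in> I \<Longrightarrow> u i \<in> ops T J; \<And>j. j \<in> J \<Longrightarrow> f j \<in> X\<rbrakk>
      \<Longrightarrow> m J (app T I J t u) f = m I t (\<lambda>i. m J (u i) f)"

context alg_theory
begin

lemma free_model_of: "sm K \<Longrightarrow> model_of T (ops T K) (\<lambda>I t f. app T I K t f)"
  by (unfold_locales) (auto simp: app_app intro: app_cong)

end

locale hyperaffine_theory = alg_theory T for T :: "('u, 't) algth" +
  assumes hyperaffine: "hyperaffine T"
begin

lemma app_const: "\<lbrakk>sm I; sm K; t \<in> ops T I; x \<in> ops T K\<rbrakk> \<Longrightarrow> app T I K t (\<lambda>i. x) = x"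
  using hyperaffine unfolding hyperaffine_def hyperaffine_op_def app_def by simp

lemma app_diag:
  assumes "sm I" "sm K" "t \<in> ops T I" "\<And>i j. i \<in> I \<Longrightarrow> j \<in> I \<Longrightarrow> x i j \<in> ops T K"
  shows "app T I K t (\<lambda>i. app T I K t (x i)) = app T I K t (\<lambda>i. x i i)"
proof -
  have "(\<lambda>i\<in>I. \<lambda>j\<in>I. x i j) \<in> I \<rightarrow>\<^sub>E (I \<rightarrow>\<^sub>E ops T K)" using assms by auto
  then have "subst T I K t (\<lambda>i\<in>I. subst T I K t (\<lambda>j\<in>I. (\<lambda>i\<in>I. \<lambda>j\<in>I. x i j) i j)) =
           subst T I K t (\<lambda>i\<in>I. (\<lambda>i\<in>I. \<lambda>j\<in>I. x i j) i i)"
    using assms(1-3) hyperaffine unfolding hyperaffine_def hyperaffine_op_def by blast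
  moreover have "(\<lambda>i\<in>I. subst T I K t (\<lambda>j\<in>I. (\<lambda>i\<in>I. \<lambda>j\<in>I. x i j) i j))
      = (\<lambda>i\<in>I. subst T I K t (restrict (x i) I))"
    by (rule restrict_ext) (simp cong: restrict_cong)
  ultimately show ?thesis unfolding app_def by (simp cong: restrict_cong)
qed

end

locale hyperaffine_model = hyperaffine_theory T + model_of T X m
  for T :: "('u, 't) algth" and X :: "'x set" and m
begin

text \<open>The hyperaffine laws quantify over the sets T(K). Other models are reached through the
  universal instance: the law for the generator of T({1}) is evaluated at x.\<close>

lemma m_const:
  assumes "sm I" "t \<in> ops T I" "x \<in> X"
  shows "m I t (\<lambda>i. x) = x"
proof -
  let ?K = "{num 1 :: 'u}"
  have K: "sm ?K" by (simp add: small_finite universe)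
  have "m ?K (app T I ?K t (\<lambda>i. proj T ?K (num 1))) (\<lambda>_. x) = x"
    using assms K by (simp add: app_const)
  then show ?thesis using assms K by (simp add: m_app cong: m_cong)
qed

text \<open>Again by the universal instance, now with generators indexed by coded pairs (i, j),
  which are then evaluated at \<open>x i j\<close>.\<close>

lemma m_diag:
  assumes "sm I" "t \<in> ops T I" "\<And>i j. i \<in> I \<Longrightarrow> j \<in> I \<Longrightarrow> x i j \<in> X"
  shows "m I t (\<lambda>i. m I t (x i)) = m I t (\<lambda>i. x i i)"
proof -
  note inj_pair[OF universe, simp]
  let ?K = "pair ` (I \<times> I)"
  have K: "sm ?K" using assms by (intro small_image small_Times universe)
  define f where "f k = (case inv pair k of (i, j) \<Rightarrow> x i j)" for k
  have f: "f (pair (i, j)) = x i j" for i j by (simp add: f_def)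
  have fX: "f k \<in> X" if "k \<in> ?K" for k using that assms by (auto simp: f)
  have pK: "proj T ?K (pair (i, j)) \<in> ops T ?K" if "i \<in> I" "j \<in> I" for i j
    using that K by auto
  have "m ?K (app T I ?K t (\<lambda>i. app T I ?K t (\<lambda>j. proj T ?K (pair (i, j))))) f
      = m ?K (app T I ?K t (\<lambda>i. proj T ?K (pair (i, i)))) f"
    by (subst app_diag) (auto simp: assms K)
  moreover have "m ?K (app T I ?K t (\<lambda>i. proj T ?K (pair (i, i)))) f = m I t (\<lambda>i. x i i)"
    using assms(1,2) K fX pK
    by (subst m_app) (auto simp: f intro!: m_cong m_proj[THEN trans])
  moreover have "m ?K (app T I ?K t (\<lambda>j. proj T ?K (pair (i, j)))) f = m I t (x i)" if "i \<in> I" for i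
    using assms(1,2) K fX pK that
    by (subst m_app) (auto simp: f intro!: m_cong m_proj[THEN trans])
  moreover have "m ?K (app T I ?K t (\<lambda>i. app T I ?K t (\<lambda>j. proj T ?K (pair (i, j))))) f
     = m I t (\<lambda>i. m ?K (app T I ?K t (\<lambda>j. proj T ?K (pair (i, j)))) f)"
    using assms(1,2) K fX pK by (subst m_app) auto
  ultimately show ?thesis by (simp cong: m_cong)
qed

text \<open>
  The diagonal law for the composite \<open>r = s(\<lambda>i. t(\<lambda>j. x\<^sub>i\<^sub>j))\<close>, applied to a family depending
  only on the second outer and the first inner index, states that \<open>s\<close> and \<open>t\<close> commute.
\<close>

lemma m_commute:
  assumes "sm I" "sm J" "s \<in> ops T I" "t \<in> ops T J" "\<And>i j. i \<in> I \<Longrightarrow> j \<in> J \<Longrightarrow> x i j \<in> X"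
  shows "m I s (\<lambda>i. m J t (x i)) = m J t (\<lambda>j. m I s (\<lambda>i. x i j))"
proof -
  note inj_pair[OF universe, simp]
  let ?K = "pair ` (I \<times> J)"
  have K: "sm ?K" using assms by (intro small_image small_Times universe)
  define r where "r = app T I ?K s (\<lambda>i. app T J ?K t (\<lambda>j. proj T ?K (pair (i, j))))"
  have r: "r \<in> ops T ?K" using assms K by (auto simp: r_def)
  have mr: "m ?K r f = m I s (\<lambda>i. m J t (\<lambda>j. f (pair (i, j))))"
    if f: "\<And>k. k \<in> ?K \<Longrightarrow> f k \<in> X" for f
  proof -
    have "m ?K r f = m I s (\<lambda>i. m ?K (app T J ?K t (\<lambda>j. proj T ?K (pair (i, j)))) f)"
      unfolding r_def using assms K f by (subst m_app) auto
    also have "\<dots> = m I s (\<lambda>i. m J t (\<lambda>j. m ?K (proj T ?K (pair (i, j))) f))"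
      using assms K f by (intro m_cong) (subst m_app; auto)
    also have "\<dots> = m I s (\<lambda>i. m J t (\<lambda>j. f (pair (i, j))))"
      using assms K f by (intro m_cong) auto
    finally show ?thesis .
  qed
  define Y where "Y k l = x (fst (inv pair l)) (snd (inv pair k))" for k l
  have Y: "Y (pair (i, j)) (pair (i', j')) = x i' j" for i j i' j' by (simp add: Y_def)
  have YX: "Y k l \<in> X" if "k \<in> ?K" "l \<in> ?K" for k l using that assms by (auto simp: Y)
  \<comment> \<open>The outer \<open>s\<close> and the inner \<open>t\<close> inserted here are
    applied to constant families, so by \<open>m_const\<close> they change nothing; they complete
    the term to a double application of \<open>r\<close>.\<close>
  have "m J t (\<lambda>j. m I s (\<lambda>i. x i j)) = m I s (\<lambda>i. m J t (\<lambda>j. m I s (\<lambda>i'. m J t (\<lambda>j'. x i' j))))"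
    using assms by (simp add: m_const cong: m_cong)
  also have "\<dots> = m ?K r (\<lambda>k. m ?K r (Y k))"
    using assms r K YX by (subst mr) (auto simp: mr Y intro!: m_cong)
  also have "\<dots> = m ?K r (\<lambda>k. Y k k)" using K r YX by (intro m_diag) auto
  also have "\<dots> = m I s (\<lambda>i. m J t (x i))"
    using r K YX by (subst mr) (auto simp: Y intro!: m_cong)
  finally show ?thesis by simp
qed

text \<open>By \<open>m_const\<close> every branch can be written as a value of \<open>t\<close>,
  and then the diagonal law replaces the branch at i by its i-th entry. In terms of components: on
  the i-th component, t(x) is the same as \<open>x i\<close>.\<close>

lemma m_diag_cross:
  assumes "sm I" "t \<in> ops T I" "i \<in> I" "\<And>j. j \<in> I \<Longrightarrow> x j \<in> X" "\<And>j. j \<in> I \<Longrightarrow> y j \<in> X"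
  shows "m I t (\<lambda>j. if j = i then m I t x else y j) = m I t (\<lambda>j. if j = i then x i else y j)"
proof -
  have "m I t (\<lambda>j. if j = i then m I t x else y j)
      = m I t (\<lambda>j. m I t (\<lambda>k. if j = i then x k else y j))"
    using assms by (auto simp: m_const intro!: m_cong)
  also have "\<dots> = m I t (\<lambda>j. if j = i then x j else y j)"
    using assms by (intro m_diag) auto
  also have "\<dots> = m I t (\<lambda>j. if j = i then x i else y j)"
    by (intro m_cong) auto
  finally show ?thesis .
qed

end


section \<open>The variety of models\<close>

lemma theory_sig_simps [simp]:
  "syms (theory_sig T) = {Opn I t | I t. small TYPE('u) I \<and> t \<in> ops T I}"
  "arity (theory_sig T) = std_arity" for T :: "('u, 'u \<Rightarrow> 'u) algth"
  by (simp_all add: theory_sig_def)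

lemma theory_Mod_simps [simp]:
  "cobj (theory_Mod T) = theory_models T" "cund (theory_Mod T) = und"
  "chom (theory_Mod T) M N =
    (if M \<in> theory_models T \<and> N \<in> theory_models T then homomorphisms (theory_sig T) M N else {})"
  by (simp_all add: theory_Mod_def concrete_cat_of_def)

text \<open>Brings \<open>intp\<close>, which lives on extensional families, into the looser format
  of \<open>model_of\<close>.\<close>

definition interp :: "'u mdl \<Rightarrow> 'u set \<Rightarrow> ('u \<Rightarrow> 'u) \<Rightarrow> ('u \<Rightarrow> 'u) \<Rightarrow> 'u" where
  "interp M I t f = intp M (Opn I t) (restrict f I)"

text \<open>The way back: operations on arbitrary functions are cut down to the extensional ones
  that \<open>structures\<close> demands.\<close>

definition model_with ::
  "('u, 'u \<Rightarrow> 'u) algth \<Rightarrow> 'u set \<Rightarrow> ('u set \<Rightarrow> ('u \<Rightarrow> 'u) \<Rightarrow> ('u \<Rightarrow> 'u) \<Rightarrow> 'u) \<Rightarrow> 'u mdl" where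
  "model_with T X m = \<lparr>und = X, intp = (\<lambda>s\<in>syms (theory_sig T).
     \<lambda>x\<in>std_arity s \<rightarrow>\<^sub>E X. case s of Opn I t \<Rightarrow> m I t x)\<rparr>"

lemma und_model_with [simp]: "und (model_with T X m) = X"
  by (simp add: model_with_def)

lemma structures_theory_sig_iff:
  "M \<in> structures (theory_sig T) \<longleftrightarrow> small TYPE('u) (und M) \<and>
      intp M \<in> extensional (syms (theory_sig T)) \<and>
    (\<forall>I t. small TYPE('u) I \<longrightarrow> t \<in> ops T I \<longrightarrow> intp M (Opn I t) \<in> (I \<rightarrow>\<^sub>E und M) \<rightarrow>\<^sub>E und M)"
  for T :: "('u, 'u \<Rightarrow> 'u) algth"
proof -
  have "(\<forall>s\<in>syms (theory_sig T). Q s) \<longleftrightarrow> (\<forall>I t. small TYPE('u) I \<longrightarrow> t \<in> ops T I \<longrightarrow> Q (Opn I t))" for Q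
    by auto
  then show ?thesis
    unfolding structures_def mem_Collect_eq PiE_iff[of "intp M"] theory_sig_simps(2)
        by (simp only: std_arity.simps) blast
qed

lemma model_eqI:
  fixes T :: "('u, 'u \<Rightarrow> 'u) algth"
  assumes M: "M \<in> structures (theory_sig T)" and N: "N \<in> structures (theory_sig T)"
    and "und M = und N"
    and eq: "\<And>I t x. \<lbrakk>small TYPE('u) I; t \<in> ops T I; x \<in> I \<rightarrow>\<^sub>E und M\<rbrakk>
      \<Longrightarrow> intp M (Opn I t) x = intp N (Opn I t) x"
  shows "M = N"
proof -
  have "intp M s = intp N s" if s: "s \<in> syms (theory_sig T)" for s
  proof -
    obtain I t where [simp]: "s = Opn I t" and It: "small TYPE('u) I" "t \<in> ops T I" using s by auto
    have "intp M s \<in> (I \<rightarrow>\<^sub>E und M) \<rightarrow>\<^sub>E und M" "intp N s \<in> (I \<rightarrow>\<^sub>E und M) \<rightarrow>\<^sub>E und M"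
      using M N It \<open>und M = und N\<close> by (auto simp: structures_theory_sig_iff)
    then show ?thesis by (rule PiE_ext) (use eq It in simp)
  qed
  then have "intp M = intp N"
    using M N by (intro extensionalityI[of _ "syms (theory_sig T)"])
      (auto simp: structures_theory_sig_iff)
  with \<open>und M = und N\<close> show ?thesis by simp
qed

locale set_theory_of = alg_theory T for T :: "('u, 'u \<Rightarrow> 'u) algth"
begin

text \<open>From here on models are handled through the locale, and extensionality is confined to
  membership in \<open>structures\<close>.\<close>

lemma theory_models_iff:
  "M \<in> theory_models T \<longleftrightarrow> M \<in> structures (theory_sig T) \<and> model_of T (und M) (interp M)"
proof
  assume M: "M \<in> theory_models T"
  then have S: "M \<in> structures (theory_sig T)" by (simp add: theory_models_def)
  have "model_of T (und M) (interp M)"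
  proof
    show "interp M I t f \<in> und M" if "sm I" "t \<in> ops T I" "\<And>i. i \<in> I \<Longrightarrow> f i \<in> und M" for I t f
    proof -
      have "intp M (Opn I t) \<in> (I \<rightarrow>\<^sub>E und M) \<rightarrow>\<^sub>E und M"
        using S that(1,2) by (simp only: structures_theory_sig_iff)
      moreover have "restrict f I \<in> I \<rightarrow>\<^sub>E und M" using that(3) by auto
      ultimately show ?thesis unfolding interp_def by (rule PiE_mem)
    qed
    show "interp M I t f = interp M I t g" if "\<And>i. i \<in> I \<Longrightarrow> f i = g i" for I t f g
      using that by (simp add: interp_def cong: restrict_cong)
    show "interp M I (proj T I i) f = f i" if "sm I" "i \<in> I" "\<And>i. i \<in> I \<Longrightarrow> f i \<in> und M" for I i f
      using M that by (simp add: theory_models_def interp_def)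
    show "interp M J (app T I J t u) f = interp M I t (\<lambda>i. interp M J (u i) f)"
      if "sm I" "sm J" "t \<in> ops T I" "\<And>i. i \<in> I \<Longrightarrow> u i \<in> ops T J" "\<And>j. j \<in> J \<Longrightarrow> f j \<in> und M"
          for I J t u f
    proof -
      have "restrict u I \<in> I \<rightarrow>\<^sub>E ops T J" "restrict f J \<in> J \<rightarrow>\<^sub>E und M" using that by auto
      then have "intp M (Opn J (subst T I J t (restrict u I))) (restrict f J) =
         intp M (Opn I t) (\<lambda>i\<in>I. intp M (Opn J (restrict u I i)) (restrict f J))"
        using M that(1-3) by (simp add: theory_models_def)
      then show ?thesis by (simp add: interp_def app_def cong: restrict_cong)
    qed
  qed
  with S show "M \<in> structures (theory_sig T) \<and> model_of T (und M) (interp M)" by blast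
next
  assume M: "M \<in> structures (theory_sig T) \<and> model_of T (und M) (interp M)"
  then interpret model_of T "und M" "interp M" by blast
  have [simp]: "restrict x I = x" if "x \<in> I \<rightarrow>\<^sub>E Y" for x I and Y :: "'a set"
    using that by (simp add: PiE_def extensional_restrict)
  show "M \<in> theory_models T"
    unfolding theory_models_def
  proof (safe)
    show "M \<in> structures (theory_sig T)" using M by blast
    show "intp M (Opn I (proj T I i)) x = x i" if "sm I" "i \<in> I" "x \<in> I \<rightarrow>\<^sub>E und M" for I i x
      using m_proj[of I i x, OF that(1,2) PiE_mem[OF that(3)]] that(3) by (simp add: interp_def)
    show "intp M (Opn J (subst T I J t u)) x = intp M (Opn I t) (\<lambda>i\<in>I. intp M (Opn J (u i)) x)"
      if "sm I" "sm J" "t \<in> ops T I" "u \<in> I \<rightarrow>\<^sub>E ops T J" "x \<in> J \<rightarrow>\<^sub>E und M" for I J t u x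
      using m_app[of I J t u x, OF that(1-3) PiE_mem[OF that(4)] PiE_mem[OF that(5)]] that(4,5)
      by (simp add: interp_def app_def)
  qed
qed

lemma interp_model_with [simp]:
  "\<lbrakk>sm I; t \<in> ops T I; x \<in> I \<rightarrow>\<^sub>E X\<rbrakk> \<Longrightarrow> intp (model_with T X m) (Opn I t) x = m I t x"
  by (simp add: model_with_def)

lemma model_with_closed:
  assumes "model_of T X m" "small TYPE('u) X"
  shows "model_with T X m \<in> theory_models T"
proof -
  interpret model_of T X m by fact
  have [simp]: "interp (model_with T X m) I t f = m I t f"
    if "sm I" "t \<in> ops T I" "\<And>i. i \<in> I \<Longrightarrow> f i \<in> X" for I t f
    using that by (auto simp: interp_def intro: m_cong)
  show ?thesis unfolding theory_models_iff
  proof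
    show "model_with T X m \<in> structures (theory_sig T)"
      using assms(2) unfolding structures_theory_sig_iff
      by (auto simp: model_with_def restrict_extensional dest: PiE_mem intro!: m_closed)
    show "model_of T (und (model_with T X m)) (interp (model_with T X m))"
      by unfold_locales
        (auto simp: m_app cong: m_cong, auto simp: interp_def cong: restrict_cong)
  qed
qed

lemma homomorphisms_iff:
  "h \<in> homomorphisms (theory_sig T) M N \<longleftrightarrow> h \<in> und M \<rightarrow>\<^sub>E und N \<and>
    (\<forall>I t f. sm I \<longrightarrow> t \<in> ops T I \<longrightarrow> (\<forall>i\<in>I. f i \<in> und M) \<longrightarrow> h (interp M I t f)
        = interp N I t (\<lambda>i. h (f i)))"
    (is "_ \<longleftrightarrow> _ \<and> ?r")
proof -
  have "?r" if h: "h \<in> homomorphisms (theory_sig T) M N"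
  proof (intro allI impI)
    fix I t f assume "sm I" "t \<in> ops T I" "\<forall>i\<in>I. f i \<in> und M"
    moreover from this have "restrict f I \<in> I \<rightarrow>\<^sub>E und M" by auto
    ultimately show "h (interp M I t f) = interp N I t (\<lambda>i. h (f i))"
      using h by (auto simp: homomorphisms_def interp_def cong: restrict_cong)
  qed
  moreover have "h \<in> homomorphisms (theory_sig T) M N" if h: "h \<in> und M \<rightarrow>\<^sub>E und N" and r: "?r"
    unfolding homomorphisms_def
  proof (safe)
    fix s x assume "s \<in> syms (theory_sig T)" and x: "x \<in> arity (theory_sig T) s \<rightarrow>\<^sub>E und M"
    then obtain I t where s: "s = Opn I t" "sm I" "t \<in> ops T I" by auto
    have "h (interp M I t x) = interp N I t (\<lambda>i. h (x i))"
      using r s x by (auto simp: PiE_mem)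
    then show "h (intp M s x) = intp N s (\<lambda>i\<in>arity (theory_sig T) s. h (x i))"
      using s x by (auto simp: interp_def PiE_def extensional_restrict)
  qed (use h in auto)
  ultimately show ?thesis by (auto simp: homomorphisms_def)
qed

text \<open>The underlying set of a model is a subset of \<open>'u\<close>, but T(K) consists of
  functions on \<open>'u\<close>. Being small, T(K) has an injective copy in \<open>'u\<close>, and
  the free model lives on that copy.\<close>

definition enc :: "'u set \<Rightarrow> ('u \<Rightarrow> 'u) \<Rightarrow> 'u" where
  "enc K = (SOME e. inj_on e (ops T K))"

definition dec :: "'u set \<Rightarrow> 'u \<Rightarrow> ('u \<Rightarrow> 'u)" where
  "dec K = inv_into (ops T K) (enc K)"

lemma inj_on_enc: "sm K \<Longrightarrow> inj_on (enc K) (ops T K)"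
proof -
  assume "sm K"
  then obtain e :: "('u \<Rightarrow> 'u) \<Rightarrow> 'u" where "inj_on e (ops T K)" by (rule small_embed[OF small_ops])
  then show ?thesis unfolding enc_def by (rule someI[of "\<lambda>e. inj_on e (ops T K)"])
qed

lemma dec_enc [simp]: "sm K \<Longrightarrow> t \<in> ops T K \<Longrightarrow> dec K (enc K t) = t"
  unfolding dec_def by (simp add: inj_on_enc)

lemma enc_dec [simp]: "x \<in> enc K ` ops T K \<Longrightarrow> enc K (dec K x) = x"
  by (simp add: dec_def f_inv_into_f)

lemma dec_closed [simp]: "x \<in> enc K ` ops T K \<Longrightarrow> dec K x \<in> ops T K"
  by (simp add: dec_def inv_into_into)

definition free_model :: "'u set \<Rightarrow> 'u mdl" where
  "free_model K = model_with T (enc K ` ops T K) (\<lambda>I t f. enc K (app T I K t (\<lambda>i. dec K (f i))))"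

lemma und_free_model [simp]: "und (free_model K) = enc K ` ops T K"
  by (simp add: free_model_def)

lemma free_model_closed: "sm K \<Longrightarrow> free_model K \<in> theory_models T"
  unfolding free_model_def
  by (rule model_with_closed, unfold_locales)
    (auto simp: app_app small_image small_ops intro!: arg_cong[of _ _ "enc K"] app_cong)

lemma intp_free_model:
  "\<lbrakk>sm K; sm I; t \<in> ops T I; x \<in> I \<rightarrow>\<^sub>E enc K ` ops T K\<rbrakk>
    \<Longrightarrow> intp (free_model K) (Opn I t) x = enc K (app T I K t (\<lambda>i. dec K (x i)))"
  unfolding free_model_def by simp

lemma interp_free_model:
  "\<lbrakk>sm K; sm I; t \<in> ops T I; \<And>i. i \<in> I \<Longrightarrow> f i \<in> enc K ` ops T K\<rbrakk>
    \<Longrightarrow> interp (free_model K) I t f = enc K (app T I K t (\<lambda>i. dec K (f i)))"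
  by (auto simp: interp_def intp_free_model intro!: arg_cong[of _ _ "enc K"] app_cong)

text \<open>This is the identity law of substitution. It lets an operation be recovered from its
  action on the free model, and shows that the generators generate.\<close>

lemma interp_free_model_generic:
  assumes "sm K" "t \<in> ops T K"
  shows "interp (free_model K) K t (\<lambda>i. enc K (proj T K i)) = enc K t"
proof -
  have "app T K K t (\<lambda>i. dec K (enc K (proj T K i))) = app T K K t (proj T K)"
    using assms by (intro app_cong) simp
  then show ?thesis using assms by (simp add: interp_free_model app_proj_id)
qed

text \<open>The homomorphism evaluates operations at \<open>f\<close>; that it preserves the
  structure is the law \<open>m_app\<close> of the model M.\<close>

lemma free_model_hom:
  assumes "sm K" and M: "M \<in> theory_models T" and f: "\<And>i. i \<in> K \<Longrightarrow> f i \<in> und M"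
  defines "h \<equiv> \<lambda>x\<in>enc K ` ops T K. interp M K (dec K x) f"
  shows "h \<in> homomorphisms (theory_sig T) (free_model K) M"
    and "t \<in> ops T K \<Longrightarrow> h (enc K t) = interp M K t f"
    and "i \<in> K \<Longrightarrow> h (enc K (proj T K i)) = f i"
proof -
  interpret model_of T "und M" "interp M" using M by (simp add: theory_models_iff)
  show h: "h (enc K t) = interp M K t f" if "t \<in> ops T K" for t
    using that assms by simp
  then show "h (enc K (proj T K i)) = f i" if "i \<in> K"
    using that assms by simp
  show "h \<in> homomorphisms (theory_sig T) (free_model K) M"
    unfolding homomorphisms_iff
  proof (intro conjI allI impI)
    show "h \<in> und (free_model K) \<rightarrow>\<^sub>E und M" using assms by (auto simp: h_def)
    fix I t g assume I: "sm I" "t \<in> ops T I" "\<forall>i\<in>I. g i \<in> und (free_model K)"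
    have "h (interp (free_model K) I t g) = interp M K (app T I K t (\<lambda>i. dec K (g i))) f"
      using I assms(1) by (simp add: interp_free_model h)
    also have "\<dots> = interp M I t (\<lambda>i. interp M K (dec K (g i)) f)"
      using I assms(1,3) by (intro m_app) auto
    also have "\<dots> = interp M I t (\<lambda>i. h (g i))"
      using I by (intro m_cong) (auto simp: h_def)
    finally show "h (interp (free_model K) I t g) = interp M I t (\<lambda>i. h (g i))" .
  qed
qed

lemma has_free_models_theory_Mod: "has_free_models (theory_Mod T)"
  unfolding has_free_models_def
proof (intro allI impI)
  fix V :: "'u set" assume V: "sm V"
  have "\<exists>!h. h \<in> chom (theory_Mod T) (free_model V) M \<and> (\<forall>i\<in>V. h ((\<lambda>i\<in>V. enc V (proj T V i)) i)
      = v i)"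
    if M: "M \<in> cobj (theory_Mod T)" and v: "v \<in> V \<rightarrow>\<^sub>E cund (theory_Mod T) M" for M v
  proof (rule ex1I[of _ "\<lambda>x\<in>enc V ` ops T V. interp M V (dec V x) v"])
    from M v have M: "M \<in> theory_models T" and v: "\<And>i. i \<in> V \<Longrightarrow> v i \<in> und M" by auto
    interpret model_of T "und M" "interp M" using M by (simp add: theory_models_iff)
    note h = free_model_hom[OF V M v]
    show "(\<lambda>x\<in>enc V ` ops T V. interp M V (dec V x) v) \<in> chom (theory_Mod T) (free_model V) M \<and>
       (\<forall>i\<in>V. (\<lambda>x\<in>enc V ` ops T V. interp M V (dec V x) v) ((\<lambda>i\<in>V. enc V (proj T V i)) i) = v i)"
      using h V M by (auto simp: free_model_closed)
    fix g assume g: "g \<in> chom (theory_Mod T) (free_model V) M \<and>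
        (\<forall>i\<in>V. g ((\<lambda>i\<in>V. enc V (proj T V i)) i) = v i)"
    then have g1: "g \<in> homomorphisms (theory_sig T) (free_model V) M" by (auto split: if_splits)
    show "g = (\<lambda>x\<in>enc V ` ops T V. interp M V (dec V x) v)"
    proof (rule extensionalityI[of _ "enc V ` ops T V"])
      show "g \<in> extensional (enc V ` ops T V)" using g1 by (auto simp: homomorphisms_iff PiE_def)
      fix x assume "x \<in> enc V ` ops T V"
      \<comment> \<open>The element is \<open>t\<close> applied to the generators, so a homomorphism
        is determined by the images of the generators.\<close>
      then obtain t where t: "t \<in> ops T V" "x = enc V t" by blast
      have "g x = interp M V t (\<lambda>i. g (enc V (proj T V i)))"
        using g1 t V by (auto simp: homomorphisms_iff simp flip: interp_free_model_generic)
      also have "\<dots> = interp M V t v" using g by (intro m_cong) auto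
      finally show "g x = (\<lambda>x\<in>enc V ` ops T V. interp M V (dec V x) v) x" using t V by auto
    qed auto
  qed
  moreover have "(\<lambda>i\<in>V. enc V (proj T V i)) \<in> V \<rightarrow>\<^sub>E cund (theory_Mod T) (free_model V)"
    using V by auto
  moreover have "free_model V \<in> cobj (theory_Mod T)" using V by (simp add: free_model_closed)
  ultimately show "\<exists>F\<in>cobj (theory_Mod T). \<exists>\<eta>\<in>V \<rightarrow>\<^sub>E cund (theory_Mod T) F.
      \<forall>M\<in>cobj (theory_Mod T). \<forall>v\<in>V \<rightarrow>\<^sub>E cund (theory_Mod T) M.
        \<exists>!h. h \<in> chom (theory_Mod T) F M \<and> (\<forall>i\<in>V. h (\<eta> i) = v i)"
    by (intro bexI[of _ "free_model V"] bexI[of _ "\<lambda>i\<in>V. enc V (proj T V i)"] ballI)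
qed

lemma variety_theory_Mod: "variety (theory_Mod T)"
proof -
  \<comment> \<open>\<open>E1\<close> and \<open>E2\<close> write the two clauses of
    \<open>theory_models\<close> as equations, in the contexts I and J over whose valuations those
    clauses quantify.\<close>
  define E1 :: "('u set \<times> ('u, 'u symbol) trm \<times> ('u, 'u symbol) trm) set"
    where "E1 = {(I, App (Opn I (proj T I i)) Var, Var i) | I i. sm I \<and> i \<in> I}"
  define E2 :: "('u set \<times> ('u, 'u symbol) trm \<times> ('u, 'u symbol) trm) set"
    where "E2 = {(J, App (Opn J (subst T I J t u)) Var,
        App (Opn I t) (\<lambda>i. App (Opn J (u i)) Var)) | I J t u.
      sm I \<and> sm J \<and> t \<in> ops T I \<and> u \<in> I \<rightarrow>\<^sub>E ops T J}"
  have [simp]: "(\<lambda>i\<in>I. v i) = v" if "v \<in> I \<rightarrow>\<^sub>E Y" for v :: "'u \<Rightarrow> 'u" and I Y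
    using that by (simp add: PiE_def extensional_restrict)
  have "(\<forall>(V, l, r)\<in>E1. \<forall>v\<in>V \<rightarrow>\<^sub>E und M. evalt (theory_sig T) M v l = evalt (theory_sig T) M v r) \<longleftrightarrow>
      (\<forall>I. sm I \<longrightarrow> (\<forall>i\<in>I. \<forall>x\<in>I \<rightarrow>\<^sub>E und M. intp M (Opn I (proj T I i)) x = x i))" for M
  proof -
    have *: "(\<forall>x\<in>E1. Q x) \<longleftrightarrow> (\<forall>I i. sm I \<and> i \<in> I \<longrightarrow> Q (I, App (Opn I (proj T I i)) Var, Var i))" for Q
      unfolding E1_def by blast
    show ?thesis unfolding * by auto
  qed
  moreover have "(\<forall>(V, l, r)\<in>E2. \<forall>v\<in>V \<rightarrow>\<^sub>E und M. evalt (theory_sig T) M v l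
      = evalt (theory_sig T) M v r) \<longleftrightarrow>
      (\<forall>I J. sm I \<longrightarrow> sm J \<longrightarrow> (\<forall>t\<in>ops T I. \<forall>u\<in>I \<rightarrow>\<^sub>E ops T J. \<forall>x\<in>J \<rightarrow>\<^sub>E und M.
         intp M (Opn J (subst T I J t u)) x = intp M (Opn I t) (\<lambda>i\<in>I. intp M (Opn J (u i)) x)))"
             for M
  proof -
    have *: "(\<forall>x\<in>E2. Q x) \<longleftrightarrow> (\<forall>I J t u. sm I \<and> sm J \<and> t \<in> ops T I \<and> u \<in> I \<rightarrow>\<^sub>E ops T J \<longrightarrow>
        Q (J, App (Opn J (subst T I J t u)) Var, App (Opn I t) (\<lambda>i. App (Opn J (u i)) Var)))" for Q
      unfolding E2_def by blast
    show ?thesis unfolding * by (auto cong: restrict_cong)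
  qed
  ultimately have "theory_models T = models (theory_sig T) (E1 \<union> E2)"
    unfolding theory_models_def models_def ball_Un by (rule_tac Collect_cong) simp
  moreover have "\<forall>(V, l, r)\<in>E1 \<union> E2. sm V \<and> l \<in> terms (theory_sig T) V \<and> r \<in> terms (theory_sig T) V"
    unfolding E1_def E2_def
    by (safe; intro terms.intros) (auto simp: subst_closed dest: PiE_mem)
  moreover have "\<forall>s\<in>syms (theory_sig T). sm (arity (theory_sig T) s)" by auto
  ultimately show ?thesis
    unfolding variety_def
    by (intro conjI has_free_models_theory_Mod exI[of _ "theory_sig T"] exI[of _ "E1 \<union> E2"])
      (simp_all add: theory_Mod_def)
qed

end

section \<open>The categories of varieties and of hyperaffine theories\<close>

lemma VAR_simps [simp]:
  "ob VAR = {C. variety C}" "hom VAR = concrete_functors"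
  "idt VAR C = (\<lambda>M\<in>cobj C. M)" "cmp VAR C D E G F = (\<lambda>M\<in>cobj C. G (F M))"
  by (simp_all add: VAR_def)

lemma concrete_functors_iff:
  "F \<in> concrete_functors C D \<longleftrightarrow> F \<in> extensional (cobj C) \<and>
    (\<forall>M\<in>cobj C. F M \<in> cobj D \<and> cund D (F M) = cund C M) \<and>
    (\<forall>M\<in>cobj C. \<forall>N\<in>cobj C. \<forall>h\<in>chom C M N. h \<in> chom D (F M) (F N))"
  unfolding concrete_functors_def mem_Collect_eq PiE_iff by blast

lemma category_VAR: "category VAR"
  unfolding category_def
  by (auto simp: concrete_functors_iff fun_eq_iff extensional_def)

lemma HAff_simps [simp]:
  "ob HAff = {T :: ('u, 'u \<Rightarrow> 'u) algth. algebraic_theory T \<and> nondegenerate_theory T \<and>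
      hyperaffine T}"
  "hom HAff = (theory_homs :: ('u, 'u \<Rightarrow> 'u) algth \<Rightarrow> _)"
  "idt HAff (T :: ('u, 'u \<Rightarrow> 'u) algth) = (\<lambda>I\<in>{I. small TYPE('u) I}. \<lambda>t\<in>ops T I. t)"
  "cmp HAff (R :: ('u, 'u \<Rightarrow> 'u) algth) S T \<psi> \<phi>
      = (\<lambda>I\<in>{I. small TYPE('u) I}. \<lambda>t\<in>ops R I. \<psi> I (\<phi> I t))"
  by (simp_all add: HAff_def)

text \<open>Restated with \<open>app\<close>, so that the families of arguments need not be
  extensional.\<close>

lemma theory_homs_iff:
  fixes S T :: "('u, 't) algth"
  assumes S: "alg_theory S"
  shows "\<phi> \<in> theory_homs S T \<longleftrightarrow>
    \<phi> \<in> extensional {I. small TYPE('u) I} \<and>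
    (\<forall>I. small TYPE('u) I \<longrightarrow> \<phi> I \<in> extensional (ops S I)) \<and>
    (\<forall>I. small TYPE('u) I \<longrightarrow> (\<forall>t\<in>ops S I. \<phi> I t \<in> ops T I)) \<and>
    (\<forall>I. small TYPE('u) I \<longrightarrow> (\<forall>i\<in>I. \<phi> I (proj S I i) = proj T I i)) \<and>
    (\<forall>I J. small TYPE('u) I \<longrightarrow> small TYPE('u) J \<longrightarrow> (\<forall>t\<in>ops S I. \<forall>u. (\<forall>i\<in>I. u i \<in> ops S J) \<longrightarrow>
      \<phi> J (app S I J t u) = app T I J (\<phi> I t) (\<lambda>i. \<phi> J (u i))))"
proof -
  interpret alg_theory S by fact
  have "(\<forall>u\<in>I \<rightarrow>\<^sub>E ops S J. \<phi> J (subst S I J t u) = subst T I J (\<phi> I t) (\<lambda>i\<in>I. \<phi> J (u i))) \<longleftrightarrow>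
     (\<forall>u. (\<forall>i\<in>I. u i \<in> ops S J) \<longrightarrow> \<phi> J (app S I J t u) = app T I J (\<phi> I t) (\<lambda>i. \<phi> J (u i)))"
    (is "?l \<longleftrightarrow> ?r") for I J t
  proof
    assume l: ?l
    show ?r
    proof (intro allI impI)
      fix u assume "\<forall>i\<in>I. u i \<in> ops S J"
      then have "restrict u I \<in> I \<rightarrow>\<^sub>E ops S J" by auto
      with l show "\<phi> J (app S I J t u) = app T I J (\<phi> I t) (\<lambda>i. \<phi> J (u i))"
        by (auto simp: app_def cong: restrict_cong)
    qed
  next
    assume r: ?r
    show ?l
    proof
      fix u assume u: "u \<in> I \<rightarrow>\<^sub>E ops S J"
      then have "\<forall>i\<in>I. u i \<in> ops S J" "restrict u I = u"
        by (auto simp: PiE_def extensional_restrict)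
      with r show "\<phi> J (subst S I J t u) = subst T I J (\<phi> I t) (\<lambda>i\<in>I. \<phi> J (u i))"
        by (metis app_def)
    qed
  qed
  note eq = this
  have "(\<phi> \<in> (\<Pi>\<^sub>E I\<in>{I. small TYPE('u) I}. ops S I \<rightarrow>\<^sub>E ops T I)) \<longleftrightarrow>
     \<phi> \<in> extensional {I. small TYPE('u) I} \<and>
     (\<forall>I. small TYPE('u) I \<longrightarrow> \<phi> I \<in> extensional (ops S I)) \<and>
     (\<forall>I. small TYPE('u) I \<longrightarrow> (\<forall>t\<in>ops S I. \<phi> I t \<in> ops T I))"
    by (simp only: PiE_iff mem_Collect_eq Ball_def) blast
  note peq = this
  show ?thesis
    unfolding theory_homs_def mem_Collect_eq eq peq by (simp only: conj_assoc)
qed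

lemma theory_hom_simps:
  fixes S T :: "('u, 't) algth"
  assumes "alg_theory S" "\<phi> \<in> theory_homs S T"
  shows "small TYPE('u) I \<Longrightarrow> t \<in> ops S I \<Longrightarrow> \<phi> I t \<in> ops T I"
    and "small TYPE('u) I \<Longrightarrow> i \<in> I \<Longrightarrow> \<phi> I (proj S I i) = proj T I i"
    and "\<lbrakk>small TYPE('u) I; small TYPE('u) J; t \<in> ops S I; \<And>i. i \<in> I \<Longrightarrow> u i \<in> ops S J\<rbrakk>
      \<Longrightarrow> \<phi> J (app S I J t u) = app T I J (\<phi> I t) (\<lambda>i. \<phi> J (u i))"
  using assms(2) by (simp_all add: theory_homs_iff[OF assms(1)])

lemma theory_hom_eqI:
  fixes S T :: "('u, 't) algth"
  assumes "\<phi> \<in> theory_homs S T" "\<psi> \<in> theory_homs S T"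
    and "\<And>I t. small TYPE('u) I \<Longrightarrow> t \<in> ops S I \<Longrightarrow> \<phi> I t = \<psi> I t"
  shows "\<phi> = \<psi>"
proof (rule PiE_ext)
  show "\<phi> \<in> (\<Pi>\<^sub>E I\<in>{I. small TYPE('u) I}. ops S I \<rightarrow>\<^sub>E ops T I)"
    "\<psi> \<in> (\<Pi>\<^sub>E I\<in>{I. small TYPE('u) I}. ops S I \<rightarrow>\<^sub>E ops T I)"
    using assms(1,2) by (simp_all add: theory_homs_def)
  fix I :: "'u set" assume I: "I \<in> {I. small TYPE('u) I}"
  then have "\<phi> I \<in> ops S I \<rightarrow>\<^sub>E ops T I" "\<psi> I \<in> ops S I \<rightarrow>\<^sub>E ops T I"
    using \<open>\<phi> \<in> (\<Pi>\<^sub>E I\<in>_. _)\<close> \<open>\<psi> \<in> (\<Pi>\<^sub>E I\<in>_. _)\<close> by (auto dest: PiE_mem)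
  then show "\<phi> I = \<psi> I" by (rule PiE_ext) (use assms(3) I in auto)
qed

lemma category_HAff:
  assumes U: "universe TYPE('u)"
  shows "category (HAff :: (('u, 'u \<Rightarrow> 'u) algth, _) cat)"
proof -
  have th: "alg_theory T" if "T \<in> ob HAff" for T :: "('u, 'u \<Rightarrow> 'u) algth"
    using that U by (simp add: alg_theory_def)
  have id: "idt HAff T \<in> hom HAff T T" if "T \<in> ob HAff" for T :: "('u, 'u \<Rightarrow> 'u) algth"
  proof -
    interpret alg_theory T using that by (rule th)
    show ?thesis
      by (auto simp: theory_homs_iff[OF th[OF that]] intro: app_cong)
  qed
  have cmp: "cmp HAff R S T g f \<in> hom HAff R T"
    if obs: "R \<in> ob HAff" "S \<in> ob HAff" "T \<in> ob HAff" and f: "f \<in> hom HAff R S"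
        and g: "g \<in> hom HAff S T"
    for R S T :: "('u, 'u \<Rightarrow> 'u) algth" and f g
  proof -
    interpret R: alg_theory R using obs(1) by (rule th)
    interpret T: alg_theory T using obs(3) by (rule th)
    show ?thesis
      using f g unfolding HAff_simps(2,4) theory_homs_iff[OF th[OF obs(1)]]
          theory_homs_iff[OF th[OF obs(2)]]
      by (auto intro: T.app_cong)
  qed
  have ext: "f = g" if "X \<in> ob HAff" "f \<in> hom HAff X Y" "g \<in> hom HAff X Y"
    "\<And>I t. small TYPE('u) I \<Longrightarrow> t \<in> ops X I \<Longrightarrow> f I t = g I t" for X Y :: "('u, 'u \<Rightarrow> 'u) algth" and f g
    using that theory_hom_eqI by (simp del: HAff_simps(1)) blast
  have app: "f I t \<in> ops Y I" if "X \<in> ob HAff" "f \<in> hom HAff X Y" "small TYPE('u) I" "t \<in> ops X I"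
    for X Y :: "('u, 'u \<Rightarrow> 'u) algth" and f I t
    using theory_hom_simps(1)[OF th[OF that(1)]] that(2-) by simp
  show ?thesis
    unfolding category_def
  proof (intro conjI ballI)
    fix W X Y Z :: "('u, 'u \<Rightarrow> 'u) algth" and f g h
    assume obs: "W \<in> ob HAff" "X \<in> ob HAff" "Y \<in> ob HAff" "Z \<in> ob HAff"
      and homs: "f \<in> hom HAff W X" "g \<in> hom HAff X Y" "h \<in> hom HAff Y Z"
    show "cmp HAff W Y Z h (cmp HAff W X Y g f) = cmp HAff W X Z (cmp HAff X Y Z h g) f"
      by (rule ext[OF obs(1) cmp[OF obs(1,3,4) cmp[OF obs(1-3) homs(1,2)] homs(3)]
            cmp[OF obs(1,2,4) homs(1) cmp[OF obs(2-4) homs(2,3)]]])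
        (simp add: app[OF obs(1) homs(1)] del: HAff_simps(1,2))
  next
    fix X Y :: "('u, 'u \<Rightarrow> 'u) algth" and f
    assume obs: "X \<in> ob HAff" "Y \<in> ob HAff" and f: "f \<in> hom HAff X Y"
    show "cmp HAff X X Y f (idt HAff X) = f"
      by (rule ext[OF obs(1) cmp[OF obs(1,1,2) id[OF obs(1)] f] f]) simp
    show "cmp HAff X Y Y (idt HAff Y) f = f"
      by (rule ext[OF obs(1) cmp[OF obs(1,2,2) f id[OF obs(2)]] f])
          (simp add: app[OF obs(1) f] del: HAff_simps(1,2))
  qed (use id cmp in blast)+
qed

text \<open>The levelwise inverses preserve projections and substitution because
  \<open>\<phi>\<close> does and is injective at every arity.\<close>

lemma iso_in_HAff:
  fixes S T :: "('u, 'u \<Rightarrow> 'u) algth"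
  assumes U: "universe TYPE('u)" and S: "S \<in> ob HAff" and T: "T \<in> ob HAff" and \<phi>: "\<phi> \<in> hom HAff S T"
    and bij: "\<And>I. small TYPE('u) I \<Longrightarrow> bij_betw (\<phi> I) (ops S I) (ops T I)"
  shows "iso_in HAff S T \<phi>"
proof -
  interpret S: alg_theory S using S U by (simp add: alg_theory_def)
  interpret T: alg_theory T using T U by (simp add: alg_theory_def)
  define \<psi> where "\<psi> = (\<lambda>I\<in>{I. small TYPE('u) I}. \<lambda>t\<in>ops T I. inv_into (ops S I) (\<phi> I) t)"
  have \<phi>': "\<phi> I t \<in> ops T I" "\<psi> I (\<phi> I t) = t" if "small TYPE('u) I" "t \<in> ops S I" for I t
    using bij[OF that(1)] that(2) by (auto simp: bij_betw_def \<psi>_def that(1))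
  have \<psi>': "\<psi> I t \<in> ops S I" "\<phi> I (\<psi> I t) = t" if "small TYPE('u) I" "t \<in> ops T I" for I t
    using bij[OF that(1)] that(2) by (auto simp: bij_betw_def \<psi>_def that(1) inv_into_into
        f_inv_into_f)
  have \<phi>_proj: "\<phi> I (proj S I i) = proj T I i" if "small TYPE('u) I" "i \<in> I" for I i
    using theory_hom_simps[OF S.alg_theory_axioms] \<phi> that by simp
  have \<phi>_app: "\<phi> J (app S I J t u) = app T I J (\<phi> I t) (\<lambda>i. \<phi> J (u i))"
    if "small TYPE('u) I" "small TYPE('u) J" "t \<in> ops S I" "\<And>i. i \<in> I \<Longrightarrow> u i \<in> ops S J" for I J t u
    using theory_hom_simps[OF S.alg_theory_axioms] \<phi> that by simp
  have "\<psi> \<in> hom HAff T S"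
    unfolding HAff_simps(2) theory_homs_iff[OF T.alg_theory_axioms]
  proof (intro conjI allI impI ballI)
    show "\<psi> I (proj T I i) = proj S I i" if "small TYPE('u) I" "i \<in> I" for I i
      using that \<phi>'(2)[OF that(1) S.proj_closed[OF that]] by (simp add: \<phi>_proj)
    show "\<psi> J (app T I J t u) = app S I J (\<psi> I t) (\<lambda>i. \<psi> J (u i))"
      if "small TYPE('u) I" "small TYPE('u) J" "t \<in> ops T I" "\<forall>i\<in>I. u i \<in> ops T J" for I J t u
    proof -
      have "\<phi> J (app S I J (\<psi> I t) (\<lambda>i. \<psi> J (u i))) = app T I J t (\<lambda>i. \<phi> J (\<psi> J (u i)))"
        using that by (simp add: \<phi>_app \<psi>')
      also have "\<dots> = app T I J t u" using that by (intro T.app_cong) (simp add: \<psi>')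
      finally show ?thesis using that \<phi>'(2)[of J "app S I J (\<psi> I t) (\<lambda>i. \<psi> J (u i))"]
          by (simp add: \<psi>')
    qed
  qed (auto simp: \<psi>'(1), auto simp: \<psi>_def)
  then show ?thesis
    using \<phi> unfolding iso_in_def
    by (intro conjI bexI[of _ \<psi>]) (auto simp: \<phi>' \<psi>' cong: restrict_cong)
qed

section \<open>Concrete functors between categories of models\<close>

context
  fixes S T :: "('u, 'u \<Rightarrow> 'u) algth"
  assumes S: "set_theory_of S" and T: "set_theory_of T"
begin

interpretation S: set_theory_of S by (fact S)
interpretation T: set_theory_of T by (fact T)

lemma intp_pullback_model:
  "\<lbrakk>S.sm I; t \<in> ops S I; x \<in> I \<rightarrow>\<^sub>E und M\<rbrakk>
    \<Longrightarrow> intp (pullback_model S \<phi> M) (Opn I t) x = intp M (Opn I (\<phi> I t)) x"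
  by (simp add: pullback_model_def)

lemma interp_pullback_model:
  "\<lbrakk>S.sm I; t \<in> ops S I; \<And>i. i \<in> I \<Longrightarrow> f i \<in> und M\<rbrakk>
    \<Longrightarrow> interp (pullback_model S \<phi> M) I t f = interp M I (\<phi> I t) f"
  unfolding interp_def by (rule intp_pullback_model) auto

lemma und_pullback_model [simp]: "und (pullback_model S \<phi> M) = und M"
  by (simp add: pullback_model_def)

lemma pullback_model_closed:
  assumes \<phi>: "\<phi> \<in> theory_homs S T" and M: "M \<in> theory_models T"
  shows "pullback_model S \<phi> M \<in> theory_models S"
proof -
  note \<phi>s = theory_hom_simps[OF S.alg_theory_axioms \<phi>]
  interpret model_of T "und M" "interp M" using M by (simp add: T.theory_models_iff)
  have str: "M \<in> structures (theory_sig T)" using M by (simp add: T.theory_models_iff)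
  have *: "intp M (Opn I (\<phi> I t)) \<in> (I \<rightarrow>\<^sub>E und M) \<rightarrow>\<^sub>E und M" if "S.sm I" "t \<in> ops S I" for I t
    using str \<phi>s(1)[OF that] that(1) by (simp only: structures_theory_sig_iff)
  show ?thesis unfolding S.theory_models_iff
  proof
    show "pullback_model S \<phi> M \<in> structures (theory_sig S)"
      using str PiE_mem[OF *] unfolding structures_theory_sig_iff
      by (auto simp: pullback_model_def restrict_extensional)
    show "model_of S (und (pullback_model S \<phi> M)) (interp (pullback_model S \<phi> M))"
      by unfold_locales
        (auto simp: interp_pullback_model \<phi>s m_app intro: m_cong,
            auto simp: interp_def cong: restrict_cong)
  qed
qed

lemma pullback_model_functor:
  assumes \<phi>: "\<phi> \<in> theory_homs S T"
  shows "(\<lambda>M\<in>theory_models T. pullback_model S \<phi> M) \<in> concrete_functors (theory_Mod T)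
      (theory_Mod S)"
proof -
  have "h \<in> homomorphisms (theory_sig S) (pullback_model S \<phi> M) (pullback_model S \<phi> N)"
    if h: "h \<in> homomorphisms (theory_sig T) M N" for h M N
    unfolding S.homomorphisms_iff
  proof (intro conjI allI impI)
    show "h \<in> und (pullback_model S \<phi> M) \<rightarrow>\<^sub>E und (pullback_model S \<phi> N)"
      using h by (simp add: T.homomorphisms_iff)
    fix I t f assume I: "S.sm I" "t \<in> ops S I" and f: "\<forall>i\<in>I. f i \<in> und (pullback_model S \<phi> M)"
    then have hf: "h (f i) \<in> und N" if "i \<in> I" for i
      using that h by (auto simp: T.homomorphisms_iff)
    show "h (interp (pullback_model S \<phi> M) I t f) = interp (pullback_model S \<phi> N) I t (\<lambda>i. h (f i))"
      using h I f by (simp add: interp_pullback_model hf T.homomorphisms_iff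
          theory_hom_simps[OF S.alg_theory_axioms \<phi>])
  qed
  then show ?thesis
    by (simp add: concrete_functors_iff pullback_model_closed[OF \<phi>])
qed

text \<open>Evaluation at the generators of the free model gives the operation back. Equations
  between operations can therefore be checked in all models.\<close>

lemma op_eqI:
  assumes "S.sm I" "t \<in> ops T I" "t' \<in> ops T I"
    and "\<And>M x. \<lbrakk>M \<in> theory_models T; x \<in> I \<rightarrow>\<^sub>E und M\<rbrakk> \<Longrightarrow> intp M (Opn I t) x = intp M (Opn I t') x"
  shows "t = t'"
proof -
  have "interp (T.free_model I) I t (\<lambda>i. T.enc I (proj T I i))
      = interp (T.free_model I) I t' (\<lambda>i. T.enc I (proj T I i))"
    using assms by (auto simp: interp_def T.free_model_closed)
  then show ?thesis
    using assms(1-3) T.inj_on_enc[of I] by (simp add: T.interp_free_model_generic inj_on_eq_iff)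
qed

lemma pullback_model_inject:
  assumes \<phi>: "\<phi> \<in> theory_homs S T" and \<psi>: "\<psi> \<in> theory_homs S T"
    and eq: "\<And>M. M \<in> theory_models T \<Longrightarrow> pullback_model S \<phi> M = pullback_model S \<psi> M"
  shows "\<phi> = \<psi>"
proof (rule theory_hom_eqI[OF \<phi> \<psi>])
  fix I t assume It: "S.sm I" "t \<in> ops S I"
  show "\<phi> I t = \<psi> I t"
  proof (rule op_eqI)
    show "intp M (Opn I (\<phi> I t)) x = intp M (Opn I (\<psi> I t)) x"
      if M: "M \<in> theory_models T" and x: "x \<in> I \<rightarrow>\<^sub>E und M" for M x
      using intp_pullback_model[OF It x, of \<phi>] intp_pullback_model[OF It x, of \<psi>] eq[OF M] by simp
  qed (use It theory_hom_simps(1)[OF S.alg_theory_axioms \<phi>]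
      theory_hom_simps(1)[OF S.alg_theory_axioms \<psi>] in auto)
qed

text \<open>Any family in a model M is the image of the generators under a homomorphism from a free
  model. F keeps the underlying function of that homomorphism and makes it a homomorphism over S, so
  the operations of S on all \<open>F M\<close> are controlled by their values at
  generators.\<close>

lemma concrete_functor_is_pullback:
  assumes F: "F \<in> concrete_functors (theory_Mod T) (theory_Mod S)"
  obtains \<phi> where "\<phi> \<in> theory_homs S T" "F = (\<lambda>M\<in>theory_models T. pullback_model S \<phi> M)"
proof -
  have FM: "F M \<in> theory_models S" "und (F M) = und M" if "M \<in> theory_models T" for M
    using F that by (auto simp: concrete_functors_iff)
  have Fh: "h \<in> homomorphisms (theory_sig S) (F M) (F N)"
    if "h \<in> homomorphisms (theory_sig T) M N" "M \<in> theory_models T" "N \<in> theory_models T" for M N h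
    using F that FM by (auto simp: concrete_functors_iff)
  define \<phi> where "\<phi> = (\<lambda>I\<in>{I. S.sm I}. \<lambda>s\<in>ops S I.
    T.dec I (interp (F (T.free_model I)) I s (\<lambda>i. T.enc I (proj T I i))))"
  have gen: "interp (F (T.free_model I)) I s (\<lambda>i. T.enc I (proj T I i)) \<in> T.enc I ` ops T I"
    if "S.sm I" "s \<in> ops S I" for I s
  proof -
    note free = T.free_model_closed[OF that(1)]
    interpret F: model_of S "und (F (T.free_model I))" "interp (F (T.free_model I))"
      using FM(1)[OF free] by (simp add: S.theory_models_iff)
    show ?thesis using F.m_closed[OF that] FM(2)[OF free] that(1) by simp
  qed
  then have \<phi>: "\<phi> I s \<in> ops T I" if "S.sm I" "s \<in> ops S I" for I s
    using that by (simp add: \<phi>_def)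
  \<comment> \<open>The evaluation homomorphism \<open>h\<close> sends the value of \<open>s\<close>
    at the generators, which is the code of \<open>\<phi> I s\<close>, to the value of
    \<open>s\<close> at \<open>f\<close> in \<open>F M\<close>.\<close>
  have key: "interp (F M) I s f = interp M I (\<phi> I s) f"
    if M: "M \<in> theory_models T" and I: "S.sm I" "s \<in> ops S I" and f: "\<And>i. i \<in> I \<Longrightarrow> f i \<in> und M"
        for M I s f
  proof -
    define h where "h = (\<lambda>x\<in>T.enc I ` ops T I. interp M I (T.dec I x) f)"
    note free = T.free_model_closed[OF I(1)]
    have h: "h \<in> homomorphisms (theory_sig T) (T.free_model I) M"
      "\<And>t. t \<in> ops T I \<Longrightarrow> h (T.enc I t) = interp M I t f"
      "\<And>i. i \<in> I \<Longrightarrow> h (T.enc I (proj T I i)) = f i"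
      unfolding h_def using T.free_model_hom[of I M f] I(1) M f by blast+
    interpret F: model_of S "und (F M)" "interp (F M)"
      using FM(1)[OF M] by (simp add: S.theory_models_iff)
    have "h (interp (F (T.free_model I)) I s (\<lambda>i. T.enc I (proj T I i)))
        = interp (F M) I s (\<lambda>i. h (T.enc I (proj T I i)))"
      using Fh[OF h(1) free M] I FM(2)[OF free] by (auto simp: S.homomorphisms_iff)
    also have "\<dots> = interp (F M) I s f" using h(3) by (intro F.m_cong) auto
    also have "interp (F (T.free_model I)) I s (\<lambda>i. T.enc I (proj T I i)) = T.enc I (\<phi> I s)"
      using gen I by (simp add: \<phi>_def)
    finally show ?thesis using h(2)[OF \<phi>[OF I]] by simp
  qed
  have int: "interp M I t x = intp M (Opn I t) x" if "x \<in> I \<rightarrow>\<^sub>E und M" for M :: "'u mdl" and I t x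
    using that by (simp add: interp_def PiE_def extensional_restrict)
  \<comment> \<open>Through \<open>key\<close> the laws of a theory homomorphism turn into the model
    laws of \<open>F M\<close>, compared in all models M by \<open>op_eqI\<close>.\<close>
  have "\<phi> \<in> theory_homs S T"
    unfolding theory_homs_iff[OF S.alg_theory_axioms]
  proof (intro conjI allI impI ballI)
    show "\<phi> I (proj S I i) = proj T I i" if I: "S.sm I" "i \<in> I" for I i
    proof (rule op_eqI[OF I(1)])
      fix M x assume M: "M \<in> theory_models T" and x: "x \<in> I \<rightarrow>\<^sub>E und M"
      interpret F: model_of S "und (F M)" "interp (F M)" using FM(1)[OF M]
          by (simp add: S.theory_models_iff)
      interpret M: model_of T "und M" "interp M" using M by (simp add: T.theory_models_iff)
      have "interp M I (\<phi> I (proj S I i)) x = interp M I (proj T I i) x"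
        using key[OF M I(1), of "proj S I i" x] x FM(2)[OF M] I by (simp add: PiE_mem[OF x])
      then show "intp M (Opn I (\<phi> I (proj S I i))) x = intp M (Opn I (proj T I i)) x"
        by (simp add: int[OF x])
    qed (use I \<phi> in auto)
    show "\<phi> J (app S I J t u) = app T I J (\<phi> I t) (\<lambda>i. \<phi> J (u i))"
      if I: "S.sm I" "S.sm J" "t \<in> ops S I" "\<forall>i\<in>I. u i \<in> ops S J" for I J t u
    proof (rule op_eqI[OF I(2)])
      fix M x assume M: "M \<in> theory_models T" and x: "x \<in> J \<rightarrow>\<^sub>E und M"
      interpret F: model_of S "und (F M)" "interp (F M)" using FM(1)[OF M]
          by (simp add: S.theory_models_iff)
      interpret M: model_of T "und M" "interp M" using M by (simp add: T.theory_models_iff)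
      note xm = PiE_mem[OF x]
      have "interp M J (\<phi> J (app S I J t u)) x = interp (F M) J (app S I J t u) x"
        using key[OF M I(2), of "app S I J t u" x] I xm by simp
      also have "\<dots> = interp (F M) I t (\<lambda>i. interp (F M) J (u i) x)"
        using I xm FM(2)[OF M] by (intro F.m_app) auto
      also have "\<dots> = interp (F M) I t (\<lambda>i. interp M J (\<phi> J (u i)) x)"
        using I xm by (intro F.m_cong) (simp add: key[OF M])
      also have "\<dots> = interp M I (\<phi> I t) (\<lambda>i. interp M J (\<phi> J (u i)) x)"
        using I xm by (intro key[OF M]) (auto simp: \<phi>)
      also have "\<dots> = interp M J (app T I J (\<phi> I t) (\<lambda>i. \<phi> J (u i))) x"
        using I xm by (subst M.m_app) (auto simp: \<phi>)
      finally show "intp M (Opn J (\<phi> J (app S I J t u))) x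
          = intp M (Opn J (app T I J (\<phi> I t) (\<lambda>i. \<phi> J (u i)))) x"
        by (simp add: int[OF x])
    qed (use I \<phi> in auto)
  qed (auto simp: \<phi>, auto simp: \<phi>_def)
  moreover have "F = (\<lambda>M\<in>theory_models T. pullback_model S \<phi> M)"
  proof (rule extensionalityI[of _ "theory_models T"])
    fix M assume M: "M \<in> theory_models T"
    have "F M = pullback_model S \<phi> M"
    proof (rule model_eqI)
      show "F M \<in> structures (theory_sig S)" "pullback_model S \<phi> M \<in> structures (theory_sig S)"
        using FM(1)[OF M] pullback_model_closed[OF calculation M]
            by (simp_all add: S.theory_models_iff)
      show "intp (F M) (Opn I t) x = intp (pullback_model S \<phi> M) (Opn I t) x"
        if "S.sm I" "t \<in> ops S I" "x \<in> I \<rightarrow>\<^sub>E und (F M)" for I t x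
      proof -
        have x: "x \<in> I \<rightarrow>\<^sub>E und M" using that(3) FM(2)[OF M] by simp
        have "interp (F M) I t x = interp M I (\<phi> I t) x"
          by (rule key[OF M that(1,2)]) (rule PiE_mem[OF x])
        then show ?thesis
          unfolding int[OF that(3)] int[OF x] intp_pullback_model[OF that(1,2) x] .
      qed
    qed (simp add: FM(2)[OF M])
    then show "F M = (\<lambda>M\<in>theory_models T. pullback_model S \<phi> M) M" using M by simp
  qed (use F in \<open>auto simp: concrete_functors_iff\<close>)
  ultimately show thesis by (rule that)
qed

end

lemma Mod_functor_simps [simp]:
  "fob Mod_functor = theory_Mod"
  "far Mod_functor S T \<phi> = (\<lambda>M\<in>theory_models T. pullback_model S \<phi> M)"
  by (simp_all add: Mod_functor_def)

theorem fully_faithful_Mod_functor: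
  assumes U: "universe TYPE('u)"
  shows "fully_faithful (HAff :: (('u, 'u \<Rightarrow> 'u) algth, _) cat) (op_cat VAR) Mod_functor"
proof -
  have th: "set_theory_of T" if "T \<in> ob HAff" for T :: "('u, 'u \<Rightarrow> 'u) algth"
    using that U by (simp add: set_theory_of_def alg_theory_def)
  have func: "is_functor (HAff :: (('u, 'u \<Rightarrow> 'u) algth, _) cat) (op_cat VAR) Mod_functor"
    unfolding is_functor_def
  proof (intro conjI ballI)
    show "category (HAff :: (('u, 'u \<Rightarrow> 'u) algth, _) cat)" using U by (rule category_HAff)
    show "category (op_cat VAR :: ('u ccat, _) cat)" by (rule category_op_cat[OF category_VAR])
    show "fob Mod_functor T \<in> ob (op_cat VAR)" if "T \<in> ob HAff" for T :: "('u, 'u \<Rightarrow> 'u) algth"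
      using set_theory_of.variety_theory_Mod[OF th[OF that]] by simp
    show "far Mod_functor S T \<phi> \<in> hom (op_cat VAR) (fob Mod_functor S) (fob Mod_functor T)"
      if "S \<in> ob HAff" "T \<in> ob HAff" "\<phi> \<in> hom HAff S T" for S T :: "('u, 'u \<Rightarrow> 'u) algth" and \<phi>
      using pullback_model_functor[OF th[OF that(1)] th[OF that(2)]] that(3) by simp
    show "far Mod_functor T T (idt HAff T) = idt (op_cat VAR) (fob Mod_functor T)"
      if T: "T \<in> ob HAff" for T :: "('u, 'u \<Rightarrow> 'u) algth"
    proof -
      interpret set_theory_of T using T by (rule th)
      have id: "idt HAff T \<in> theory_homs T T" using cat_idt[OF category_HAff[OF U] T] by simp
      have "pullback_model T (idt HAff T) M = M" if M: "M \<in> theory_models T" for M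
        by (rule model_eqI[of _ T]) (use M pullback_model_closed[OF th[OF T] th[OF T] id M] in
            \<open>auto simp: theory_models_iff intp_pullback_model[OF th[OF T] th[OF T]]
                und_pullback_model[OF th[OF T] th[OF T]]\<close>)
      then show ?thesis by (auto simp del: HAff_simps(3))
    qed
    show "far Mod_functor R T (cmp HAff R S T \<psi> \<phi>) =
        cmp (op_cat VAR) (fob Mod_functor R) (fob Mod_functor S) (fob Mod_functor T)
            (far Mod_functor S T \<psi>) (far Mod_functor R S \<phi>)"
      if obs: "R \<in> ob HAff" "S \<in> ob HAff" "T \<in> ob HAff"
          and homs: "\<phi> \<in> hom HAff R S" "\<psi> \<in> hom HAff S T"
      for R S T :: "('u, 'u \<Rightarrow> 'u) algth" and \<phi> \<psi>
    proof -
      have c: "cmp HAff R S T \<psi> \<phi> \<in> theory_homs R T"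
        using cat_cmp[OF category_HAff[OF U] obs homs] by simp
      have h: "\<phi> \<in> theory_homs R S" "\<psi> \<in> theory_homs S T" using homs by simp_all
      have "pullback_model R (cmp HAff R S T \<psi> \<phi>) M = pullback_model R \<phi> (pullback_model S \<psi> M)"
        if M: "M \<in> theory_models T" for M
      proof (rule model_eqI[of _ R])
        note p = pullback_model_closed[OF th[OF obs(2)] th[OF obs(3)] h(2) M]
        show "pullback_model R (cmp HAff R S T \<psi> \<phi>) M \<in> structures (theory_sig R)"
          "pullback_model R \<phi> (pullback_model S \<psi> M) \<in> structures (theory_sig R)"
          using pullback_model_closed[OF th[OF obs(1)] th[OF obs(3)] c M]
            pullback_model_closed[OF th[OF obs(1)] th[OF obs(2)] h(1) p]
          by (simp_all add: set_theory_of.theory_models_iff[OF th[OF obs(1)]])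
      qed (use theory_hom_simps(1)[OF set_theory_of.axioms[OF th[OF obs(1)]] h(1)] in \<open>auto simp:
          pullback_model_def\<close>)
      then show ?thesis
        using pullback_model_closed[OF th[OF obs(2)] th[OF obs(3)] h(2)]
            by (auto simp del: HAff_simps(4))
    qed
  qed
  moreover have "bij_betw (far Mod_functor S T) (hom HAff S T)
      (hom (op_cat VAR) (fob Mod_functor S) (fob Mod_functor T))"
    if obs: "S \<in> ob HAff" "T \<in> ob HAff" for S T :: "('u, 'u \<Rightarrow> 'u) algth"
    unfolding bij_betw_def
  proof
    show "inj_on (far Mod_functor S T) (hom HAff S T)"
    proof (rule inj_onI)
      fix \<phi> \<psi> assume h: "\<phi> \<in> hom HAff S T" "\<psi> \<in> hom HAff S T"
          and eq: "far Mod_functor S T \<phi> = far Mod_functor S T \<psi>"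
      show "\<phi> = \<psi>"
      proof (rule pullback_model_inject[OF th[OF obs(1)] th[OF obs(2)]])
        fix M assume "M \<in> theory_models T"
        then show "pullback_model S \<phi> M = pullback_model S \<psi> M"
          using fun_cong[OF eq, of M] by simp
      qed (use h in simp_all)
    qed
    show "far Mod_functor S T ` hom HAff S T =
        hom (op_cat VAR) (fob Mod_functor S) (fob Mod_functor T)"
    proof
      show "far Mod_functor S T ` hom HAff S T \<subseteq> hom (op_cat VAR) (fob Mod_functor S)
          (fob Mod_functor T)"
        using functor_hom[OF func obs] by blast
      show "hom (op_cat VAR) (fob Mod_functor S)
          (fob Mod_functor T) \<subseteq> far Mod_functor S T ` hom HAff S T"
      proof
        fix F assume "F \<in> hom (op_cat VAR) (fob Mod_functor S) (fob Mod_functor T)"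
        then have "F \<in> concrete_functors (theory_Mod T) (theory_Mod S)" by simp
        then obtain \<phi> where "\<phi> \<in> theory_homs S T" "F = (\<lambda>M\<in>theory_models T. pullback_model S \<phi> M)"
          by (rule concrete_functor_is_pullback[OF th[OF obs(1)] th[OF obs(2)]])
        then show "F \<in> far Mod_functor S T ` hom HAff S T" by auto
      qed
    qed
  qed
  ultimately show ?thesis unfolding fully_faithful_def by blast
qed

section \<open>Boolean algebras\<close>

locale balgebra =
  fixes B :: "('u, 'z) balg_scheme"
  assumes boolean_alg: "boolean_alg B"
begin

abbreviation meet (infixl "\<sqinter>" 70) where "a \<sqinter> b \<equiv> bmeet B a b"
abbreviation join (infixl "\<squnion>" 65) where "a \<squnion> b \<equiv> bjoin B a b"
abbreviation neg ("\<sim> _" [80] 80) where "\<sim> a \<equiv> bneg B a"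
abbreviation bot ("\<bottom>") where "\<bottom> \<equiv> bzero B"
abbreviation top ("\<top>") where "\<top> \<equiv> bone B"
abbreviation le (infix "\<sqsubseteq>" 50) where "a \<sqsubseteq> b \<equiv> ble B a b"
abbreviation C where "C \<equiv> bcarrier B"

lemma closed [simp]:
  "\<bottom> \<in> C" "\<top> \<in> C" "a \<in> C \<Longrightarrow> \<sim> a \<in> C"
  "a \<in> C \<Longrightarrow> b \<in> C \<Longrightarrow> a \<sqinter> b \<in> C" "a \<in> C \<Longrightarrow> b \<in> C \<Longrightarrow> a \<squnion> b \<in> C"
  using boolean_alg by (simp_all add: boolean_alg_def)

lemma small_carrier: "small TYPE('u) C"
  using boolean_alg by (simp add: boolean_alg_def)

lemma meet_commute: "a \<in> C \<Longrightarrow> b \<in> C \<Longrightarrow> a \<sqinter> b = b \<sqinter> a"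
  and join_commute: "a \<in> C \<Longrightarrow> b \<in> C \<Longrightarrow> a \<squnion> b = b \<squnion> a"
  and meet_assoc: "a \<in> C \<Longrightarrow> b \<in> C \<Longrightarrow> c \<in> C \<Longrightarrow> a \<sqinter> b \<sqinter> c = a \<sqinter> (b \<sqinter> c)"
  and join_assoc: "a \<in> C \<Longrightarrow> b \<in> C \<Longrightarrow> c \<in> C \<Longrightarrow> a \<squnion> b \<squnion> c = a \<squnion> (b \<squnion> c)"
  and meet_join: "a \<in> C \<Longrightarrow> b \<in> C \<Longrightarrow> c \<in> C \<Longrightarrow> a \<sqinter> (b \<squnion> c) = (a \<sqinter> b) \<squnion> (a \<sqinter> c)"
  and join_meet: "a \<in> C \<Longrightarrow> b \<in> C \<Longrightarrow> c \<in> C \<Longrightarrow> a \<squnion> (b \<sqinter> c) = (a \<squnion> b) \<sqinter> (a \<squnion> c)"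
  using boolean_alg unfolding boolean_alg_def by meson+

lemma meet_top [simp]: "a \<in> C \<Longrightarrow> a \<sqinter> \<top> = a"
  and join_bot [simp]: "a \<in> C \<Longrightarrow> a \<squnion> \<bottom> = a"
  and meet_neg [simp]: "a \<in> C \<Longrightarrow> a \<sqinter> \<sim> a = \<bottom>"
  and join_neg [simp]: "a \<in> C \<Longrightarrow> a \<squnion> \<sim> a = \<top>"
  using boolean_alg by (simp_all add: boolean_alg_def)

lemma top_meet [simp]: "a \<in> C \<Longrightarrow> \<top> \<sqinter> a = a"
  and bot_join [simp]: "a \<in> C \<Longrightarrow> \<bottom> \<squnion> a = a"
  and neg_meet [simp]: "a \<in> C \<Longrightarrow> \<sim> a \<sqinter> a = \<bottom>"
  and neg_join [simp]: "a \<in> C \<Longrightarrow> \<sim> a \<squnion> a = \<top>"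
  using meet_commute[of "\<top>" a] join_commute[of "\<bottom>" a] meet_commute[of "\<sim> a" a] join_commute[of "\<sim> a"
      a]
  by simp_all

lemma meet_left_commute: "a \<in> C \<Longrightarrow> b \<in> C \<Longrightarrow> c \<in> C \<Longrightarrow> a \<sqinter> (b \<sqinter> c) = b \<sqinter> (a \<sqinter> c)"
  by (metis meet_assoc meet_commute)

lemmas meet_ac = meet_assoc meet_commute meet_left_commute

lemma meet_idem [simp]: "a \<in> C \<Longrightarrow> a \<sqinter> a = a"
  using meet_join[of a a "\<sim> a"] by simp

lemma join_idem [simp]: "a \<in> C \<Longrightarrow> a \<squnion> a = a"
  using join_meet[of a a "\<sim> a"] by simp

lemma meet_left_idem [simp]: "a \<in> C \<Longrightarrow> b \<in> C \<Longrightarrow> a \<sqinter> (a \<sqinter> b) = a \<sqinter> b"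
  by (simp flip: meet_assoc)

lemma meet_bot [simp]: "a \<in> C \<Longrightarrow> a \<sqinter> \<bottom> = \<bottom>"
  using meet_assoc[of a a "\<sim> a"] by simp

lemma bot_meet [simp]: "a \<in> C \<Longrightarrow> \<bottom> \<sqinter> a = \<bottom>"
  using meet_commute[of "\<bottom>" a] by simp

lemma join_top [simp]: "a \<in> C \<Longrightarrow> a \<squnion> \<top> = \<top>"
  using join_assoc[of a a "\<sim> a"] by simp

lemma top_join [simp]: "a \<in> C \<Longrightarrow> \<top> \<squnion> a = \<top>"
  using join_commute[of "\<top>" a] by simp

lemma join_meet_absorb: "a \<in> C \<Longrightarrow> b \<in> C \<Longrightarrow> a \<squnion> (a \<sqinter> b) = a"
  using meet_join[of a "\<top>" b] by simp

lemma meet_join_absorb: "a \<in> C \<Longrightarrow> b \<in> C \<Longrightarrow> a \<sqinter> (a \<squnion> b) = a"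
  using join_meet[of a "\<bottom>" b] by simp

lemma le_refl [simp]: "a \<in> C \<Longrightarrow> a \<sqsubseteq> a"
  by (simp add: ble_def)

lemma bot_le [simp]: "a \<in> C \<Longrightarrow> \<bottom> \<sqsubseteq> a" and le_top [simp]: "a \<in> C \<Longrightarrow> a \<sqsubseteq> \<top>"
  by (simp_all add: ble_def)

lemma le_antisym: "a \<in> C \<Longrightarrow> b \<in> C \<Longrightarrow> a \<sqsubseteq> b \<Longrightarrow> b \<sqsubseteq> a \<Longrightarrow> a = b"
  using meet_commute[of a b] by (simp add: ble_def)

lemma le_trans: "a \<in> C \<Longrightarrow> b \<in> C \<Longrightarrow> c \<in> C \<Longrightarrow> a \<sqsubseteq> b \<Longrightarrow> b \<sqsubseteq> c \<Longrightarrow> a \<sqsubseteq> c"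
  unfolding ble_def by (metis meet_assoc)

lemma meet_le1 [simp]: "a \<in> C \<Longrightarrow> b \<in> C \<Longrightarrow> a \<sqinter> b \<sqsubseteq> a"
  and meet_le2 [simp]: "a \<in> C \<Longrightarrow> b \<in> C \<Longrightarrow> a \<sqinter> b \<sqsubseteq> b"
  by (simp_all add: ble_def meet_ac)

lemma le_meet: "a \<in> C \<Longrightarrow> b \<in> C \<Longrightarrow> c \<in> C \<Longrightarrow> a \<sqsubseteq> b \<Longrightarrow> a \<sqsubseteq> c \<Longrightarrow> a \<sqsubseteq> b \<sqinter> c"
  unfolding ble_def by (metis meet_assoc)

lemma le_iff_join: "a \<in> C \<Longrightarrow> b \<in> C \<Longrightarrow> a \<sqsubseteq> b \<longleftrightarrow> a \<squnion> b = b"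
  unfolding ble_def by (metis join_commute join_meet_absorb meet_commute meet_join_absorb)

lemma join_ge1 [simp]: "a \<in> C \<Longrightarrow> b \<in> C \<Longrightarrow> a \<sqsubseteq> a \<squnion> b"
  by (simp add: ble_def meet_join_absorb)

lemma join_ge2 [simp]: "a \<in> C \<Longrightarrow> b \<in> C \<Longrightarrow> b \<sqsubseteq> a \<squnion> b"
  using join_ge1[of b a] by (simp add: join_commute)

lemma join_le: "a \<in> C \<Longrightarrow> b \<in> C \<Longrightarrow> c \<in> C \<Longrightarrow> a \<sqsubseteq> c \<Longrightarrow> b \<sqsubseteq> c \<Longrightarrow> a \<squnion> b \<sqsubseteq> c"
  by (simp add: le_iff_join join_assoc)

text \<open>Residuation: meeting with b has a right adjoint, Boolean implication from b. As left
  adjoints preserve whatever joins exist, this takes the place of an infinite distributive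
  law.\<close>

lemma meet_le_iff:
  assumes [simp]: "a \<in> C" "b \<in> C" "c \<in> C"
  shows "a \<sqinter> b \<sqsubseteq> c \<longleftrightarrow> a \<sqsubseteq> c \<squnion> \<sim> b"
proof
  assume "a \<sqinter> b \<sqsubseteq> c"
  then have "a \<sqinter> b \<sqsubseteq> c \<squnion> \<sim> b" by (rule le_trans[of "a \<sqinter> b" c, rotated 3]) simp_all
  moreover have "a \<sqinter> \<sim> b \<sqsubseteq> c \<squnion> \<sim> b" by (rule le_trans[of "a \<sqinter> \<sim> b" "\<sim> b"]) simp_all
  ultimately have "(a \<sqinter> b) \<squnion> (a \<sqinter> \<sim> b) \<sqsubseteq> c \<squnion> \<sim> b" by (simp add: join_le)
  then show "a \<sqsubseteq> c \<squnion> \<sim> b" using meet_join[of a b "\<sim> b"] by simp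
next
  assume "a \<sqsubseteq> c \<squnion> \<sim> b"
  then have "a \<sqinter> b \<sqsubseteq> c \<squnion> \<sim> b" by (rule le_trans[of "a \<sqinter> b" a, rotated 4]) simp_all
  then have "a \<sqinter> b \<sqsubseteq> (c \<squnion> \<sim> b) \<sqinter> b" by (simp add: le_meet)
  also have "(c \<squnion> \<sim> b) \<sqinter> b = b \<sqinter> c" using meet_join[of b c "\<sim> b"] by (simp add: meet_commute)
  finally show "a \<sqinter> b \<sqsubseteq> c" by (rule le_trans[of "a \<sqinter> b" "b \<sqinter> c", rotated 3]) simp_all
qed

lemma le_bot_iff: "a \<in> C \<Longrightarrow> a \<sqsubseteq> \<bottom> \<longleftrightarrow> a = \<bottom>"
  by (auto simp: ble_def)

lemma le_neg_iff: "a \<in> C \<Longrightarrow> b \<in> C \<Longrightarrow> a \<sqsubseteq> \<sim> b \<longleftrightarrow> a \<sqinter> b = \<bottom>"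
  using meet_le_iff[of a b "\<bottom>"] by (simp add: le_bot_iff)

lemma neg_unique:
  assumes "a \<in> C" "b \<in> C" "a \<sqinter> b = \<bottom>" "a \<squnion> b = \<top>"
  shows "b = \<sim> a"
proof (rule le_antisym)
  show "b \<sqsubseteq> \<sim> a" using assms by (simp add: le_neg_iff meet_commute)
  have "\<sim> a \<sqinter> (a \<squnion> b) = \<sim> a \<sqinter> b" using assms(1,2) by (simp add: meet_join del: meet_top)
  then show "\<sim> a \<sqsubseteq> b" using assms by (simp add: ble_def)
qed (use assms in auto)

lemma neg_neg [simp]: "a \<in> C \<Longrightarrow> \<sim> \<sim> a = a"
  using neg_unique[of "\<sim> a" a] by simp

lemma neg_bot [simp]: "\<sim> \<bottom> = \<top>" and neg_top [simp]: "\<sim> \<top> = \<bottom>"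
  using neg_unique[of "\<bottom>" "\<top>"] neg_unique[of "\<top>" "\<bottom>"] by simp_all

lemma neg_meet_eq:
  assumes [simp]: "a \<in> C" "b \<in> C"
  shows "\<sim> (a \<sqinter> b) = \<sim> a \<squnion> \<sim> b"
proof -
  have "(a \<sqinter> b) \<sqinter> \<sim> a = \<bottom>" using meet_commute[of "a \<sqinter> b" "\<sim> a"] meet_assoc[of "\<sim> a" a b] by simp
  moreover have "(a \<sqinter> b) \<sqinter> \<sim> b = \<bottom>" by (simp add: meet_assoc)
  ultimately have 1: "(a \<sqinter> b) \<sqinter> (\<sim> a \<squnion> \<sim> b) = \<bottom>" by (simp add: meet_join)
  have "(\<sim> a \<squnion> \<sim> b) \<squnion> a = \<top>" using join_commute[of "\<sim> a" "\<sim> b"] by (simp add: join_assoc)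
  moreover have "(\<sim> a \<squnion> \<sim> b) \<squnion> b = \<top>" by (simp add: join_assoc)
  ultimately have "(\<sim> a \<squnion> \<sim> b) \<squnion> (a \<sqinter> b) = \<top>" by (simp add: join_meet)
  then show ?thesis using 1 neg_unique[of "a \<sqinter> b" "\<sim> a \<squnion> \<sim> b"] by (simp add: join_commute)
qed

lemma join_conv: "a \<in> C \<Longrightarrow> b \<in> C \<Longrightarrow> a \<squnion> b = \<sim> (\<sim> a \<sqinter> \<sim> b)"
  by (simp add: neg_meet_eq)

lemma is_lub_closed: "is_lub B S a \<Longrightarrow> a \<in> C"
  and is_lub_upper: "is_lub B S a \<Longrightarrow> s \<in> S \<Longrightarrow> s \<sqsubseteq> a"
  and is_lub_least: "is_lub B S a \<Longrightarrow> c \<in> C \<Longrightarrow> (\<And>s. s \<in> S \<Longrightarrow> s \<sqsubseteq> c) \<Longrightarrow> a \<sqsubseteq> c"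
  by (simp_all add: is_lub_def)

lemma is_lub_unique: "is_lub B S a \<Longrightarrow> is_lub B S b \<Longrightarrow> a = b"
  unfolding is_lub_def using le_antisym by blast

lemma bsup_eq: "is_lub B S a \<Longrightarrow> bsup B S = a"
  unfolding bsup_def using is_lub_unique by blast

lemma is_lub_bsup: "is_lub B S a \<Longrightarrow> is_lub B S (bsup B S)"
  by (simp add: bsup_eq)

lemma is_lub_diff_bot [simp]: "is_lub B (S - {\<bottom>}) a \<longleftrightarrow> is_lub B S a"
  unfolding is_lub_def by (metis Diff_iff bot_le singletonD)

lemma is_lub_empty: "is_lub B {} \<bottom>"
  by (simp add: is_lub_def)

text \<open>By residuation the hypotheses put every member of P below
  \<open>c \<squnion> \<sim> a\<close>, hence also their join, the top element.\<close>

lemma cover_le: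
  assumes P: "is_lub B P \<top>" "P \<subseteq> C" and [simp]: "a \<in> C" "c \<in> C" and le: "\<And>p. p \<in> P \<Longrightarrow> p \<sqinter> a \<sqsubseteq> c"
  shows "a \<sqsubseteq> c"
proof -
  have "p \<sqsubseteq> c \<squnion> \<sim> a" if "p \<in> P" for p
    using le[OF that] P(2) that by (subst (asm) meet_le_iff) auto
  then have "\<top> \<sqsubseteq> c \<squnion> \<sim> a" using P(1) unfolding is_lub_def by simp
  then have "\<top> \<sqinter> a \<sqsubseteq> c" by (subst meet_le_iff) auto
  then show ?thesis by simp
qed

lemma cover_eq:
  assumes P: "is_lub B P \<top>" "P \<subseteq> C" and a: "a \<in> C" "c \<in> C" and eq: "\<And>p. p \<in> P \<Longrightarrow> p \<sqinter> a = p \<sqinter> c"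
  shows "a = c"
proof (rule le_antisym)
  show "a \<sqsubseteq> c"
    by (rule cover_le[OF P a]) (use P(2) a in \<open>auto simp: eq\<close>)
  show "c \<sqsubseteq> a"
    by (rule cover_le[OF P a(2,1)]) (use P(2) a in \<open>auto simp flip: eq\<close>)
qed (use a in auto)

lemma partition_of_iff: "partition_of B P \<longleftrightarrow> P \<subseteq> C \<and> \<bottom> \<notin> P \<and> is_lub B P \<top> \<and>
    (\<forall>c\<in>P. \<forall>d\<in>P. c \<noteq> d \<longrightarrow> c \<sqinter> d = \<bottom>)"
  by (auto simp: partition_of_def)

lemma partition_of_pair: "a \<in> C \<Longrightarrow> partition_of B ({a, \<sim> a} - {\<bottom>})"
proof -
  assume a: "a \<in> C"
  then have "is_lub B {a, \<sim> a} \<top>"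
    using join_le[of a "\<sim> a"] by (auto simp: is_lub_def)
  then show ?thesis
    unfolding partition_of_iff is_lub_diff_bot using a by auto
qed

lemma is_lub_insert:
  assumes "is_lub B S a" "x \<in> C" "S \<subseteq> C"
  shows "is_lub B (insert x S) (x \<squnion> a)"
  unfolding is_lub_def
proof (intro conjI ballI impI)
  have [simp]: "x \<in> C" "a \<in> C" using assms by (auto simp: is_lub_def)
  show "x \<squnion> a \<in> C" by simp
  show "s \<sqsubseteq> x \<squnion> a" if "s \<in> insert x S" for s
  proof (cases "s = x")
    case False
    then have "s \<sqsubseteq> a" using that assms(1) by (simp add: is_lub_def)
    then show ?thesis using that assms(3) by - (rule le_trans[of s a], auto)
  qed simp
  show "x \<squnion> a \<sqsubseteq> c" if "c \<in> C" "\<forall>s\<in>insert x S. s \<sqsubseteq> c" for c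
    using that assms(1) by (intro join_le) (auto simp: is_lub_def)
qed

text \<open>Formulated for any set I closed under joins rather than for the carrier, because
  \<open>act_cover_eq\<close> applies it to the set of all b with
  \<open>act b z w = w\<close>.\<close>

lemma finite_lub:
  assumes "finite S" "S \<subseteq> I" "I \<subseteq> C" "\<bottom> \<in> I" "\<And>a b. a \<in> I \<Longrightarrow> b \<in> I \<Longrightarrow> a \<squnion> b \<in> I"
  shows "\<exists>a\<in>I. is_lub B S a"
  using assms(1,2)
proof induction
  case empty
  then show ?case using assms(4) is_lub_empty by blast
next
  case (insert x S)
  then obtain a where a: "a \<in> I" "is_lub B S a" by blast
  have "is_lub B (insert x S) (x \<squnion> a)"
    using a insert.prems assms(3) by (intro is_lub_insert) auto
  then show ?case using a insert.prems assms(5) by blast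
qed

end

lemma
  assumes "f \<in> boolean_homs B C"
  shows hom_closed: "a \<in> bcarrier B \<Longrightarrow> f a \<in> bcarrier C"
    and hom_zero: "f (bzero B) = bzero C" and hom_one: "f (bone B) = bone C"
    and hom_neg: "a \<in> bcarrier B \<Longrightarrow> f (bneg B a) = bneg C (f a)"
    and hom_meet: "\<lbrakk>a \<in> bcarrier B; b \<in> bcarrier B\<rbrakk> \<Longrightarrow> f (bmeet B a b) = bmeet C (f a) (f b)"
    and hom_join: "\<lbrakk>a \<in> bcarrier B; b \<in> bcarrier B\<rbrakk> \<Longrightarrow> f (bjoin B a b) = bjoin C (f a) (f b)"
    and hom_extensional: "f \<in> extensional (bcarrier B)"
  using assms by (simp_all add: boolean_homs_def PiE_iff)

section \<open>The theory of a Grothendieck Boolean algebra\<close>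

locale grbalgebra = balgebra B for B :: "'u gbalg" +
  assumes universe: "universe TYPE('u)" and nondeg: "\<bottom> \<noteq> \<top>"
      and zero_dim: "zero_dim_topology B (topo B)"
begin

abbreviation sm :: "'u set \<Rightarrow> bool" where "sm I \<equiv> small TYPE('u) I"

abbreviation T where "T \<equiv> partition_theory B"

lemma topo_partition: "P \<in> topo B \<Longrightarrow> partition_of B P"
  using zero_dim by (simp add: zero_dim_topology_def)

lemma topo_finite: "partition_of B P \<Longrightarrow> finite P \<Longrightarrow> P \<in> topo B"
  using zero_dim by (simp add: zero_dim_topology_def)

lemma topo_refine:
  assumes "P \<in> topo B" "\<And>b. b \<in> P \<Longrightarrow> Q b \<in> topo B"
  shows "{b \<sqinter> c | b c. b \<in> P \<and> c \<in> Q b} - {\<bottom>} \<in> topo B"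
proof -
  have "\<forall>P\<in>topo B. \<forall>Q. (\<forall>b\<in>P. Q b \<in> topo B) \<longrightarrow> {b \<sqinter> c | b c. b \<in> P \<and> c \<in> Q b} - {\<bottom>} \<in> topo B"
    using zero_dim unfolding zero_dim_topology_def by (elim conjE)
  from bspec[OF this assms(1)] show ?thesis using assms(2) by blast
qed

lemma topo_coarsen:
  fixes \<alpha> :: "'u \<Rightarrow> 'u"
  assumes "P \<in> topo B"
  shows "i \<in> \<alpha> ` P \<Longrightarrow> \<exists>a. is_lub B {b \<in> P. \<alpha> b = i} a"
    and "{bsup B {b \<in> P. \<alpha> b = i} | i. i \<in> \<alpha> ` P} \<in> topo B"
proof -
  have "\<forall>P\<in>topo B. \<forall>\<alpha> :: 'u \<Rightarrow> 'u. (\<forall>i\<in>\<alpha> ` P. \<exists>a. is_lub B {b \<in> P. \<alpha> b = i} a) \<and>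
      {bsup B {b \<in> P. \<alpha> b = i} | i. i \<in> \<alpha> ` P} \<in> topo B"
    using zero_dim unfolding zero_dim_topology_def by (elim conjE)
  from spec[OF bspec[OF this assms], of \<alpha>]
  show "i \<in> \<alpha> ` P \<Longrightarrow> \<exists>a. is_lub B {b \<in> P. \<alpha> b = i} a"
    and "{bsup B {b \<in> P. \<alpha> b = i} | i. i \<in> \<alpha> ` P} \<in> topo B"
    by blast+
qed

lemma topo_subset: "P \<in> topo B \<Longrightarrow> P \<subseteq> C"
  using topo_partition by (auto simp: partition_of_iff)

lemma small_topo: "P \<in> topo B \<Longrightarrow> sm P"
  using small_subset[OF small_carrier topo_subset] .

lemma num_eq [simp]: "(num m :: 'u) = num n \<longleftrightarrow> m = n"
  by (rule num_eq_iff[OF universe])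

lemmas nset_2_eq = nset_2[OF universe]

lemma num_in_nset_2 [simp]: "num 1 \<in> (nset 2 :: 'u set)" "num 2 \<in> (nset 2 :: 'u set)"
  "num (Suc 0) \<in> (nset 2 :: 'u set)"
  by (simp_all add: nset_2_eq)

text \<open>Injectivity on the support becomes disjointness, which treats all indices alike:
  distinct nonzero values are disjoint as members of a partition, and a nonzero value taken twice
  would not be disjoint from itself.\<close>

lemma ops_iff: "\<omega> \<in> ops T I \<longleftrightarrow> \<omega> \<in> I \<rightarrow>\<^sub>E C \<and> (\<forall>i\<in>I. \<forall>j\<in>I. i \<noteq> j \<longrightarrow> \<omega> i \<sqinter> \<omega> j
    = \<bottom>) \<and> \<omega> ` I - {\<bottom>} \<in> topo B"
proof -
  have img: "\<omega> ` bsupp B I \<omega> = \<omega> ` I - {\<bottom>}" by (auto simp: bsupp_def)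
  have "inj_on \<omega> (bsupp B I \<omega>) \<longleftrightarrow> (\<forall>i\<in>I. \<forall>j\<in>I. i \<noteq> j \<longrightarrow> \<omega> i \<sqinter> \<omega> j = \<bottom>)"
    if w: "\<omega> \<in> I \<rightarrow>\<^sub>E C" "\<omega> ` I - {\<bottom>} \<in> topo B"
  proof -
    have wC: "\<omega> i \<in> C" if "i \<in> I" for i using w(1) that by auto
    have p: "partition_of B (\<omega> ` I - {\<bottom>})" by (rule topo_partition[OF w(2)])
    show ?thesis
    proof (intro iffI ballI impI)
      fix i j assume inj: "inj_on \<omega> (bsupp B I \<omega>)" and ij: "i \<in> I" "j \<in> I" "i \<noteq> j"
      show "\<omega> i \<sqinter> \<omega> j = \<bottom>"
      proof (cases "\<omega> i = \<bottom> \<or> \<omega> j = \<bottom>")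
        case False
        then have "\<omega> i \<noteq> \<omega> j" using inj ij by (auto simp: bsupp_def inj_on_def)
        then show ?thesis using p ij False by (auto simp: partition_of_iff)
      qed (use wC ij in auto)
    next
      assume d: "\<forall>i\<in>I. \<forall>j\<in>I. i \<noteq> j \<longrightarrow> \<omega> i \<sqinter> \<omega> j = \<bottom>"
      show "inj_on \<omega> (bsupp B I \<omega>)"
      proof (rule inj_onI, rule ccontr)
        fix i j assume ij: "i \<in> bsupp B I \<omega>" "j \<in> bsupp B I \<omega>" "\<omega> i = \<omega> j" "i \<noteq> j"
        then have "\<omega> i \<sqinter> \<omega> i = \<bottom>" using d by (auto simp: bsupp_def)
        then show False using ij wC by (auto simp: bsupp_def)
      qed
    qed
  qed
  then show ?thesis by (auto simp: partition_theory_def img)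
qed

lemma opsD:
  assumes "\<omega> \<in> ops T I"
  shows "i \<in> I \<Longrightarrow> \<omega> i \<in> C" and "\<lbrakk>i \<in> I; j \<in> I; i \<noteq> j\<rbrakk> \<Longrightarrow> \<omega> i \<sqinter> \<omega> j = \<bottom>"
    and "\<omega> ` I - {\<bottom>} \<in> topo B" and "\<omega> \<in> extensional I" and "is_lub B (\<omega> ` I) \<top>"
proof -
  show "\<omega> ` I - {\<bottom>} \<in> topo B" using assms by (simp add: ops_iff)
  then have "partition_of B (\<omega> ` I - {\<bottom>})" by (rule topo_partition)
  then show "is_lub B (\<omega> ` I) \<top>" by (simp add: partition_of_iff)
  show "\<omega> \<in> extensional I" using assms by (simp add: ops_iff PiE_iff)
qed (use assms in \<open>auto simp: ops_iff\<close>)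

lemma ops_cover_eq:
  "\<lbrakk>\<omega> \<in> ops T I; a \<in> C; c \<in> C; \<And>i. i \<in> I \<Longrightarrow> \<omega> i \<sqinter> a = \<omega> i \<sqinter> c\<rbrakk> \<Longrightarrow> a = c"
  using opsD[of \<omega> I] by - (rule cover_eq[of "\<omega> ` I"], auto)

lemma ops_cover_le:
  "\<lbrakk>\<omega> \<in> ops T I; a \<in> C; c \<in> C; \<And>i. i \<in> I \<Longrightarrow> \<omega> i \<sqinter> a \<sqsubseteq> c\<rbrakk> \<Longrightarrow> a \<sqsubseteq> c"
  using opsD[of \<omega> I] by - (rule cover_le[of "\<omega> ` I"], auto)

text \<open>
  Identities between operations of a partition theory are checked below each member of a partition.
\<close>

lemma is_lub_glue:
  assumes \<omega>: "\<omega> \<in> ops T I" and \<gamma>: "\<And>i. i \<in> I \<Longrightarrow> g i \<in> C"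
  shows "is_lub B {\<omega> i \<sqinter> g i | i. i \<in> I} a \<longleftrightarrow> a \<in> C \<and> (\<forall>i\<in>I. \<omega> i \<sqinter> a = \<omega> i \<sqinter> g i)"
proof (intro iffI conjI ballI)
  note \<omega>C [simp] = opsD(1)[OF \<omega>] \<gamma>
  assume lub: "is_lub B {\<omega> i \<sqinter> g i | i. i \<in> I} a"
  then show a [simp]: "a \<in> C" by (simp add: is_lub_def)
  fix i assume i [simp]: "i \<in> I"
  \<comment> \<open>The terms with \<open>j \<noteq> i\<close> lie below
    \<open>\<sim> \<omega> i\<close>. So all terms lie below the implication from
    \<open>\<omega> i\<close> to \<open>g i\<close>, and so does their join.\<close>
  have "\<omega> j \<sqinter> g j \<sqsubseteq> g i \<squnion> \<sim> \<omega> i" if j [simp]: "j \<in> I" for j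
  proof (cases "i = j")
    case True
    then show ?thesis by - (rule le_trans[of "\<omega> j \<sqinter> g j" "g j"], auto)
  next
    case False
    then have "\<omega> j \<sqinter> \<omega> i = \<bottom>" using opsD(2)[OF \<omega> j i] by blast
    then have "\<omega> j \<sqsubseteq> \<sim> \<omega> i" by (simp add: le_neg_iff)
    then have "\<omega> j \<sqinter> g j \<sqsubseteq> \<sim> \<omega> i" by - (rule le_trans[of "\<omega> j \<sqinter> g j" "\<omega> j"], auto)
    then show ?thesis by - (rule le_trans[of "\<omega> j \<sqinter> g j" "\<sim> \<omega> i"], auto)
  qed
  then have "a \<sqsubseteq> g i \<squnion> \<sim> \<omega> i" by (intro is_lub_least[OF lub]) auto
  then have "a \<sqinter> \<omega> i \<sqsubseteq> g i" by (subst meet_le_iff) auto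
  then have "\<omega> i \<sqinter> a \<sqsubseteq> \<omega> i \<sqinter> g i" by (simp add: le_meet meet_commute)
  moreover have "\<omega> i \<sqinter> g i \<sqsubseteq> a" using i by (intro is_lub_upper[OF lub]) blast
  then have "\<omega> i \<sqinter> g i \<sqsubseteq> \<omega> i \<sqinter> a" by (intro le_meet) auto
  ultimately show "\<omega> i \<sqinter> a = \<omega> i \<sqinter> g i" by (intro le_antisym) auto
next
  note \<omega>C [simp] = opsD(1)[OF \<omega>] \<gamma>
  assume a: "a \<in> C \<and> (\<forall>i\<in>I. \<omega> i \<sqinter> a = \<omega> i \<sqinter> g i)"
  then show "is_lub B {\<omega> i \<sqinter> g i | i. i \<in> I} a"
    unfolding is_lub_def
  proof (intro conjI ballI impI)
    show "s \<sqsubseteq> a" if "s \<in> {\<omega> i \<sqinter> g i | i. i \<in> I}" for s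
    proof -
      obtain i where i: "i \<in> I" "s = \<omega> i \<sqinter> a" using \<open>s \<in> _\<close> a by auto
      show ?thesis unfolding i(2) using i(1) a by (intro meet_le2) auto
    qed
    show "a \<sqsubseteq> c" if c: "c \<in> C" "\<forall>s\<in>{\<omega> i \<sqinter> g i | i. i \<in> I}. s \<sqsubseteq> c" for c
    proof (rule ops_cover_le[OF \<omega> _ c(1)])
      fix i assume "i \<in> I"
      then have "\<omega> i \<sqinter> g i \<sqsubseteq> c" "\<omega> i \<sqinter> a = \<omega> i \<sqinter> g i" using a c(2) by blast+
      then show "\<omega> i \<sqinter> a \<sqsubseteq> c" by simp
    qed (use a in blast)
  qed simp
qed

lemma subst_eq: "j \<in> J \<Longrightarrow> subst T I J \<omega> \<gamma> j = bsup B {\<omega> i \<sqinter> \<gamma> i j | i. i \<in> I}"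
  by (simp add: partition_theory_def)

lemma proj_eq: "j \<in> I \<Longrightarrow> proj T I i j = (if i = j then \<top> else \<bottom>)"
  by (simp add: partition_theory_def)

lemma proj_in_ops: "i \<in> I \<Longrightarrow> proj T I i \<in> ops T I"
proof -
  assume i: "i \<in> I"
  have "{\<top>, \<sim> \<top>} - {\<bottom>} \<in> topo B" by (intro topo_finite partition_of_pair) auto
  moreover have "proj T I i ` I - {\<bottom>} = {\<top>, \<sim> \<top>} - {\<bottom>}"
    using i nondeg by (auto simp: proj_eq image_iff)
  moreover have "proj T I i \<in> I \<rightarrow>\<^sub>E C" by (auto simp: partition_theory_def)
  ultimately show ?thesis using i by (simp add: ops_iff proj_eq)
qed

text \<open>The nonzero meets \<open>\<omega> i \<sqinter> \<gamma> i j\<close> form a partition in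
  the topology by the refinement axiom. The join needed at j is the join of those meets with second
  index j, a fibre of a map out of this partition, and the coarsening axiom supplies it.\<close>

lemma subst_exists:
  assumes \<omega>: "\<omega> \<in> ops T I" and \<gamma>': "\<forall>i\<in>I. \<gamma> i \<in> ops T J"
  shows "subst T I J \<omega> \<gamma> \<in> ops T J"
    and "j \<in> J \<Longrightarrow> is_lub B {\<omega> i \<sqinter> \<gamma> i j | i. i \<in> I} (subst T I J \<omega> \<gamma> j)"
proof -
  have \<gamma>: "\<And>i. i \<in> I \<Longrightarrow> \<gamma> i \<in> ops T J" using \<gamma>' by blast
  note [simp] = opsD(1)[OF \<omega>] opsD(1)[OF \<gamma>]
  let ?s = "subst T I J \<omega> \<gamma>"
  define P where "P = \<omega> ` I - {\<bottom>}"
  \<comment> \<open>The refinement axiom indexes the second family of partitions by members b and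
    not by indices i; as \<open>\<omega>\<close> is injective on its support, \<open>idx\<close>
    recovers i from b.\<close>
  define idx where "idx b = (SOME i. i \<in> I \<and> \<omega> i = b)" for b
  have idx: "idx b \<in> I" "\<omega> (idx b) = b" if "b \<in> P" for b
    unfolding idx_def using someI_ex[of "\<lambda>i. i \<in> I \<and> \<omega> i = b"] that by (auto simp: P_def)
  have \<omega>_inj: "i = k" if "i \<in> I" "k \<in> I" "\<omega> i = \<omega> k" "\<omega> i \<noteq> \<bottom>" for i k
    using opsD(2)[OF \<omega> that(1,2)] that by auto
  have \<gamma>_inj: "j = k" if "i \<in> I" "j \<in> J" "k \<in> J" "\<gamma> i j = \<gamma> i k" "\<gamma> i j \<noteq> \<bottom>" for i j k
    using opsD(2)[OF \<gamma>[OF that(1)] that(2,3)] that by auto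
  define D where "D = {\<omega> i \<sqinter> \<gamma> i j | i j. i \<in> I \<and> j \<in> J} - {\<bottom>}"
  have "{b \<sqinter> c | b c. b \<in> P \<and> c \<in> \<gamma> (idx b) ` J - {\<bottom>}} - {\<bottom>} \<in> topo B"
    by (intro topo_refine) (auto simp: P_def opsD(3)[OF \<omega>] opsD(3)[OF \<gamma>] idx)
  also have "{b \<sqinter> c | b c. b \<in> P \<and> c \<in> \<gamma> (idx b) ` J - {\<bottom>}} - {\<bottom>} = D"
  proof (intro set_eqI iffI)
    fix x assume "x \<in> D"
    then obtain i j where x: "i \<in> I" "j \<in> J" "x = \<omega> i \<sqinter> \<gamma> i j" "x \<noteq> \<bottom>" by (auto simp: D_def)
    then have nz: "\<omega> i \<noteq> \<bottom>" "\<gamma> i j \<noteq> \<bottom>" by auto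
    then have "\<omega> i \<in> P" using x by (simp add: P_def)
    moreover from this have "idx (\<omega> i) = i" using idx[of "\<omega> i"] x nz \<omega>_inj by metis
    ultimately have "x = \<omega> i \<sqinter> \<gamma> i j \<and> \<omega> i \<in> P \<and> \<gamma> i j \<in> \<gamma> (idx (\<omega> i)) ` J - {\<bottom>}"
      using x nz by simp
    then show "x \<in> {b \<sqinter> c | b c. b \<in> P \<and> c \<in> \<gamma> (idx b) ` J - {\<bottom>}} - {\<bottom>}"
      using x(4) by blast
  next
    fix x assume "x \<in> {b \<sqinter> c | b c. b \<in> P \<and> c \<in> \<gamma> (idx b) ` J - {\<bottom>}} - {\<bottom>}"
    then obtain b j where x: "b \<in> P" "j \<in> J" "x = b \<sqinter> \<gamma> (idx b) j" "x \<noteq> \<bottom>" by auto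
    then have "x = \<omega> (idx b) \<sqinter> \<gamma> (idx b) j" using idx[OF x(1)] by simp
    then show "x \<in> D" unfolding D_def using idx(1)[OF x(1)] x by blast
  qed
  finally have D: "D \<in> topo B" .
  have disj: "(\<omega> i \<sqinter> \<gamma> i j) \<sqinter> (\<omega> k \<sqinter> \<gamma> k l) = \<bottom>" if "i \<in> I" "j \<in> J" "k \<in> I" "l \<in> J" "i \<noteq> k \<or> j \<noteq> l"
      for i j k l
  proof -
    have "(\<omega> i \<sqinter> \<gamma> i j) \<sqinter> (\<omega> k \<sqinter> \<gamma> k l) = (\<omega> i \<sqinter> \<omega> k) \<sqinter> (\<gamma> i j \<sqinter> \<gamma> k l)"
      using that by (simp add: meet_ac)
    also have "\<dots> = \<bottom>"
      using that opsD(2)[OF \<omega>, of i k] opsD(2)[OF \<gamma>, of i j l] by (cases "i = k") auto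
    finally show ?thesis .
  qed
  \<comment> \<open>Reads off the second index of a nonzero meet; by \<open>disj\<close> a nonzero
    meet has only one.\<close>
  define \<alpha> where "\<alpha> d = (SOME j. j \<in> J \<and> (\<exists>i\<in>I. d = \<omega> i \<sqinter> \<gamma> i j))" for d
  have \<alpha>: "\<alpha> (\<omega> i \<sqinter> \<gamma> i j) = j" if "i \<in> I" "j \<in> J" "\<omega> i \<sqinter> \<gamma> i j \<noteq> \<bottom>" for i j
    unfolding \<alpha>_def
  proof (rule some_equality)
    fix k assume "k \<in> J \<and> (\<exists>l\<in>I. \<omega> i \<sqinter> \<gamma> i j = \<omega> l \<sqinter> \<gamma> l k)"
    then obtain l where l: "k \<in> J" "l \<in> I" "\<omega> i \<sqinter> \<gamma> i j = \<omega> l \<sqinter> \<gamma> l k" by blast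
    show "k = j"
    proof (rule ccontr)
      assume "k \<noteq> j"
      then have "(\<omega> i \<sqinter> \<gamma> i j) \<sqinter> (\<omega> i \<sqinter> \<gamma> i j) = \<bottom>"
        using disj[of i j l k] l that by auto
      then show False using that by simp
    qed
  qed (use that in auto)
  have fib: "{d \<in> D. \<alpha> d = j} = {\<omega> i \<sqinter> \<gamma> i j | i. i \<in> I} - {\<bottom>}" if "j \<in> J" for j
    using that \<alpha> by (fastforce simp: D_def)
  have img: "j \<in> \<alpha> ` D \<longleftrightarrow> {d \<in> D. \<alpha> d = j} \<noteq> {}" for j by auto
  have \<alpha>J: "j \<in> J" if "j \<in> \<alpha> ` D" for j
  proof -
    from that obtain d where "d \<in> D" "j = \<alpha> d" by blast
    moreover from this obtain i k where "i \<in> I" "k \<in> J" "d = \<omega> i \<sqinter> \<gamma> i k" "d \<noteq> \<bottom>"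
      unfolding D_def by blast
    ultimately show ?thesis using \<alpha>[of i k] by simp
  qed
  show lub: "is_lub B {\<omega> i \<sqinter> \<gamma> i j | i. i \<in> I} (?s j)" if j: "j \<in> J" for j
  proof -
    \<comment> \<open>The coarsening axiom speaks only of indices in the image of
      \<open>\<alpha>\<close>. For any other j the fibre is empty, with join bottom.\<close>
    have "\<exists>a. is_lub B {d \<in> D. \<alpha> d = j} a"
    proof (cases "j \<in> \<alpha> ` D")
      case True
      then show ?thesis by (rule topo_coarsen(1)[OF D])
    next
      case False
      then have "{d \<in> D. \<alpha> d = j} = {}" unfolding img by blast
      then show ?thesis using is_lub_empty by metis
    qed
    then have "\<exists>a. is_lub B {\<omega> i \<sqinter> \<gamma> i j | i. i \<in> I} a" unfolding fib[OF j] by simp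
    then show ?thesis unfolding subst_eq[OF j] using is_lub_bsup by blast
  qed
  then have loc: "?s j \<in> C" "\<And>i. i \<in> I \<Longrightarrow> \<omega> i \<sqinter> ?s j = \<omega> i \<sqinter> \<gamma> i j" if "j \<in> J" for j
    using that is_lub_glue[OF \<omega>, of "\<lambda>i. \<gamma> i j"] by auto
  have nz: "?s j \<noteq> \<bottom> \<longleftrightarrow> j \<in> \<alpha> ` D" if j: "j \<in> J" for j
  proof -
    have "?s j = \<bottom> \<longleftrightarrow> (\<forall>d\<in>{\<omega> i \<sqinter> \<gamma> i j | i. i \<in> I}. d = \<bottom>)"
    proof
      assume "?s j = \<bottom>"
      then show "\<forall>d\<in>{\<omega> i \<sqinter> \<gamma> i j | i. i \<in> I}. d = \<bottom>" using loc(2)[OF j] j by auto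
    next
      assume "\<forall>d\<in>{\<omega> i \<sqinter> \<gamma> i j | i. i \<in> I}. d = \<bottom>"
      then have "is_lub B {\<omega> i \<sqinter> \<gamma> i j | i. i \<in> I} \<bottom>" by (auto simp: is_lub_def)
      then show "?s j = \<bottom>" using lub[OF j] is_lub_unique by blast
    qed
    then show ?thesis unfolding img fib[OF j] by blast
  qed
  have "?s ` J - {\<bottom>} = {bsup B {d \<in> D. \<alpha> d = j} | j. j \<in> \<alpha> ` D}"
  proof -
    have "bsup B {d \<in> D. \<alpha> d = j} = ?s j" if "j \<in> J" for j
      unfolding fib[OF that] using lub[OF that] by (simp add: bsup_eq)
    then have "{bsup B {d \<in> D. \<alpha> d = j} | j. j \<in> \<alpha> ` D} = ?s ` (\<alpha> ` D)"
      using \<alpha>J unfolding Setcompr_eq_image by (intro image_cong) blast+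
    moreover have "\<alpha> ` D = {j \<in> J. ?s j \<noteq> \<bottom>}" using nz \<alpha>J by blast
    ultimately show ?thesis by (auto simp only:)
  qed
  then have "?s ` J - {\<bottom>} \<in> topo B" using topo_coarsen(2)[OF D] by simp
  moreover have "?s j \<sqinter> ?s k = \<bottom>" if "j \<in> J" "k \<in> J" "j \<noteq> k" for j k
  proof (rule ops_cover_eq[OF \<omega>])
    fix i assume i: "i \<in> I"
    have "\<omega> i \<sqinter> (?s j \<sqinter> ?s k) = (\<omega> i \<sqinter> ?s j) \<sqinter> (\<omega> i \<sqinter> ?s k)"
      using i that loc(1) by (simp add: meet_ac)
    also have "\<dots> = \<bottom>" using i that by (simp add: loc disj)
    finally show "\<omega> i \<sqinter> (?s j \<sqinter> ?s k) = \<omega> i \<sqinter> \<bottom>" using i by simp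
  qed (use loc that in auto)
  moreover have "?s \<in> J \<rightarrow>\<^sub>E C" using loc(1) by (auto simp: partition_theory_def)
  ultimately show "?s \<in> ops T J" by (simp add: ops_iff)
qed

lemma subst_local:
  assumes "\<omega> \<in> ops T I" "\<forall>i\<in>I. \<gamma> i \<in> ops T J" "j \<in> J"
  shows "subst T I J \<omega> \<gamma> j \<in> C" "i \<in> I \<Longrightarrow> \<omega> i \<sqinter> subst T I J \<omega> \<gamma> j = \<omega> i \<sqinter> \<gamma> i j"
  using subst_exists(2)[OF assms] is_lub_glue[OF assms(1), of "\<lambda>i. \<gamma> i j"] opsD(1)[of "\<gamma> _"
      J j] assms(2,3)
  by auto

lemma subst_eqI:
  assumes "\<omega> \<in> ops T I" "\<forall>i\<in>I. \<gamma> i \<in> ops T J" "\<delta> \<in> J \<rightarrow>\<^sub>E C"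
    and "\<And>i j. i \<in> I \<Longrightarrow> j \<in> J \<Longrightarrow> \<omega> i \<sqinter> \<delta> j = \<omega> i \<sqinter> \<gamma> i j"
  shows "subst T I J \<omega> \<gamma> = \<delta>"
proof (rule PiE_ext[OF _ assms(3)])
  show "subst T I J \<omega> \<gamma> \<in> J \<rightarrow>\<^sub>E C" using subst_exists(1)[OF assms(1,2)] by (simp add: ops_iff)
  show "subst T I J \<omega> \<gamma> j = \<delta> j" if "j \<in> J" for j
    using subst_local[OF assms(1,2) that] assms(3,4) that
        by - (rule ops_cover_eq[OF assms(1)], auto)
qed

lemma ops_PiE: "\<omega> \<in> ops T I \<Longrightarrow> \<omega> \<in> I \<rightarrow>\<^sub>E C"
  by (simp add: ops_iff)

lemma algebraic_theory_T: "algebraic_theory T"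
  unfolding algebraic_theory_def
proof (intro conjI allI impI ballI)
  fix I J K :: "'u set" and t u v i
  show "small TYPE('u) (ops T I)" if "sm I"
    by (rule small_subset[OF small_PiE[OF universe that small_carrier]]) (auto simp: ops_iff)
  show "proj T I i \<in> ops T I" if "i \<in> I" using that by (rule proj_in_ops)
  show "subst T I J t u \<in> ops T J" if "t \<in> ops T I" "u \<in> I \<rightarrow>\<^sub>E ops T J"
    using that by (intro subst_exists) auto
  show "subst T I I t (\<lambda>i\<in>I. proj T I i) = t" if t: "t \<in> ops T I"
    using opsD(1,2)[OF t] by (intro subst_eqI t ops_PiE[OF t]) (auto simp: proj_in_ops proj_eq)
  show "subst T I J (proj T I i) u = u i" if "i \<in> I" "u \<in> I \<rightarrow>\<^sub>E ops T J"
  proof (rule subst_eqI)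
    have u: "u i \<in> ops T J" if "i \<in> I" for i using that \<open>u \<in> I \<rightarrow>\<^sub>E ops T J\<close>
        by (rule PiE_mem[rotated])
    then show "\<forall>i\<in>I. u i \<in> ops T J" by blast
    show "u i \<in> J \<rightarrow>\<^sub>E C" using u[OF that(1)] by (rule ops_PiE)
    show "proj T I i \<in> ops T I" using that(1) by (rule proj_in_ops)
    show "proj T I i k \<sqinter> u i j = proj T I i k \<sqinter> u k j" if "k \<in> I" "j \<in> J" for k j
      using opsD(1)[OF u[OF that(1)] that(2)] opsD(1)[OF u[OF \<open>i \<in> I\<close>] that(2)] that
          by (simp add: proj_eq)
  qed
  show "subst T J K (subst T I J t u) v = subst T I K t (\<lambda>i\<in>I. subst T J K (u i) v)"
    if t: "t \<in> ops T I" and u': "u \<in> I \<rightarrow>\<^sub>E ops T J" and v': "v \<in> J \<rightarrow>\<^sub>E ops T K"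
  proof -
    have u: "\<forall>i\<in>I. u i \<in> ops T J" and v: "\<forall>j\<in>J. v j \<in> ops T K" using u' v' by auto
    let ?tu = "subst T I J t u" and ?uv = "\<lambda>i\<in>I. subst T J K (u i) v"
    have tu: "?tu \<in> ops T J" by (rule subst_exists(1)[OF t u])
    have uv: "\<forall>i\<in>I. ?uv i \<in> ops T K" using u by (auto intro: subst_exists(1)[OF _ v])
    have r: "subst T I K t ?uv \<in> ops T K" by (rule subst_exists(1)[OF t uv])
    show ?thesis
    proof (rule subst_eqI[OF tu v ops_PiE[OF r]])
      fix j k assume j: "j \<in> J" and k: "k \<in> K"
      let ?x = "?tu j" and ?y = "subst T I K t ?uv k"
      have [simp]: "?x \<in> C" "?y \<in> C" "v j k \<in> C"
        using opsD(1)[OF tu j] opsD(1)[OF r k] opsD(1)[of "v j" K k] v j k by auto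
      show "?x \<sqinter> ?y = ?x \<sqinter> v j k"
      \<comment> \<open>Everything is cut down by \<open>t i\<close>: there \<open>?x\<close>
        becomes \<open>u i j\<close> and \<open>?y\<close> becomes \<open>?z\<close>, the value of
        \<open>u i\<close> composed with \<open>v\<close>, and locality of that composite
        finishes.\<close>
      proof (rule ops_cover_eq[OF t])
        fix i assume i: "i \<in> I"
        let ?z = "subst T J K (u i) v k"
        have ui: "u i \<in> ops T J" using u i by blast
        have [simp]: "?z \<in> C" "t i \<in> C" "u i j \<in> C"
          using subst_local(1)[OF ui v k] opsD(1)[OF t i] opsD(1)[OF ui j] by auto
        have "t i \<sqinter> (?x \<sqinter> ?y) = (t i \<sqinter> ?x) \<sqinter> (t i \<sqinter> ?y)" by (simp add: meet_ac)
        also have "\<dots> = (t i \<sqinter> u i j) \<sqinter> (t i \<sqinter> ?z)"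
          unfolding subst_local(2)[OF t u j i] subst_local(2)[OF t uv k i] restrict_apply'[OF i] ..
        also have "\<dots> = t i \<sqinter> (u i j \<sqinter> ?z)" by (simp add: meet_ac)
        also have "\<dots> = (t i \<sqinter> u i j) \<sqinter> v j k"
          using subst_local(2)[OF ui v k j] by (simp add: meet_assoc)
        also have "\<dots> = t i \<sqinter> (?x \<sqinter> v j k)"
          using subst_local(2)[OF t u j i] by (simp flip: meet_assoc)
        finally show "t i \<sqinter> (?x \<sqinter> ?y) = t i \<sqinter> (?x \<sqinter> v j k)" .
      qed auto
    qed
  qed
qed

text \<open>Below \<open>t i\<close>, a substitution into \<open>t\<close> is just its i-th
  argument, so the two sides of each law have equal meets with every \<open>t i\<close>.\<close>

lemma hyperaffine_T: "hyperaffine T"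
  unfolding hyperaffine_def hyperaffine_op_def
proof (intro conjI allI impI ballI)
  fix I K :: "'u set" and t
  assume t: "t \<in> ops T I"
  show "subst T I K t (\<lambda>i\<in>I. x) = x" if "x \<in> ops T K" for x
    using that by (intro subst_eqI[OF t] ops_PiE) auto
  show "subst T I K t (\<lambda>i\<in>I. subst T I K t (\<lambda>j\<in>I. x i j)) = subst T I K t (\<lambda>i\<in>I. x i i)"
    if x: "x \<in> I \<rightarrow>\<^sub>E (I \<rightarrow>\<^sub>E ops T K)" for x
  proof (rule subst_eqI[OF t])
    have xi: "\<forall>j\<in>I. (\<lambda>j\<in>I. x i j) j \<in> ops T K" if "i \<in> I" for i
      using PiE_mem[OF x that] by auto
    have d: "\<forall>i\<in>I. (\<lambda>i\<in>I. x i i) i \<in> ops T K" using xi by auto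
    show "\<forall>i\<in>I. (\<lambda>i\<in>I. subst T I K t (\<lambda>j\<in>I. x i j)) i \<in> ops T K"
    proof
      fix i assume i: "i \<in> I"
      show "(\<lambda>i\<in>I. subst T I K t (\<lambda>j\<in>I. x i j)) i \<in> ops T K"
        unfolding restrict_apply'[OF i] by (rule subst_exists(1)[OF t xi[OF i]])
    qed
    show "subst T I K t (\<lambda>i\<in>I. x i i) \<in> K \<rightarrow>\<^sub>E C"
      by (rule ops_PiE[OF subst_exists(1)[OF t d]])
    fix i k assume i: "i \<in> I" and k: "k \<in> K"
    show "t i \<sqinter> subst T I K t (\<lambda>i\<in>I. x i i) k = t i \<sqinter> (\<lambda>i\<in>I. subst T I K t (\<lambda>j\<in>I. x i j)) i k"
      unfolding subst_local(2)[OF t d k i] restrict_apply'[OF i] subst_local(2)[OF t xi[OF i] k i]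
          ..
  qed
qed

lemma nondegenerate_T: "nondegenerate_theory T"
  using nondeg proj_eq[of "num 1" "nset 2" "num 1"] proj_eq[of "num 1" "nset 2" "num 2"]
  unfolding nondegenerate_theory_def by auto

lemma T_in_HAff: "T \<in> ob HAff"
  by (simp add: algebraic_theory_T hyperaffine_T nondegenerate_T)

sublocale th: hyperaffine_theory T
  by unfold_locales (fact universe algebraic_theory_T hyperaffine_T)+

sublocale th: set_theory_of T
  by unfold_locales

end

section \<open>The categories of Boolean and Grothendieck Boolean algebras\<close>

lemma grBAlg_simps [simp]:
  "ob grBAlg = {B. boolean_alg B \<and> bzero B \<noteq> bone B \<and> zero_dim_topology B (topo B)}"
  "hom grBAlg B C = {f \<in> boolean_homs B C. \<forall>P\<in>topo B. f ` P - {bzero C} \<in> topo C}"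
  "idt grBAlg B = (\<lambda>b\<in>bcarrier B. b)" "cmp grBAlg B C D g f = (\<lambda>a\<in>bcarrier B. g (f a))"
  by (simp_all add: grBAlg_def)

lemma BAlg_simps [simp]:
  "ob BAlg = {B. boolean_alg B \<and> bzero B \<noteq> bone B}" "hom BAlg = boolean_homs"
  "idt BAlg B = (\<lambda>b\<in>bcarrier B. b)" "cmp BAlg B C D g f = (\<lambda>a\<in>bcarrier B. g (f a))"
  by (simp_all add: BAlg_def)

lemma boolean_homs_id: "boolean_alg B \<Longrightarrow> (\<lambda>b\<in>bcarrier B. b) \<in> boolean_homs B B"
  by (simp add: boolean_homs_def boolean_alg_def)

lemma boolean_homs_comp:
  assumes "boolean_alg A" "f \<in> boolean_homs A B" "g \<in> boolean_homs B C"
  shows "(\<lambda>a\<in>bcarrier A. g (f a)) \<in> boolean_homs A C"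
proof -
  interpret balgebra A by unfold_locales fact
  show ?thesis
    unfolding boolean_homs_def mem_Collect_eq PiE_iff
    by (simp add: hom_closed[OF assms(2)] hom_closed[OF assms(3)] hom_zero[OF assms(2)]
        hom_zero[OF assms(3)]
        hom_one[OF assms(2)] hom_one[OF assms(3)] hom_neg[OF assms(2)] hom_neg[OF assms(3)]
        hom_meet[OF assms(2)] hom_meet[OF assms(3)] hom_join[OF assms(2)] hom_join[OF assms(3)])
qed

lemma boolean_homs_restrict_id:
  assumes "f \<in> boolean_homs A B"
  shows "(\<lambda>a\<in>bcarrier A. f a) = f" "(\<lambda>a\<in>bcarrier A.
      if f a \<in> bcarrier B then f a else undefined) = f"
  using hom_extensional[OF assms] hom_closed[OF assms]
  by (auto simp: fun_eq_iff extensional_def restrict_def)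

lemma category_BAlg: "category BAlg"
  unfolding category_def
proof (intro conjI ballI)
  fix X Y :: "'u balg" and f
  assume "X \<in> ob BAlg" "Y \<in> ob BAlg" and f: "f \<in> hom BAlg X Y"
  show "cmp BAlg X X Y f (idt BAlg X) = f" "cmp BAlg X Y Y (idt BAlg Y) f = f"
    using boolean_homs_restrict_id[of f X Y] f by (simp_all cong: restrict_cong)
next
  fix W X Y Z :: "'u balg" and f g h
  assume "f \<in> hom BAlg W X"
  then have [simp]: "f a \<in> bcarrier X" if "a \<in> bcarrier W" for a using hom_closed[of f] that by simp
  show "cmp BAlg W Y Z h (cmp BAlg W X Y g f) = cmp BAlg W X Z (cmp BAlg X Y Z h g) f"
    by (simp cong: restrict_cong)
qed (simp_all add: boolean_homs_id boolean_homs_comp)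

lemma grBAlg_topo_subset:
  assumes "B \<in> ob grBAlg" "P \<in> topo B"
  shows "P \<subseteq> bcarrier B - {bzero B}"
proof -
  have "\<forall>P\<in>topo B. partition_of B P"
    using assms(1) unfolding grBAlg_simps(1) mem_Collect_eq zero_dim_topology_def by (elim conjE)
  then show ?thesis using assms(2) by (simp add: partition_of_def)
qed

lemma category_grBAlg: "category grBAlg"
  unfolding category_def
proof (intro conjI ballI)
  fix X Y :: "'u gbalg" and f
  assume "X \<in> ob grBAlg" "Y \<in> ob grBAlg" and f: "f \<in> hom grBAlg X Y"
  show "cmp grBAlg X X Y f (idt grBAlg X) = f" "cmp grBAlg X Y Y (idt grBAlg Y) f = f"
    using boolean_homs_restrict_id[of f X Y] f by (simp_all cong: restrict_cong)
next
  fix W X Y Z :: "'u gbalg" and f g h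
  assume "f \<in> hom grBAlg W X"
  then have [simp]: "f a \<in> bcarrier X" if "a \<in> bcarrier W" for a using hom_closed[of f W X] that
      by simp
  show "cmp grBAlg W Y Z h (cmp grBAlg W X Y g f) = cmp grBAlg W X Z (cmp grBAlg X Y Z h g) f"
    by (simp cong: restrict_cong)
next
  fix X :: "'u gbalg"
  assume X: "X \<in> ob grBAlg"
  have "(\<lambda>b\<in>bcarrier X. b) ` P - {bzero X} = P" if "P \<in> topo X" for P
  proof -
    have P: "P \<subseteq> bcarrier X - {bzero X}"
      by (rule grBAlg_topo_subset[OF X that])
    then have "(\<lambda>b\<in>bcarrier X. b) ` P = (\<lambda>b. b) ` P" by (intro image_cong) auto
    then show ?thesis using P by auto
  qed
  then show "idt grBAlg X \<in> hom grBAlg X X" using X boolean_homs_id[of X] by simp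
next
  fix X Y Z :: "'u gbalg" and f g
  assume X: "X \<in> ob grBAlg" "Y \<in> ob grBAlg" and f: "f \<in> hom grBAlg X Y" and g: "g \<in> hom grBAlg Y Z"
  have "(\<lambda>a\<in>bcarrier X. g (f a)) ` P - {bzero Z} \<in> topo Z" if P: "P \<in> topo X" for P
  proof -
    have "P \<subseteq> bcarrier X" using grBAlg_topo_subset[OF X(1) P] by blast
    then have "(\<lambda>a\<in>bcarrier X. g (f a)) ` P = g ` f ` P"
      unfolding image_image by (intro image_cong) auto
    moreover have "g ` f ` P - {bzero Z} = g ` (f ` P - {bzero Y}) - {bzero Z}"
      using hom_zero[of g Y Z] g by auto
    ultimately show ?thesis using f g P by simp
  qed
  then show "cmp grBAlg X Y Z g f \<in> hom grBAlg X Z"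
    using X f g boolean_homs_comp[of X f Y g Z] by simp
qed

section \<open>Homomorphisms between theories of partitions\<close>

context grbalgebra
begin

text \<open>The two weights of a binary operation are complementary, so this identifies B with
  T(2).\<close>

definition bin :: "'u \<Rightarrow> 'u \<Rightarrow> 'u" where
  "bin b = (\<lambda>k\<in>nset 2. if k = num 1 then b else \<sim> b)"

lemma bin_simps [simp]: "bin b (num 1) = b" "bin b (num (Suc 0)) = b" "bin b (num 2) = \<sim> b"
  by (simp_all add: bin_def)

lemma bin_in_ops:
  assumes "b \<in> C"
  shows "bin b \<in> ops T (nset 2)"
proof -
  have "{b, \<sim> b} - {\<bottom>} \<in> topo B" using assms by (intro topo_finite partition_of_pair) auto
  moreover have "bin b ` nset 2 = {b, \<sim> b}" by (auto simp: nset_2_eq)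
  moreover have "bin b \<in> nset 2 \<rightarrow>\<^sub>E C" using assms by (auto simp: bin_def)
  ultimately show ?thesis using assms by (auto simp: ops_iff nset_2_eq)
qed

lemma bin_eqI:
  assumes "\<omega> \<in> ops T (nset 2)" "\<omega> (num 1) = b"
  shows "\<omega> = bin b"
proof -
  note [simp] = opsD(1)[OF assms(1)]
  have [simp]: "b \<in> C" using assms by auto
  have "\<sim> b = \<omega> (num 2)"
  proof (rule ops_cover_eq[OF assms(1)])
    fix i :: 'u assume "i \<in> nset 2"
    then show "\<omega> i \<sqinter> \<sim> b = \<omega> i \<sqinter> \<omega> (num 2)"
      using opsD(2)[OF assms(1), of "num 1" "num 2"] opsD(2)[OF assms(1), of "num 2"
          "num 1"] assms(2)
      by (auto simp: nset_2_eq) (metis ble_def le_neg_iff meet_idem opsD(1)[OF assms(1)]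
          num_in_nset_2 \<open>b \<in> C\<close>)
  qed auto
  then show ?thesis
    using opsD(4)[OF assms(1)] assms(2)
    by (intro extensionalityI[of _ "nset 2"]) (auto simp: nset_2_eq bin_def)
qed

lemma proj_bin: "proj T (nset 2) (num 1) = bin \<top>" "proj T (nset 2) (num 2) = bin \<bottom>"
  by (auto intro!: bin_eqI proj_in_ops simp: proj_eq)

lemma app_eqI:
  assumes "\<omega> \<in> ops T I" "\<And>i. i \<in> I \<Longrightarrow> \<gamma> i \<in> ops T J" "\<delta> \<in> ops T J"
    and "\<And>i j. i \<in> I \<Longrightarrow> j \<in> J \<Longrightarrow> \<omega> i \<sqinter> \<delta> j = \<omega> i \<sqinter> \<gamma> i j"
  shows "app T I J \<omega> \<gamma> = \<delta>"
  unfolding app_def using assms by (intro subst_eqI ops_PiE) auto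

lemma app_local:
  assumes "\<omega> \<in> ops T I" "\<forall>i\<in>I. \<gamma> i \<in> ops T J" "j \<in> J" "i \<in> I"
  shows "\<omega> i \<sqinter> app T I J \<omega> \<gamma> j = \<omega> i \<sqinter> \<gamma> i j"
  unfolding app_def using assms by (subst subst_local(2)) auto

lemma app_binI:
  assumes "\<omega> \<in> ops T I" "\<And>i. i \<in> I \<Longrightarrow> g i \<in> C" "b \<in> C" "\<And>i. i \<in> I \<Longrightarrow> \<omega> i \<sqinter> b = \<omega> i \<sqinter> g i"
  shows "app T I (nset 2) \<omega> (\<lambda>i. bin (g i)) = bin b"
proof -
  let ?a = "app T I (nset 2) \<omega> (\<lambda>i. bin (g i))"
  have g: "\<forall>i\<in>I. bin (g i) \<in> ops T (nset 2)" using assms(2) by (auto simp: bin_in_ops)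
  then have "\<forall>i\<in>I. (\<lambda>i\<in>I. bin (g i)) i \<in> ops T (nset 2)" by simp
  then have "?a \<in> ops T (nset 2)" unfolding app_def by (rule subst_exists(1)[OF assms(1)])
  moreover have "?a (num 1) = b"
  proof (rule ops_cover_eq[OF assms(1)])
    show "?a (num 1) \<in> C" using opsD(1)[OF calculation] by simp
    show "\<omega> i \<sqinter> ?a (num 1) = \<omega> i \<sqinter> b" if "i \<in> I" for i
      using app_local[OF assms(1) g _ that, of "num 1"] assms(4)[OF that] by simp
  qed fact
  ultimately show ?thesis by (rule bin_eqI)
qed

text \<open>The weights of \<open>\<omega>\<close> are recovered inside the theory, as binary
  operations. A homomorphism of theories is therefore determined by its effect on T(2).\<close>

lemma component:
  assumes "\<omega> \<in> ops T I" "i \<in> I"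
  shows "app T I (nset 2) \<omega> (\<lambda>j. if j = i then proj T (nset 2) (num 1) else proj T (nset 2) (num 2))
      = bin (\<omega> i)"
proof -
  have "app T I (nset 2) \<omega> (\<lambda>j. if j = i then bin \<top> else bin \<bottom>)
      = app T I (nset 2) \<omega> (\<lambda>j. bin (if j = i then \<top> else \<bottom>))"
    by (rule th.app_cong) simp
  also have "\<dots> = bin (\<omega> i)"
    using opsD(1)[OF assms(1)] opsD(2)[OF assms(1)] assms by (intro app_binI) auto
  finally show ?thesis by (simp only: proj_bin)
qed

lemma bin_meet:
  assumes "b \<in> C" "c \<in> C"
  shows "app T (nset 2) (nset 2) (bin b) (\<lambda>k.
      if k = num 1 then bin c else proj T (nset 2) (num 2)) = bin (b \<sqinter> c)"
proof -
  have "app T (nset 2) (nset 2) (bin b) (\<lambda>k. if k = num 1 then bin c else bin \<bottom>)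
      = app T (nset 2) (nset 2) (bin b) (\<lambda>k. bin (if k = num 1 then c else \<bottom>))"
    by (rule th.app_cong) simp
  also have "\<dots> = bin (b \<sqinter> c)"
    using assms meet_assoc[of "\<sim> b" b c] by (intro app_binI bin_in_ops) (auto simp: nset_2_eq)
  finally show ?thesis by (simp only: proj_bin)
qed

text \<open>Every partition in the topology is itself an operation with tautological weights. This
  makes membership in the topology visible to homomorphisms of theories.\<close>

lemma identity_in_ops: "P \<in> topo B \<Longrightarrow> (\<lambda>p\<in>P. p) \<in> ops T P"
proof -
  assume P: "P \<in> topo B"
  have p: "partition_of B P" by (rule topo_partition[OF P])
  then have "(\<lambda>p\<in>P. p) ` P - {\<bottom>} = P" by (auto simp: partition_of_iff image_iff)
  then show ?thesis using P p by (auto simp: ops_iff partition_of_iff)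
qed

end

lemma T_functor_simps [simp]:
  "fob T_functor = partition_theory"
  "far T_functor B C f = (\<lambda>I\<in>{I. small TYPE('u) I}. \<lambda>\<omega>\<in>ops (partition_theory B) I. \<lambda>i\<in>I. f (\<omega> i))"
  for B :: "'u gbalg"
  by (simp_all add: T_functor_def)

context
  fixes B C :: "'u gbalg"
  assumes B: "grbalgebra B" and C: "grbalgebra C"
begin

interpretation B: grbalgebra B by (fact B)
interpretation C: grbalgebra C by (fact C)

lemma far_T_functor_hom:
  assumes f: "f \<in> hom grBAlg B C"
  shows "far T_functor B C f \<in> theory_homs B.T C.T"
proof -
  have fh: "f \<in> boolean_homs B C" and ft: "\<And>P. P \<in> topo B \<Longrightarrow> f ` P - {bzero C} \<in> topo C"
    using f by simp_all
  note [simp] = hom_closed[OF fh] hom_zero[OF fh] hom_one[OF fh] hom_meet[OF fh, symmetric]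
  have ops: "(\<lambda>i\<in>I. f (\<omega> i)) \<in> ops C.T I" if w: "\<omega> \<in> ops B.T I" for I \<omega>
    unfolding C.ops_iff
  proof (intro conjI ballI impI)
    note w1 = B.opsD(1)[OF w]
    show "(\<lambda>i\<in>I. f (\<omega> i)) \<in> I \<rightarrow>\<^sub>E bcarrier C" by (auto simp: w1)
    show "bmeet C ((\<lambda>i\<in>I. f (\<omega> i)) i) ((\<lambda>i\<in>I. f (\<omega> i)) j) = bzero C" if "i \<in> I" "j \<in> I" "i \<noteq> j"
        for i j
      using that B.opsD(2)[OF w that] by (simp add: w1)
    have "(\<lambda>i\<in>I. f (\<omega> i)) ` I - {bzero C} = f ` (\<omega> ` I - {bzero B}) - {bzero C}" by auto
    then show "(\<lambda>i\<in>I. f (\<omega> i)) ` I - {bzero C} \<in> topo C" using ft[OF B.opsD(3)[OF w]] by simp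
  qed
  show ?thesis
    unfolding theory_homs_iff[OF B.th.alg_theory_axioms]
  proof (intro conjI allI impI ballI)
    show "far T_functor B C f I (proj B.T I i) = proj C.T I i" if "small TYPE('u) I" "i \<in> I" for I i
      using that B.proj_in_ops[OF that(2)]
      by (auto simp: partition_theory_def fun_eq_iff)
    show "far T_functor B C f J (app B.T I J t u)
        = app C.T I J (far T_functor B C f I t) (\<lambda>i. far T_functor B C f J (u i))"
      if I: "small TYPE('u) I" "small TYPE('u) J" and t: "t \<in> ops B.T I"
          and u: "\<forall>i\<in>I. u i \<in> ops B.T J" for I J t u
    proof -
      have tu: "app B.T I J t u \<in> ops B.T J" using I t u by simp
      have "app C.T I J (\<lambda>i\<in>I. f (t i)) (\<lambda>i. far T_functor B C f J (u i))
          = (\<lambda>j\<in>J. f (app B.T I J t u j))"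
      proof (rule C.app_eqI)
        fix i j assume i: "i \<in> I" and j: "j \<in> J"
        have "bmeet B (t i) (app B.T I J t u j) = bmeet B (t i) (u i j)"
          by (rule B.app_local[OF t u j i])
        then show "bmeet C ((\<lambda>i\<in>I. f (t i)) i) ((\<lambda>j\<in>J. f (app B.T I J t u j)) j) =
            bmeet C ((\<lambda>i\<in>I. f (t i)) i) (far T_functor B C f J (u i) j)"
          using I i j u B.opsD(1)[OF t i] B.opsD(1)[OF tu j] B.opsD(1)[of "u i" J j] by simp
      qed (use I t u tu ops in auto)
      then show ?thesis using I t tu by simp
    qed
  qed (auto simp: ops)
qed

lemma theory_hom_bin:
  assumes \<phi>: "\<phi> \<in> theory_homs B.T C.T" and b: "b \<in> bcarrier B"
  shows "\<phi> (nset 2) (B.bin b) (num 1) \<in> bcarrier C"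
    and "\<phi> (nset 2) (B.bin b) = C.bin (\<phi> (nset 2) (B.bin b) (num 1))"
proof -
  have *: "\<phi> (nset 2) (B.bin b) \<in> ops C.T (nset 2)"
    using theory_hom_simps(1)[OF B.th.alg_theory_axioms \<phi>] B.bin_in_ops[OF b] by simp
  show "\<phi> (nset 2) (B.bin b) (num 1) \<in> bcarrier C" using C.opsD(1)[OF *] by simp
  show "\<phi> (nset 2) (B.bin b) = C.bin (\<phi> (nset 2) (B.bin b) (num 1))"
    by (rule C.bin_eqI[OF *]) simp
qed

lemma theory_hom_component:
  assumes \<phi>: "\<phi> \<in> theory_homs B.T C.T" and I: "small TYPE('u) I" and w: "\<omega> \<in> ops B.T I"
      and i: "i \<in> I"
  shows "\<phi> I \<omega> i = \<phi> (nset 2) (B.bin (\<omega> i)) (num 1)"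
proof -
  note \<phi>s = theory_hom_simps[OF B.th.alg_theory_axioms \<phi>]
  let ?p = "\<lambda>T j. if j = i then proj T (nset 2) (num 1) else proj T (nset 2) (num 2)"
  have "\<phi> (nset 2) (B.bin (\<omega> i)) = \<phi> (nset 2) (app B.T I (nset 2) \<omega> (?p B.T))"
    by (simp only: B.component[OF w i])
  also have "\<dots> = app C.T I (nset 2) (\<phi> I \<omega>) (\<lambda>j. \<phi> (nset 2) (?p B.T j))"
    using I w by (intro \<phi>s(3)) auto
  also have "\<dots> = app C.T I (nset 2) (\<phi> I \<omega>) (?p C.T)"
    by (intro C.th.app_cong) (simp add: \<phi>s(2))
  also have "\<dots> = C.bin (\<phi> I \<omega> i)" by (rule C.component[OF \<phi>s(1)[OF I w] i])
  finally show ?thesis by simp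
qed

text \<open>In T(2) the top element is a projection, a meet is a substitution, and the complement of
  b is the second weight of \<open>bin b\<close>. So \<open>f\<close> preserves these, and joins by
  De Morgan. As \<open>\<phi>\<close> acts on all weights through \<open>f\<close>, it is the image
  of \<open>f\<close>.\<close>

lemma theory_hom_is_far_T_functor:
  assumes \<phi>: "\<phi> \<in> theory_homs B.T C.T"
  defines "f \<equiv> \<lambda>b\<in>bcarrier B. \<phi> (nset 2) (B.bin b) (num 1)"
  shows "f \<in> hom grBAlg B C" and "\<phi> = far T_functor B C f"
proof -
  note \<phi>s = theory_hom_simps[OF B.th.alg_theory_axioms \<phi>]
  note [simp] = B.bin_in_ops
  have f: "f b \<in> bcarrier C" "\<phi> (nset 2) (B.bin b) = C.bin (f b)" if "b \<in> bcarrier B" for b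
    using theory_hom_bin[OF \<phi> that] that by (simp_all add: f_def)
  have comp: "\<phi> I \<omega> i = f (\<omega> i)" if "small TYPE('u) I" "\<omega> \<in> ops B.T I" "i \<in> I" for I \<omega> i
    using theory_hom_component[OF \<phi> that] B.opsD(1)[OF that(2,3)] by (simp add: f_def)
  have bin_inj: "b = c" if "C.bin b = C.bin c" for b c
    using fun_cong[OF that, of "num 1"] by simp
  have one: "f (bone B) = bone C"
    using \<phi>s(2)[of "nset 2" "num 1", unfolded B.proj_bin C.proj_bin]
        by (intro bin_inj) (simp add: f)
  have neg: "f (bneg B b) = bneg C (f b)" if "b \<in> bcarrier B" for b
    using comp[of "nset 2" "B.bin b" "num 2"] that by (simp add: f)
  have meet: "f (bmeet B b c) = bmeet C (f b) (f c)" if b: "b \<in> bcarrier B" "c \<in> bcarrier B" for b c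
  proof -
    let ?r = "\<lambda>T y k. if k = num 1 then y else proj T (nset 2) (num 2)"
    have "C.bin (f (bmeet B b c)) = \<phi> (nset 2)
        (app B.T (nset 2) (nset 2) (B.bin b) (?r B.T (B.bin c)))"
      using b by (simp only: B.bin_meet f(2)[symmetric] B.closed)
    also have "\<dots> = app C.T (nset 2) (nset 2) (C.bin (f b)) (\<lambda>k. \<phi> (nset 2) (?r B.T (B.bin c) k))"
      using b by (subst \<phi>s(3)) (auto simp: f)
    also have "\<dots> = app C.T (nset 2) (nset 2) (C.bin (f b)) (?r C.T (C.bin (f c)))"
      using b by (intro C.th.app_cong) (simp add: f \<phi>s(2))
    also have "\<dots> = C.bin (bmeet C (f b) (f c))" using b by (simp only: C.bin_meet f(1))
    finally show ?thesis by (rule bin_inj)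
  qed
  have join: "f (bjoin B b c) = bjoin C (f b) (f c)" if b: "b \<in> bcarrier B" "c \<in> bcarrier B" for b c
    using b by (simp add: B.join_conv C.join_conv f(1) neg meet)
  have zero: "f (bzero B) = bzero C" using neg[of "bone B"] one by simp
  \<comment> \<open>Continuity: \<open>\<phi>\<close> sends the identity operation on P to an
    operation with weights \<open>f p\<close>, whose nonzero weights form a member of the topology
    of C.\<close>
  have "f ` P - {bzero C} \<in> topo C" if P: "P \<in> topo B" for P
  proof -
    have "\<phi> P (\<lambda>p\<in>P. p) \<in> ops C.T P" using \<phi>s(1) B.small_topo[OF P] B.identity_in_ops[OF P] by blast
    then have "\<phi> P (\<lambda>p\<in>P. p) ` P - {bzero C} \<in> topo C" by (rule C.opsD(3))
    moreover have "\<phi> P (\<lambda>p\<in>P. p) ` P = f ` P"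
      using comp[OF B.small_topo[OF P] B.identity_in_ops[OF P]] by (intro image_cong) auto
    ultimately show ?thesis by simp
  qed
  moreover have "f \<in> boolean_homs B C"
    using one neg meet join zero f(1) unfolding boolean_homs_def by (auto simp: f_def)
  ultimately show fh: "f \<in> hom grBAlg B C" by simp
  show "\<phi> = far T_functor B C f"
  proof (rule theory_hom_eqI[OF \<phi> far_T_functor_hom[OF fh]])
    fix I :: "'u set" and \<omega> assume I: "small TYPE('u) I" "\<omega> \<in> ops B.T I"
    show "\<phi> I \<omega> = far T_functor B C f I \<omega>"
      using comp[OF I] C.opsD(4)[OF \<phi>s(1)[OF I]] I by (intro extensionalityI[of _ I]) auto
  qed
qed

lemma bij_betw_far_T_functor: "bij_betw (far T_functor B C) (hom grBAlg B C) (theory_homs B.T C.T)"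
  unfolding bij_betw_def
proof
  show "inj_on (far T_functor B C) (hom grBAlg B C)"
  proof (rule inj_onI)
    fix f g assume h: "f \<in> hom grBAlg B C" "g \<in> hom grBAlg B C"
        and eq: "far T_functor B C f = far T_functor B C g"
    have "f b = g b" if "b \<in> bcarrier B" for b
      using fun_cong[OF fun_cong[OF fun_cong[OF eq, of "nset 2"], of "B.bin b"], of "num 1"] that
      by (simp add: B.bin_in_ops)
    moreover have "f \<in> extensional (bcarrier B)" "g \<in> extensional (bcarrier B)"
      using h hom_extensional by auto
    ultimately show "f = g" by (intro extensionalityI[of _ "bcarrier B"])
  qed
  show "far T_functor B C ` hom grBAlg B C = theory_homs B.T C.T"
    using far_T_functor_hom theory_hom_is_far_T_functor by blast
qed

end

theorem fully_faithful_T_functor: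
  assumes U: "universe TYPE('u)"
  shows "fully_faithful (grBAlg :: ('u gbalg, _) cat) HAff T_functor"
proof -
  have gr: "grbalgebra B" if "B \<in> ob grBAlg" for B :: "'u gbalg"
    using that U by (simp add: grbalgebra_def balgebra_def grbalgebra_axioms_def)
  have H: "far T_functor B C f \<in> theory_homs (partition_theory B) (partition_theory C)"
    if "B \<in> ob grBAlg" "C \<in> ob grBAlg" "f \<in> hom grBAlg B C" for B C :: "'u gbalg" and f
    using far_T_functor_hom[OF gr[OF that(1)] gr[OF that(2)] that(3)] .
  have "is_functor (grBAlg :: ('u gbalg, _) cat) HAff T_functor"
    unfolding is_functor_def
  proof (intro conjI ballI)
    show "category (grBAlg :: ('u gbalg, _) cat)" by (rule category_grBAlg)
    show "category (HAff :: (('u, 'u \<Rightarrow> 'u) algth, _) cat)" using U by (rule category_HAff)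
    show "fob T_functor B \<in> ob HAff" if "B \<in> ob grBAlg" for B :: "'u gbalg"
      using grbalgebra.T_in_HAff[OF gr[OF that]] by simp
    show "far T_functor B C f \<in> hom HAff (fob T_functor B) (fob T_functor C)"
      if "B \<in> ob grBAlg" "C \<in> ob grBAlg" "f \<in> hom grBAlg B C" for B C :: "'u gbalg" and f
      using H[OF that] by simp
    show "far T_functor B B (idt grBAlg B) = idt HAff (fob T_functor B)" if "B \<in> ob grBAlg"
        for B :: "'u gbalg"
    proof -
      interpret grbalgebra B using that by (rule gr)
      have "(\<lambda>i\<in>I. (\<lambda>b\<in>bcarrier B. b) (\<omega> i)) = \<omega>" if "\<omega> \<in> ops T I" for I \<omega>
        using opsD(1,4)[OF that] by (auto intro!: extensionalityI[of _ I])
      then show ?thesis by (simp cong: restrict_cong)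
    qed
    show "far T_functor A C (cmp grBAlg A B C g f) =
        cmp HAff (fob T_functor A) (fob T_functor B) (fob T_functor C) (far T_functor B C g)
            (far T_functor A B f)"
      if obs: "A \<in> ob grBAlg" "B \<in> ob grBAlg" "C \<in> ob grBAlg" and f: "f \<in> hom grBAlg A B"
          and g: "g \<in> hom grBAlg B C"
      for A B C :: "'u gbalg" and f g
    proof -
      interpret A: grbalgebra A using obs(1) by (rule gr)
      have "(\<lambda>i\<in>I. f (\<omega> i)) \<in> ops (partition_theory B) I" if "small TYPE('u) I" "\<omega> \<in> ops A.T I"
          for I \<omega>
        using theory_hom_simps(1)[OF A.th.alg_theory_axioms H[OF obs(1,2) f] that] that by simp
      moreover have "(\<lambda>i\<in>I. (\<lambda>a\<in>bcarrier A. g (f a)) (\<omega> i)) = (\<lambda>i\<in>I. g ((\<lambda>i\<in>I. f (\<omega> i)) i))"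
        if "\<omega> \<in> ops A.T I" for I \<omega>
        using A.opsD(1)[OF that] by (auto simp: fun_eq_iff)
      ultimately show ?thesis by (simp cong: restrict_cong)
    qed
  qed
  then show ?thesis
    unfolding fully_faithful_def using bij_betw_far_T_functor[OF gr gr] by simp
qed

section \<open>Sets over a Boolean algebra\<close>

text \<open>Again the carrier may lie in any type, because the laws are also used for the free
  models T(I).\<close>

locale bset = balgebra B for B :: "('u, 'z) balg_scheme" +
  fixes X :: "'x set" and act :: "'u \<Rightarrow> 'x \<Rightarrow> 'x \<Rightarrow> 'x"
  assumes act_closed [simp]: "\<lbrakk>b \<in> C; x \<in> X; y \<in> X\<rbrakk> \<Longrightarrow> act b x y \<in> X"
    and act_idem [simp]: "\<lbrakk>b \<in> C; x \<in> X\<rbrakk> \<Longrightarrow> act b x x = x"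
    and act_left [simp]: "\<lbrakk>b \<in> C; x \<in> X; y \<in> X; z \<in> X\<rbrakk> \<Longrightarrow> act b (act b x y) z = act b x z"
    and act_right [simp]: "\<lbrakk>b \<in> C; x \<in> X; y \<in> X; z \<in> X\<rbrakk> \<Longrightarrow> act b x (act b y z) = act b x z"
    and act_top [simp]: "\<lbrakk>x \<in> X; y \<in> X\<rbrakk> \<Longrightarrow> act \<top> x y = x"
    and act_neg [simp]: "\<lbrakk>b \<in> C; x \<in> X; y \<in> X\<rbrakk> \<Longrightarrow> act (\<sim> b) x y = act b y x"
    and act_meet: "\<lbrakk>b \<in> C; c \<in> C; x \<in> X; y \<in> X\<rbrakk> \<Longrightarrow> act (b \<sqinter> c) x y = act b (act c x y) y"
begin

lemma act_bot [simp]: "\<lbrakk>x \<in> X; y \<in> X\<rbrakk> \<Longrightarrow> act \<bottom> x y = y"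
  using act_neg[of "\<top>" x y] by simp

lemma act_join: "\<lbrakk>b \<in> C; c \<in> C; x \<in> X; y \<in> X\<rbrakk> \<Longrightarrow> act (b \<squnion> c) x y = act b x (act c x y)"
  by (simp add: join_conv act_meet)

text \<open>The equation \<open>act b z x = x\<close> is to be read as: z and x agree on b. Elements
  that agree on b may replace each other in the branch that b selects.\<close>

lemma act_agree_left: "\<lbrakk>b \<in> C; z \<in> X; x \<in> X; w \<in> X; act b z x = x\<rbrakk> \<Longrightarrow> act b z w = act b x w"
  using act_left[of b z x w] by simp

lemma act_agree_sym: "\<lbrakk>b \<in> C; z \<in> X; x \<in> X; act b z x = x\<rbrakk> \<Longrightarrow> act b x z = z"
  using act_left[of b z x z] by simp

text \<open>Disjointness gives \<open>b = b \<sqinter> \<sim> q\<close>, and on the complement of q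
  the inner conditional takes its second branch.\<close>

lemma act_disjoint:
  assumes [simp]: "b \<in> C" "q \<in> C" "u \<in> X" "v \<in> X" "w \<in> X" and "b \<sqinter> q = \<bottom>"
  shows "act b (act q u v) w = act b v w"
proof -
  have b: "b \<sqinter> \<sim> q = b" using assms le_neg_iff[of b q] by (simp add: ble_def)
  have "act b (act q u v) w = act (b \<sqinter> \<sim> q) (act q u v) w" by (simp only: b)
  also have "\<dots> = act (b \<sqinter> \<sim> q) v w" by (simp add: act_meet)
  finally show ?thesis by (simp only: b)
qed

text \<open>The elements b on which z and w agree include bottom and are closed under joins, by
  \<open>act_join\<close>. So they include the join of the finite set P, and agreement on top is
  equality.\<close>

lemma act_cover_eq:
  assumes "finite P" "is_lub B P \<top>" "P \<subseteq> C" and [simp]: "z \<in> X" "w \<in> X"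
    and "\<And>p. p \<in> P \<Longrightarrow> act p z w = w"
  shows "z = w"
proof -
  obtain a where "a \<in> {b \<in> C. act b z w = w}" "is_lub B P a"
    using finite_lub[of P "{b \<in> C. act b z w = w}"] assms by (auto simp: act_join)
  then have "act \<top> z w = w" using is_lub_unique assms(2) by blast
  then show ?thesis by simp
qed

text \<open>Pieces are added one at a time: \<open>act q (x q) z\<close> takes the new value on q
  and, by disjointness, still agrees with \<open>x p\<close> on the other p.\<close>

lemma finite_glue:
  assumes "finite F" "F \<noteq> {}" "F \<subseteq> C" "\<And>p q. p \<in> F \<Longrightarrow> q \<in> F \<Longrightarrow> p \<noteq> q \<Longrightarrow> p \<sqinter> q = \<bottom>"
    and "\<And>p. p \<in> F \<Longrightarrow> x p \<in> X"
  shows "\<exists>z\<in>X. \<forall>p\<in>F. act p z (x p) = x p"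
  using assms
proof (induction F rule: finite_ne_induct)
  case (singleton p)
  then show ?case by (auto intro!: bexI[of _ "x p"])
next
  case (insert q F)
  then obtain z where z: "z \<in> X" "\<forall>p\<in>F. act p z (x p) = x p" by auto
  have "act p (act q (x q) z) (x p) = x p" if "p \<in> insert q F" for p
  proof (cases "p = q")
    case True
    then show ?thesis using insert.prems z by simp
  next
    case False
    then have "p \<sqinter> q = \<bottom>" "p \<in> F" using that insert.prems by auto
    then show ?thesis using insert.prems z by (subst act_disjoint) auto
  qed
  then show ?case using insert.prems z by (intro bexI[of _ "act q (x q) z"]) auto
qed

end

section \<open>The Boolean algebra of a hyperaffine theory\<close>

definition sel :: "'x \<Rightarrow> 'x \<Rightarrow> 'u \<Rightarrow> 'x" where
  "sel x y k = (if k = num 1 then x else y)"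

locale haff = hyperaffine_theory T + set_theory_of T for T :: "('u, 'u \<Rightarrow> 'u) algth" +
  assumes nondegenerate: "nondegenerate_theory T"
begin

abbreviation e where "e \<equiv> enc (nset 2)"
abbreviation d where "d \<equiv> dec (nset 2)"
abbreviation Ops2 where "Ops2 \<equiv> ops T (nset 2)"
abbreviation fst2 where "fst2 \<equiv> proj T (nset 2) (num 1)"
abbreviation snd2 where "snd2 \<equiv> proj T (nset 2) (num 2)"

lemma sel_simps [simp]: "sel x y (num 1 :: 'u) = x" "sel x y (num (Suc 0) :: 'u)
    = x" "sel x y (num 2 :: 'u) = y"
  by (simp_all add: sel_def)

definition comp :: "'u set \<Rightarrow> ('u \<Rightarrow> 'u) \<Rightarrow> 'u \<Rightarrow> 'u" where
  "comp I t i = e (app T I (nset 2) t (\<lambda>j. if j = i then fst2 else snd2))"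

text \<open>The operations are truth tables for conditionals, with the two projections as truth
  values: the conjunction of b and c is \<open>if b then c else false\<close>. The elements of T(2)
  enter through their codes in \<open>'u\<close>.\<close>

definition galg :: "'u gbalg" where
  "galg = \<lparr>bcarrier = e ` Ops2,
     bmeet = (\<lambda>b c. e (app T (nset 2) (nset 2) (d b) (sel (d c) snd2))),
     bjoin = (\<lambda>b c. e (app T (nset 2) (nset 2) (d b) (sel fst2 (d c)))),
     bneg = (\<lambda>b. e (app T (nset 2) (nset 2) (d b) (sel snd2 fst2))),
     bzero = e snd2, bone = e fst2,
     topo = {comp I t ` I - {e snd2} | I t. sm I \<and> t \<in> ops T I}\<rparr>"

lemma carrier_galg [simp]: "bcarrier galg = e ` Ops2"
  and bmeet_galg: "bmeet galg b c = e (app T (nset 2) (nset 2) (d b) (sel (d c) snd2))"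
  and bjoin_galg: "bjoin galg b c = e (app T (nset 2) (nset 2) (d b) (sel fst2 (d c)))"
  and bneg_galg: "bneg galg b = e (app T (nset 2) (nset 2) (d b) (sel snd2 fst2))"
  and bzero_galg: "bzero galg = e snd2" and bone_galg: "bone galg = e fst2"
  by (simp_all add: galg_def)

lemma topo_galg: "topo galg = {comp I t ` I - {bzero galg} | I t. sm I \<and> t \<in> ops T I}"
  by (simp add: galg_def)

lemma sel_in_ops [simp]: "u \<in> Ops2 \<Longrightarrow> v \<in> Ops2 \<Longrightarrow> sel u v k \<in> Ops2"
  by (simp add: sel_def)

lemma comp_closed [simp]: "sm I \<Longrightarrow> t \<in> ops T I \<Longrightarrow> comp I t i \<in> e ` Ops2"
  unfolding comp_def by (rule imageI) simp

end

locale haff_model = haff T + model_of T X m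
  for T :: "('u, 'u \<Rightarrow> 'u) algth" and X :: "'x set" and m
begin

sublocale hyperaffine_model T X m
  by unfold_locales

definition act :: "'u \<Rightarrow> 'x \<Rightarrow> 'x \<Rightarrow> 'x" where
  "act b x y = m (nset 2) (d b) (sel x y)"

lemma sel_closed [simp]: "x \<in> X \<Longrightarrow> y \<in> X \<Longrightarrow> sel x y (k :: 'u) \<in> X"
  by (simp add: sel_def)

lemma m_sel: "m (nset 2) t f = m (nset 2) t (sel (f (num 1)) (f (num 2)))"
  by (rule m_cong) (auto simp: nset_2_eq)

lemma act_closed [simp]: "\<lbrakk>b \<in> e ` Ops2; x \<in> X; y \<in> X\<rbrakk> \<Longrightarrow> act b x y \<in> X"
  unfolding act_def by (rule m_closed) auto

lemma act_enc: "t \<in> Ops2 \<Longrightarrow> act (e t) x y = m (nset 2) t (sel x y)"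
  by (simp add: act_def)

lemma act_enc_app:
  assumes "t \<in> Ops2" "u \<in> Ops2" "v \<in> Ops2" "x \<in> X" "y \<in> X"
  shows "act (e (app T (nset 2) (nset 2) t (sel u v))) x y
    = m (nset 2) t (sel (m (nset 2) u (sel x y)) (m (nset 2) v (sel x y)))"
proof -
  have "act (e (app T (nset 2) (nset 2) t (sel u v))) x y
      = m (nset 2) t (\<lambda>k. m (nset 2) (sel u v k) (sel x y))"
    using assms by (simp add: act_enc m_app)
  also have "\<dots> = m (nset 2) t (sel (m (nset 2) u (sel x y)) (m (nset 2) v (sel x y)))"
    by (subst m_sel) simp
  finally show ?thesis .
qed

lemma act_bone [simp]: "x \<in> X \<Longrightarrow> y \<in> X \<Longrightarrow> act (bone galg) x y = x"
  and act_bzero [simp]: "x \<in> X \<Longrightarrow> y \<in> X \<Longrightarrow> act (bzero galg) x y = y"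
  unfolding bone_galg bzero_galg by (subst act_enc; simp)+

lemma act_bmeet: "\<lbrakk>b \<in> e ` Ops2; c \<in> e ` Ops2; x \<in> X; y \<in> X\<rbrakk>
    \<Longrightarrow> act (bmeet galg b c) x y = act b (act c x y) y"
  and act_bjoin: "\<lbrakk>b \<in> e ` Ops2; c \<in> e ` Ops2; x \<in> X; y \<in> X\<rbrakk>
    \<Longrightarrow> act (bjoin galg b c) x y = act b x (act c x y)"
  and act_bneg: "\<lbrakk>b \<in> e ` Ops2; x \<in> X; y \<in> X\<rbrakk> \<Longrightarrow> act (bneg galg b) x y = act b y x"
  unfolding bmeet_galg bjoin_galg bneg_galg by (subst act_enc_app; simp add: act_def)+

lemma act_idem [simp]: "\<lbrakk>b \<in> e ` Ops2; x \<in> X\<rbrakk> \<Longrightarrow> act b x x = x"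
  unfolding act_def using m_const[of "nset 2" "d b" x] by (simp add: m_sel[of _ "\<lambda>_. x"])

lemma m_act: "m (nset 2) (d b) f = act b (f (num 1)) (f (num 2))"
  unfolding act_def by (rule m_sel)

lemma act_commute:
  assumes "b \<in> e ` Ops2" "c \<in> e ` Ops2" "x \<in> X" "y \<in> X" "z \<in> X" "w \<in> X"
  shows "act b (act c x y) (act c z w) = act c (act b x z) (act b y w)"
proof -
  have "m (nset 2) (d b) (\<lambda>i. m (nset 2) (d c) (\<lambda>j. sel (sel x y j) (sel z w j) i))
      = m (nset 2) (d c) (\<lambda>j. m (nset 2) (d b) (\<lambda>i. sel (sel x y j) (sel z w j) i))"
    using assms by (intro m_commute) auto
  then show ?thesis by (simp only: m_act sel_simps)
qed

text \<open>The law of a rectangular band, as the binary case of the diagonal law. The two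
  absorption laws of a B-set are its special cases with two equal arguments.\<close>

lemma act_rect:
  assumes "b \<in> e ` Ops2" "x \<in> X" "y \<in> X" "z \<in> X" "w \<in> X"
  shows "act b (act b x y) (act b z w) = act b x w"
proof -
  have "m (nset 2) (d b) (\<lambda>i. m (nset 2) (d b) (\<lambda>j. sel (sel x y j) (sel z w j) i))
      = m (nset 2) (d b) (\<lambda>i. sel (sel x y i) (sel z w i) i)"
    using assms by (intro m_diag) auto
  then show ?thesis by (simp only: m_act sel_simps)
qed

lemma act_left [simp]: "\<lbrakk>b \<in> e ` Ops2; x \<in> X; y \<in> X; z \<in> X\<rbrakk> \<Longrightarrow> act b (act b x y) z = act b x z"
  using act_rect[of b x y z z] by simp

lemma act_right [simp]: "\<lbrakk>b \<in> e ` Ops2; x \<in> X; y \<in> X; z \<in> X\<rbrakk> \<Longrightarrow> act b x (act b y z) = act b x z"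
  using act_rect[of b x x y z] by simp

lemma act_commute_left:
  "\<lbrakk>b \<in> e ` Ops2; c \<in> e ` Ops2; x \<in> X; y \<in> X; z \<in> X\<rbrakk>
    \<Longrightarrow> act b (act c x y) z = act c (act b x z) (act b y z)"
  using act_commute[of b c x y z z] by simp

lemma act_commute_right:
  "\<lbrakk>b \<in> e ` Ops2; c \<in> e ` Ops2; x \<in> X; y \<in> X; z \<in> X\<rbrakk>
    \<Longrightarrow> act b x (act c y z) = act c (act b x y) (act b x z)"
  using act_commute[of b c x x y z] by simp

lemma act_comp:
  assumes "sm I" "t \<in> ops T I" "x \<in> X" "y \<in> X"
  shows "act (comp I t i) x y = m I t (\<lambda>j. if j = i then x else y)"
proof -
  have "act (comp I t i) x y = m I t (\<lambda>j. m (nset 2) (if j = i then fst2 else snd2) (sel x y))"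
    unfolding comp_def using assms by (simp add: act_enc m_app)
  also have "\<dots> = m I t (\<lambda>j. if j = i then x else y)"
    using assms by (intro m_cong) auto
  finally show ?thesis .
qed

lemma act_comp_cross:
  assumes "sm I" "t \<in> ops T I" "i \<in> I" "\<And>j. j \<in> I \<Longrightarrow> f j \<in> X" "y \<in> X"
  shows "act (comp I t i) (m I t f) y = act (comp I t i) (f i) y"
  using assms by (simp add: act_comp m_diag_cross)

text \<open>Agreement on the i-th component can be turned around: \<open>t\<close> applied to
  \<open>f i\<close> at place i and z elsewhere is again z. As z is also \<open>t\<close> of the
  constant family z, each entry may be replaced by such a value, and the diagonal law then selects
  \<open>f i\<close> at place i.\<close>

lemma m_eqI:
  assumes "sm I" "t \<in> ops T I" "\<And>i. i \<in> I \<Longrightarrow> f i \<in> X" "z \<in> X"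
    and eq: "\<And>i. i \<in> I \<Longrightarrow> act (comp I t i) z (f i) = f i"
  shows "m I t f = z"
proof -
  have "z = m I t (\<lambda>i. z)" using assms by (simp add: m_const)
  also have "\<dots> = m I t (\<lambda>i. m I t (\<lambda>j. if j = i then f i else z))"
  proof (rule m_cong)
    fix i assume i: "i \<in> I"
    have "act (comp I t i) (act (comp I t i) z (f i)) z = z"
      using assms(1-4) i by (subst act_left) auto
    then have "act (comp I t i) (f i) z = z" by (simp only: eq[OF i])
    then show "z = m I t (\<lambda>j. if j = i then f i else z)" using assms i by (simp add: act_comp)
  qed
  also have "\<dots> = m I t (\<lambda>i. f i)"
    using assms by (subst m_diag) auto
  finally show ?thesis by simp
qed

lemma m_agree:
  assumes "sm I" "t \<in> ops T I" "\<And>i. i \<in> I \<Longrightarrow> f i \<in> X" "i \<in> I"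
  shows "act (comp I t i) (m I t f) (f i) = f i"
  using assms by (simp add: act_comp_cross)

end

context haff
begin

interpretation G: haff_model T Ops2 "\<lambda>I t f. app T I (nset 2) t f"
  by (intro haff_model.intro haff_axioms free_model_of) simp

text \<open>Acting on the two generators of the free model T(2), an element returns itself. Boolean
  identities can thus be verified as identities between nested conditionals.\<close>

lemma galg_eqI:
  assumes "b \<in> e ` Ops2" "c \<in> e ` Ops2"
    and eq: "\<And>x y. x \<in> Ops2 \<Longrightarrow> y \<in> Ops2 \<Longrightarrow> G.act b x y = G.act c x y"
  shows "b = c"
proof -
  have "app T (nset 2) (nset 2) t (sel fst2 snd2) = t" if "t \<in> Ops2" for t
  proof -
    have "app T (nset 2) (nset 2) t (sel fst2 snd2) = app T (nset 2) (nset 2) t (proj T (nset 2))"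
      by (rule app_cong) (auto simp: nset_2_eq)
    then show ?thesis using that by (simp add: app_proj_id)
  qed
  then have "G.act b fst2 snd2 = d b" if "b \<in> e ` Ops2" for b
    unfolding G.act_def using that by simp
  then have "d b = d c" using eq[of fst2 snd2] assms by simp
  then show ?thesis using assms(1,2) enc_dec by metis
qed

lemma galg_closed [simp]:
  "bzero galg \<in> e ` Ops2" "bone galg \<in> e ` Ops2" "b \<in> e ` Ops2 \<Longrightarrow> bneg galg b \<in> e ` Ops2"
  "b \<in> e ` Ops2 \<Longrightarrow> c \<in> e ` Ops2 \<Longrightarrow> bmeet galg b c \<in> e ` Ops2"
  "b \<in> e ` Ops2 \<Longrightarrow> c \<in> e ` Ops2 \<Longrightarrow> bjoin galg b c \<in> e ` Ops2"
  unfolding bzero_galg bone_galg bneg_galg bmeet_galg bjoin_galg by (auto intro!: imageI app_closed)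

lemma boolean_alg_galg: "boolean_alg galg"
  unfolding boolean_alg_def carrier_galg
proof (intro conjI ballI)
  show "small TYPE('u) (e ` Ops2)" by (simp add: small_image small_ops)
next
  fix b c D assume [simp]: "b \<in> e ` Ops2" "c \<in> e ` Ops2" "D \<in> e ` Ops2"
  note [simp] = G.act_bmeet G.act_bjoin G.act_bneg
  show "bmeet galg b c = bmeet galg c b"
    by (rule galg_eqI) (simp_all add: G.act_commute_left[of b c])
  show "bjoin galg b c = bjoin galg c b"
    by (rule galg_eqI) (simp_all add: G.act_commute_right[of b c])
  show "bmeet galg (bmeet galg b c) D = bmeet galg b (bmeet galg c D)"
    "bjoin galg (bjoin galg b c) D = bjoin galg b (bjoin galg c D)"
    by (rule galg_eqI; simp)+
  show "bmeet galg b (bjoin galg c D) = bjoin galg (bmeet galg b c) (bmeet galg b D)"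
  proof (rule galg_eqI)
    fix x y assume [simp]: "x \<in> Ops2" "y \<in> Ops2"
    \<comment> \<open>\<open>?z\<close> is the value of the meet of b and D. Its own second branch
      for b is y, so it can be replaced by y in the second branch of b; commuting b with c then
      turns one side into the other. The dual law below works in the same way.\<close>
    let ?z = "G.act b (G.act D x y) y"
    have "G.act b (G.act c x ?z) ?z = G.act b (G.act c x ?z) y" by simp
    also have "\<dots> = G.act c (G.act b x y) ?z" by (simp add: G.act_commute_left[of b c])
    also have "\<dots> = G.act b (G.act c x (G.act D x y)) y" by (simp add: G.act_commute_left[of b c])
    finally show "G.act (bmeet galg b (bjoin galg c D)) x y
        = G.act (bjoin galg (bmeet galg b c) (bmeet galg b D)) x y"
      by simp
  qed simp_all
  show "bjoin galg b (bmeet galg c D) = bmeet galg (bjoin galg b c) (bjoin galg b D)"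
  proof (rule galg_eqI)
    fix x y assume [simp]: "x \<in> Ops2" "y \<in> Ops2"
    let ?v = "G.act D x y" let ?u = "G.act b x ?v"
    have "G.act b ?u (G.act c ?u y) = G.act b x (G.act c ?u y)" by simp
    also have "\<dots> = G.act c ?u (G.act b x y)" by (simp add: G.act_commute_right[of b c])
    also have "\<dots> = G.act b x (G.act c ?v y)" by (simp add: G.act_commute_right[of b c])
    finally show "G.act (bjoin galg b (bmeet galg c D)) x y
        = G.act (bmeet galg (bjoin galg b c) (bjoin galg b D)) x y"
      by simp
  qed simp_all
next
  fix b assume [simp]: "b \<in> e ` Ops2"
  note [simp] = G.act_bmeet G.act_bjoin G.act_bneg
  show "bmeet galg b (bone galg) = b" "bjoin galg b (bzero galg) = b"
    "bmeet galg b (bneg galg b) = bzero galg" "bjoin galg b (bneg galg b) = bone galg"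
    by (rule galg_eqI; simp)+
qed simp_all

sublocale b: balgebra galg
  by unfold_locales (rule boolean_alg_galg)

lemma galg_nondegenerate: "bzero galg \<noteq> bone galg"
  using nondegenerate inj_on_enc[of "nset 2"]
      unfolding bzero_galg bone_galg nondegenerate_theory_def
  by (subst inj_on_eq_iff[OF inj_on_enc]) auto

end

context haff_model
begin

sublocale b: bset galg X act
  by unfold_locales (auto simp: act_bneg act_bmeet)

end

section \<open>The topology of a hyperaffine theory\<close>

context haff
begin

interpretation G: haff_model T Ops2 "\<lambda>I t f. app T I (nset 2) t f"
  by (intro haff_model.intro haff_axioms free_model_of) simp

abbreviation meet (infixl "\<sqinter>" 70) where "b \<sqinter> c \<equiv> bmeet galg b c"
abbreviation bot ("\<bottom>") where "\<bottom> \<equiv> bzero galg"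
abbreviation top ("\<top>") where "\<top> \<equiv> bone galg"
abbreviation le (infix "\<sqsubseteq>" 50) where "b \<sqsubseteq> c \<equiv> ble galg b c"

lemma galg_leI:
  assumes "b \<in> e ` Ops2" "c \<in> e ` Ops2"
    and "\<And>x y. x \<in> Ops2 \<Longrightarrow> y \<in> Ops2 \<Longrightarrow> G.act b (G.act c x y) y = G.act b x y"
  shows "b \<sqsubseteq> c"
  unfolding ble_def using assms by (intro galg_eqI) (auto simp: G.act_bmeet)

lemma galg_disjI:
  assumes "b \<in> e ` Ops2" "c \<in> e ` Ops2"
    and "\<And>x y. x \<in> Ops2 \<Longrightarrow> y \<in> Ops2 \<Longrightarrow> G.act b (G.act c x y) y = y"
  shows "b \<sqinter> c = \<bottom>"
  using assms by (intro galg_eqI) (auto simp: G.act_bmeet)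

text \<open>On the i-th component, \<open>t\<close> applied to the family with x at k and y
  elsewhere is the i-th entry of that family, namely y.\<close>

lemma comp_disjoint:
  assumes "sm I" "t \<in> ops T I" "i \<in> I" "k \<in> I" "i \<noteq> k"
  shows "comp I t i \<sqinter> comp I t k = \<bottom>"
proof (rule galg_disjI)
  fix x y assume [simp]: "x \<in> Ops2" "y \<in> Ops2"
  have "G.act (comp I t k) x y = app T I (nset 2) t (\<lambda>j. if j = k then x else y)"
    using assms by (simp add: G.act_comp)
  then show "G.act (comp I t i) (G.act (comp I t k) x y) y = y"
    using assms by (simp add: G.act_comp_cross)
qed (use assms in auto)

text \<open>If c is above all components, then \<open>act c x y\<close> agrees with x on each of
  them, so by \<open>m_eqI\<close> it equals \<open>t\<close> of the constant family x, which is x.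
  Hence c is above top.\<close>

lemma comp_is_lub:
  assumes "sm I" "t \<in> ops T I"
  shows "is_lub galg (comp I t ` I) \<top>"
proof -
  have "\<top> \<sqsubseteq> c" if c: "c \<in> e ` Ops2" and ub: "\<forall>i\<in>I. comp I t i \<sqsubseteq> c" for c
  proof (rule galg_leI)
    fix x y assume [simp]: "x \<in> Ops2" "y \<in> Ops2"
    have "app T I (nset 2) t (\<lambda>i. x) = G.act c x y"
    proof (rule G.m_eqI[OF assms])
      fix i assume i: "i \<in> I"
      let ?b = "comp I t i"
      have b: "?b \<in> e ` Ops2" using assms by simp
      have "G.act ?b (G.act c x y) y = G.act ?b x y"
        using ub i b c by (simp add: ble_def flip: G.act_bmeet)
      then have "G.act ?b (G.act ?b (G.act c x y) y) x = G.act ?b (G.act ?b x y) x" by simp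
      then show "G.act ?b (G.act c x y) x = x" using b c by simp
    qed (use c in auto)
    then show "G.act \<top> (G.act c x y) y = G.act \<top> x y" using assms c by (simp add: app_const)
  qed (use c in auto)
  then show ?thesis using assms unfolding is_lub_def by simp
qed

text \<open>In the free model T(I) an operation is its own value at the generators, and by
  \<open>m_eqI\<close> the components determine this value.\<close>

lemma ops_eqI:
  assumes "sm I" "s \<in> ops T I" "t \<in> ops T I" "\<And>i. i \<in> I \<Longrightarrow> comp I s i = comp I t i"
  shows "s = t"
proof -
  interpret F: haff_model T "ops T I" "\<lambda>J t f. app T J I t f"
    by (intro haff_model.intro haff_axioms free_model_of assms)
  have "app T I I t (proj T I) = app T I I s (proj T I)"
    using assms F.m_agree[OF assms(1,2), of "proj T I"] by (intro F.m_eqI) auto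
  then show ?thesis using assms by (simp add: app_proj_id)
qed

lemma partition_of_comp:
  assumes "sm I" "t \<in> ops T I"
  shows "partition_of galg (comp I t ` I - {\<bottom>})"
  unfolding b.partition_of_iff
proof (intro conjI ballI impI)
  show "is_lub galg (comp I t ` I - {\<bottom>}) \<top>"
    using comp_is_lub[OF assms] by simp
  fix p q assume pq: "p \<in> comp I t ` I - {\<bottom>}" "q \<in> comp I t ` I - {\<bottom>}" "p \<noteq> q"
  then obtain i k where "i \<in> I" "p = comp I t i" "k \<in> I" "q = comp I t k" by blast
  then show "p \<sqinter> q = \<bottom>" using pq(3) comp_disjoint[OF assms, of i k] by blast
qed (use assms in auto)

lemma topo_galgI: "sm I \<Longrightarrow> t \<in> ops T I \<Longrightarrow> comp I t ` I - {\<bottom>} \<in> topo galg"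
  unfolding topo_galg by blast

lemma topo_galg_partition: "P \<in> topo galg \<Longrightarrow> partition_of galg P"
  unfolding topo_galg using partition_of_comp by blast

lemma comp_app:
  assumes "sm I" "sm J" "t \<in> ops T I" "\<And>i. i \<in> I \<Longrightarrow> u i \<in> ops T J" "x \<in> Ops2" "y \<in> Ops2"
  shows "G.act (comp J (app T I J t u) k) x y = app T I (nset 2) t (\<lambda>i. G.act (comp J (u i) k) x y)"
proof -
  have "G.act (comp J (app T I J t u) k) x y = app T J (nset 2) (app T I J t u) (\<lambda>j.
      if j = k then x else y)"
    using assms by (intro G.act_comp) auto
  also have "\<dots> = app T I (nset 2) t (\<lambda>i. app T J (nset 2) (u i) (\<lambda>j. if j = k then x else y))"
    using assms by (intro app_app) auto
  also have "\<dots> = app T I (nset 2) t (\<lambda>i. G.act (comp J (u i) k) x y)"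
    using assms by (intro app_cong) (simp add: G.act_comp)
  finally show ?thesis .
qed

lemma comp_proj:
  assumes "sm I" "j \<in> I" "x \<in> Ops2" "y \<in> Ops2"
  shows "G.act (comp I (proj T I j) k) x y = (if j = k then x else y)"
  using assms by (simp add: G.act_comp)

text \<open>Renaming arguments along \<open>r\<close> merges them by fibres: the component at k acts
  as \<open>t\<close> does on the family that separates the fibre over k from the rest.\<close>

lemma comp_relabel:
  assumes "sm I" "sm J" "t \<in> ops T I" "\<And>i. i \<in> I \<Longrightarrow> r i \<in> J" "x \<in> Ops2" "y \<in> Ops2"
  shows "G.act (comp J (app T I J t (\<lambda>i. proj T J (r i))) k) x y = app T I (nset 2) t (\<lambda>i.
      if r i = k then x else y)"
  using assms by (subst comp_app) (auto simp: comp_proj intro!: app_cong)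

text \<open>A member of the topology comes from an operation of some arity I. Renaming its
  arguments, each index to its component, yields an operation of arity P whose p-th component is p,
  so the original index set can be forgotten.\<close>

lemma topo_galgE:
  assumes P: "P \<in> topo galg"
  obtains t where "sm P" "t \<in> ops T P" "\<And>p. p \<in> P \<Longrightarrow> comp P t p = p"
proof -
  obtain I s where I: "sm I" "s \<in> ops T I" and PI: "P = comp I s ` I - {\<bottom>}"
    using P unfolding topo_galg by blast
  have p: "partition_of galg P" by (rule topo_galg_partition[OF P])
  then have PC: "P \<subseteq> e ` Ops2" by (simp add: b.partition_of_iff)
  have smP: "sm P" unfolding PI by (rule small_subset[OF small_image[OF I(1)]]) auto
  have "P \<noteq> {}"
    using p b.is_lub_empty b.is_lub_unique galg_nondegenerate unfolding b.partition_of_iff by blast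
  then obtain p0 where p0: "p0 \<in> P" by blast
  \<comment> \<open>An index with zero component has no member of P to go to. The default
    \<open>p0\<close> is harmless, since agreement on bottom is no condition.\<close>
  define r where "r i = (if comp I s i = \<bottom> then p0 else comp I s i)" for i
  have r: "r i \<in> P" if "i \<in> I" for i using that p0 by (auto simp: r_def PI)
  define t where "t = app T I P s (\<lambda>i. proj T P (r i))"
  have t: "t \<in> ops T P" using I smP r by (simp add: t_def)
  have "comp P t p = p" if "p \<in> P" for p
  proof (rule galg_eqI)
    fix x y assume xy [simp]: "x \<in> Ops2" "y \<in> Ops2"
    have pC [simp]: "p \<in> e ` Ops2" using that PC by blast
    from that obtain i0 where i0: "i0 \<in> I" "p = comp I s i0" "p \<noteq> \<bottom>" unfolding PI by blast
    have "app T I (nset 2) s (\<lambda>i. if r i = p then x else y) = G.act p x y"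
    proof (rule G.m_eqI[OF I])
      fix i assume i: "i \<in> I"
      have iC [simp]: "comp I s i \<in> e ` Ops2" using I by simp
      consider "comp I s i = \<bottom>" | "comp I s i = p" | "comp I s i \<noteq> p" "comp I s i \<noteq> \<bottom>" by blast
      then show "G.act (comp I s i) (G.act p x y) (if r i = p then x else y)
          = (if r i = p then x else y)"
      proof cases
        case 1
        then show ?thesis using pC by simp
      next
        case 2
        then show ?thesis using pC i0(3) by (simp add: r_def)
      next
        case 3
        then have "comp I s i \<sqinter> p = \<bottom>" "r i \<noteq> p"
          using comp_disjoint[OF I i i0(1)] i0(2) by (auto simp: r_def)
        then show ?thesis by (simp add: G.b.act_disjoint)
      qed
    qed auto
    then show "G.act (comp P t p) x y = G.act p x y"
      unfolding t_def using I smP r by (simp add: comp_relabel)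
  qed (use that PC smP t in auto)
  then show thesis using that smP t by blast
qed

text \<open>The operation is found by gluing: the free model T(P) is a set over \<open>galg\<close>,
  and \<open>finite_glue\<close> yields a \<open>t\<close> in it that agrees on each p with the
  generator at p. Its components are then the members of P.\<close>

lemma finite_partition_in_topo:
  assumes p: "partition_of galg P" and fin: "finite P"
  shows "P \<in> topo galg"
proof -
  have PC: "P \<subseteq> e ` Ops2" and lub: "is_lub galg P \<top>" and nz: "\<bottom> \<notin> P"
    and disj: "\<And>p q. p \<in> P \<Longrightarrow> q \<in> P \<Longrightarrow> p \<noteq> q \<Longrightarrow> p \<sqinter> q = \<bottom>"
    using p by (simp_all add: b.partition_of_iff)
  have P: "sm P" using fin universe by (rule small_finite[rotated])
  interpret F: haff_model T "ops T P" "\<lambda>J t f. app T J P t f"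
    by (intro haff_model.intro haff_axioms free_model_of P)
  have "P \<noteq> {}" using lub b.is_lub_empty b.is_lub_unique galg_nondegenerate by blast
  then obtain t where t: "t \<in> ops T P" and glue: "\<And>p. p \<in> P \<Longrightarrow> F.act p t (proj T P p) = proj T P p"
    using F.b.finite_glue[OF fin _ _ disj, of "proj T P"] PC P by auto
  \<comment> \<open>Substituting \<open>f\<close> for the generators carries the agreement of
    \<open>t\<close> with them over to families in T(2).\<close>
  have agree: "G.act q (app T P (nset 2) t f) (f q) = f q" if q: "q \<in> P"
      and f: "\<And>p. p \<in> P \<Longrightarrow> f p \<in> Ops2" for q f
  proof -
    have dq: "d q \<in> Ops2" using q PC by auto
    have "f q = app T P (nset 2) (F.act q t (proj T P q)) f" using q f P by (simp add: glue)
    also have "\<dots> = app T (nset 2) (nset 2) (d q) (\<lambda>k. app T P (nset 2) (sel t (proj T P q) k) f)"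
      unfolding F.act_def using dq t q f P by (subst app_app) (auto simp: sel_def)
    also have "\<dots> = G.act q (app T P (nset 2) t f) (f q)"
      using q f P by (simp add: G.m_act)
    finally show ?thesis by simp
  qed
  \<comment> \<open>Tested on the cover P: the meets with \<open>q = p\<close> are both p, and those
    with any other q are both bottom.\<close>
  have "comp P t p = p" if pP: "p \<in> P" for p
  proof (rule b.cover_eq[OF lub])
    show "comp P t p \<in> bcarrier galg" "p \<in> bcarrier galg" using P t pP PC by auto
    fix q assume q: "q \<in> P"
    have qC [simp]: "q \<in> e ` Ops2" "comp P t p \<in> e ` Ops2" using q PC P t by auto
    have ag: "G.act q (G.act (comp P t p) x y) (if q = p then x else y) = (if q = p then x else y)"
      if "x \<in> Ops2" "y \<in> Ops2" for x y
      using agree[OF q, of "\<lambda>j. if j = p then x else y"] that P t by (simp add: G.act_comp)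
    show "q \<sqinter> comp P t p = q \<sqinter> p"
    proof (cases "q = p")
      case True
      have "q \<sqsubseteq> comp P t p"
      proof (rule galg_leI)
        fix x y assume [simp]: "x \<in> Ops2" "y \<in> Ops2"
        have "G.act q (G.act (comp P t p) x y) x = x" using ag[of x y] True by simp
        from G.b.act_agree_left[OF _ _ _ _ this, of y]
        show "G.act q (G.act (comp P t p) x y) y = G.act q x y" by simp
      qed simp_all
      then show ?thesis using True qC b.meet_idem[of p] by (simp add: ble_def)
    next
      case False
      then have "q \<sqinter> comp P t p = \<bottom>"
        using ag by (intro galg_disjI) auto
      then show ?thesis using disj[OF q pP False] by simp
    qed
  qed (use PC in simp)
  then have "comp P t ` P - {\<bottom>} = P" using nz by auto
  then show ?thesis using topo_galgI[OF P t] by simp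
qed

text \<open>The operations of the \<open>Q b\<close>, given disjoint sets of variables, are
  substituted into the operation of P. The composite has the disjoint sum of the \<open>Q b\<close>
  as arity, and its component at (b, c) is \<open>b \<sqinter> c\<close>.\<close>

lemma topo_galg_refine:
  assumes P: "P \<in> topo galg" and Q: "\<And>b. b \<in> P \<Longrightarrow> Q b \<in> topo galg"
  shows "{b \<sqinter> c | b c. b \<in> P \<and> c \<in> Q b} - {\<bottom>} \<in> topo galg"
proof -
  note inj = inj_pair[OF universe, simp]
  obtain t where P': "sm P" and t: "t \<in> ops T P" "\<And>p. p \<in> P \<Longrightarrow> comp P t p = p"
    using topo_galgE[OF P] by blast
  have "\<exists>s. sm (Q b) \<and> s \<in> ops T (Q b) \<and> (\<forall>c\<in>Q b. comp (Q b) s c = c)" if "b \<in> P" for b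
    using topo_galgE[OF Q[OF that]] by metis
  then obtain s where s: "\<And>b. b \<in> P \<Longrightarrow> sm (Q b)" "\<And>b. b \<in> P \<Longrightarrow> s b \<in> ops T (Q b)"
    "\<And>b c. b \<in> P \<Longrightarrow> c \<in> Q b \<Longrightarrow> comp (Q b) (s b) c = c"
    by metis
  define I where "I = pair ` (SIGMA b : P. Q b)"
  have QC: "c \<in> e ` Ops2" if "b \<in> P" "c \<in> Q b" for b c
    using topo_galg_partition[OF Q[OF that(1)]] that(2) by (auto simp: b.partition_of_iff)
  have PC: "b \<in> e ` Ops2" if "b \<in> P" for b
    using topo_galg_partition[OF P] that by (auto simp: b.partition_of_iff)
  have I: "sm I"
    unfolding I_def
    by (rule small_image, rule small_subset[OF small_Times[OF universe small_image[OF small_ops]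
        small_image[OF small_ops]]])
      (use PC QC in auto)
  define u where "u b = app T (Q b) I (s b) (\<lambda>c. proj T I (pair (b, c)))" for b
  have pI: "pair (b, c) \<in> I" if "b \<in> P" "c \<in> Q b" for b c using that by (auto simp: I_def)
  have u: "u b \<in> ops T I" if "b \<in> P" for b
    using that s I pI by (simp add: u_def)
  define r where "r = app T P I t u"
  have r: "r \<in> ops T I" using P' I t u by (simp add: r_def)
  have "comp I r (pair (b, c)) = b \<sqinter> c" if b: "b \<in> P" and c: "c \<in> Q b" for b c
  proof (rule galg_eqI)
    fix x y assume [simp]: "x \<in> Ops2" "y \<in> Ops2"
    have "G.act (comp I (u b') (pair (b, c))) x y = (if b' = b then G.act c x y else y)"
        if b': "b' \<in> P" for b'
    proof -
      have "G.act (comp I (u b') (pair (b, c))) x y = app T (Q b') (nset 2) (s b') (\<lambda>c'.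
          if pair (b', c') = pair (b, c) then x else y)"
        unfolding u_def using b' s I pI by (intro comp_relabel) auto
      also have "\<dots> = (if b' = b then G.act c x y else y)"
        using b' c s(1,2) s(3)[OF b c] G.act_comp[OF s(1,2)[OF b], of x y c]
        by (auto simp: inj_eq app_const)
      finally show ?thesis .
    qed
    then have "G.act (comp I r (pair (b, c))) x y = app T P (nset 2) t (\<lambda>b'.
        if b' = b then G.act c x y else y)"
      unfolding r_def using P' I t u by (subst comp_app) (auto intro!: app_cong)
    also have "\<dots> = G.act b (G.act c x y) y"
      using G.act_comp[OF P' t(1), of "G.act c x y" y b] t(2)[OF b] QC[OF b c] by simp
    finally show "G.act (comp I r (pair (b, c))) x y = G.act (b \<sqinter> c) x y"
      using PC[OF b] QC[OF b c] by (simp add: G.act_bmeet)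
  qed (use I r PC[OF b] QC[OF b c] in auto)
  then have "comp I r ` I = {b \<sqinter> c | b c. b \<in> P \<and> c \<in> Q b}"
    unfolding I_def by (force simp: image_iff)
  then show ?thesis using topo_galgI[OF I r] by simp
qed

text \<open>Renaming the arguments of the operation of P along \<open>\<alpha>\<close> gives an
  \<open>s\<close> whose i-th component meets p in p or in bottom, according to whether
  \<open>\<alpha> p = i\<close>. As P is a cover, that component is the join of the fibre over
  i.\<close>

lemma topo_galg_coarsen:
  fixes \<alpha> :: "'u \<Rightarrow> 'u"
  assumes P: "P \<in> topo galg"
  shows "i \<in> \<alpha> ` P \<Longrightarrow> \<exists>a. is_lub galg {b \<in> P. \<alpha> b = i} a"
    and "{bsup galg {b \<in> P. \<alpha> b = i} | i. i \<in> \<alpha> ` P} \<in> topo galg"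
proof -
  obtain t where P': "sm P" and t: "t \<in> ops T P" "\<And>p. p \<in> P \<Longrightarrow> comp P t p = p"
    using topo_galgE[OF P] by blast
  have p: "partition_of galg P" by (rule topo_galg_partition[OF P])
  then have PC: "P \<subseteq> e ` Ops2" by (simp add: b.partition_of_iff)
  define I where "I = \<alpha> ` P"
  have I: "sm I" unfolding I_def by (rule small_image[OF P'])
  define s where "s = app T P I t (\<lambda>p. proj T I (\<alpha> p))"
  have s: "s \<in> ops T I" using P' I t by (simp add: s_def I_def)
  have meet: "p \<sqinter> comp I s i = (if \<alpha> p = i then p else \<bottom>)" if pP: "p \<in> P" for p i
  proof (rule galg_eqI)
    fix x y assume [simp]: "x \<in> Ops2" "y \<in> Ops2"
    have pC: "p \<in> e ` Ops2" using pP PC by blast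
    have "G.act (comp I s i) x y = app T P (nset 2) t (\<lambda>p. if \<alpha> p = i then x else y)"
      unfolding s_def using P' I t by (intro comp_relabel) (auto simp: I_def)
    then have "G.act p (G.act (comp I s i) x y) y = G.act p (if \<alpha> p = i then x else y) y"
      using G.act_comp_cross[OF P' t(1) pP, of "\<lambda>p. if \<alpha> p = i then x else y" y] t(2)[OF pP] by simp
    then show "G.act (p \<sqinter> comp I s i) x y = G.act (if \<alpha> p = i then p else \<bottom>) x y"
      using pC I s by (simp add: G.act_bmeet)
  qed (use pP PC I s in auto)
  have lub: "is_lub galg {b \<in> P. \<alpha> b = i} (comp I s i)" for i
    unfolding is_lub_def
  proof (intro conjI ballI impI)
    show "comp I s i \<in> bcarrier galg" using I s by simp
    show "p \<sqsubseteq> comp I s i" if "p \<in> {b \<in> P. \<alpha> b = i}" for p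
      using that meet[of p i] by (simp add: ble_def)
    show "comp I s i \<sqsubseteq> c" if c: "c \<in> bcarrier galg" "\<forall>p\<in>{b \<in> P. \<alpha> b = i}. p \<sqsubseteq> c" for c
    proof (rule b.cover_le[of P])
      show "p \<sqinter> comp I s i \<sqsubseteq> c" if "p \<in> P" for p
        using c that by (auto simp: meet)
    qed (use p c I s in \<open>auto simp: b.partition_of_iff\<close>)
  qed
  then show "i \<in> \<alpha> ` P \<Longrightarrow> \<exists>a. is_lub galg {b \<in> P. \<alpha> b = i} a" by blast
  \<comment> \<open>Each i in I is some \<open>\<alpha> p\<close> with p nonzero, so removing bottom
    from the set of components changes nothing.\<close>
  have "comp I s i \<noteq> \<bottom>" if "i \<in> I" for i
  proof -
    from that obtain p where pi: "p \<in> P" "\<alpha> p = i" unfolding I_def by blast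
    then have "p \<noteq> \<bottom>" "p \<in> e ` Ops2" using p PC by (auto simp: b.partition_of_iff)
    then show ?thesis using meet[OF pi(1), of i] pi(2) by auto
  qed
  then have "comp I s ` I - {\<bottom>} = comp I s ` I" by auto
  then have "{bsup galg {b \<in> P. \<alpha> b = i} | i. i \<in> \<alpha> ` P} = comp I s ` I - {\<bottom>}"
    unfolding b.bsup_eq[OF lub] I_def[symmetric] Setcompr_eq_image by (rule sym)
  then show "{bsup galg {b \<in> P. \<alpha> b = i} | i. i \<in> \<alpha> ` P} \<in> topo galg"
    using topo_galgI[OF I s] by simp
qed

lemma zero_dim_topology_galg: "zero_dim_topology galg (topo galg)"
  unfolding zero_dim_topology_def
proof (intro conjI ballI allI impI)
  show "partition_of galg P" if "P \<in> topo galg" for P using that by (rule topo_galg_partition)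
  show "P \<in> topo galg" if "partition_of galg P \<and> finite P" for P
    using that finite_partition_in_topo by blast
  show "{bmeet galg b c | b c. b \<in> P \<and> c \<in> Q b} - {bzero galg} \<in> topo galg"
    if "P \<in> topo galg" "\<forall>b\<in>P. Q b \<in> topo galg" for P Q
    using topo_galg_refine[OF that(1)] that(2) by blast
  show "\<exists>a. is_lub galg {b \<in> P. \<alpha> b = i} a" if "P \<in> topo galg" "i \<in> \<alpha> ` P" for P i
      and \<alpha> :: "'u \<Rightarrow> 'u"
    using that by (rule topo_galg_coarsen)
  show "{bsup galg {b \<in> P. \<alpha> b = i} | i. i \<in> \<alpha> ` P} \<in> topo galg" if "P \<in> topo galg" for P
      and \<alpha> :: "'u \<Rightarrow> 'u"
    using that by (rule topo_galg_coarsen)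
qed

sublocale b: grbalgebra galg
  by unfold_locales (fact universe galg_nondegenerate zero_dim_topology_galg)+

lemma galg_in_grBAlg: "galg \<in> ob grBAlg"
  by (simp add: boolean_alg_galg galg_nondegenerate zero_dim_topology_galg)

section \<open>The isomorphism with the theory of partitions\<close>

definition components :: "'u set \<Rightarrow> ('u \<Rightarrow> 'u) \<Rightarrow> 'u \<Rightarrow> 'u" where
  "components = (\<lambda>I\<in>{I. sm I}. \<lambda>t\<in>ops T I. \<lambda>i\<in>I. comp I t i)"

lemma components_closed:
  assumes "sm I" "t \<in> ops T I"
  shows "(\<lambda>i\<in>I. comp I t i) \<in> ops b.T I"
  unfolding b.ops_iff using assms topo_galgI[OF assms] by (simp add: comp_disjoint)

text \<open>Composition in the theory of partitions is characterised locally by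
  \<open>b.app_eqI\<close>. On the i-th component of \<open>t\<close>, the composite t(u) acts as
  \<open>u i\<close>, which is that local condition.\<close>

lemma components_hom: "components \<in> theory_homs T b.T"
  unfolding theory_homs_iff[OF alg_theory_axioms]
proof (intro conjI allI impI ballI)
  show "components I (proj T I i) = proj b.T I i" if "sm I" "i \<in> I" for I i
  proof (rule extensionalityI[of _ I])
    fix j assume j: "j \<in> I"
    have "comp I (proj T I i) j = (if i = j then \<top> else \<bottom>)"
      using that by (intro galg_eqI) (auto simp: comp_proj)
    then show "components I (proj T I i) j = proj b.T I i j"
      using that j by (simp add: components_def b.proj_eq)
  qed (use that in \<open>simp_all add: components_def partition_theory_def\<close>)
  show "components J (app T I J t u) = app b.T I J (components I t) (\<lambda>i. components J (u i))"
    if I: "sm I" "sm J" and t: "t \<in> ops T I" and u: "\<forall>i\<in>I. u i \<in> ops T J" for I J t u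
  proof -
    have "app b.T I J (\<lambda>i\<in>I. comp I t i) (\<lambda>i. components J (u i))
        = (\<lambda>j\<in>J. comp J (app T I J t u) j)"
    proof (rule b.app_eqI)
      fix i j assume i: "i \<in> I" and j: "j \<in> J"
      have "comp I t i \<sqinter> comp J (app T I J t u) j = comp I t i \<sqinter> comp J (u i) j"
      proof (rule galg_eqI)
        fix x y assume [simp]: "x \<in> Ops2" "y \<in> Ops2"
        have "G.act (comp I t i) (G.act (comp J (app T I J t u) j) x y) y
            = G.act (comp I t i) (G.act (comp J (u i) j) x y) y"
          using I t u i by (simp add: comp_app G.act_comp_cross)
        then show "G.act (comp I t i \<sqinter> comp J (app T I J t u) j) x y
            = G.act (comp I t i \<sqinter> comp J (u i) j) x y"
          using I t u i by (simp add: G.act_bmeet)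
      qed (use I t u i in auto)
      then show "(\<lambda>i\<in>I. comp I t i) i \<sqinter> (\<lambda>j\<in>J. comp J (app T I J t u) j) j
          = (\<lambda>i\<in>I. comp I t i) i \<sqinter> components J (u i) j"
        using I u i j by (simp add: components_def)
    qed (use I t u in \<open>auto simp: components_closed components_def\<close>)
    then show ?thesis using I t u by (simp add: components_def)
  qed
qed (auto simp: components_def components_closed)

lemma components_inj: "sm I \<Longrightarrow> inj_on (components I) (ops T I)"
proof (rule inj_onI)
  fix s t assume I: "sm I" and st: "s \<in> ops T I" "t \<in> ops T I" "components I s = components I t"
  have "comp I s i = comp I t i" if "i \<in> I" for i
    using fun_cong[OF st(3), of i] that I st by (simp add: components_def)
  then show "s = t" using ops_eqI[OF I st(1,2)] by blast
qed

text \<open>The nonzero weights form a member P of the topology, the family of components of some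
  \<open>t\<close> of arity P. Renaming the arguments of \<open>t\<close> along a section
  \<open>r\<close> of \<open>\<omega>\<close> puts each member back at its index.\<close>

lemma components_surj:
  assumes I: "sm I" and w: "\<omega> \<in> ops b.T I"
  shows "\<omega> \<in> components I ` ops T I"
proof -
  define P where "P = \<omega> ` I - {\<bottom>}"
  have P: "P \<in> topo galg" unfolding P_def by (rule b.opsD(3)[OF w])
  obtain t where P': "sm P" and t: "t \<in> ops T P" "\<And>p. p \<in> P \<Longrightarrow> comp P t p = p"
    using topo_galgE[OF P] by blast
  have PC: "p \<in> e ` Ops2" if "p \<in> P" for p
    using that topo_galg_partition[OF P] by (auto simp: b.partition_of_iff)
  have wC [simp]: "\<omega> i \<in> e ` Ops2" if "i \<in> I" for i using b.opsD(1)[OF w that] by simp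
  define r where "r p = (SOME i. i \<in> I \<and> \<omega> i = p)" for p
  have r: "r p \<in> I" "\<omega> (r p) = p" if "p \<in> P" for p
    unfolding r_def using someI_ex[of "\<lambda>i. i \<in> I \<and> \<omega> i = p"] that by (auto simp: P_def)
  define s where "s = app T P I t (\<lambda>p. proj T I (r p))"
  have s: "s \<in> ops T I" using P' I t r by (simp add: s_def)
  have "comp I s i = \<omega> i" if i: "i \<in> I" for i
  proof (rule galg_eqI)
    fix x y assume [simp]: "x \<in> Ops2" "y \<in> Ops2"
    have "app T P (nset 2) t (\<lambda>p. if r p = i then x else y) = G.act (\<omega> i) x y"
    proof (rule G.m_eqI[OF P' t(1)])
      fix p assume p: "p \<in> P"
      have "G.act p (G.act (\<omega> i) x y) (if r p = i then x else y) = (if r p = i then x else y)"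
      proof (cases "r p = i")
        case True
        then show ?thesis using r[OF p] i PC[OF p] by simp
      next
        case False
        then have "p \<sqinter> \<omega> i = \<bottom>" using b.opsD(2)[OF w r(1)[OF p] i] r(2)[OF p] by simp
        then show ?thesis using False PC[OF p] i by (simp add: G.b.act_disjoint)
      qed
      then show "G.act (comp P t p) (G.act (\<omega> i) x y) (if r p = i then x else y)
          = (if r p = i then x else y)"
        by (simp add: t(2)[OF p])
    qed (use i in auto)
    then show "G.act (comp I s i) x y = G.act (\<omega> i) x y"
      unfolding s_def using P' I t r by (simp add: comp_relabel)
  qed (use I s i in auto)
  then have "components I s = \<omega>"
    using b.opsD(4)[OF w] I s by (intro extensionalityI[of _ I]) (auto simp: components_def)
  then show ?thesis using s by blast
qed

lemma iso_partition_theory: "isomorphic_in HAff (partition_theory galg) T"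
proof -
  have "iso_in HAff T (partition_theory galg) components"
  proof (rule iso_in_HAff[OF universe])
    show "T \<in> ob HAff" using algebraic_theory nondegenerate hyperaffine by simp
    show "partition_theory galg \<in> ob HAff" by (rule b.T_in_HAff)
    show "components \<in> hom HAff T (partition_theory galg)" using components_hom by simp
    show "bij_betw (components I) (ops T I) (ops (partition_theory galg) I)" if "small TYPE('u) I"
        for I
      unfolding bij_betw_def
      using that components_inj components_surj components_closed by (auto simp: components_def)
  qed
  then have "isomorphic_in HAff T (partition_theory galg)" unfolding isomorphic_in_def by blast
  then show ?thesis by (rule isomorphic_in_sym)
qed

end

lemma haffI: "universe TYPE('u) \<Longrightarrow> T \<in> ob HAff \<Longrightarrow> haff T" for T :: "('u, 'u \<Rightarrow> 'u) algth"
  by (simp add: haff_def hyperaffine_theory_def set_theory_of_def alg_theory_def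
      hyperaffine_theory_axioms_def haff_axioms_def)

theorem T_functor_essentially_surjective:
  assumes "universe TYPE('u)" "T \<in> ob (HAff :: (('u, 'u \<Rightarrow> 'u) algth, _) cat)"
  shows "\<exists>B\<in>ob grBAlg. isomorphic_in HAff (partition_theory B) T"
  using haff.iso_partition_theory[OF haffI[OF assms]] haff.galg_in_grBAlg[OF haffI[OF assms]]
      by blast

section \<open>Sets over a Grothendieck Boolean algebra\<close>

lemma BJ_sig_simps [simp]:
  "syms (BJ_sig B) = Act ` bcarrier B \<union> Glue ` {P \<in> topo B. infinite P}" "arity (BJ_sig B)
      = std_arity"
  by (simp_all add: BJ_sig_def)

definition BJ_sets :: "'u gbalg \<Rightarrow> 'u mdl set" where
  "BJ_sets B = {M \<in> structures (BJ_sig B). B_set_laws B M \<and> glue_laws B M}"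

lemma BJ_Set_simps [simp]:
  "cobj (BJ_Set B) = BJ_sets B" "cund (BJ_Set B) = und"
  "chom (BJ_Set B) M N = (if M \<in> BJ_sets B \<and> N \<in> BJ_sets B then homomorphisms
      (BJ_sig B) M N else {})"
  by (simp_all add: BJ_Set_def BJ_sets_def concrete_cat_of_def)

lemma structures_BJ_sig_iff:
  "M \<in> structures (BJ_sig B) \<longleftrightarrow> small TYPE('u) (und M) \<and> intp M \<in> extensional (syms (BJ_sig B)) \<and>
    (\<forall>b\<in>bcarrier B. intp M (Act b) \<in> (nset 2 \<rightarrow>\<^sub>E und M) \<rightarrow>\<^sub>E und M) \<and>
    (\<forall>P\<in>topo B. infinite P \<longrightarrow> intp M (Glue P) \<in> (P \<rightarrow>\<^sub>E und M) \<rightarrow>\<^sub>E und M)"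
  for B :: "'u gbalg"
proof -
  have "(\<forall>s\<in>syms (BJ_sig B). Q s) \<longleftrightarrow> (\<forall>b\<in>bcarrier B. Q (Act b)) \<and> (\<forall>P\<in>topo B. infinite P
      \<longrightarrow> Q (Glue P))" for Q
    by auto
  then show ?thesis
    unfolding structures_def mem_Collect_eq PiE_iff[of "intp M"] BJ_sig_simps(2)
    by (simp only: std_arity.simps) blast
qed

lemma structures_BJ_sigD:
  fixes B :: "'u gbalg"
  assumes "M \<in> structures (BJ_sig B)"
  shows "b \<in> bcarrier B \<Longrightarrow> intp M (Act b) \<in> (nset 2 \<rightarrow>\<^sub>E und M) \<rightarrow>\<^sub>E und M"
    and "P \<in> topo B \<Longrightarrow> infinite P \<Longrightarrow> intp M (Glue P) \<in> (P \<rightarrow>\<^sub>E und M) \<rightarrow>\<^sub>E und M"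
proof -
  note * = assms[unfolded structures_BJ_sig_iff, THEN conjunct2, THEN conjunct2]
  show "b \<in> bcarrier B \<Longrightarrow> intp M (Act b) \<in> (nset 2 \<rightarrow>\<^sub>E und M) \<rightarrow>\<^sub>E und M"
    by (rule bspec[OF conjunct1[OF *]])
  show "P \<in> topo B \<Longrightarrow> infinite P \<Longrightarrow> intp M (Glue P) \<in> (P \<rightarrow>\<^sub>E und M) \<rightarrow>\<^sub>E und M"
    by (rule bspec[OF conjunct2[OF *], THEN mp])
qed

text \<open>A sheaf condition in place of the operations P: families indexed by a partition can be
  glued, and agreement on all members forces equality. It refers to the binary operations alone and
  treats finite and infinite partitions uniformly.\<close>

locale bjset = grbalgebra B + bset B X act for B :: "'u gbalg" and X :: "'x set" and act +
  assumes glue_exists: "P \<in> topo B \<Longrightarrow> \<forall>p\<in>P. x p \<in> X \<Longrightarrow> \<exists>z\<in>X. \<forall>p\<in>P. act p z (x p) = x p"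
    and separated: "\<lbrakk>P \<in> topo B; z \<in> X; w \<in> X; \<forall>p\<in>P. act p z w = w\<rbrakk> \<Longrightarrow> z = w"
begin

lemma ops_separated:
  assumes w: "\<omega> \<in> ops T I" and "z \<in> X" "y \<in> X" "\<And>i. i \<in> I \<Longrightarrow> act (\<omega> i) z y = y"
  shows "z = y"
proof (rule separated[OF opsD(3)[OF w]])
  show "\<forall>p\<in>\<omega> ` I - {\<bottom>}. act p z y = y" using assms(4) by blast
qed fact+

text \<open>On each weight both elements agree with \<open>f i\<close>, hence with each
  other.\<close>

lemma ops_agree_unique:
  assumes w: "\<omega> \<in> ops T I" and "z \<in> X" "y \<in> X" "\<And>i. i \<in> I \<Longrightarrow> f i \<in> X"
    and "\<And>i. i \<in> I \<Longrightarrow> act (\<omega> i) z (f i) = f i" "\<And>i. i \<in> I \<Longrightarrow> act (\<omega> i) y (f i) = f i"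
  shows "z = y"
proof (rule ops_separated[OF w])
  fix i assume i: "i \<in> I"
  have "act (\<omega> i) z y = act (\<omega> i) (f i) y"
    using assms i opsD(1)[OF w i] by - (rule act_agree_left, auto)
  also have "\<dots> = y"
    using assms i opsD(1)[OF w i] by - (rule act_agree_sym, auto)
  finally show "act (\<omega> i) z y = y" .
qed fact+

lemma ops_glue_exists:
  assumes w: "\<omega> \<in> ops T I" and f: "\<And>i. i \<in> I \<Longrightarrow> f i \<in> X"
  shows "\<exists>z\<in>X. \<forall>i\<in>I. act (\<omega> i) z (f i) = f i"
proof -
  define P where "P = \<omega> ` I - {\<bottom>}"
  define r where "r p = (SOME i. i \<in> I \<and> \<omega> i = p)" for p
  have r: "r p \<in> I" "\<omega> (r p) = p" if "p \<in> P" for p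
    unfolding r_def using someI_ex[of "\<lambda>i. i \<in> I \<and> \<omega> i = p"] that by (auto simp: P_def)
  have "P \<in> topo B" unfolding P_def by (rule opsD(3)[OF w])
  moreover have "\<forall>p\<in>P. f (r p) \<in> X" using r f by blast
  ultimately obtain z where z: "z \<in> X" "\<forall>p\<in>P. act p z (f (r p)) = f (r p)"
    using glue_exists[of P "\<lambda>p. f (r p)"] by blast
  have "act (\<omega> i) z (f i) = f i" if i: "i \<in> I" for i
  \<comment> \<open>The gluing z was taken over P, where a nonzero weight stands for its unique
    index; at a zero weight agreement is automatic.\<close>
  proof (cases "\<omega> i = \<bottom>")
    case True
    then show ?thesis using z f i by simp
  next
    case False
    then have p: "\<omega> i \<in> P" using i by (simp add: P_def)
    have "r (\<omega> i) = i"
      using opsD(2)[OF w r(1)[OF p] i] r(2)[OF p] opsD(1)[OF w i] False by auto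
    then show ?thesis using z(2) p by metis
  qed
  then show ?thesis using z(1) by blast
qed

definition val :: "'u set \<Rightarrow> ('u \<Rightarrow> 'u) \<Rightarrow> ('u \<Rightarrow> 'x) \<Rightarrow> 'x" where
  "val I \<omega> f = (THE z. z \<in> X \<and> (\<forall>i\<in>I. act (\<omega> i) z (f i) = f i))"

lemma val_eqI:
  assumes "\<omega> \<in> ops T I" "\<And>i. i \<in> I \<Longrightarrow> f i \<in> X" "z \<in> X" "\<And>i. i \<in> I \<Longrightarrow> act (\<omega> i) z (f i) = f i"
  shows "val I \<omega> f = z"
  unfolding val_def
proof (rule the_equality)
  show "y = z" if "y \<in> X \<and> (\<forall>i\<in>I. act (\<omega> i) y (f i) = f i)" for y
    using that assms by (intro ops_agree_unique[OF assms(1), of y z f]) auto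
qed (use assms in blast)

lemma
  assumes "\<omega> \<in> ops T I" "\<And>i. i \<in> I \<Longrightarrow> f i \<in> X"
  shows val_closed: "val I \<omega> f \<in> X" and val_agree: "i \<in> I \<Longrightarrow> act (\<omega> i) (val I \<omega> f) (f i) = f i"
proof -
  obtain z where z: "z \<in> X" "\<forall>i\<in>I. act (\<omega> i) z (f i) = f i" using ops_glue_exists[of \<omega> I f] assms
      by blast
  then have "val I \<omega> f = z" using assms by (intro val_eqI) auto
  then show "val I \<omega> f \<in> X" "i \<in> I \<Longrightarrow> act (\<omega> i) (val I \<omega> f) (f i) = f i" using z by auto
qed

text \<open>For composites, the iterated value \<open>?z\<close> must agree with \<open>f j\<close>
  on the j-th weight of t(u). This is checked on each \<open>t i\<close>, where that weight may be
  replaced by \<open>u i j\<close> and \<open>?z\<close> by the value of \<open>u i\<close>.\<close>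

lemma model_of_val: "model_of T X val"
proof
  show "val I t f = val I t g" if "\<And>i. i \<in> I \<Longrightarrow> f i = g i" for I t f g
    unfolding val_def using that by (simp cong: ball_cong)
  show "val I t f \<in> X" if "t \<in> ops T I" "\<And>i. i \<in> I \<Longrightarrow> f i \<in> X" for I t f
    using that by (rule val_closed)
  show "val I (proj T I i) f = f i" if i: "i \<in> I" and f: "\<And>i. i \<in> I \<Longrightarrow> f i \<in> X" for I i f
    using i f by (intro val_eqI) (auto simp: proj_in_ops proj_eq)
  show "val J (app T I J t u) f = val I t (\<lambda>i. val J (u i) f)"
    if I: "sm I" "sm J" and t: "t \<in> ops T I" and u: "\<And>i. i \<in> I \<Longrightarrow> u i \<in> ops T J"
        and f: "\<And>j. j \<in> J \<Longrightarrow> f j \<in> X"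
    for I J t u f
  proof (rule val_eqI)
    let ?g = "\<lambda>i. val J (u i) f" let ?z = "val I t ?g"
    have g: "?g i \<in> X" if "i \<in> I" for i by (rule val_closed[OF u[OF that] f])
    have z: "?z \<in> X" by (rule val_closed[OF t g])
    have tu: "app T I J t u \<in> ops T J" using I t u by simp
    show "app T I J t u \<in> ops T J" "?z \<in> X" by fact+
    fix j assume j: "j \<in> J"
    have fj: "f j \<in> X" using f j by blast
    let ?a = "app T I J t u j"
    have a: "?a \<in> C" using opsD(1)[OF tu j] .
    show "act ?a ?z (f j) = f j"
    proof (rule ops_separated[OF t])
      fix i assume i: "i \<in> I"
      have ti: "t i \<in> C" and ui: "u i j \<in> C" using opsD(1)[OF t i] opsD(1)[OF u[OF i] j] by auto
      note [simp] = fj a ti ui z g[OF i]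
      have "act (t i) (act ?a ?z (f j)) (f j) = act (t i \<sqinter> ?a) ?z (f j)" by (simp add: act_meet)
      also have "t i \<sqinter> ?a = t i \<sqinter> u i j" using app_local[OF t _ j i] u by blast
      also have "\<dots> = u i j \<sqinter> t i" by (simp add: meet_commute)
      also have "act (u i j \<sqinter> t i) ?z (f j) = act (u i j) (act (t i) ?z (f j)) (f j)"
        by (simp add: act_meet)
      also have "act (t i) ?z (f j) = act (t i) (?g i) (f j)"
        using val_agree[OF t, of ?g i] g i by - (rule act_agree_left, auto)
      also have "act (u i j) (act (t i) (?g i) (f j)) (f j) = act (u i j \<sqinter> t i) (?g i) (f j)"
        by (simp add: act_meet)
      also have "\<dots> = act (t i) (act (u i j) (?g i) (f j)) (f j)"
        by (subst meet_commute) (simp_all add: act_meet)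
      also have "\<dots> = f j" using val_agree[OF u[OF i], of f j] f j by simp
      finally show "act (t i) (act ?a ?z (f j)) (f j) = f j" .
    qed (use a z fj in simp_all)
  qed (use f in blast)
qed

end

text \<open>The condition that singles out \<open>val\<close> mentions only the binary operations,
  so a map preserving those preserves all operations of the theory.\<close>

lemma bjset_hom_val:
  assumes "bjset B X act1" "bjset B Y act2"
    and h: "\<And>x. x \<in> X \<Longrightarrow> h x \<in> Y"
      "\<And>b x y. b \<in> bcarrier B \<Longrightarrow> x \<in> X \<Longrightarrow> y \<in> X \<Longrightarrow> h (act1 b x y) = act2 b (h x) (h y)"
    and w: "\<omega> \<in> ops (partition_theory B) I" and f: "\<And>i. i \<in> I \<Longrightarrow> f i \<in> X"
  shows "h (bjset.val X act1 I \<omega> f) = bjset.val Y act2 I \<omega> (\<lambda>i. h (f i))"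
proof -
  interpret X: bjset B X act1 by fact
  interpret Y: bjset B Y act2 by fact
  have v: "X.val I \<omega> f \<in> X" by (rule X.val_closed[OF w f])
  have "Y.val I \<omega> (\<lambda>i. h (f i)) = h (X.val I \<omega> f)"
  proof (rule Y.val_eqI[OF w])
    show "act2 (\<omega> i) (h (X.val I \<omega> f)) (h (f i)) = h (f i)" if i: "i \<in> I" for i
    proof -
      have "act1 (\<omega> i) (X.val I \<omega> f) (f i) = f i" by (rule X.val_agree[OF w f i])
      then show ?thesis using h(2)[OF X.opsD(1)[OF w i] v f[OF i]] by simp
    qed
  qed (use h(1) f v in auto)
  then show ?thesis by simp
qed

section \<open>Translation between models of the theory and B_J-sets\<close>

context grbalgebra
begin

lemma act_closed':
  assumes "M \<in> structures (BJ_sig B)" "b \<in> C" "x \<in> und M" "y \<in> und M"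
  shows "act M b x y \<in> und M"
proof -
  have "intp M (Act b) \<in> (nset 2 \<rightarrow>\<^sub>E und M) \<rightarrow>\<^sub>E und M"
    by (rule structures_BJ_sigD(1)[OF assms(1,2)])
  moreover have "(\<lambda>k\<in>nset 2. if k = num 1 then x else y) \<in> nset 2 \<rightarrow>\<^sub>E und M" using assms by auto
  ultimately show ?thesis unfolding act_def by (rule PiE_mem)
qed

lemma glue_closed:
  assumes "M \<in> structures (BJ_sig B)" "P \<in> topo B" "infinite P" "x \<in> P \<rightarrow>\<^sub>E und M"
  shows "intp M (Glue P) x \<in> und M"
  by (rule PiE_mem[OF structures_BJ_sigD(2)[OF assms(1-3)] assms(4)])

lemma bset_act:
  assumes M: "M \<in> BJ_sets B"
  shows "bset B (und M) (act M)"
proof -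
  have str: "M \<in> structures (BJ_sig B)" and laws: "B_set_laws B M" using M
      by (auto simp: BJ_sets_def)
  have "act M \<top> x y = x" if "x \<in> und M" "y \<in> und M" for x y
    using laws that closed(2) unfolding B_set_laws_def by blast
  then show ?thesis using laws str by unfold_locales (auto simp: B_set_laws_def act_closed')
qed

lemma glue_laws:
  assumes M: "M \<in> BJ_sets B" and P: "P \<in> topo B" "infinite P"
  shows "x \<in> und M \<Longrightarrow> intp M (Glue P) (\<lambda>b\<in>P. x) = x"
    and "\<lbrakk>f \<in> P \<rightarrow>\<^sub>E und M; g \<in> P \<rightarrow>\<^sub>E und M\<rbrakk>
      \<Longrightarrow> intp M (Glue P) (\<lambda>b\<in>P. act M b (f b) (g b)) = intp M (Glue P) f"
    and "\<lbrakk>f \<in> P \<rightarrow>\<^sub>E und M; b \<in> P\<rbrakk> \<Longrightarrow> act M b (intp M (Glue P) f) (f b) = f b"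
  using M P by (simp_all add: BJ_sets_def glue_laws_def)

text \<open>Infinite partitions are glued by their function symbols. Finite ones have no symbol; for
  them \<open>finite_glue\<close> and \<open>act_cover_eq\<close> derive both conditions from the
  Boolean operations.\<close>

lemma bjset_act:
  assumes M: "M \<in> BJ_sets B"
  shows "bjset B (und M) (act M)"
proof -
  interpret bset B "und M" "act M" by (rule bset_act[OF M])
  have str: "M \<in> structures (BJ_sig B)" using M by (simp add: BJ_sets_def)
  show ?thesis
  proof
    fix P and x :: "'u \<Rightarrow> 'u" assume P: "P \<in> topo B" and x: "\<forall>p\<in>P. x p \<in> und M"
    have p: "partition_of B P" by (rule topo_partition[OF P])
    show "\<exists>z\<in>und M. \<forall>p\<in>P. act M p z (x p) = x p"
    proof (cases "finite P")
      case True
      have "P \<noteq> {}" using p is_lub_empty is_lub_unique nondeg unfolding partition_of_iff by blast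
      then show ?thesis using p x by (intro finite_glue True) (auto simp: partition_of_iff)
    next
      case False
      have xP: "restrict x P \<in> P \<rightarrow>\<^sub>E und M" using x by auto
      show ?thesis
        using glue_laws(3)[OF M P False xP] glue_closed[OF str P False xP]
        by (intro bexI[of _ "intp M (Glue P) (restrict x P)"]) auto
    qed
  next
    fix P z w assume P: "P \<in> topo B" and zw: "z \<in> und M" "w \<in> und M" "\<forall>p\<in>P. act M p z w = w"
    have p: "partition_of B P" by (rule topo_partition[OF P])
    show "z = w"
    proof (cases "finite P")
      case True
      then show ?thesis using p zw by - (rule act_cover_eq[of P], auto simp: partition_of_iff)
    next
      case False
      \<comment> \<open>Separation from the laws of P: z = P(z) = P(b(z, w)) = P(w) = w, where the
        second equality is the law that absorbs the w and the third is agreement on each b.\<close>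
      have "z = intp M (Glue P) (\<lambda>p\<in>P. z)" using glue_laws(1)[OF M P False] zw by simp
      also have "\<dots> = intp M (Glue P) (\<lambda>p\<in>P. act M p ((\<lambda>p\<in>P. z) p) ((\<lambda>p\<in>P. w) p))"
        using zw by (intro glue_laws(2)[OF M P False, symmetric]) auto
      also have "(\<lambda>p\<in>P. act M p ((\<lambda>p\<in>P. z) p) ((\<lambda>p\<in>P. w) p)) = (\<lambda>p\<in>P. w)"
        using zw(3) by (intro restrict_ext) simp
      also have "intp M (Glue P) \<dots> = w" using glue_laws(1)[OF M P False] zw by simp
      finally show ?thesis .
    qed
  qed
qed

lemma act_intp:
  fixes M :: "'u mdl"
  assumes "x \<in> nset 2 \<rightarrow>\<^sub>E Y"
  shows "intp M (Act b) x = act M b (x (num 1)) (x (num 2))"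
proof -
  have "(\<lambda>k\<in>nset 2. if k = num 1 then x (num 1) else x (num 2)) = x"
    by (rule extensionalityI[of _ "nset 2"]) (use assms in \<open>auto simp: nset_2_eq PiE_iff\<close>)
  then show ?thesis by (simp only: act_def)
qed

text \<open>\<open>Glue P\<close> must return the unique gluing with respect to the binary
  operations, so these fix the whole structure. This gives the uniqueness behind the definite
  description in \<open>Set_functor\<close>.\<close>

lemma BJ_sets_eqI:
  fixes M N :: "'u mdl"
  assumes M: "M \<in> BJ_sets B" and N: "N \<in> BJ_sets B" and und: "und M = und N"
    and act: "\<And>b x y. b \<in> C \<Longrightarrow> x \<in> und M \<Longrightarrow> y \<in> und M \<Longrightarrow> act M b x y = act N b x y"
  shows "M = N"
proof -
  interpret M: bjset B "und M" "act M" by (rule bjset_act[OF M])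
  have str: "M \<in> structures (BJ_sig B)" "N \<in> structures (BJ_sig B)" using M N
      by (simp_all add: BJ_sets_def)
  have "intp M s = intp N s" if s: "s \<in> syms (BJ_sig B)" for s
  proof -
    consider b where "b \<in> C" "s = Act b" | P where "P \<in> topo B" "infinite P" "s = Glue P" using s
        by auto
    then show ?thesis
    proof cases
      case 1
      have "intp M (Act b) \<in> (nset 2 \<rightarrow>\<^sub>E und M) \<rightarrow>\<^sub>E und M"
          "intp N (Act b) \<in> (nset 2 \<rightarrow>\<^sub>E und M) \<rightarrow>\<^sub>E und M"
        using structures_BJ_sigD(1)[OF str(1) 1(1)] structures_BJ_sigD(1)[OF str(2) 1(1)]
            by (simp_all add: und)
      then have "intp M (Act b) = intp N (Act b)"
      proof (rule PiE_ext)
        fix x :: "'u \<Rightarrow> 'u" assume x: "x \<in> nset 2 \<rightarrow>\<^sub>E und M"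
        show "intp M (Act b) x = intp N (Act b) x"
          unfolding act_intp[OF x] using PiE_mem[OF x] 1(1) by (intro act) auto
      qed
      then show ?thesis using 1 by simp
    next
      case 2
      have "intp M (Glue P) \<in> (P \<rightarrow>\<^sub>E und M) \<rightarrow>\<^sub>E und M" "intp N (Glue P) \<in> (P \<rightarrow>\<^sub>E und M) \<rightarrow>\<^sub>E und M"
        using structures_BJ_sigD(2)[OF str(1) 2(1,2)] structures_BJ_sigD(2)[OF str(2) 2(1,2)]
            by (simp_all add: und)
      then have "intp M (Glue P) = intp N (Glue P)"
      proof (rule PiE_ext)
        fix x assume x: "x \<in> P \<rightarrow>\<^sub>E und M"
        have xN: "x \<in> P \<rightarrow>\<^sub>E und N" using x und by simp
        show "intp M (Glue P) x = intp N (Glue P) x"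
        proof (rule M.ops_agree_unique[OF identity_in_ops[OF 2(1)]])
          show "intp M (Glue P) x \<in> und M" by (rule glue_closed[OF str(1) 2(1,2) x])
          show iN: "intp N (Glue P) x \<in> und M" using glue_closed[OF str(2) 2(1,2) xN] und by simp
          show "x i \<in> und M" if "i \<in> P" for i using x that by (rule PiE_mem)
          fix p assume p: "p \<in> P"
          show "act M ((\<lambda>p\<in>P. p) p) (intp M (Glue P) x) (x p) = x p"
            using glue_laws(3)[OF M 2(1,2) x p] p by simp
          show "act M ((\<lambda>p\<in>P. p) p) (intp N (Glue P) x) (x p) = x p"
            using glue_laws(3)[OF N 2(1,2) xN p] p act[OF _ iN PiE_mem[OF x p],
                of p] topo_subset[OF 2(1)] by auto
        qed
      qed
      then show ?thesis using 2 by simp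
    qed
  qed
  then have "intp M = intp N"
    using str by (intro extensionalityI[of _ "syms (BJ_sig B)"])
        (auto simp only: structures_BJ_sig_iff)
  with und show ?thesis by simp
qed

definition to_model :: "'u mdl \<Rightarrow> 'u mdl" where
  "to_model M = model_with T (und M) (bjset.val (und M) (act M))"

lemma und_to_model [simp]: "und (to_model M) = und M"
  by (simp add: to_model_def)

lemma to_model_closed: "M \<in> BJ_sets B \<Longrightarrow> to_model M \<in> theory_models T"
  unfolding to_model_def
  by (intro th.model_with_closed bjset.model_of_val bjset_act)
      (simp_all add: BJ_sets_def structures_BJ_sig_iff)

lemma interp_to_model:
  assumes "M \<in> BJ_sets B" "sm I" "t \<in> ops T I" "\<And>i. i \<in> I \<Longrightarrow> f i \<in> und M"
  shows "interp (to_model M) I t f = bjset.val (und M) (act M) I t f"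
proof -
  interpret bjset B "und M" "act M" by (rule bjset_act[OF assms(1)])
  have "restrict f I \<in> I \<rightarrow>\<^sub>E und M" using assms by auto
  then have "interp (to_model M) I t f = val I t (restrict f I)"
    using assms unfolding interp_def to_model_def by simp
  also have "\<dots> = val I t f" using model_of.m_cong[OF model_of_val] by (metis restrict_apply')
  finally show ?thesis .
qed

lemma interp_to_model_bin:
  assumes M: "M \<in> BJ_sets B" and b: "b \<in> C" and x: "x \<in> und M" "y \<in> und M"
  shows "interp (to_model M) (nset 2) (bin b) (sel x y) = act M b x y"
proof -
  interpret bjset B "und M" "act M" by (rule bjset_act[OF M])
  have "val (nset 2) (bin b) (sel x y) = act M b x y"
    using b x by (intro val_eqI bin_in_ops) (auto simp: nset_2_eq sel_def)
  then show ?thesis using M b x by (subst interp_to_model) (auto simp: bin_in_ops sel_def)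
qed

text \<open>The reconstruction of an algebra is applied to the theory of B itself. In
  \<open>haff.galg\<close> the element b of B appears as \<open>haff.e (bin b)\<close>.\<close>

interpretation haff: haff T
  by unfold_locales (rule nondegenerate_T)

definition to_set :: "'u mdl \<Rightarrow> 'u mdl" where
  "to_set M = \<lparr>und = und M, intp = (\<lambda>s\<in>syms (BJ_sig B). \<lambda>x\<in>std_arity s \<rightarrow>\<^sub>E und M.
     case s of Act b \<Rightarrow> interp M (nset 2) (bin b) x | Glue P \<Rightarrow> interp M P (\<lambda>p\<in>P. p) x)\<rparr>"

lemma und_to_set [simp]: "und (to_set M) = und M"
  by (simp add: to_set_def)

lemma act_to_set:
  assumes "b \<in> C" "x \<in> und M" "y \<in> und M"
  shows "act (to_set M) b x y = interp M (nset 2) (bin b) (sel x y)"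
proof -
  have r: "(\<lambda>k\<in>nset 2. if k = num 1 then x else y) \<in> nset 2 \<rightarrow>\<^sub>E und M" using assms by auto
  then have "act (to_set M) b x y = interp M (nset 2) (bin b) (\<lambda>k\<in>nset 2.
      if k = num 1 then x else y)"
    using assms by (simp add: act_def to_set_def)
  also have "\<dots> = interp M (nset 2) (bin b) (sel x y)"
    unfolding interp_def sel_def by (simp cong: restrict_cong)
  finally show ?thesis .
qed

lemma glue_to_set:
  "\<lbrakk>P \<in> topo B; infinite P; x \<in> P \<rightarrow>\<^sub>E und M\<rbrakk> \<Longrightarrow> intp (to_set M) (Glue P) x = interp M P (\<lambda>p\<in>P. p) x"
  by (simp add: to_set_def)

context
  fixes M assumes M: "M \<in> theory_models T"
begin

interpretation H: haff_model T "und M" "interp M"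
  by (intro haff_model.intro haff.haff_axioms) (use M in \<open>simp add: th.theory_models_iff\<close>)

lemma act_to_set_enc:
  "b \<in> C \<Longrightarrow> x \<in> und M \<Longrightarrow> y \<in> und M \<Longrightarrow> act (to_set M) b x y = H.act (haff.e (bin b)) x y"
  by (simp add: act_to_set H.act_enc bin_in_ops)

lemma comp_eq: "t \<in> ops T I \<Longrightarrow> i \<in> I \<Longrightarrow> haff.comp I t i = haff.e (bin (t i))"
  by (simp only: haff.comp_def component)

lemma to_set_agree:
  assumes "sm I" "t \<in> ops T I" "\<And>i. i \<in> I \<Longrightarrow> f i \<in> und M" "i \<in> I"
  shows "act (to_set M) (t i) (interp M I t f) (f i) = f i"
  using H.m_agree[OF assms] assms opsD(1)[OF assms(2,4)] by (simp add: act_to_set_enc comp_eq)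

lemma to_set_eqI:
  assumes "sm I" "t \<in> ops T I" "\<And>i. i \<in> I \<Longrightarrow> f i \<in> und M" "z \<in> und M"
    and "\<And>i. i \<in> I \<Longrightarrow> act (to_set M) (t i) z (f i) = f i"
  shows "interp M I t f = z"
  using assms opsD(1)[OF assms(2)] by (intro H.m_eqI) (simp_all add: act_to_set_enc comp_eq)

lemma bin_enc_in [simp]: "b \<in> C \<Longrightarrow> haff.e (bin b) \<in> haff.e ` haff.Ops2"
  by (simp add: bin_in_ops)

text \<open>Together with \<open>bneg_bin\<close> this turns laws for the action of
  \<open>haff.galg\<close> on a model into laws for B.\<close>

lemma bmeet_bin: "b \<in> C \<Longrightarrow> c \<in> C \<Longrightarrow> bmeet haff.galg (haff.e (bin b)) (haff.e (bin c))
    = haff.e (bin (b \<sqinter> c))"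
  unfolding haff.bmeet_galg using bin_meet[of b c] by (simp add: bin_in_ops sel_def[abs_def])

lemma bneg_bin:
  assumes "b \<in> C"
  shows "bneg haff.galg (haff.e (bin b)) = haff.e (bin (\<sim> b))"
proof -
  have "app T (nset 2) (nset 2) (bin b) (\<lambda>k. if k
      = num 2 then proj T (nset 2) (num 1) else proj T (nset 2) (num 2))
      = bin (bin b (num 2))"
    using assms by (intro component bin_in_ops) simp_all
  moreover have "app T (nset 2) (nset 2) (bin b) (\<lambda>k.
      if k = num 2 then proj T (nset 2) (num 1) else proj T (nset 2) (num 2))
      = app T (nset 2) (nset 2) (bin b) (sel (proj T (nset 2) (num 2)) (proj T (nset 2) (num 1)))"
    by (rule th.app_cong) (auto simp: nset_2_eq sel_def)
  ultimately show ?thesis unfolding haff.bneg_galg using assms by (simp add: bin_in_ops)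
qed

lemma bset_to_set: "bset B (und M) (act (to_set M))"
proof -
  have cl: "act (to_set M) b x y \<in> und M" if "b \<in> C" "x \<in> und M" "y \<in> und M" for b x y
    using that by (simp add: act_to_set_enc)
  show ?thesis
  proof
    show "act (to_set M) \<top> x y = x" if "x \<in> und M" "y \<in> und M" for x y
    proof -
      have "act (to_set M) \<top> x y = interp M (nset 2) (proj T (nset 2) (num 1)) (sel x y)"
        using that by (simp only: act_to_set closed proj_bin)
      then show ?thesis using that H.m_proj[of "nset 2" "num 1" "sel x y"] by simp
    qed
    show "act (to_set M) (\<sim> b) x y = act (to_set M) b y x" if "b \<in> C" "x \<in> und M" "y \<in> und M"
        for b x y
      using that H.act_bneg[of "haff.e (bin b)" x y] by (simp add: act_to_set_enc bneg_bin)
    show "act (to_set M) (b \<sqinter> c) x y = act (to_set M) b (act (to_set M) c x y) y"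
      if "b \<in> C" "c \<in> C" "x \<in> und M" "y \<in> und M" for b c x y
      using that H.act_bmeet[of "haff.e (bin b)" "haff.e (bin c)" x y]
          by (simp add: act_to_set_enc bmeet_bin)
  qed (simp_all add: cl, simp_all add: act_to_set_enc)
qed

lemma to_set_closed: "to_set M \<in> BJ_sets B"
proof -
  interpret bset B "und M" "act (to_set M)" by (rule bset_to_set)
  note id = identity_in_ops
  have "to_set M \<in> structures (BJ_sig B)"
    unfolding structures_BJ_sig_iff
  proof (intro conjI ballI impI)
    show "sm (und (to_set M))" using M by (simp add: th.theory_models_iff structures_theory_sig_iff)
    show "intp (to_set M) \<in> extensional (syms (BJ_sig B))" by (simp add: to_set_def)
    show "intp (to_set M) (Act b) \<in> (nset 2 \<rightarrow>\<^sub>E und (to_set M)) \<rightarrow>\<^sub>E und (to_set M)" if "b \<in> C" for b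
    proof (rule PiE_I)
      show "intp (to_set M) (Act b) x \<in> und (to_set M)" if x: "x \<in> nset 2 \<rightarrow>\<^sub>E und (to_set M)" for x
        unfolding act_intp[OF x] using PiE_mem[OF x] \<open>b \<in> C\<close> by simp
    qed (use that in \<open>simp add: to_set_def\<close>)
    show "intp (to_set M) (Glue P) \<in> (P \<rightarrow>\<^sub>E und (to_set M)) \<rightarrow>\<^sub>E und (to_set M)"
        if P: "P \<in> topo B" "infinite P" for P
    proof (rule PiE_I)
      show "intp (to_set M) (Glue P) x \<in> und (to_set M)" if x: "x \<in> P \<rightarrow>\<^sub>E und (to_set M)" for x
        using x P PiE_mem[OF x] H.m_closed[OF small_topo[OF P(1)] id[OF P(1)], of x]
            by (simp add: glue_to_set)
    qed (use P in \<open>simp add: to_set_def\<close>)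
  qed
  moreover have "B_set_laws B (to_set M)"
    unfolding B_set_laws_def by (simp add: act_meet)
  moreover have "glue_laws B (to_set M)"
    unfolding glue_laws_def
  proof (intro ballI impI conjI)
    fix P assume P: "P \<in> topo B" "infinite P"
    note sP = small_topo[OF P(1)] and idP = id[OF P(1)]
    have pC: "p \<in> C" if "p \<in> P" for p using that topo_subset[OF P(1)] by blast
    show "intp (to_set M) (Glue P) (\<lambda>b\<in>P. x) = x" if "x \<in> und (to_set M)" for x
    proof -
      have "interp M P (\<lambda>p\<in>P. p) (\<lambda>b\<in>P. x) = interp M P (\<lambda>p\<in>P. p) (\<lambda>b. x)"
        by (rule H.m_cong) simp
      then show ?thesis using that P H.m_const[OF sP idP] by (simp add: glue_to_set)
    qed
    have agree: "act (to_set M) p (interp M P (\<lambda>p\<in>P. p) x) (x p) = x p" if "x \<in> P \<rightarrow>\<^sub>E und M" "p \<in> P"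
        for x p
      using to_set_agree[OF sP idP PiE_mem[OF that(1)] that(2)] that(2) by simp
    show "act (to_set M) b (intp (to_set M) (Glue P) x) (x b) = x b"
        if "x \<in> P \<rightarrow>\<^sub>E und (to_set M)" "b \<in> P" for x b
      using that P agree by (simp add: glue_to_set)
    show "intp (to_set M) (Glue P) (\<lambda>b\<in>P. act (to_set M) b (x b) (y b))
        = intp (to_set M) (Glue P) x"
      if x: "x \<in> P \<rightarrow>\<^sub>E und (to_set M)" and y: "y \<in> P \<rightarrow>\<^sub>E und (to_set M)" for x y
    proof -
      have x': "x \<in> P \<rightarrow>\<^sub>E und M" and xm: "\<And>p. p \<in> P \<Longrightarrow> x p \<in> und M" and ym: "\<And>p. p \<in> P \<Longrightarrow> y p \<in> und M"
        using x y by auto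
      have z: "interp M P (\<lambda>p\<in>P. p) x \<in> und M" using H.m_closed[OF sP idP] xm by blast
      have "interp M P (\<lambda>p\<in>P. p) (\<lambda>b\<in>P. act (to_set M) b (x b) (y b)) = interp M P (\<lambda>p\<in>P. p) x"
      proof (rule to_set_eqI[OF sP idP])
        fix p assume p: "p \<in> P"
        \<comment> \<open>On p the glued element may be replaced by \<open>x p\<close>; hence it
          also satisfies the agreement conditions for the family with entries b(x b, y b).\<close>
        have "act (to_set M) p (interp M P (\<lambda>p\<in>P. p) x) (y p) = act (to_set M) p (x p) (y p)"
          using p pC xm ym z agree[OF x' p] by - (rule act_agree_left, auto)
        then show "act (to_set M) ((\<lambda>p\<in>P. p) p) (interp M P (\<lambda>p\<in>P. p) x)
            ((\<lambda>b\<in>P. act (to_set M) b (x b) (y b)) p)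
            = (\<lambda>b\<in>P. act (to_set M) b (x b) (y b)) p"
          using p pC xm ym z by simp
      qed (use pC xm ym z in auto)
      moreover have "(\<lambda>b\<in>P. act (to_set M) b (x b) (y b)) \<in> P \<rightarrow>\<^sub>E und M" using pC xm ym by auto
      ultimately show ?thesis using P x' by (simp add: glue_to_set)
    qed
  qed
  ultimately show ?thesis by (simp add: BJ_sets_def)
qed

text \<open>The value of \<open>t\<close> in M agrees with \<open>x i\<close> on each weight, and
  this agreement singles out \<open>val\<close>.\<close>

lemma to_model_to_set: "to_model (to_set M) = M"
proof (rule model_eqI)
  interpret bjset B "und M" "act (to_set M)" using bjset_act[OF to_set_closed] by simp
  show "to_model (to_set M) \<in> structures (theory_sig T)" "M \<in> structures (theory_sig T)"
    using to_model_closed[OF to_set_closed] M by (simp_all add: th.theory_models_iff)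
  fix I t x assume I: "sm I" "t \<in> ops T I" and x: "x \<in> I \<rightarrow>\<^sub>E und (to_model (to_set M))"
  then have x: "x \<in> I \<rightarrow>\<^sub>E und M" by simp
  note xm = PiE_mem[OF x]
  have "val I t x = interp M I t x"
    using to_set_agree[OF I xm] H.m_closed[OF I, of x] xm by (intro val_eqI I) auto
  moreover have "intp (to_model (to_set M)) (Opn I t) x = val I t x"
    using I x unfolding to_model_def by simp
  moreover have "interp M I t x = intp M (Opn I t) x"
    using x by (simp add: interp_def PiE_def extensional_restrict)
  ultimately show "intp (to_model (to_set M)) (Opn I t) x = intp M (Opn I t) x" by simp
qed simp

end

lemma to_set_to_model: "M \<in> BJ_sets B \<Longrightarrow> to_set (to_model M) = M"
  by (rule BJ_sets_eqI) (simp_all add: to_set_closed to_model_closed act_to_set interp_to_model_bin)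

lemma BJ_homD:
  assumes "h \<in> homomorphisms (BJ_sig B) M N" "M \<in> BJ_sets B" "N \<in> BJ_sets B"
  shows "x \<in> und M \<Longrightarrow> h x \<in> und N"
    and "\<lbrakk>b \<in> C; x \<in> und M; y \<in> und M\<rbrakk> \<Longrightarrow> h (act M b x y) = act N b (h x) (h y)"
proof -
  show "h x \<in> und N" if "x \<in> und M" for x using assms(1) that by (auto simp: homomorphisms_def)
  assume b: "b \<in> C" "x \<in> und M" "y \<in> und M"
  have "Act b \<in> syms (BJ_sig B)" "(\<lambda>k\<in>nset 2.
      if k = num 1 then x else y) \<in> arity (BJ_sig B) (Act b) \<rightarrow>\<^sub>E und M"
    using b by auto
  then have "h (act M b x y) = intp N (Act b) (\<lambda>i\<in>nset 2. h ((\<lambda>k\<in>nset 2.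
      if k = num 1 then x else y) i))"
    using assms(1) unfolding homomorphisms_def act_def by auto
  also have "\<dots> = act N b (h x) (h y)"
    unfolding act_def by (intro arg_cong[of _ _ "intp N (Act b)"] restrict_ext) auto
  finally show "h (act M b x y) = act N b (h x) (h y)" .
qed

lemma to_model_hom:
  assumes "h \<in> homomorphisms (BJ_sig B) M N" "M \<in> BJ_sets B" "N \<in> BJ_sets B"
  shows "h \<in> homomorphisms (theory_sig T) (to_model M) (to_model N)"
  unfolding th.homomorphisms_iff
proof (intro conjI allI impI)
  show "h \<in> und (to_model M) \<rightarrow>\<^sub>E und (to_model N)" using assms(1) by (simp add: homomorphisms_def)
  fix I t f assume I: "sm I" "t \<in> ops T I" "\<forall>i\<in>I. f i \<in> und (to_model M)"
  then show "h (interp (to_model M) I t f) = interp (to_model N) I t (\<lambda>i. h (f i))"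
    using assms BJ_homD[OF assms] bjset_hom_val[OF bjset_act[OF assms(2)] bjset_act[OF assms(3)],
        of h t I f]
    by (simp add: interp_to_model)
qed

lemma to_set_hom:
  assumes h: "h \<in> homomorphisms (theory_sig T) M N" and M: "M \<in> theory_models T"
      and N: "N \<in> theory_models T"
  shows "h \<in> homomorphisms (BJ_sig B) (to_set M) (to_set N)"
  unfolding homomorphisms_def
proof (intro CollectI conjI ballI)
  have hf: "h \<in> und M \<rightarrow>\<^sub>E und N" and hi: "\<And>I t f. \<lbrakk>sm I; t \<in> ops T I; \<forall>i\<in>I. f i \<in> und M\<rbrakk>
      \<Longrightarrow> h (interp M I t f) = interp N I t (\<lambda>i. h (f i))"
    using h by (simp_all add: th.homomorphisms_iff)
  show "h \<in> und (to_set M) \<rightarrow>\<^sub>E und (to_set N)" using hf by simp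
  fix s x assume s: "s \<in> syms (BJ_sig B)" and x: "x \<in> arity (BJ_sig B) s \<rightarrow>\<^sub>E und (to_set M)"
  have x': "(\<lambda>i\<in>std_arity s. h (x i)) \<in> std_arity s \<rightarrow>\<^sub>E und N" and xm: "\<forall>i\<in>std_arity s. x i \<in> und M"
    using x hf by auto
  have *: "h (interp M I t x) = interp N I t (\<lambda>i\<in>I. h (x i))"
      if "sm I" "t \<in> ops T I" "\<forall>i\<in>I. x i \<in> und M" for I t
    using hi[OF that] by (simp add: interp_def cong: restrict_cong)
  consider b where "b \<in> C" "s = Act b" | P where "P \<in> topo B" "infinite P" "s = Glue P" using s
      by auto
  then show "h (intp (to_set M) s x) = intp (to_set N) s (\<lambda>i\<in>arity (BJ_sig B) s. h (x i))"
  proof cases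
    case 1
    then show ?thesis using x x' xm *[of "nset 2" "bin b"] by (simp add: to_set_def bin_in_ops)
  next
    case 2
    then show ?thesis using x x' xm *[of P "\<lambda>p\<in>P. p"] small_topo[OF 2(1)] identity_in_ops[OF 2(1)]
      by (simp add: to_set_def)
  qed
qed

lemma to_model_functor: "(\<lambda>M\<in>BJ_sets B. to_model M) \<in> concrete_functors (BJ_Set B) (theory_Mod T)"
  by (simp add: concrete_functors_iff to_model_closed to_model_hom)

lemma to_set_functor: "(\<lambda>M\<in>theory_models T. to_set M) \<in> concrete_functors (theory_Mod T) (BJ_Set B)"
  by (simp add: concrete_functors_iff to_set_closed to_set_hom)

end

text \<open>Inverse concrete functors give equal sets of underlying functions as hom-sets, so the
  free object and its generators \<open>\<eta>\<close> can be carried over unchanged.\<close>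

lemma has_free_models_transfer:
  fixes C :: "('u, 'm) concrete_cat" and D :: "('u, 'n) concrete_cat"
  assumes F: "F \<in> concrete_functors C D" and G: "G \<in> concrete_functors D C"
    and GF: "\<And>M. M \<in> cobj C \<Longrightarrow> G (F M) = M" and FG: "\<And>N. N \<in> cobj D \<Longrightarrow> F (G N) = N"
    and free: "has_free_models D"
  shows "has_free_models C"
  unfolding has_free_models_def
proof (intro allI impI)
  fix V :: "'u set" assume "small TYPE('u) V"
  then have "\<exists>N\<in>cobj D. \<exists>\<eta>\<in>V \<rightarrow>\<^sub>E cund D N. \<forall>M\<in>cobj D. \<forall>v\<in>V \<rightarrow>\<^sub>E cund D M.
      \<exists>!h. h \<in> chom D N M \<and> (\<forall>i\<in>V. h (\<eta> i) = v i)"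
    using free unfolding has_free_models_def by simp
  then obtain N \<eta> where N: "N \<in> cobj D" "\<eta> \<in> V \<rightarrow>\<^sub>E cund D N"
    and univ: "\<forall>M\<in>cobj D. \<forall>v\<in>V \<rightarrow>\<^sub>E cund D M. \<exists>!h. h \<in> chom D N M \<and> (\<forall>i\<in>V. h (\<eta> i) = v i)"
    by (elim bexE) (rule that)
  have GN: "G N \<in> cobj C" "cund C (G N) = cund D N" using G N(1)
      by (auto simp: concrete_functors_iff)
  have chom: "chom C (G N) M = chom D N (F M)" if M: "M \<in> cobj C" for M
  proof
    show "chom C (G N) M \<subseteq> chom D N (F M)"
      using F GN(1) M FG[OF N(1)] by (fastforce simp: concrete_functors_iff)
    have "F M \<in> cobj D" using F M by (simp add: concrete_functors_iff)
    then show "chom D N (F M) \<subseteq> chom C (G N) M"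
      using G N(1) GF[OF M] by (fastforce simp: concrete_functors_iff)
  qed
  have "\<exists>!h. h \<in> chom C (G N) M \<and> (\<forall>i\<in>V. h (\<eta> i) = v i)"
    if M: "M \<in> cobj C" and v: "v \<in> V \<rightarrow>\<^sub>E cund C M" for M v
    unfolding chom[OF M] using F M v by (intro univ[rule_format])
        (simp_all add: concrete_functors_iff)
  moreover have "\<eta> \<in> V \<rightarrow>\<^sub>E cund C (G N)" using N(2) GN(2) by simp
  ultimately show "\<exists>F\<in>cobj C. \<exists>\<eta>\<in>V \<rightarrow>\<^sub>E cund C F. \<forall>M\<in>cobj C. \<forall>v\<in>V \<rightarrow>\<^sub>E cund C M.
      \<exists>!h. h \<in> chom C F M \<and> (\<forall>i\<in>V. h (\<eta> i) = v i)"
    using GN(1) by (intro bexI[of _ "G N"] bexI[of _ \<eta>] ballI)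
qed

section \<open>An equational presentation of B_J-sets\<close>

definition act_term :: "'u \<Rightarrow> ('u, 'u symbol) trm \<Rightarrow> ('u, 'u symbol) trm \<Rightarrow> ('u, 'u symbol) trm" where
  "act_term b t u = App (Act b) (\<lambda>k. if k = num 1 then t else u)"

lemma evalt_act_term [simp]:
  "evalt (BJ_sig B) M v (act_term b t u) = act M b (evalt (BJ_sig B) M v t)
      (evalt (BJ_sig B) M v u)"
  unfolding act_term_def act_def by (simp add: if_distrib cong: restrict_cong)

context grbalgebra
begin

lemma act_term_closed:
  "\<lbrakk>b \<in> C; t \<in> terms (BJ_sig B) V; u \<in> terms (BJ_sig B) V\<rbrakk> \<Longrightarrow> act_term b t u \<in> terms (BJ_sig B) V"
  unfolding act_term_def by (rule terms.intros) auto

lemma Glue_term_closed: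
  "\<lbrakk>P \<in> topo B; infinite P; \<And>p. p \<in> P \<Longrightarrow> f p \<in> terms (BJ_sig B) V\<rbrakk>
      \<Longrightarrow> App (Glue P) f \<in> terms (BJ_sig B) V"
  by (rule terms.intros) auto

text \<open>Taking all valid equations makes soundness trivial; only the laws have to be derived.\<close>

definition BJ_equations :: "('u set \<times> ('u, 'u symbol) trm \<times> ('u, 'u symbol) trm) set" where
  "BJ_equations = {(V, l, r). sm V \<and> l \<in> terms (BJ_sig B) V \<and> r \<in> terms (BJ_sig B) V \<and>
     (\<forall>M\<in>BJ_sets B. \<forall>v\<in>V \<rightarrow>\<^sub>E und M. evalt (BJ_sig B) M v l = evalt (BJ_sig B) M v r)}"

lemma models_BJ_equationsD:
  assumes "M \<in> models (BJ_sig B) BJ_equations" "sm V" "l \<in> terms (BJ_sig B) V"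
      "r \<in> terms (BJ_sig B) V"
    and "\<And>N v. N \<in> BJ_sets B \<Longrightarrow> v \<in> V \<rightarrow>\<^sub>E und N \<Longrightarrow> evalt (BJ_sig B) N v l = evalt (BJ_sig B) N v r"
    and "v \<in> V \<rightarrow>\<^sub>E und M"
  shows "evalt (BJ_sig B) M v l = evalt (BJ_sig B) M v r"
proof -
  have "(V, l, r) \<in> BJ_equations" using assms(2-5) by (simp add: BJ_equations_def)
  then show ?thesis using assms(1,6) unfolding models_def by blast
qed

lemma models_BJ_equations_B_set_laws:
  assumes M: "M \<in> models (BJ_sig B) BJ_equations"
  shows "B_set_laws B M"
  unfolding B_set_laws_def
proof (intro ballI)
  fix b x y z assume b: "b \<in> C" and xyz: "x \<in> und M" "y \<in> und M" "z \<in> und M"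
  \<comment> \<open>The three variables stand for x, y and z. In this context each law is an
    equation valid in all B_J-sets, hence a member of \<open>BJ_equations\<close>.\<close>
  define V :: "'u set" where "V = {num 1, num 2, num 3}"
  define v where "v = (\<lambda>k\<in>V. if k = num 1 then x else if k = num 2 then y else z)"
  have V: "sm V" unfolding V_def by (rule small_finite[OF universe]) simp
  have v: "v \<in> V \<rightarrow>\<^sub>E und M" using xyz by (auto simp: v_def)
  let ?x = "Var (num 1 :: 'u) :: ('u, 'u symbol) trm"
      and ?y = "Var (num 2 :: 'u) :: ('u, 'u symbol) trm"
    and ?z = "Var (num 3 :: 'u) :: ('u, 'u symbol) trm"
  have tms: "?x \<in> terms (BJ_sig B) V" "?y \<in> terms (BJ_sig B) V" "?z \<in> terms (BJ_sig B) V"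
    by (auto simp: V_def intro: terms.intros)
  have vars: "v (num 1) = x" "v (num 2) = y" "v (num 3) = z"
    by (auto simp: v_def V_def)
  note eq = models_BJ_equationsD[OF M V _ _ _ v]
  have var: "w (num 1) \<in> und N" "w (num 2) \<in> und N" "w (num 3) \<in> und N" if "w \<in> V \<rightarrow>\<^sub>E und N" for w
      and N :: "'u mdl"
    using that by (auto simp: V_def)
  have laws: "act N b x x = x" "act N b (act N b x y) z = act N b x z"
     "act N b x (act N b y z) = act N b x z" "act N \<top> x y = x" "act N (\<sim> b) x y = act N b y x"
     "c \<in> C \<Longrightarrow> act N (b \<sqinter> c) x y = act N b (act N c x y) y"
    if N: "N \<in> BJ_sets B" and "x \<in> und N" "y \<in> und N" "z \<in> und N" for N and x y z c :: 'u
  proof -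
    interpret bset B "und N" "act N" by (rule bset_act[OF N])
    show "act N b x x = x" "act N b (act N b x y) z = act N b x z"
     "act N b x (act N b y z) = act N b x z" "act N \<top> x y = x" "act N (\<sim> b) x y = act N b y x"
     "c \<in> C \<Longrightarrow> act N (b \<sqinter> c) x y = act N b (act N c x y) y"
      using that b by (simp_all add: act_meet)
  qed
  note tm = act_term_closed tms closed b
  have "evalt (BJ_sig B) M v (act_term b ?x ?x) = evalt (BJ_sig B) M v (?x)"
  proof (rule eq)
    show "evalt (BJ_sig B) N w (act_term b ?x ?x) = evalt (BJ_sig B) N w (?x)"
      if "N \<in> BJ_sets B" "w \<in> V \<rightarrow>\<^sub>E und N" for N w
      unfolding evalt_act_term evalt.simps by (rule laws(1)[OF that(1) var[OF that(2)]])
  qed (intro tm)+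
  moreover have "evalt (BJ_sig B) M v (act_term b (act_term b ?x ?y) ?z)
      = evalt (BJ_sig B) M v (act_term b ?x ?z)"
  proof (rule eq)
    show "evalt (BJ_sig B) N w (act_term b (act_term b ?x ?y) ?z)
        = evalt (BJ_sig B) N w (act_term b ?x ?z)"
      if "N \<in> BJ_sets B" "w \<in> V \<rightarrow>\<^sub>E und N" for N w
      unfolding evalt_act_term evalt.simps by (rule laws(2)[OF that(1) var[OF that(2)]])
  qed (intro tm)+
  moreover have "evalt (BJ_sig B) M v (act_term b ?x (act_term b ?y ?z))
      = evalt (BJ_sig B) M v (act_term b ?x ?z)"
  proof (rule eq)
    show "evalt (BJ_sig B) N w (act_term b ?x (act_term b ?y ?z))
        = evalt (BJ_sig B) N w (act_term b ?x ?z)"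
      if "N \<in> BJ_sets B" "w \<in> V \<rightarrow>\<^sub>E und N" for N w
      unfolding evalt_act_term evalt.simps by (rule laws(3)[OF that(1) var[OF that(2)]])
  qed (intro tm)+
  moreover have "evalt (BJ_sig B) M v (act_term \<top> ?x ?y) = evalt (BJ_sig B) M v (?x)"
  proof (rule eq)
    show "evalt (BJ_sig B) N w (act_term \<top> ?x ?y) = evalt (BJ_sig B) N w (?x)"
      if "N \<in> BJ_sets B" "w \<in> V \<rightarrow>\<^sub>E und N" for N w
      unfolding evalt_act_term evalt.simps by (rule laws(4)[OF that(1) var[OF that(2)]])
  qed (intro tm)+
  moreover have "evalt (BJ_sig B) M v (act_term (\<sim> b) ?x ?y)
      = evalt (BJ_sig B) M v (act_term b ?y ?x)"
  proof (rule eq)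
    show "evalt (BJ_sig B) N w (act_term (\<sim> b) ?x ?y) = evalt (BJ_sig B) N w (act_term b ?y ?x)"
      if "N \<in> BJ_sets B" "w \<in> V \<rightarrow>\<^sub>E und N" for N w
      unfolding evalt_act_term evalt.simps by (rule laws(5)[OF that(1) var[OF that(2)]])
  qed (intro tm)+
  moreover have "evalt (BJ_sig B) M v (act_term (b \<sqinter> c) ?x ?y)
      = evalt (BJ_sig B) M v (act_term b (act_term c ?x ?y) ?y)" if c: "c \<in> C" for c
  proof (rule eq)
    show "evalt (BJ_sig B) N w (act_term (b \<sqinter> c) ?x ?y)
        = evalt (BJ_sig B) N w (act_term b (act_term c ?x ?y) ?y)"
      if "N \<in> BJ_sets B" "w \<in> V \<rightarrow>\<^sub>E und N" for N w
      unfolding evalt_act_term evalt.simps by (rule laws(6)[OF that(1) var[OF that(2)] c])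
  qed (intro tm c)+
  ultimately show "act M b x x = x \<and> act M b (act M b x y) z = act M b x z \<and>
      act M b x (act M b y z) = act M b x z \<and> act M \<top> x y = x \<and> act M (\<sim> b) x y = act M b y x \<and>
      (\<forall>c\<in>C. act M (b \<sqinter> c) x y = act M b (act M c x y) y)"
    by (simp only: evalt_act_term evalt.simps vars) blast
qed

lemma models_BJ_equations_glue_laws:
  assumes M: "M \<in> models (BJ_sig B) BJ_equations"
  shows "glue_laws B M"
  unfolding glue_laws_def
proof (intro ballI impI conjI)
  note inj_pair[OF universe, THEN inj_eq, simp]
  fix P assume P: "P \<in> topo B" "infinite P"
  have PC: "p \<in> C" if "p \<in> P" for p using topo_subset[OF P(1)] that by blast
  have sP: "sm P" by (rule small_topo[OF P(1)])
  note tm = act_term_closed Glue_term_closed[OF P] terms.intros(1)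
  have rP: "restrict w P = w" if "w \<in> P \<rightarrow>\<^sub>E Y" for w and Y :: "'u set"
    using that by (simp add: PiE_def extensional_restrict)
  show "intp M (Glue P) (\<lambda>b\<in>P. x) = x" if x: "x \<in> und M" for x
  proof -
    let ?v = "\<lambda>k\<in>{num 1 :: 'u}. x"
    have "evalt (BJ_sig B) M ?v (App (Glue P) (\<lambda>_. Var (num 1)))
        = evalt (BJ_sig B) M ?v (Var (num 1))"
    proof (rule models_BJ_equationsD[OF M, of "{num 1}"])
      show "sm {num 1}" by (rule small_finite[OF universe]) simp
      show "evalt (BJ_sig B) N v (App (Glue P) (\<lambda>_. Var (num 1)))
          = evalt (BJ_sig B) N v (Var (num 1))"
        if "N \<in> BJ_sets B" "v \<in> {num 1} \<rightarrow>\<^sub>E und N" for N v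
        using glue_laws(1)[OF that(1) P PiE_mem[OF that(2)]] by simp
    qed (use x in \<open>auto intro: tm\<close>)
    then show ?thesis by simp
  qed
  show "act M b (intp M (Glue P) x) (x b) = x b" if x: "x \<in> P \<rightarrow>\<^sub>E und M" and b: "b \<in> P" for x b
  proof -
    have "evalt (BJ_sig B) M x (act_term b (App (Glue P) Var) (Var b))
        = evalt (BJ_sig B) M x (Var b)"
    proof (rule models_BJ_equationsD[OF M sP _ _ _ x])
      show "evalt (BJ_sig B) N v (act_term b (App (Glue P) Var) (Var b))
          = evalt (BJ_sig B) N v (Var b)"
        if "N \<in> BJ_sets B" "v \<in> P \<rightarrow>\<^sub>E und N" for N v
        using glue_laws(3)[OF that(1) P that(2) b] rP[OF that(2)] by simp
    qed (use b PC in \<open>auto intro!: tm\<close>)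
    then show ?thesis using rP[OF x] by simp
  qed
  show "intp M (Glue P) (\<lambda>b\<in>P. act M b (x b) (y b)) = intp M (Glue P) x"
    if x: "x \<in> P \<rightarrow>\<^sub>E und M" and y: "y \<in> P \<rightarrow>\<^sub>E und M" for x y
  proof -
    \<comment> \<open>The law involves two families of variables indexed by P, so the context is
      made of two coded copies of P.\<close>
    define V where "V = pair ` ({num 1 :: 'u, num 2} \<times> P)"
    have V: "sm V"
      unfolding V_def by (rule small_image[OF small_Times[OF universe small_finite[OF universe]
          sP]]) simp
    have pV: "pair (num 1, p) \<in> V" "pair (num 2, p) \<in> V" if "p \<in> P" for p using that
        by (auto simp: V_def)
    define v where "v = (\<lambda>k\<in>V. case inv pair k of (n, p) \<Rightarrow> if n = num 1 then x p else y p)"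
    have v: "v \<in> V \<rightarrow>\<^sub>E und M"
      using x y inj_pair[OF universe] by (auto simp: v_def V_def)
    have vp: "v (pair (num 1, p)) = x p" "v (pair (num 2, p)) = y p" if "p \<in> P" for p
      using pV[OF that] inj_pair[OF universe] by (simp_all add: v_def)
    let ?l = "App (Glue P) (\<lambda>p. act_term p (Var (pair (num 1, p))) (Var (pair (num 2, p))))"
      and ?r = "App (Glue P) (\<lambda>p. Var (pair (num 1, p)))"
    have ev: "evalt (BJ_sig B) N w ?l = intp N (Glue P)
        (\<lambda>p\<in>P. act N p ((\<lambda>p\<in>P. w (pair (num 1, p))) p) ((\<lambda>p\<in>P. w (pair (num 2, p))) p))"
      "evalt (BJ_sig B) N w ?r = intp N (Glue P) (\<lambda>p\<in>P. w (pair (num 1, p)))" for N w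
      by (simp_all cong: restrict_cong)
    have E: "evalt (BJ_sig B) M v ?l = evalt (BJ_sig B) M v ?r"
    proof (rule models_BJ_equationsD[OF M V _ _ _ v])
      show "evalt (BJ_sig B) N w ?l = evalt (BJ_sig B) N w ?r" if "N \<in> BJ_sets B" "w \<in> V \<rightarrow>\<^sub>E und N"
          for N w
        unfolding ev using that pV by (intro glue_laws(2)[OF _ P]) auto
    qed (use pV PC in \<open>auto intro!: tm\<close>)
    have e1: "(\<lambda>p\<in>P. v (pair (num 1, p))) = restrict x P"
      by (rule restrict_ext) (rule vp(1))
    have e2: "(\<lambda>p\<in>P. act M p ((\<lambda>p\<in>P. v (pair (num 1, p))) p) ((\<lambda>p\<in>P. v (pair (num 2, p))) p))
        = (\<lambda>p\<in>P. act M p (x p) (y p))"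
      by (rule restrict_ext) (simp only: restrict_apply' vp)
    have "intp M (Glue P) (\<lambda>p\<in>P. act M p (x p) (y p)) = intp M (Glue P) (restrict x P)"
      using E unfolding ev by (simp only: e1[symmetric] e2[symmetric])
    then show ?thesis by (simp only: rP[OF x])
  qed
qed

lemma models_BJ_equations: "models (BJ_sig B) BJ_equations = BJ_sets B"
proof
  show "models (BJ_sig B) BJ_equations \<subseteq> BJ_sets B"
    using models_BJ_equations_B_set_laws models_BJ_equations_glue_laws
        by (auto simp: BJ_sets_def models_def)
  show "BJ_sets B \<subseteq> models (BJ_sig B) BJ_equations"
  proof
    fix M assume M: "M \<in> BJ_sets B"
    then have "M \<in> structures (BJ_sig B)" by (simp add: BJ_sets_def)
    then show "M \<in> models (BJ_sig B) BJ_equations"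
      using M unfolding models_def BJ_equations_def by blast
  qed
qed

lemma has_free_models_BJ_Set: "has_free_models (BJ_Set B)"
  by (rule has_free_models_transfer[OF to_model_functor to_set_functor _ _
      th.has_free_models_theory_Mod])
    (simp_all add: to_model_closed to_set_closed to_set_to_model to_model_to_set)

lemma variety_BJ_Set: "variety (BJ_Set B)"
proof -
  have "\<forall>s\<in>syms (BJ_sig B). sm (arity (BJ_sig B) s)"
    using small_topo by auto
  moreover have "\<forall>(V, l, r)\<in>BJ_equations. sm V \<and> l \<in> terms (BJ_sig B) V \<and> r \<in> terms (BJ_sig B) V"
    by (auto simp: BJ_equations_def)
  moreover have "BJ_Set B = concrete_cat_of (BJ_sig B) (models (BJ_sig B) BJ_equations)"
    unfolding models_BJ_equations by (simp add: BJ_Set_def BJ_sets_def)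
  ultimately show ?thesis
    unfolding variety_def
    by (intro conjI has_free_models_BJ_Set exI[of _ "BJ_sig B"] exI[of _ BJ_equations])
qed

lemma iso_to_model: "iso_in VAR (BJ_Set B) (theory_Mod T) (\<lambda>M\<in>BJ_sets B. to_model M)"
  unfolding iso_in_def
proof (intro conjI bexI)
  show "(\<lambda>M\<in>BJ_sets B. to_model M) \<in> hom VAR (BJ_Set B) (theory_Mod T)"
    "(\<lambda>M\<in>theory_models T. to_set M) \<in> hom VAR (theory_Mod T) (BJ_Set B)"
    using to_model_functor to_set_functor by simp_all
qed (auto simp: to_model_closed to_set_closed to_set_to_model to_model_to_set)

end

section \<open>The functor of sets\<close>

lemma grbalgebraI: "universe TYPE('u) \<Longrightarrow> B \<in> ob grBAlg \<Longrightarrow> grbalgebra B" for B :: "'u gbalg"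
  by (simp add: grbalgebra_def balgebra_def grbalgebra_axioms_def)

lemma Set_functor_fob [simp]: "fob Set_functor = BJ_Set"
  by (simp add: Set_functor_def)

context
  fixes A B :: "'u gbalg" and f
  assumes U: "universe TYPE('u)" and A: "A \<in> ob grBAlg" and B: "B \<in> ob grBAlg"
      and f: "f \<in> hom grBAlg A B"
begin

interpretation A: grbalgebra A by (rule grbalgebraI[OF U A])
interpretation B: grbalgebra B by (rule grbalgebraI[OF U B])

lemma Set_functor_far_eqI:
  assumes M: "M \<in> BJ_sets B" and N: "N \<in> BJ_sets A" "und N = und M"
    and act: "\<And>b x y. b \<in> bcarrier A \<Longrightarrow> x \<in> und M \<Longrightarrow> y \<in> und M \<Longrightarrow> act N b x y = act M (f b) x y"
  shows "far Set_functor A B f M = N"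
proof -
  have "(THE N. N \<in> cobj (BJ_Set A) \<and> und N = und M \<and>
      (\<forall>b\<in>bcarrier A. \<forall>x\<in>und M. \<forall>y\<in>und M. act N b x y = act M (f b) x y)) = N"
  proof (rule the_equality)
    fix N' assume N': "N' \<in> cobj (BJ_Set A) \<and> und N' = und M \<and>
      (\<forall>b\<in>bcarrier A. \<forall>x\<in>und M. \<forall>y\<in>und M. act N' b x y = act M (f b) x y)"
    then show "N' = N" using N act by (intro A.BJ_sets_eqI) auto
  qed (use N act in simp)
  then show ?thesis using M by (simp add: Set_functor_def)
qed

text \<open>Existence for the definite description: pass to a model of the theory of B, pull back
  along the theory homomorphism induced by \<open>f\<close>, and return to sets over A. The detour
  supplies the operations \<open>Glue P\<close> over A.\<close>

lemma Set_functor_far: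
  assumes M: "M \<in> BJ_sets B"
  defines "N \<equiv> A.to_set (pullback_model A.T (far T_functor A B f) (B.to_model M))"
  shows "far Set_functor A B f M = N" and "N \<in> BJ_sets A" and "und N = und M"
    and "\<lbrakk>b \<in> bcarrier A; x \<in> und M; y \<in> und M\<rbrakk> \<Longrightarrow> act N b x y = act M (f b) x y"
proof -
  have fh: "f \<in> boolean_homs A B" using f by simp
  have th: "far T_functor A B f \<in> theory_homs A.T B.T"
    by (rule far_T_functor_hom[OF A.grbalgebra_axioms B.grbalgebra_axioms f])
  note s = A.th.set_theory_of_axioms B.th.set_theory_of_axioms
  have und: "und (pullback_model A.T (far T_functor A B f) (B.to_model M)) = und M"
    by (simp add: pullback_model_def)
  have p: "pullback_model A.T (far T_functor A B f) (B.to_model M) \<in> theory_models A.T"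
    by (rule pullback_model_closed[OF s th B.to_model_closed[OF M]])
  show N: "N \<in> BJ_sets A" unfolding N_def by (rule A.to_set_closed[OF p])
  show uN: "und N = und M" unfolding N_def by (simp only: A.und_to_set und)
  have act: "act N b x y = act M (f b) x y" if b: "b \<in> bcarrier A" and x: "x \<in> und M" "y \<in> und M"
      for b x y
  proof -
    have fb: "f b \<in> bcarrier B" using hom_closed[OF fh b] .
    have "far T_functor A B f (nset 2) (A.bin b) = (\<lambda>i\<in>nset 2. f (A.bin b i))"
      using A.bin_in_ops[OF b] by simp
    also have "\<dots> = B.bin (f b)"
      using hom_neg[OF fh b] by (auto simp: A.bin_def B.bin_def fun_eq_iff)
    finally have "far T_functor A B f (nset 2) (A.bin b) = B.bin (f b)" .
    moreover have "act N b x y = interp (B.to_model M) (nset 2)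
        (far T_functor A B f (nset 2) (A.bin b)) (sel x y)"
      unfolding N_def using b x A.bin_in_ops[OF b]
      by (simp add: A.act_to_set und interp_pullback_model[OF s] sel_def del: T_functor_simps)
    ultimately show ?thesis using B.interp_to_model_bin[OF M fb x] by simp
  qed
  then show "\<lbrakk>b \<in> bcarrier A; x \<in> und M; y \<in> und M\<rbrakk> \<Longrightarrow> act N b x y = act M (f b) x y" .
  show "far Set_functor A B f M = N" by (rule Set_functor_far_eqI[OF M N uN act])
qed

text \<open>The naturality square of the comparison: \<open>A.to_model\<close> cancels the
  \<open>A.to_set\<close> in \<open>Set_functor_far\<close>.\<close>

lemma to_model_Set_functor_far:
  assumes M: "M \<in> BJ_sets B"
  shows "A.to_model (far Set_functor A B f M)
      = pullback_model A.T (far T_functor A B f) (B.to_model M)"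
  unfolding Set_functor_far(1)[OF M]
  by (rule A.to_model_to_set, rule pullback_model_closed)
    (fact A.th.set_theory_of_axioms B.th.set_theory_of_axioms
      far_T_functor_hom[OF A.grbalgebra_axioms B.grbalgebra_axioms f] B.to_model_closed[OF M])+

lemma Set_functor_far_hom: "far Set_functor A B f \<in> concrete_functors (BJ_Set B) (BJ_Set A)"
proof -
  have th: "far T_functor A B f \<in> theory_homs A.T B.T"
    by (rule far_T_functor_hom[OF A.grbalgebra_axioms B.grbalgebra_axioms f])
  note s = A.th.set_theory_of_axioms B.th.set_theory_of_axioms
  have "far Set_functor A B f \<in> extensional (BJ_sets B)" by (simp add: Set_functor_def)
  moreover have "far Set_functor A B f M \<in> BJ_sets A" "und (far Set_functor A B f M) = und M"
      if "M \<in> BJ_sets B" for M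
    unfolding Set_functor_far(1)[OF that] by (rule Set_functor_far(2,3)[OF that])+
  moreover have "h \<in> homomorphisms (BJ_sig A) (far Set_functor A B f M) (far Set_functor A B f N)"
    if M: "M \<in> BJ_sets B" and N: "N \<in> BJ_sets B" and h: "h \<in> homomorphisms (BJ_sig B) M N" for M N h
  proof -
    note p = pullback_model_functor[OF s th]
    have c: "B.to_model M \<in> theory_models B.T" "B.to_model N \<in> theory_models B.T"
      using M N by (simp_all add: B.to_model_closed)
    have "h \<in> homomorphisms (theory_sig B.T) (B.to_model M) (B.to_model N)"
        by (rule B.to_model_hom[OF h M N])
    then have "h \<in> homomorphisms (theory_sig A.T) (pullback_model A.T (far T_functor A B f)
        (B.to_model M))
        (pullback_model A.T (far T_functor A B f) (B.to_model N))"
      using p c pullback_model_closed[OF s th]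
          by (simp add: concrete_functors_iff del: T_functor_simps)
    then show ?thesis
      unfolding Set_functor_far(1)[OF M] Set_functor_far(1)[OF N]
      by (rule A.to_set_hom) (rule pullback_model_closed[OF s th] c)+
  qed
  ultimately show ?thesis by (simp add: concrete_functors_iff)
qed

end

lemma is_functor_Set_functor:
  assumes U: "universe TYPE('u)"
  shows "is_functor (grBAlg :: ('u gbalg, _) cat) (op_cat VAR) Set_functor"
  unfolding is_functor_def
proof (intro conjI ballI)
  show "category (grBAlg :: ('u gbalg, _) cat)" by (rule category_grBAlg)
  show "category (op_cat VAR :: ('u ccat, _) cat)" by (rule category_op_cat[OF category_VAR])
  show "fob Set_functor B \<in> ob (op_cat VAR)" if "B \<in> ob grBAlg" for B :: "'u gbalg"
    using grbalgebra.variety_BJ_Set[OF grbalgebraI[OF U that]] by simp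
  show "far Set_functor A B f \<in> hom (op_cat VAR) (fob Set_functor A) (fob Set_functor B)"
    if "A \<in> ob grBAlg" "B \<in> ob grBAlg" "f \<in> hom grBAlg A B" for A B :: "'u gbalg" and f
    using Set_functor_far_hom[OF U that] by simp
  show "far Set_functor B B (idt grBAlg B) = idt (op_cat VAR) (fob Set_functor B)"
      if B: "B \<in> ob grBAlg" for B :: "'u gbalg"
  proof (rule extensionalityI[of _ "BJ_sets B"])
    have id: "idt grBAlg B \<in> hom grBAlg B B" by (rule cat_idt[OF category_grBAlg B])
    show "far Set_functor B B (idt grBAlg B) M = idt (op_cat VAR) (fob Set_functor B) M"
        if M: "M \<in> BJ_sets B" for M
      using M Set_functor_far_eqI[OF U B B id M M] by simp
  qed (simp_all add: Set_functor_def)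
  show "far Set_functor A C (cmp grBAlg A B C g f) =
      cmp (op_cat VAR) (fob Set_functor A) (fob Set_functor B) (fob Set_functor C)
          (far Set_functor B C g) (far Set_functor A B f)"
    if obs: "A \<in> ob grBAlg" "B \<in> ob grBAlg" "C \<in> ob grBAlg" and f: "f \<in> hom grBAlg A B"
        and g: "g \<in> hom grBAlg B C"
    for A B C :: "'u gbalg" and f g
  proof (rule extensionalityI[of _ "BJ_sets C"])
    have gf: "cmp grBAlg A B C g f \<in> hom grBAlg A C" by (rule cat_cmp[OF category_grBAlg obs f g])
    fix M assume M: "M \<in> BJ_sets C"
    note Mg = Set_functor_far[OF U obs(2,3) g M]
    define N where "N = far Set_functor B C g M"
    have N: "N \<in> BJ_sets B" "und N = und M"
      "\<And>b x y. b \<in> bcarrier B \<Longrightarrow> x \<in> und M \<Longrightarrow> y \<in> und M \<Longrightarrow> act N b x y = act M (g b) x y"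
      unfolding N_def using Mg by simp_all
    define K where "K = far Set_functor A B f N"
    have K: "K \<in> BJ_sets A" "und K = und N"
      "\<And>b x y. b \<in> bcarrier A \<Longrightarrow> x \<in> und N \<Longrightarrow> y \<in> und N \<Longrightarrow> act K b x y = act N (f b) x y"
      unfolding K_def using Set_functor_far[OF U obs(1,2) f N(1)] by simp_all
    have "far Set_functor A C (cmp grBAlg A B C g f) M = K"
      using N K hom_closed[of f A B] f by (intro Set_functor_far_eqI[OF U obs(1,3) gf M]) simp_all
    then show "far Set_functor A C (cmp grBAlg A B C g f) M =
      cmp (op_cat VAR) (fob Set_functor A) (fob Set_functor B) (fob Set_functor C)
          (far Set_functor B C g) (far Set_functor A B f) M"
      using M by (simp add: K_def N_def del: grBAlg_simps)
  qed (simp_all add: Set_functor_def)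
qed

text \<open>The components \<open>to_model\<close> lead from B_J-sets to models; in the opposite
  category this is the direction from the composite to \<open>Set_functor\<close>.\<close>

lemma natural_iso_Mod_T_Set:
  assumes U: "universe TYPE('u)"
  shows "naturally_isomorphic (grBAlg :: ('u gbalg, _) cat) (op_cat VAR)
      (Mod_functor \<circ>\<^sub>F T_functor) Set_functor"
  unfolding naturally_isomorphic_def
proof (intro conjI exI[of _ "\<lambda>B. \<lambda>M\<in>BJ_sets B. grbalgebra.to_model B M"] ballI)
  show "is_functor (grBAlg :: ('u gbalg, _) cat) (op_cat VAR) (Mod_functor \<circ>\<^sub>F T_functor)"
    using fully_faithful_comp[OF fully_faithful_T_functor[OF U] fully_faithful_Mod_functor[OF U]]
    by (simp add: fully_faithful_def)
  show "is_functor (grBAlg :: ('u gbalg, _) cat) (op_cat VAR) Set_functor"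
    by (rule is_functor_Set_functor[OF U])
  show "iso_in (op_cat VAR) (fob (Mod_functor \<circ>\<^sub>F T_functor) B) (fob Set_functor B)
      (\<lambda>M\<in>BJ_sets B. grbalgebra.to_model B M)"
    if "B \<in> ob grBAlg" for B :: "'u gbalg"
    using grbalgebra.iso_to_model[OF grbalgebraI[OF U that]] by simp
  show "cmp (op_cat VAR) (fob (Mod_functor \<circ>\<^sub>F T_functor) A) (fob (Mod_functor \<circ>\<^sub>F T_functor) B)
      (fob Set_functor B)
        (\<lambda>M\<in>BJ_sets B. grbalgebra.to_model B M) (far (Mod_functor \<circ>\<^sub>F T_functor) A B f) =
      cmp (op_cat VAR) (fob (Mod_functor \<circ>\<^sub>F T_functor) A) (fob Set_functor A) (fob Set_functor B)
        (far Set_functor A B f) (\<lambda>M\<in>BJ_sets A. grbalgebra.to_model A M)"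
    if A: "A \<in> ob grBAlg" and B: "B \<in> ob grBAlg" and f: "f \<in> hom grBAlg A B" for A B :: "'u gbalg"
        and f
  proof -
    have "far Set_functor A B f M \<in> BJ_sets A" if "M \<in> BJ_sets B" for M
      using Set_functor_far(1,2)[OF U A B f that] by simp
    then show ?thesis
      using to_model_Set_functor_far[OF U A B f] grbalgebra.to_model_closed[OF grbalgebraI[OF U B]]
      by (simp del: T_functor_simps(2) add: T_functor_simps(1) cong: restrict_cong)
  qed
qed

section \<open>Boolean algebras with the finite topology\<close>

lemma finite_topology_simps [simp]:
  "bcarrier (finite_topology B) = bcarrier B" "bmeet (finite_topology B) = bmeet B"
  "bjoin (finite_topology B) = bjoin B" "bneg (finite_topology B) = bneg B"
  "bzero (finite_topology B) = bzero B" "bone (finite_topology B) = bone B"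
  "topo (finite_topology B) = {P. partition_of B P \<and> finite P}"
  by (simp_all add: finite_topology_def balg.defs)

lemma finite_topology_transfer [simp]:
  "boolean_alg (finite_topology B) = boolean_alg B"
  "boolean_homs (finite_topology B) (finite_topology C) = boolean_homs B C"
  "is_lub (finite_topology B) = is_lub B" "bsup (finite_topology B) = bsup B"
  "partition_of (finite_topology B) = partition_of B"
proof -
  have le: "ble (finite_topology B) = ble B" by (simp add: ble_def fun_eq_iff)
  show lub: "is_lub (finite_topology B) = is_lub B" by (simp add: is_lub_def fun_eq_iff le)
  show "bsup (finite_topology B) = bsup B" by (simp add: bsup_def fun_eq_iff lub)
  show "partition_of (finite_topology B) = partition_of B"
      by (simp add: partition_of_def fun_eq_iff lub)
qed (simp_all add: boolean_alg_def boolean_homs_def)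

context balgebra
begin

text \<open>For the join, \<open>cover_le\<close> is used twice: an upper bound of all
  \<open>b \<sqinter> c\<close> is above each b because \<open>Q b\<close> is a cover, and then
  above top because P is one.\<close>

lemma partition_refine:
  assumes P: "partition_of B P" and Q: "\<And>b. b \<in> P \<Longrightarrow> partition_of B (Q b)"
  shows "partition_of B ({b \<sqinter> c | b c. b \<in> P \<and> c \<in> Q b} - {\<bottom>})"
  unfolding partition_of_iff is_lub_diff_bot
proof (intro conjI ballI impI)
  have PC [simp]: "b \<in> C" if "b \<in> P" for b using P that by (auto simp: partition_of_iff)
  have QC [simp]: "c \<in> C" if "b \<in> P" "c \<in> Q b" for b c using Q[OF that(1)] that(2)
      by (auto simp: partition_of_iff)
  show "{b \<sqinter> c | b c. b \<in> P \<and> c \<in> Q b} - {\<bottom>} \<subseteq> C" by auto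
  show "is_lub B {b \<sqinter> c | b c. b \<in> P \<and> c \<in> Q b} \<top>"
    unfolding is_lub_def
  proof (intro conjI ballI impI)
    show "\<top> \<sqsubseteq> a" if a: "a \<in> C" "\<forall>s\<in>{b \<sqinter> c | b c. b \<in> P \<and> c \<in> Q b}. s \<sqsubseteq> a" for a
    proof (rule cover_le[of P])
      show "b \<sqinter> \<top> \<sqsubseteq> a" if b: "b \<in> P" for b
      proof (rule cover_le[of "Q b"])
        show "c \<sqinter> (b \<sqinter> \<top>) \<sqsubseteq> a" if c: "c \<in> Q b" for c
        proof -
          have "c \<sqinter> (b \<sqinter> \<top>) = b \<sqinter> c" using b c by (simp add: meet_commute)
          then show ?thesis using a(2) b c by auto
        qed
      qed (use Q[OF b] a b in \<open>auto simp: partition_of_iff\<close>)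
    qed (use P a in \<open>auto simp: partition_of_iff\<close>)
  qed auto
  fix x y assume "x \<in> {b \<sqinter> c | b c. b \<in> P \<and> c \<in> Q b} - {\<bottom>}"
      "y \<in> {b \<sqinter> c | b c. b \<in> P \<and> c \<in> Q b} - {\<bottom>}" "x \<noteq> y"
  then obtain b c b' c' where xy: "x = b \<sqinter> c" "b \<in> P" "c \<in> Q b" "y = b' \<sqinter> c'" "b' \<in> P" "c' \<in> Q b'"
      "b \<noteq> b' \<or> c \<noteq> c'"
    by auto
  have "x \<sqinter> y = (b \<sqinter> b') \<sqinter> (c \<sqinter> c')" using xy by (simp add: meet_ac)
  also have "\<dots> = \<bottom>"
  proof (cases "b = b'")
    case True
    then have "c \<sqinter> c' = \<bottom>" using Q[OF xy(2)] xy by (auto simp: partition_of_iff)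
    then show ?thesis using xy by simp
  next
    case False
    then have "b \<sqinter> b' = \<bottom>" using P xy by (auto simp: partition_of_iff)
    then show ?thesis using xy by simp
  qed
  finally show "x \<sqinter> y = \<bottom>" .
qed auto

lemma partition_coarsen:
  assumes P: "partition_of B P" and lub: "\<And>i. i \<in> \<alpha> ` P \<Longrightarrow> is_lub B {b \<in> P. \<alpha> b = i} (a i)"
  shows "partition_of B (a ` \<alpha> ` P)"
  unfolding partition_of_iff
proof (intro conjI ballI impI)
  have PC [simp]: "b \<in> C" if "b \<in> P" for b using P that by (auto simp: partition_of_iff)
  have aC [simp]: "a i \<in> C" if "i \<in> \<alpha> ` P" for i by (rule is_lub_closed[OF lub[OF that]])
  have le: "p \<sqsubseteq> a (\<alpha> p)" if "p \<in> P" for p using that by (intro is_lub_upper[OF lub]) auto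
  show "a ` \<alpha> ` P \<subseteq> C" by auto
  show "\<bottom> \<notin> a ` \<alpha> ` P"
  proof
    assume "\<bottom> \<in> a ` \<alpha> ` P"
    then obtain p where p: "p \<in> P" "a (\<alpha> p) = \<bottom>" by auto
    then have "p = \<bottom>" using le[OF p(1)] by (simp add: le_bot_iff)
    then show False using P p by (simp add: partition_of_iff)
  qed
  show "is_lub B (a ` \<alpha> ` P) \<top>"
    unfolding is_lub_def
  proof (intro conjI ballI impI)
    show "\<top> \<sqsubseteq> c" if c: "c \<in> C" "\<forall>s\<in>a ` \<alpha> ` P. s \<sqsubseteq> c" for c
    proof (rule is_lub_least[of P])
      show "p \<sqsubseteq> c" if "p \<in> P" for p using that c le by - (rule le_trans[of p "a (\<alpha> p)"], auto)
    qed (use P c in \<open>auto simp: partition_of_iff\<close>)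
  qed auto
  fix x y assume "x \<in> a ` \<alpha> ` P" "y \<in> a ` \<alpha> ` P" "x \<noteq> y"
  then obtain p q where pq: "p \<in> P" "x = a (\<alpha> p)" "q \<in> P" "y = a (\<alpha> q)" by blast
  define i j where "i = \<alpha> p" and "j = \<alpha> q"
  have ij: "x = a i" "i \<in> \<alpha> ` P" "y = a j" "j \<in> \<alpha> ` P" "i \<noteq> j"
    using pq \<open>x \<noteq> y\<close> by (auto simp: i_def j_def)
  \<comment> \<open>Through complements disjointness becomes a statement about upper bounds, and so
    passes to the join \<open>a i\<close> of one fibre and then to the join \<open>a j\<close> of
    the other.\<close>
  have "q \<sqsubseteq> \<sim> a i" if q: "q \<in> P" "\<alpha> q = j" for q
  proof -
    have "p \<sqsubseteq> \<sim> q" if "p \<in> {b \<in> P. \<alpha> b = i}" for p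
      using that q ij(5) P by (subst le_neg_iff) (auto simp: partition_of_iff)
    then have "a i \<sqsubseteq> \<sim> q" using q by (intro is_lub_least[OF lub[OF ij(2)]]) auto
    then show ?thesis using q ij by (simp add: le_neg_iff meet_commute)
  qed
  then have "a j \<sqsubseteq> \<sim> a i" using ij by (intro is_lub_least[OF lub[OF ij(4)]]) auto
  then show "x \<sqinter> y = \<bottom>" using ij by (simp add: le_neg_iff meet_commute)
qed

lemma zero_dim_finite_topology: "zero_dim_topology B {P. partition_of B P \<and> finite P}"
  unfolding zero_dim_topology_def mem_Collect_eq
proof (intro conjI ballI allI impI)
  fix P Q assume P: "P \<in> {P. partition_of B P \<and> finite P}"
      and Q: "\<forall>b\<in>P. partition_of B (Q b) \<and> finite (Q b)"
  show "partition_of B ({b \<sqinter> c | b c. b \<in> P \<and> c \<in> Q b} - {\<bottom>})"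
    using P Q by (intro partition_refine) auto
  have "{b \<sqinter> c | b c. b \<in> P \<and> c \<in> Q b} = (\<lambda>(b, c). b \<sqinter> c) ` (SIGMA b : P. Q b)" by auto
  then show "finite ({b \<sqinter> c | b c. b \<in> P \<and> c \<in> Q b} - {\<bottom>})" using P Q by simp
next
  fix P and \<alpha> :: "'u \<Rightarrow> 'u" assume P: "P \<in> {P. partition_of B P \<and> finite P}"
  have ex: "\<exists>a. is_lub B {b \<in> P. \<alpha> b = i} a" for i
    using finite_lub[of "{b \<in> P. \<alpha> b = i}" C] P by (auto simp: partition_of_iff)
  then show "\<exists>a. is_lub B {b \<in> P. \<alpha> b = i} a" for i .
  have "is_lub B {b \<in> P. \<alpha> b = i} (bsup B {b \<in> P. \<alpha> b = i})" for i using ex is_lub_bsup by blast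
  then have "partition_of B ((\<lambda>i. bsup B {b \<in> P. \<alpha> b = i}) ` \<alpha> ` P)"
    using P by (intro partition_coarsen) auto
  then show "partition_of B {bsup B {b \<in> P. \<alpha> b = i} | i. i \<in> \<alpha> ` P}"
    unfolding Setcompr_eq_image .
  show "finite {bsup B {b \<in> P. \<alpha> b = i} | i. i \<in> \<alpha> ` P}" using P by simp
qed auto

text \<open>The existential ties the two joins together: the induction builds a join in B and
  follows it through \<open>f\<close> at the same time.\<close>

lemma finite_lub_hom:
  assumes f: "f \<in> boolean_homs B D" and D: "boolean_alg D" and S: "finite S" "S \<subseteq> C"
  shows "\<exists>a. is_lub B S a \<and> is_lub D (f ` S) (f a)"
  using S
proof induction
  case empty
  interpret D: balgebra D by unfold_locales fact
  show ?case using is_lub_empty D.is_lub_empty hom_zero[OF f] by force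
next
  case (insert x S)
  interpret D: balgebra D by unfold_locales fact
  obtain a where a: "is_lub B S a" "is_lub D (f ` S) (f a)" using insert by auto
  have "is_lub B (insert x S) (x \<squnion> a)" using a insert.prems by (intro is_lub_insert) auto
  moreover have "is_lub D (insert (f x) (f ` S)) (bjoin D (f x) (f a))"
    using a insert.prems hom_closed[OF f] by (intro D.is_lub_insert) auto
  ultimately show ?case using hom_join[OF f, of x a] is_lub_closed[OF a(1)] insert.prems by force
qed

text \<open>Makes every Boolean homomorphism continuous for the topologies of finite partitions, so
  that \<open>BAlg\<close> is full in \<open>grBAlg\<close>.\<close>

lemma finite_partition_hom:
  assumes f: "f \<in> boolean_homs B D" and D: "boolean_alg D" and P: "partition_of B P" "finite P"
  shows "partition_of D (f ` P - {bzero D})"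
proof -
  interpret D: balgebra D by unfold_locales fact
  obtain a where "is_lub B P a" "is_lub D (f ` P) (f a)"
    using finite_lub_hom[OF f D P(2)] P(1) by (auto simp: partition_of_iff)
  then have "is_lub D (f ` P) (bone D)"
    using P(1) is_lub_unique hom_one[OF f] unfolding partition_of_iff by metis
  moreover have "bmeet D (f p) (f q) = bzero D" if "p \<in> P" "q \<in> P" "f p \<noteq> f q" for p q
  proof -
    have "p \<in> C" "q \<in> C" "p \<sqinter> q = \<bottom>" using P(1) that by (auto simp: partition_of_iff)
    then show ?thesis using hom_meet[OF f, of p q] hom_zero[OF f] by simp
  qed
  ultimately show ?thesis
    using P(1) hom_closed[OF f] unfolding D.partition_of_iff D.is_lub_diff_bot
        by (auto simp: partition_of_iff)
qed

end

lemma finite_topology_in_grBAlg: "B \<in> ob BAlg \<Longrightarrow> finite_topology B \<in> ob grBAlg"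
proof -
  assume B: "B \<in> ob BAlg"
  interpret balgebra B by unfold_locales (use B in simp)
  have "zero_dim_topology (finite_topology B) (topo (finite_topology B))
      = zero_dim_topology B {P. partition_of B P \<and> finite P}"
    by (simp add: zero_dim_topology_def)
  then show ?thesis using B zero_dim_finite_topology by simp
qed

lemma BAlg_inclusion_simps [simp]: "fob BAlg_inclusion = finite_topology" "far BAlg_inclusion B C f
    = f"
  by (simp_all add: BAlg_inclusion_def)

lemma fully_faithful_BAlg_inclusion: "fully_faithful BAlg grBAlg BAlg_inclusion"
proof -
  have hom: "hom grBAlg (finite_topology B) (finite_topology D) = hom BAlg B D"
      if "B \<in> ob BAlg" "D \<in> ob BAlg" for B D :: "'a balg"
  proof -
    interpret balgebra B by unfold_locales (use that in simp)
    show ?thesis using finite_partition_hom[of _ D] that by auto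
  qed
  have "is_functor (BAlg :: ('a balg, _) cat) grBAlg BAlg_inclusion"
    unfolding is_functor_def
  proof (intro conjI ballI)
    show "fob BAlg_inclusion B \<in> ob grBAlg" if "B \<in> ob BAlg" for B :: "'a balg"
      using finite_topology_in_grBAlg[OF that] by (simp only: BAlg_inclusion_simps)
    show "far BAlg_inclusion B D f \<in> hom grBAlg (fob BAlg_inclusion B) (fob BAlg_inclusion D)"
      if "B \<in> ob BAlg" "D \<in> ob BAlg" "f \<in> hom BAlg B D" for B D :: "'a balg" and f
      using that(3) by (simp only: BAlg_inclusion_simps hom[OF that(1,2)])
  qed (simp_all add: category_BAlg category_grBAlg)
  moreover have "bij_betw (far BAlg_inclusion B D) (hom BAlg B D)
      (hom grBAlg (fob BAlg_inclusion B) (fob BAlg_inclusion D))"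
    if "B \<in> ob BAlg" "D \<in> ob BAlg" for B D :: "'a balg"
    unfolding BAlg_inclusion_simps(1) hom[OF that] by (simp add: bij_betw_def inj_on_def)
  ultimately show ?thesis unfolding fully_faithful_def by blast
qed

text \<open>No partition in the finite topology is infinite, so there are no symbols
  \<open>Glue P\<close> and the two signatures coincide literally.\<close>

lemma B_Set_eq: "B_Set B = BJ_Set (finite_topology B)"
proof -
  have sig: "B_sig B = BJ_sig (finite_topology B)"
    by (auto simp: B_sig_def BJ_sig_def)
  moreover have "B_set_laws B = B_set_laws (finite_topology B)"
      by (simp add: B_set_laws_def fun_eq_iff)
  moreover have "glue_laws (finite_topology B) M" for M by (simp add: glue_laws_def)
  ultimately show ?thesis by (simp add: B_Set_def BJ_Set_def)
qed

text \<open>Only finitely many weights are nonzero and they sit at distinct indices, so the support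
  is finite. Enumerating it by \<open>nset n\<close> gives an operation that takes just the
  arguments in the support.\<close>

lemma finitary_finite_topology:
  fixes B :: "'u balg"
  assumes U: "universe TYPE('u)" and B: "B \<in> ob BAlg"
  shows "finitary (partition_theory (finite_topology B))"
proof -
  interpret grbalgebra "finite_topology B" by
      (rule grbalgebraI[OF U finite_topology_in_grBAlg[OF B]])
  let ?F = "finite_topology B"
  show ?thesis
    unfolding finitary_def
  proof (intro allI impI ballI)
    fix I and \<omega> assume I: "sm I" and w: "\<omega> \<in> ops T I"
    define S where "S = {i \<in> I. \<omega> i \<noteq> bzero B}"
    have inj: "inj_on \<omega> S"
    proof (rule inj_onI, rule ccontr)
      fix i j assume ij: "i \<in> S" "j \<in> S" "\<omega> i = \<omega> j" "i \<noteq> j"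
      then show False using opsD(2)[OF w, of i j] opsD(1)[OF w, of i] meet_idem[of "\<omega> i"]
          by (auto simp: S_def)
    qed
    have "\<omega> ` S = \<omega> ` I - {bzero B}" by (auto simp: S_def)
    then have "finite (\<omega> ` S)" using opsD(3)[OF w] by simp
    then have fin: "finite S" using inj finite_imageD by blast
    define n where "n = card S"
    have cardn: "card (nset n :: 'u set) = n" "finite (nset n :: 'u set)"
      unfolding nset_def by (simp_all add: card_image inj_on_def)
    have "card (nset n :: 'u set) = card S" using cardn n_def by simp
    from finite_same_card_bij[OF cardn(2) fin this] obtain r where r:
        "bij_betw r (nset n :: 'u set) S" by blast
    have rS: "r k \<in> S" "r k \<in> I" if "k \<in> nset n" for k using r that
        by (auto simp: bij_betw_def S_def)
    define u where "u = (\<lambda>k\<in>nset n. \<omega> (r k))"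
    have u: "u \<in> ops T (nset n)"
      unfolding ops_iff
    proof (intro conjI ballI impI)
      show "u \<in> nset n \<rightarrow>\<^sub>E bcarrier ?F" using opsD(1)[OF w] rS by (auto simp: u_def)
      show "bmeet ?F (u i) (u j) = bzero ?F" if "i \<in> nset n" "j \<in> nset n" "i \<noteq> j" for i j
        using that r opsD(2)[OF w, of "r i" "r j"] rS by (auto simp: u_def bij_betw_def inj_on_def)
      have "u ` nset n = \<omega> ` S" using r by (force simp: u_def bij_betw_def)
      then have "u ` nset n - {bzero ?F} = \<omega> ` I - {bzero ?F}" by (auto simp: S_def)
      then show "u ` nset n - {bzero ?F} \<in> topo ?F" using opsD(3)[OF w] by simp
    qed
    show "\<exists>n. \<exists>i\<in>nset n \<rightarrow>\<^sub>E I. \<exists>u\<in>ops T (nset n). \<forall>K. sm K \<longrightarrow>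
      (\<forall>x\<in>I \<rightarrow>\<^sub>E ops T K. subst T I K \<omega> x = subst T (nset n) K u (\<lambda>k\<in>nset n. x (i k)))"
    proof (rule exI[of _ n], rule bexI[of _ "restrict r (nset n)"], rule bexI[OF _ u],
        intro allI impI ballI)
      show "restrict r (nset n) \<in> nset n \<rightarrow>\<^sub>E I" using rS by auto
      fix K x assume x: "x \<in> I \<rightarrow>\<^sub>E ops T K"
      define y where "y = (\<lambda>k\<in>nset n. x (restrict r (nset n) k))"
      have yr: "y k = x (r k)" if "k \<in> nset n" for k using that by (simp add: y_def)
      have y: "\<forall>k\<in>nset n. y k \<in> ops T K" using x rS by (auto simp: yr)
      have x': "\<forall>i\<in>I. x i \<in> ops T K" using x by auto
      show "subst T I K \<omega> x = subst T (nset n) K u (\<lambda>k\<in>nset n. x (restrict r (nset n) k))"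
        unfolding y_def[symmetric]
      proof (rule subst_eqI[OF w x' ops_PiE[OF subst_exists(1)[OF u y]]])
        fix i k assume i: "i \<in> I" and k: "k \<in> K"
        have C: "subst T (nset n) K u y k \<in> bcarrier ?F" "x i k \<in> bcarrier ?F"
          by (rule subst_local(1)[OF u y k]) (use opsD(1)[of "x i" K k] x' i k in blast)
        show "bmeet ?F (\<omega> i) (subst T (nset n) K u y k) = bmeet ?F (\<omega> i) (x i k)"
        \<comment> \<open>An index in the support is some \<open>r l\<close>, where locality of
          \<open>u\<close> applies; outside the support both meets are bottom.\<close>
        proof (cases "i \<in> S")
          case True
          then obtain l where l: "l \<in> nset n" "i = r l" using r by (auto simp: bij_betw_def)
          then show ?thesis using subst_local(2)[OF u y k l(1)] by (simp add: u_def yr)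
        next
          case False
          then have "\<omega> i = bzero ?F" using i by (simp add: S_def)
          then show ?thesis using bot_meet[OF C(1)] bot_meet[OF C(2)] by simp
        qed
      qed
    qed
  qed
qed

context haff
begin

interpretation G: haff_model T Ops2 "\<lambda>I t f. app T I (nset 2) t f"
  by (intro haff_model.intro haff_axioms free_model_of) simp

text \<open>A finitary operation sees only the finitely many arguments \<open>r k\<close>. At any
  other index the component acts as \<open>u\<close> does on the constant family y, hence is
  zero.\<close>

lemma finitary_topo:
  assumes fin: "finitary T"
  shows "topo galg = {P. partition_of galg P \<and> finite P}"
proof (intro equalityI subsetI CollectI conjI)
  fix P assume P: "P \<in> topo galg"
  then show "partition_of galg P" by (rule topo_galg_partition)
  obtain I t where I: "sm I" "t \<in> ops T I" and PI: "P = comp I t ` I - {bzero galg}"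
    using P unfolding topo_galg by blast
  obtain n r u where r: "r \<in> nset n \<rightarrow>\<^sub>E I" and u: "u \<in> ops T (nset n)"
    and eq: "\<And>K x. sm K \<Longrightarrow> x \<in> I \<rightarrow>\<^sub>E ops T K \<Longrightarrow> subst T I K t x
        = subst T (nset n) K u (\<lambda>k\<in>nset n. x (r k))"
    using fin I unfolding finitary_def by metis
  have "comp I t i = bzero galg" if i: "i \<in> I" "i \<notin> r ` nset n" for i
  proof (rule galg_eqI)
    fix x y assume [simp]: "x \<in> Ops2" "y \<in> Ops2"
    let ?f = "\<lambda>j\<in>I. if j = i then x else y"
    have "G.act (comp I t i) x y = app T I (nset 2) t (\<lambda>j. if j = i then x else y)"
      using I by (simp add: G.act_comp)
    also have "\<dots> = subst T (nset n) (nset 2) u (\<lambda>k\<in>nset n. ?f (r k))"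
      unfolding app_def by (rule eq) auto
    also have "\<dots> = app T (nset n) (nset 2) u (\<lambda>k. y)"
      unfolding app_def using r i by (intro arg_cong[of _ _
          "subst T (nset n) (nset 2) u"] restrict_ext) auto
    also have "\<dots> = y" using u by (simp add: app_const)
    finally show "G.act (comp I t i) x y = G.act (bzero galg) x y" by simp
  qed (use I in auto)
  then have "P \<subseteq> comp I t ` r ` nset n" unfolding PI by auto
  moreover have "finite (nset n :: 'u set)" by (simp add: nset_def)
  ultimately show "finite P" by (meson finite_imageI finite_subset)
qed (use finite_partition_in_topo in auto)

text \<open>\<open>balg.truncate\<close> forgets the topology, and by \<open>finitary_topo\<close>
  it is the one that \<open>finite_topology\<close> puts back.\<close>

lemma finitary_galg:
  assumes "finitary T"
  shows "\<exists>B\<in>ob BAlg. galg = finite_topology B"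
proof (intro bexI)
  show "galg = finite_topology (balg.truncate galg)"
    using finitary_topo[OF assms]
    by (simp add: finite_topology_def balg.defs galg_def partition_of_def is_lub_def ble_def)
  show "balg.truncate galg \<in> ob BAlg"
    using boolean_alg_galg galg_nondegenerate by (simp add: balg.defs boolean_alg_def)
qed

end

theorem theorem4p9:
  assumes "universe TYPE('u)"
  shows
    "equivalence (grBAlg :: ('u gbalg, _) cat) HAff T_functor \<and>
     equivalence (grBAlg :: ('u gbalg, _) cat) (op_cat BJ_Var) Set_functor \<and>
     equivalence (HAff :: (('u, _) algth, _) cat) (op_cat BJ_Var) Mod_functor \<and>
     naturally_isomorphic (grBAlg :: ('u gbalg, _) cat) (op_cat BJ_Var)
       (Mod_functor \<circ>\<^sub>F T_functor) Set_functor \<and>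
     fully_faithful (BAlg :: ('u balg, _) cat) grBAlg BAlg_inclusion \<and>
     ob (B_Var :: ('u ccat, _) cat) \<subseteq> ob BJ_Var \<and>
     equivalence (BAlg :: ('u balg, _) cat) HAff_fin (T_functor \<circ>\<^sub>F BAlg_inclusion) \<and>
     equivalence (BAlg :: ('u balg, _) cat) (op_cat B_Var) (Set_functor \<circ>\<^sub>F BAlg_inclusion) \<and>
     equivalence (HAff_fin :: (('u, _) algth, _) cat) (op_cat B_Var) Mod_functor \<and>
     naturally_isomorphic (BAlg :: ('u balg, _) cat) (op_cat B_Var)
       (Mod_functor \<circ>\<^sub>F (T_functor \<circ>\<^sub>F BAlg_inclusion)) (Set_functor \<circ>\<^sub>F BAlg_inclusion)"
proof -
  note U = assms
  \<comment> \<open>Predicates that present the duals of \<open>BJ_Var\<close> and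
    \<open>B_Var\<close> as full subcategories of \<open>op_cat VAR\<close>, ready for
    corestriction.\<close>
  define PJ :: "'u ccat \<Rightarrow> bool" where "PJ C \<longleftrightarrow> (\<exists>B\<in>ob grBAlg. isomorphic_in VAR C (BJ_Set B))" for C
  define PB :: "'u ccat \<Rightarrow> bool" where "PB C \<longleftrightarrow> (\<exists>B\<in>ob BAlg. isomorphic_in VAR C (B_Set B))" for C
  have BJ: "op_cat BJ_Var = full_subcat (op_cat VAR) PJ"
      and BV: "op_cat B_Var = full_subcat (op_cat VAR) PB"
    by (simp_all add: BJ_Var_def B_Var_def op_cat_full_subcat PJ_def[abs_def] PB_def[abs_def])
  let ?inc = "BAlg_inclusion :: ('u balg, _, _, _) funct"
  let ?HAff = "HAff :: (('u, 'u \<Rightarrow> 'u) algth, _) cat"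
  have ffT: "fully_faithful (grBAlg :: ('u gbalg, _) cat) HAff T_functor"
      by (rule fully_faithful_T_functor[OF U])
  have ffM: "fully_faithful ?HAff (op_cat VAR) Mod_functor"
      by (rule fully_faithful_Mod_functor[OF U])
  have ffI: "fully_faithful BAlg grBAlg ?inc" by (rule fully_faithful_BAlg_inclusion)
  note nat = natural_iso_Mod_T_Set[OF U]
  have ffS: "fully_faithful (grBAlg :: ('u gbalg, _) cat) (op_cat VAR) Set_functor"
    by (rule fully_faithful_naturally_isomorphic[OF fully_faithful_comp[OF ffT ffM] nat])
  note is_func = fully_faithful_def[THEN iffD1, THEN conjunct1]
  have VAR_iso_refl: "isomorphic_in VAR (BJ_Set B) (BJ_Set B)" if "B \<in> ob grBAlg"
      for B :: "'u gbalg"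
    using functor_ob[OF is_func[OF ffS] that] by (intro isomorphic_in_refl category_VAR) simp
  have MT: "isomorphic_in VAR (BJ_Set B) (theory_Mod (partition_theory B))" if "B \<in> ob grBAlg"
      for B :: "'u gbalg"
    using grbalgebra.iso_to_model[OF grbalgebraI[OF U that]] unfolding isomorphic_in_def by blast
  have var: "variety (BJ_Set B)" "partition_theory B \<in> ob HAff" if "B \<in> ob grBAlg"
      for B :: "'u gbalg"
    using functor_ob[OF is_func[OF ffS] that] functor_ob[OF is_func[OF ffT] that] by simp_all
  have varM: "variety (theory_Mod T)" if "T \<in> ob ?HAff" for T
    using functor_ob[OF is_func[OF ffM] that] by simp
  \<comment> \<open>Converts an isomorphism of theories into one of varieties:
    \<open>Mod_functor\<close> preserves it, and \<open>MT\<close> identifies the models of the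
    theory of B with the B_J-sets.\<close>
  have Mod_iso: "isomorphic_in VAR (theory_Mod T) (BJ_Set B)"
    if B: "B \<in> ob grBAlg" and T: "T \<in> ob ?HAff" and iso: "isomorphic_in HAff (partition_theory B) T"
        for B T
  proof -
    have "isomorphic_in (op_cat VAR) (theory_Mod (partition_theory B)) (theory_Mod T)"
      using isomorphic_in_functor[OF is_func[OF ffM] var(2)[OF B] T iso] by simp
    then have "isomorphic_in VAR (theory_Mod T) (theory_Mod (partition_theory B))" by simp
    then show ?thesis
      using isomorphic_in_sym[OF MT[OF B]] var[OF B] varM T
      by - (rule isomorphic_in_trans[OF category_VAR, of _ "theory_Mod (partition_theory B)"],
          simp_all)
  qed
  have haff: "haff T" if "T \<in> ob ?HAff" for T using U that by (rule haffI)
  have PJ_Set: "PJ (BJ_Set B)" if "B \<in> ob grBAlg" for B unfolding PJ_def using VAR_iso_refl that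
      by blast
  have PJ_Mod: "PJ (theory_Mod T)" if "T \<in> ob ?HAff" for T
    unfolding PJ_def using Mod_iso[OF _ that] T_functor_essentially_surjective[OF U that] by blast
  have PB_Set: "PB (BJ_Set (finite_topology B))" if "B \<in> ob BAlg" for B
    unfolding PB_def B_Set_eq using VAR_iso_refl finite_topology_in_grBAlg that by blast
  have ess_fin: "\<exists>B\<in>ob BAlg. isomorphic_in HAff (partition_theory (finite_topology B)) T"
    if T: "T \<in> ob ?HAff" "finitary T" for T
    using haff.iso_partition_theory[OF haff[OF T(1)]] haff.finitary_galg[OF haff[OF T(1)] T(2)]
        by auto
  have PB_Mod: "PB (theory_Mod T)" if T: "T \<in> ob ?HAff" "finitary T" for T
    unfolding PB_def B_Set_eq using ess_fin[OF T] Mod_iso[OF finite_topology_in_grBAlg T(1)]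
        by blast
  have fin: "finitary (partition_theory (finite_topology B))" if "B \<in> ob BAlg" for B :: "'u balg"
    by (rule finitary_finite_topology[OF U that])
  have inc_ob: "finite_topology B \<in> ob grBAlg" if "B \<in> ob BAlg" for B :: "'u balg"
    by (rule finite_topology_in_grBAlg[OF that])

  have "equivalence (grBAlg :: ('u gbalg, _) cat) HAff T_functor"
    by (rule equivalenceI[OF ffT]) (use T_functor_essentially_surjective[OF U] in simp)
  moreover have "equivalence (grBAlg :: ('u gbalg, _) cat) (op_cat BJ_Var) Set_functor"
    unfolding BJ
  proof (rule equivalenceI[OF fully_faithful_corestrict[OF ffS]])
    show "PJ (fob Set_functor B)" if "B \<in> ob grBAlg" for B using PJ_Set[OF that] by simp
    \<comment> \<open>Essential surjectivity is the membership condition \<open>PJ\<close> itself,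
      read in the opposite category.\<close>
    show "\<exists>B\<in>ob grBAlg. isomorphic_in (full_subcat (op_cat VAR) PJ) (fob Set_functor B) Y"
      if "Y \<in> ob (full_subcat (op_cat VAR) PJ)" for Y
      using that by (simp add: PJ_def del: grBAlg_simps)
  qed
  moreover have "equivalence ?HAff (op_cat BJ_Var) Mod_functor"
    unfolding BJ
  proof (rule equivalenceI[OF fully_faithful_corestrict[OF ffM]])
    show "PJ (fob Mod_functor T)" if "T \<in> ob ?HAff" for T using PJ_Mod[OF that] by simp
    fix Y assume Y: "Y \<in> ob (full_subcat (op_cat VAR) PJ)"
    then obtain B where B: "B \<in> ob grBAlg" and iso: "isomorphic_in VAR Y (BJ_Set B)"
      by (auto simp: PJ_def simp del: grBAlg_simps)
    \<comment> \<open>The given isomorphism with \<open>BJ_Set B\<close> is continued by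
      \<open>MT\<close>, so the theory of B is the required object of \<open>HAff\<close>.\<close>
    have "isomorphic_in VAR Y (theory_Mod (partition_theory B))"
      using iso MT[OF B] Y var[OF B] varM
      by - (rule isomorphic_in_trans[OF category_VAR, of _ "BJ_Set B"], simp_all)
    then show "\<exists>T\<in>ob ?HAff. isomorphic_in (full_subcat (op_cat VAR) PJ) (fob Mod_functor T) Y"
      using var(2)[OF B] by auto
  qed
  moreover have "naturally_isomorphic (grBAlg :: ('u gbalg, _) cat) (op_cat BJ_Var)
      (Mod_functor \<circ>\<^sub>F T_functor) Set_functor"
    unfolding BJ using PJ_Mod[OF var(2)] PJ_Set
    by (intro naturally_isomorphic_corestrict[OF nat]) simp_all
  moreover have "ob (B_Var :: ('u ccat, _) cat) \<subseteq> ob BJ_Var"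
    unfolding B_Var_def BJ_Var_def B_Set_eq using inc_ob by (auto simp del: grBAlg_simps BAlg_simps)
  moreover have "equivalence BAlg HAff_fin (T_functor \<circ>\<^sub>F ?inc)"
    unfolding HAff_fin_def
  proof (rule equivalenceI[OF fully_faithful_corestrict[OF fully_faithful_comp[OF ffI ffT]]])
    show "finitary (fob (T_functor \<circ>\<^sub>F ?inc) B)" if "B \<in> ob BAlg" for B using fin[OF that] by simp
    show "\<exists>B\<in>ob BAlg. isomorphic_in (full_subcat HAff finitary) (fob (T_functor \<circ>\<^sub>F ?inc) B) T"
      if "T \<in> ob (full_subcat HAff finitary)" for T
      using ess_fin[of T] that by simp
  qed
  moreover have "equivalence BAlg (op_cat B_Var) (Set_functor \<circ>\<^sub>F ?inc)"
    unfolding BV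
  proof (rule equivalenceI[OF fully_faithful_corestrict[OF fully_faithful_comp[OF ffI ffS]]])
    show "PB (fob (Set_functor \<circ>\<^sub>F ?inc) B)" if "B \<in> ob BAlg" for B using PB_Set[OF that] by simp
    show "\<exists>B\<in>ob BAlg. isomorphic_in (full_subcat (op_cat VAR) PB) (fob (Set_functor \<circ>\<^sub>F ?inc) B) Y"
      if "Y \<in> ob (full_subcat (op_cat VAR) PB)" for Y
      using that by (simp add: PB_def B_Set_eq del: BAlg_simps)
  qed
  moreover have "equivalence (HAff_fin :: (('u, _) algth, _) cat) (op_cat B_Var) Mod_functor"
    unfolding BV HAff_fin_def
  proof (rule equivalenceI[OF fully_faithful_corestrict[OF fully_faithful_restrict[OF ffM]]])
    show "PB (fob Mod_functor T)" if "T \<in> ob (full_subcat HAff finitary)" for T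
        using PB_Mod[of T] that by simp
    fix Y assume Y: "Y \<in> ob (full_subcat (op_cat VAR) PB)"
    then obtain B :: "'u balg" where B: "B \<in> ob BAlg"
        and iso: "isomorphic_in VAR Y (BJ_Set (finite_topology B))"
      by (auto simp: PB_def B_Set_eq simp del: BAlg_simps)
    have "isomorphic_in VAR Y (theory_Mod (partition_theory (finite_topology B)))"
      using iso MT[OF inc_ob[OF B]] Y var[OF inc_ob[OF B]] varM
      by - (rule isomorphic_in_trans[OF category_VAR, of _ "BJ_Set (finite_topology B)"], simp_all)
    then show "\<exists>T\<in>ob (full_subcat HAff finitary). isomorphic_in (full_subcat (op_cat VAR) PB)
        (fob Mod_functor T) Y"
      using var(2)[OF inc_ob[OF B]] fin[OF B] by auto
  qed
  moreover have "naturally_isomorphic BAlg (op_cat B_Var) (Mod_functor \<circ>\<^sub>F (T_functor \<circ>\<^sub>F ?inc))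
      (Set_functor \<circ>\<^sub>F ?inc)"
    unfolding BV comp_functor_assoc
    using PB_Mod[OF var(2)[OF inc_ob] fin] PB_Set
    by (intro naturally_isomorphic_corestrict[OF naturally_isomorphic_comp[OF nat is_func[OF ffI]]])
        simp_all
  ultimately show ?thesis using ffI by blast
qed

end
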